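(* Let $r,s$ be positive integers. The algebra $\Lambda_{r,s,a}$ is Cohen--Macaulay for all but finitely many values of $a\in\mathbb{C}$.
   Context: For $a\in\mathbb{C}$, $\Lambda_{r,s,a}$ denotes the subalgebra of $\mathbb{C}[y_1,\dots,y_r,z_1,\dots,z_s]$ generated by the deformed Newton sums $Q_{r,s,i}=a(y_1^i+\cdots+y_r^i)+(z_1^i+\cdots+z_s^i)$, $i=1,2,\dots$ *)

theory Defs
  imports "HOL-Algebra.Algebra" "HOL-Library.Extended_Nat"
begin

text \<open>Points of the affine space with coordinates y_1..y_r, z_1..z_s: a pair of
  coordinate functions (only indices below r resp. s are used).  Since complex is
  infinite, polynomials in C[y,z] are identified with the polynomial functions they
  induce, so subalgebras of C[y,z] are represented as rings of functions.\<close>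
type_synonym pt = "(nat \<Rightarrow> complex) \<times> (nat \<Rightarrow> complex)"

definition Q :: "nat \<Rightarrow> nat \<Rightarrow> complex \<Rightarrow> nat \<Rightarrow> pt \<Rightarrow> complex" where
  "Q r s a i = (\<lambda>(y, z). a * (\<Sum>j<r. y j ^ i) + (\<Sum>j<s. z j ^ i))"

inductive_set Lam :: "nat \<Rightarrow> nat \<Rightarrow> complex \<Rightarrow> (pt \<Rightarrow> complex) set"
  for r s a where
  Lam_const: "(\<lambda>_. c) \<in> Lam r s a"
| Lam_gen: "i \<ge> 1 \<Longrightarrow> Q r s a i \<in> Lam r s a"
| Lam_add: "f \<in> Lam r s a \<Longrightarrow> g \<in> Lam r s a \<Longrightarrow> (\<lambda>x. f x + g x) \<in> Lam r s a"
| Lam_mult: "f \<in> Lam r s a \<Longrightarrow> g \<in> Lam r s a \<Longrightarrow> (\<lambda>x. f x * g x) \<in> Lam r s a"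

definition Lambda_ring :: "nat \<Rightarrow> nat \<Rightarrow> complex \<Rightarrow> (pt \<Rightarrow> complex) ring" where
  "Lambda_ring r s a =
     \<lparr>carrier = Lam r s a, monoid.mult = (\<lambda>f g x. f x * g x), one = (\<lambda>_. 1),
      ring.zero = (\<lambda>_. 0), ring.add = (\<lambda>f g x. f x + g x)\<rparr>"

definition regular_seq :: "('a, 'b) ring_scheme \<Rightarrow> 'a list \<Rightarrow> bool" where
  "regular_seq R xs \<longleftrightarrow>
     set xs \<subseteq> carrier R \<and>
     Idl\<^bsub>R\<^esub> (set xs) \<noteq> carrier R \<and>
     (\<forall>k < length xs. \<forall>b \<in> carrier R.
        xs ! k \<otimes>\<^bsub>R\<^esub> b \<in> Idl\<^bsub>R\<^esub> (set (take k xs)) \<longrightarrow> b \<in> Idl\<^bsub>R\<^esub> (set (take k xs)))"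

definition grade :: "('a, 'b) ring_scheme \<Rightarrow> 'a set \<Rightarrow> enat" where
  "grade R I = Sup {enat (length xs) | xs. regular_seq R xs \<and> set xs \<subseteq> I}"

definition height :: "('a, 'b) ring_scheme \<Rightarrow> 'a set \<Rightarrow> enat" where
  "height R p = Sup {enat n | n. \<exists>P :: nat \<Rightarrow> 'a set.
      (\<forall>i\<le>n. primeideal (P i) R) \<and> (\<forall>i<n. P i \<subset> P (Suc i)) \<and> P n = p}"

text \<open>Cohen--Macaulay: Noetherian commutative ring such that every localization at a
  maximal ideal m has depth = dimension; here depth R_m = grade(m,R) and dim R_m = height m.\<close>
definition cohen_macaulay :: "('a, 'b) ring_scheme \<Rightarrow> bool" where
  "cohen_macaulay R \<longleftrightarrow> cring R \<and> noetherian_ring R \<and>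
     (\<forall>m. maximalideal m R \<longrightarrow> grade R m = height R m)"

end

(* Let a tend to 0. Every family of elements of Lam a (a \<noteq> 0) that is polynomial in a and homogeneous has a limit
   at a = 0, and these limits form the algebra of all polynomials that are symmetric in the y and in the z separately
   and whose derivative in y_i vanishes on y_i = z_j: one inclusion is the quasi-invariance
   d/dy_i f = a d/dz_j f on y_i = z_j, which holds on Lam a; for the other one, symmetrized products of the known limits
   are lifted by polarization. The limit algebra is a free module over a polynomial ring in n = r + s homogeneous
   parameters, with a basis of symmetrizations of explicit monomials. Lifting parameters and basis to families in a,
   only finitely many a are lost, because spanning and independence have to be tested in finitely many degrees only:
   integrality of the coordinates over the parameters bounds the generators Q_k that matter, and independence follows
   from the independence of the basis elements modulo the first n - 1 parameters at a = 0. Finally, an algebra of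
   functions that is finite and free over a polynomial ring in n variables is Cohen--Macaulay: the translated parameters
   in a maximal ideal form a regular sequence of length n, grade is at most height, and the height is at most n by
   counting monomials. *)
theory Submission
  imports Defs "HOL-Analysis.Analysis" "Jordan_Normal_Form.Char_Poly" "HOL-Library.Function_Algebras"
begin

section \<open>Functions, subalgebras and finite modules\<close>

text \<open>For a \<noteq> 0 independence is tested in the full polynomial ring \<open>S\<close>,
  where the basis \<open>bas (thA a) epS\<close> is available, and passing from the limit algebra to
  \<open>S\<close> can destroy independence modulo all n parameters. For r = s = 1 the parameters
  are, up to sign, z and y^2 - 2yz, and the basis element y^3 - (3/2) z y^2 of \<open>Tp\<close>
  lies in the ideal of \<open>S\<close> that they generate. The last parameter is therefore left
  invertible: up to sign it is the product of the \<open>xi i\<close>, and modulo the parameters in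
  z a power of it equals an element of the conductor of \<open>Tp\<close> in \<open>S\<close>, so
  nothing is lost once it is set to 1. Its exponent is recovered afterwards from the degree. The
  polynomials \<open>Dp k\<close> arise because a polynomial in y whose derivative vanishes at all
  z_j has a derivative divisible by the product of the y - z_j; so degrees 1, ..., s cannot occur as
  degrees of monic ones. Each basis over the parameters is indexed by the same exponent vectors as a
  family that is visibly independent, with the same degrees. Hence spanning gives independence by
  counting dimensions degree by degree.\<close>

lemma fun_power_apply : "(f ^ k) x = f x ^ k" for f :: "'x \<Rightarrow> 'b::comm_ring_1"
  by (induction k) auto

lemma fun_sum_apply: "(\<Sum>i\<in>I. F i) x = (\<Sum>i\<in>I. F i x)" for F :: "'i \<Rightarrow> 'x \<Rightarrow> 'b::comm_ring_1"
  by (induction I rule: infinite_finite_induct) auto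

lemma fun_prod_apply: "(\<Prod>i\<in>I. F i) x = (\<Prod>i\<in>I. F i x)" for F :: "'i \<Rightarrow> 'x \<Rightarrow> 'b::comm_ring_1"
  by (induction I rule: infinite_finite_induct) auto

definition cst :: "complex \<Rightarrow> 'x \<Rightarrow> complex" where
  "cst c = (\<lambda>_. c)"

lemma cst_apply: "cst c x = c"
  by (simp add: cst_def)

text \<open>Functions are treated as elements of a commutative ring; identities are reduced to
  points only where these rules are invoked explicitly.\<close>

lemmas fapp = plus_fun_apply times_fun_apply zero_fun_apply one_fun_apply minus_apply uminus_apply
  fun_power_apply fun_sum_apply fun_prod_apply of_nat_fun_apply numeral_fun_apply cst_apply

declare fapp [simp del]

lemma cst_0 [simp]: "cst 0 = 0" and cst_1 [simp]: "cst 1 = 1"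
  by (auto simp: fun_eq_iff fapp)

lemma cst_add: "cst (a + b) = cst a + cst b" and cst_mult: "cst (a * b) = cst a * cst b"
  and cst_diff: "cst (a - b) = cst a - cst b" and cst_uminus: "cst (- a) = - cst a"
  and cst_power: "cst (a ^ k) = cst a ^ k"
  by (auto simp: fun_eq_iff fapp)

lemma cst_sum: "cst (\<Sum>i\<in>I. h i) = (\<Sum>i\<in>I. cst (h i))"
  by (auto simp: fun_eq_iff fapp)

lemma cst_neg1: "cst (- 1) * f = - f"
  by (auto simp: fun_eq_iff fapp)

section \<open>Linear independence and spans of families of functions\<close>

global_interpretation fv: vector_space "\<lambda>c (f :: 'x \<Rightarrow> complex). cst c * f"
  by unfold_locales (auto simp: fun_eq_iff fapp algebra_simps)

text \<open>Independence of the indexed family and not of its range: a repeated value counts as a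
  relation. The index set can stay fixed while the functions vary with the parameter.\<close>

definition indep :: "'i set \<Rightarrow> ('i \<Rightarrow> 'x \<Rightarrow> complex) \<Rightarrow> bool" where
  "indep I v \<longleftrightarrow> (\<forall>J c. finite J \<and> J \<subseteq> I \<and> (\<Sum>j\<in>J. cst (c j) * v j) = 0 \<longrightarrow> (\<forall>j\<in>J. c j = 0))"

lemma indepI:
  assumes "\<And>J c j. finite J \<Longrightarrow> J \<subseteq> I \<Longrightarrow> (\<Sum>j\<in>J. cst (c j) * v j) = 0 \<Longrightarrow> j \<in> J \<Longrightarrow> c j = 0"
  shows "indep I v"
  using assms unfolding indep_def by blast

lemma indepD:
  assumes "indep I v" "finite J" "J \<subseteq> I" "(\<Sum>j\<in>J. cst (c j) * v j) = 0" "j \<in> J"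
  shows "c j = 0"
  using assms unfolding indep_def by blast

lemma indep_finite_iff:
  assumes "finite I"
  shows "indep I v \<longleftrightarrow> (\<forall>c. (\<Sum>j\<in>I. cst (c j) * v j) = 0 \<longrightarrow> (\<forall>j\<in>I. c j = 0))" (is "_ \<longleftrightarrow> ?R")
proof
  assume R: ?R
  show "indep I v"
  proof (rule indepI)
    fix J c j assume J: "finite J" "J \<subseteq> I" "(\<Sum>j\<in>J. cst (c j) * v j) = 0" "j \<in> J"
    have "(\<Sum>j\<in>I. cst (if j \<in> J then c j else 0) * v j) = (\<Sum>j\<in>J. cst (c j) * v j)"
      using assms J by (intro sum.mono_neutral_cong_right) auto
    then have z: "(\<Sum>j\<in>I. cst (if j \<in> J then c j else 0) * v j) = 0" using J(3) by simp
    have "(if j \<in> J then c j else 0) = 0"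
      using R[rule_format, of "\<lambda>j. if j \<in> J then c j else 0", OF z, of j] J(2,4) by blast
    then show "c j = 0" using J(4) by simp
  qed
next
  assume "indep I v"
  from indepD[OF this assms order_refl] show ?R by blast
qed

lemma indep_subset: "indep I v \<Longrightarrow> J \<subseteq> I \<Longrightarrow> indep J v"
  unfolding indep_def by blast

lemma indep_reindex:
  assumes "inj_on h I" shows "indep (h ` I) v \<longleftrightarrow> indep I (v \<circ> h)"
proof
  assume L: "indep (h ` I) v"
  show "indep I (v \<circ> h)"
  proof (rule indepI)
    fix J c j assume J: "finite J" "J \<subseteq> I" "(\<Sum>j\<in>J. cst (c j) * (v \<circ> h) j) = 0" "j \<in> J"
    have inj: "inj_on h J" using assms J(2) inj_on_subset by blast
    have "(\<Sum>j\<in>h ` J. cst (c (inv_into J h j)) * v j) = 0"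
      using J inj by (subst sum.reindex) auto
    from indepD[OF L _ _ this, of "h j"] J inj show "c j = 0" by auto
  qed
next
  assume R: "indep I (v \<circ> h)"
  show "indep (h ` I) v"
  proof (rule indepI)
    fix J c j assume J: "finite J" "J \<subseteq> h ` I" "(\<Sum>j\<in>J. cst (c j) * v j) = 0" "j \<in> J"
    then obtain K where K: "K \<subseteq> I" "J = h ` K" "finite K" by (metis finite_subset_image)
    have inj: "inj_on h K" using assms K inj_on_subset by blast
    have "(\<Sum>j\<in>K. cst (c (h j)) * (v \<circ> h) j) = (\<Sum>j\<in>J. cst (c j) * v j)"
      unfolding K(2) by (simp add: sum.reindex[OF inj])
    then have z: "(\<Sum>j\<in>K. cst (c (h j)) * (v \<circ> h) j) = 0" using J(3) by simp
    from J(4) K(2) obtain k where "k \<in> K" "j = h k" by auto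
    with indepD[OF R K(3,1) z] show "c j = 0" by auto
  qed
qed

lemma indep_inj_on:
  assumes "indep I v" shows "inj_on v I"
proof (rule inj_onI, rule ccontr)
  fix i j assume ij: "i \<in> I" "j \<in> I" "v i = v j" "i \<noteq> j"
  have "(\<Sum>k\<in>{i,j}. cst (if k = i then 1 else -1) * v k) = v i - v j"
    using ij(4) by (simp add: cst_neg1)
  then have "(\<Sum>k\<in>{i,j}. cst (if k = i then 1 else -1) * v k) = 0"
    using ij(3) by simp
  from indepD[OF assms _ _ this, of i] ij show False by auto
qed

lemma indep_independent:
  assumes "indep I v" shows "fv.independent (v ` I)"
proof
  assume "fv.dependent (v ` I)"
  then obtain t u w where t: "finite t" "t \<subseteq> v ` I" "(\<Sum>f\<in>t. cst (u f) * f) = 0" "w \<in> t" "u w \<noteq> 0"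
    unfolding fv.dependent_explicit by blast
  then obtain J where J: "J \<subseteq> I" "finite J" "t = v ` J" using finite_subset_image[OF t(1,2)] by auto
  have "inj_on v J" by (rule inj_on_subset[OF indep_inj_on[OF assms] J(1)])
  then have "(\<Sum>j\<in>J. cst (u (v j)) * v j) = (\<Sum>f\<in>t. cst (u f) * f)" unfolding J(3) by (simp add: sum.reindex)
  then have z: "(\<Sum>j\<in>J. cst (u (v j)) * v j) = 0" using t(3) by simp
  from t(4) J(3) obtain j where "j \<in> J" "w = v j" by blast
  with indepD[OF assms J(2,1) z] t(5) show False by metis
qed

lemma span_family_explicit:
  assumes "f \<in> fv.span (v ` I)"
  obtains J c where "finite J" "J \<subseteq> I" "f = (\<Sum>j\<in>J. cst (c j) * v j)"
proof -
  have "\<exists>J c. finite J \<and> J \<subseteq> I \<and> f = (\<Sum>j\<in>J. cst (c j) * v j)"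
    using assms
  proof (induction rule: fv.span_induct_alt)
    case base
    show ?case by (rule exI[of _ "{}"]) auto
  next
    case (step k x y)
    then obtain J c i where J: "finite J" "J \<subseteq> I" "y = (\<Sum>j\<in>J. cst (c j) * v j)" "x = v i" "i \<in> I" by blast
    let ?c = "\<lambda>j. (if j \<in> J then c j else 0) + (if j = i then k else 0)"
    have "(\<Sum>j\<in>insert i J. cst (?c j) * v j) =
       (\<Sum>j\<in>insert i J. cst (if j \<in> J then c j else 0) * v j) + (\<Sum>j\<in>insert i J. cst (if j = i then k else 0) * v j)"
      by (simp add: cst_add algebra_simps sum.distrib)
    also have "(\<Sum>j\<in>insert i J. cst (if j \<in> J then c j else 0) * v j) = y"
      unfolding J using J by (intro sum.mono_neutral_cong_right) auto
    also have "(\<Sum>j\<in>insert i J. cst (if j = i then k else 0) * v j) = (\<Sum>j\<in>{i}. cst k * v j)"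
      using J by (intro sum.mono_neutral_cong_right) auto
    also have "\<dots> = cst k * x" by (simp add: J(4))
    finally have "cst k * x + y = (\<Sum>j\<in>insert i J. cst (?c j) * v j)" by (simp only: add.commute)
    then show ?case using J(1,2,5) by (intro exI[of _ "insert i J"] exI[of _ ?c]) blast
  qed
  then show ?thesis using that by blast
qed

lemma span_family_finite:
  assumes "f \<in> fv.span (v ` I)" "finite I"
  obtains c where "f = (\<Sum>j\<in>I. cst (c j) * v j)"
proof -
  obtain J c where J: "finite J" "J \<subseteq> I" "f = (\<Sum>j\<in>J. cst (c j) * v j)"
    using span_family_explicit[OF assms(1)] .
  have "f = (\<Sum>j\<in>I. cst (if j \<in> J then c j else 0) * v j)"
    unfolding J using J assms by (intro sum.mono_neutral_cong_left) auto
  then show ?thesis by (rule that)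
qed

lemma sum_in_span:
  fixes v :: "'i \<Rightarrow> 'x \<Rightarrow> complex"
  assumes "\<And>j. j \<in> J \<Longrightarrow> v j \<in> fv.span U"
  shows "(\<Sum>j\<in>J. cst (c j) * v j) \<in> fv.span U"
  using assms by (intro fv.span_sum fv.span_scale)

text \<open>Dimension count: if \<open>w\<close> were dependent, fewer than \<open>card I\<close>
  functions would span a space containing the independent \<open>v i\<close>. Whenever a spanning
  family has the right number of members, this turns it into a basis.\<close>

lemma indep_exchange:
  assumes "finite I" "indep I v" "\<And>i. i \<in> I \<Longrightarrow> v i \<in> fv.span (w ` I)"
  shows "indep I w"
proof (rule ccontr)
  assume "\<not> indep I w"
  then obtain J c j where J: "finite J" "J \<subseteq> I" "(\<Sum>j\<in>J. cst (c j) * w j) = 0" "j \<in> J" "c j \<noteq> 0"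
    unfolding indep_def by blast
  have "w j \<in> fv.span (w ` (I - {j}))"
  proof -
    have "cst (c j) * w j = - (\<Sum>i\<in>J - {j}. cst (c i) * w i)"
      using J by (simp add: sum.remove eq_neg_iff_add_eq_0)
    moreover have "- (\<Sum>i\<in>J - {j}. cst (c i) * w i) \<in> fv.span (w ` (I - {j}))"
      by (intro fv.span_neg sum_in_span fv.span_base imageI) (use J(2) in blast)
    ultimately have "cst (c j) * w j \<in> fv.span (w ` (I - {j}))" by metis
    then have "cst (1 / c j) * (cst (c j) * w j) \<in> fv.span (w ` (I - {j}))" by (rule fv.span_scale)
    moreover have "cst (1 / c j) * (cst (c j) * w j) = w j" using J by (auto simp: fun_eq_iff fapp)
    ultimately show ?thesis by simp
  qed
  then have "w i \<in> fv.span (w ` (I - {j}))" if "i \<in> I" for i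
    using that by (cases "i = j") (auto intro: fv.span_base)
  then have "w ` I \<subseteq> fv.span (w ` (I - {j}))" by blast
  then have "fv.span (w ` I) \<subseteq> fv.span (w ` (I - {j}))" by (intro fv.span_minimal) auto
  then have "v ` I \<subseteq> fv.span (w ` (I - {j}))" using assms by auto
  then have "card (v ` I) \<le> card (w ` (I - {j}))"
    using fv.independent_span_bound[OF _ indep_independent[OF assms(2)]] assms(1) by auto
  moreover have "card (v ` I) = card I" using indep_inj_on[OF assms(2)] by (rule card_image)
  moreover have "card (w ` (I - {j})) \<le> card (I - {j})" using assms by (intro card_image_le) auto
  moreover have "card (I - {j}) < card I" using assms J by (meson card_Diff1_less subsetD)
  ultimately show False by simp
qed

lemma dependent_of_card:
  assumes "finite I" "finite U" "\<And>i. i \<in> I \<Longrightarrow> v i \<in> fv.span U" "card U < card I"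
  shows "\<exists>c. (\<Sum>j\<in>I. cst (c j) * v j) = 0 \<and> (\<exists>j\<in>I. c j \<noteq> 0)"
proof (rule ccontr)
  assume "\<not> ?thesis"
  then have "indep I v" using assms by (auto simp: indep_finite_iff)
  then have "card (v ` I) \<le> card U" "card (v ` I) = card I"
    using fv.independent_span_bound[OF assms(2) indep_independent[of I v]] assms(3) card_image[OF indep_inj_on[of I v]] by auto
  then show False using assms(4) by simp
qed

lemma linear_extension:
  assumes "indep I (v :: 'i \<Rightarrow> 'x \<Rightarrow> complex)"
  obtains \<phi> :: "('x \<Rightarrow> complex) \<Rightarrow> ('y \<Rightarrow> complex)" where "\<And>f g. \<phi> (f + g) = \<phi> f + \<phi> g" "\<And>c f. \<phi> (cst c * f) = cst c * \<phi> f"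
    "\<And>i. i \<in> I \<Longrightarrow> \<phi> (v i) = h i"
proof -
  interpret p: vector_space_pair "\<lambda>c (f :: 'x \<Rightarrow> complex). cst c * f" "\<lambda>c (f :: 'y \<Rightarrow> complex). cst c * f" ..
  obtain \<phi> where \<phi>: "Vector_Spaces.linear (\<lambda>c (f :: 'x \<Rightarrow> complex). cst c * f) (\<lambda>c (f :: 'y \<Rightarrow> complex). cst c * f) \<phi>"
    "\<forall>x\<in>v ` I. \<phi> x = (h \<circ> inv_into I v) x"
    using p.linear_independent_extend[OF indep_independent[OF assms]] by blast
  interpret l: Vector_Spaces.linear "\<lambda>c (f :: 'x \<Rightarrow> complex). cst c * f" "\<lambda>c (f :: 'y \<Rightarrow> complex). cst c * f" \<phi> by (rule \<phi>)
  show ?thesis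
    by (rule that[of \<phi>]) (use l.add l.scale \<phi>(2) indep_inj_on[OF assms] in auto)
qed

lemma linear_map_sum:
  assumes "\<And>f g. \<phi> (f + g) = \<phi> f + \<phi> g" "\<And>c f. \<phi> (cst c * f) = cst c * \<phi> f"
  shows "\<phi> (\<Sum>j\<in>J. cst (c j) * v j) = (\<Sum>j\<in>J. cst (c j) * \<phi> (v j))"
proof -
  have "\<phi> 0 = 0" using assms(2)[of 0] by simp
  then show ?thesis by (induction J rule: infinite_finite_induct) (auto simp: assms)
qed

lemma subspace_mult_preimage: "fv.subspace V \<Longrightarrow> fv.subspace {f. f * g \<in> V}"
  unfolding fv.subspace_def by (auto simp: distrib_right mult.assoc)

lemma span_mult_in:
  assumes V: "fv.subspace V" and XY: "\<And>x y. x \<in> U \<Longrightarrow> y \<in> Y \<Longrightarrow> x * y \<in> V"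
    and f: "f \<in> fv.span U" and g: "g \<in> fv.span Y"
  shows "f * g \<in> V"
proof -
  have *: "f * y \<in> V" if "y \<in> Y" for y
  proof -
    have "fv.span U \<subseteq> {f. f * y \<in> V}"
      using that XY by (intro fv.span_minimal subspace_mult_preimage[OF V]) auto
    then show ?thesis using f by auto
  qed
  have "fv.span Y \<subseteq> {g. g * f \<in> V}"
    using * by (intro fv.span_minimal subspace_mult_preimage[OF V]) (auto simp: mult.commute)
  then show ?thesis using g by (auto simp: mult.commute)
qed

section \<open>Subalgebras and the modules spanned over them\<close>

definition subalg :: "('x \<Rightarrow> complex) set \<Rightarrow> bool" where
  "subalg A \<longleftrightarrow> (\<forall>c. cst c \<in> A) \<and> (\<forall>f\<in>A. \<forall>g\<in>A. f + g \<in> A \<and> f * g \<in> A)"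

inductive_set alg :: "('x \<Rightarrow> complex) set \<Rightarrow> ('x \<Rightarrow> complex) set" for U where
  alg_cst: "cst c \<in> alg U"
| alg_base: "f \<in> U \<Longrightarrow> f \<in> alg U"
| alg_add: "f \<in> alg U \<Longrightarrow> g \<in> alg U \<Longrightarrow> f + g \<in> alg U"
| alg_mult: "f \<in> alg U \<Longrightarrow> g \<in> alg U \<Longrightarrow> f * g \<in> alg U"

lemma subalg_alg [intro!, simp]: "subalg (alg U)"
  unfolding subalg_def by (auto intro: alg.intros)

context
  fixes A :: "('x \<Rightarrow> complex) set"
  assumes A: "subalg A"
begin

lemma subalg_cst: "cst c \<in> A" and subalg_add: "f \<in> A \<Longrightarrow> g \<in> A \<Longrightarrow> f + g \<in> A"
  and subalg_mult: "f \<in> A \<Longrightarrow> g \<in> A \<Longrightarrow> f * g \<in> A"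
  using A unfolding subalg_def by auto

lemma subalg_0: "0 \<in> A" and subalg_1: "1 \<in> A"
  using subalg_cst[of 0] subalg_cst[of 1] by auto

lemma subalg_uminus: "f \<in> A \<Longrightarrow> - f \<in> A"
  using subalg_mult[OF subalg_cst[of "-1"]] by (simp add: cst_neg1)

lemma subalg_diff: "f \<in> A \<Longrightarrow> g \<in> A \<Longrightarrow> f - g \<in> A"
  using subalg_add[OF _ subalg_uminus] by fastforce

lemma subalg_sum: "(\<And>i. i \<in> I \<Longrightarrow> F i \<in> A) \<Longrightarrow> (\<Sum>i\<in>I. F i) \<in> A"
  by (induction I rule: infinite_finite_induct) (auto intro: subalg_0 subalg_add)

lemma subalg_prod: "(\<And>i. i \<in> I \<Longrightarrow> F i \<in> A) \<Longrightarrow> (\<Prod>i\<in>I. F i) \<in> A"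
  by (induction I rule: infinite_finite_induct) (auto intro: subalg_1 subalg_mult)

lemma subalg_power: "f \<in> A \<Longrightarrow> f ^ k \<in> A"
  by (induction k) (auto intro: subalg_1 subalg_mult)

lemma subalg_subspace: "fv.subspace A"
  unfolding fv.subspace_def by (auto intro: subalg_0 subalg_add subalg_mult subalg_cst)

lemma alg_least: assumes "U \<subseteq> A" shows "alg U \<subseteq> A"
proof
  fix f assume "f \<in> alg U"
  then show "f \<in> A" by induction (use assms subalg_add subalg_mult subalg_cst in blast)+
qed

end

lemma alg_mono: "U \<subseteq> Y \<Longrightarrow> alg U \<subseteq> alg Y"
  by (rule alg_least) (auto intro: alg_base)

text \<open>For a subalgebra \<open>A\<close> this is the \<open>A\<close>-module generated by
  \<open>M\<close>. As a complex span of products it also makes sense for a mere subspace such as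
  \<open>Vg\<close>.\<close>

definition mspan :: "('x \<Rightarrow> complex) set \<Rightarrow> ('x \<Rightarrow> complex) set \<Rightarrow> ('x \<Rightarrow> complex) set" where
  "mspan A M = fv.span {a * m | a m. a \<in> A \<and> m \<in> M}"

lemma mspan_subspace [simp]: "fv.subspace (mspan A M)"
  unfolding mspan_def by simp

lemma mspan_add: "f \<in> mspan A M \<Longrightarrow> g \<in> mspan A M \<Longrightarrow> f + g \<in> mspan A M"
  by (rule fv.subspace_add[OF mspan_subspace])

lemma mspan_sum: "(\<And>i. i \<in> I \<Longrightarrow> F i \<in> mspan A M) \<Longrightarrow> (\<Sum>i\<in>I. F i) \<in> mspan A M"
  by (rule fv.subspace_sum[OF mspan_subspace])

lemma mspan_base: "a \<in> A \<Longrightarrow> m \<in> M \<Longrightarrow> a * m \<in> mspan A M"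
  unfolding mspan_def by (auto intro: fv.span_base)

lemma mspan_mono: "A \<subseteq> B \<Longrightarrow> M \<subseteq> N \<Longrightarrow> mspan A M \<subseteq> mspan B N"
  unfolding mspan_def by (intro fv.span_mono) auto

lemma mspan_minimal:
  assumes "fv.subspace V" "\<And>a m. a \<in> A \<Longrightarrow> m \<in> M \<Longrightarrow> a * m \<in> V" shows "mspan A M \<subseteq> V"
  unfolding mspan_def by (rule fv.span_minimal) (use assms in auto)

lemma mspan_mult:
  assumes A: "subalg A" and a: "a \<in> A" and f: "f \<in> mspan A M" shows "a * f \<in> mspan A M"
proof -
  have "mspan A M \<subseteq> {f. f * a \<in> mspan A M}"
  proof (rule mspan_minimal)
    fix b m assume "b \<in> A" "m \<in> M"
    then have "(b * a) * m \<in> mspan A M" using a by (intro mspan_base subalg_mult[OF A]) auto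
    then show "b * m \<in> {f. f * a \<in> mspan A M}" by (simp add: mult_ac)
  qed (auto intro: subspace_mult_preimage)
  then show ?thesis using f by (auto simp: mult.commute)
qed

lemma mspan_tower:
  assumes B: "subalg B" and "A \<subseteq> mspan B M"
  shows "mspan A N \<subseteq> mspan B {m * n | m n. m \<in> M \<and> n \<in> N}"
proof (rule mspan_minimal)
  fix a n assume a: "a \<in> A" and n: "n \<in> N"
  have "mspan B M \<subseteq> {f. f * n \<in> mspan B {m * n | m n. m \<in> M \<and> n \<in> N}}"
    using n by (intro mspan_minimal subspace_mult_preimage) (auto simp: mult.assoc intro!: mspan_base)
  then show "a * n \<in> mspan B {m * n | m n. m \<in> M \<and> n \<in> N}" using a assms by auto
qed simp

lemma subset_mspan: "subalg A \<Longrightarrow> 1 \<in> M \<Longrightarrow> A \<subseteq> mspan A M"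
  using mspan_base[of _ A 1 M] by auto

lemma subalg_mspan:
  assumes A: "subalg A" and 1: "1 \<in> mspan A M"
    and M: "\<And>m n. m \<in> M \<Longrightarrow> n \<in> M \<Longrightarrow> m * n \<in> mspan A M"
  shows "subalg (mspan A M)"
proof -
  have mult: "f * g \<in> mspan A M" if "f \<in> mspan A M" "g \<in> mspan A M" for f g
  proof (rule span_mult_in[OF _ _ that[unfolded mspan_def]])
    fix x y assume "x \<in> {a * m |a m. a \<in> A \<and> m \<in> M}" "y \<in> {a * m |a m. a \<in> A \<and> m \<in> M}"
    then obtain a m b n where *: "x = a * m" "y = b * n" "a \<in> A" "b \<in> A" "m \<in> M" "n \<in> M" by auto
    have "(a * b) * (m * n) \<in> mspan A M" using * by (intro mspan_mult[OF A] M subalg_mult[OF A])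
    then show "x * y \<in> mspan A M" using * by (simp add: mult_ac)
  qed simp
  have "cst c \<in> mspan A M" for c
    using mspan_mult[OF A subalg_cst[OF A] 1, of c] by simp
  then show ?thesis unfolding subalg_def using mult mspan_add by blast
qed

text \<open>The monic equation rewrites \<open>y ^ d\<close>, so the span of the lower powers is
  stable under multiplication by \<open>y\<close> and is therefore a subalgebra.\<close>

lemma alg_adjoin_monic:
  assumes A: "subalg A" and y: "y ^ d \<in> mspan A {y ^ k | k. k < d}"
  shows "alg (A \<union> {y}) \<subseteq> mspan A {y ^ k | k. k < d}"
proof -
  let ?M = "{y ^ k | k. k < d}"
  have yP: "y * f \<in> mspan A ?M" if "f \<in> mspan A ?M" for f
  proof -
    have "mspan A ?M \<subseteq> {f. f * y \<in> mspan A ?M}"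
    proof (rule mspan_minimal)
      fix a m assume "a \<in> A" "m \<in> ?M"
      then obtain k where k: "m = y ^ k" "k < d" by auto
      have "y ^ Suc k \<in> mspan A ?M"
      proof (cases "Suc k = d")
        case False
        then have "y ^ Suc k \<in> ?M" using k by (intro CollectI exI[of _ "Suc k"]) simp
        from mspan_base[OF subalg_1[OF A] this] show ?thesis by simp
      qed (use y in auto)
      then have "a * y ^ Suc k \<in> mspan A ?M" using \<open>a \<in> A\<close> by (intro mspan_mult[OF A])
      then show "a * m \<in> {f. f * y \<in> mspan A ?M}" by (simp add: k mult_ac)
    qed (auto intro: subspace_mult_preimage)
    then show ?thesis using that by (auto simp: mult.commute)
  qed
  have 1: "1 \<in> mspan A ?M"
  proof (cases "d = 0")
    case False
    then have "y ^ 0 \<in> ?M" by blast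
    then show ?thesis using mspan_base[OF subalg_1[OF A], of "y ^ 0" ?M] by auto
  qed (use y in auto)
  have pow: "y ^ k \<in> mspan A ?M" for k :: nat
    using 1 yP by (induct k) (auto simp: power_Suc)
  have "subalg (mspan A ?M)"
    using pow by (intro subalg_mspan[OF A 1]) (auto simp flip: power_add)
  moreover have "A \<union> {y} \<subseteq> mspan A ?M"
    using pow[of 1] mspan_mult[OF A _ 1] by auto
  ultimately show ?thesis by (rule alg_least)
qed

lemma alg_adjoin_monics:
  fixes r :: nat
  assumes A: "subalg A" and y: "\<And>i. i < r \<Longrightarrow> y i ^ d \<in> mspan A {y i ^ k | k. k < d}"
  shows "alg (A \<union> y ` {..<r}) \<subseteq> mspan A {(\<Prod>i<r. y i ^ \<beta> i) | \<beta>. \<forall>i<r. \<beta> i < d}"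
  using y
proof (induction r)
  case 0
  have "alg A \<subseteq> A" by (rule alg_least[OF A]) simp
  then show ?case using subset_mspan[OF A, of "{1}"] by auto
next
  case (Suc r)
  let ?N = "\<lambda>r. {(\<Prod>i<r. y i ^ \<beta> i) | \<beta>. \<forall>i<r. \<beta> i < d}"
  let ?A = "alg (A \<union> y ` {..<r})"
  have sub: "A \<subseteq> ?A" by (auto intro: alg_base)
  have "alg (A \<union> y ` {..<Suc r}) \<subseteq> alg (?A \<union> {y r})"
    by (rule alg_mono) (auto simp: lessThan_Suc intro: alg_base)
  also have "\<dots> \<subseteq> mspan ?A {y r ^ k | k. k < d}"
  proof (rule alg_adjoin_monic)
    have "y r ^ d \<in> mspan A {y r ^ k | k. k < d}" using Suc by auto
    then show "y r ^ d \<in> mspan ?A {y r ^ k | k. k < d}" using mspan_mono[OF sub order_refl] by blast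
  qed simp
  also have "\<dots> \<subseteq> mspan A {m * n | m n. m \<in> ?N r \<and> n \<in> {y r ^ k | k. k < d}}"
    using Suc by (intro mspan_tower A) auto
  also have "\<dots> \<subseteq> mspan A (?N (Suc r))"
  proof (rule mspan_mono)
    show "{m * n | m n. m \<in> ?N r \<and> n \<in> {y r ^ k | k. k < d}} \<subseteq> ?N (Suc r)"
    proof safe
      fix \<beta> k assume "\<forall>i<r. \<beta> i < d" "k < d"
      then show "\<exists>\<beta>'. (\<Prod>i<r. y i ^ \<beta> i) * y r ^ k = (\<Prod>i<Suc r. y i ^ \<beta>' i) \<and> (\<forall>i<Suc r. \<beta>' i < d)"
        by (intro exI[of _ "\<beta>(r := k)"]) (auto simp: less_Suc_eq intro!: prod.cong)
    qed
  qed simp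
  finally show ?case .
qed

section \<open>Elementary symmetric functions and Artin's basis\<close>

lemma poly_as_sum: "(\<And>k. k > n \<Longrightarrow> coeff p k = 0) \<Longrightarrow> poly p x = (\<Sum>k\<le>n. coeff p k * x ^ k)"
  for p :: "'b::comm_ring_1 poly"
proof -
  assume *: "\<And>k. k > n \<Longrightarrow> coeff p k = 0"
  then have "degree p \<le> n" by (intro degree_le) auto
  then have "(\<Sum>k\<le>n. coeff p k * x ^ k) = (\<Sum>k\<le>degree p. coeff p k * x ^ k)"
    by (intro sum.mono_neutral_right) (auto simp: coeff_eq_0)
  then show ?thesis by (simp add: poly_altdef)
qed

text \<open>Its coefficients are, up to sign, the elementary symmetric functions of
  \<open>x 0\<close>, ..., \<open>x (j - 1)\<close>.\<close>

definition chi :: "nat \<Rightarrow> (nat \<Rightarrow> 'x \<Rightarrow> complex) \<Rightarrow> ('x \<Rightarrow> complex) poly" where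
  "chi j x = (\<Prod>i<j. [:- x i, 1:])"

lemma chi_0 [simp]: "chi 0 x = 1" and chi_Suc: "chi (Suc j) x = chi j x * [:- x j, 1:]"
  by (auto simp: chi_def)

lemma coeff_chi_Suc: "coeff (chi (Suc j) x) k = (if k = 0 then 0 else coeff (chi j x) (k - 1)) - x j * coeff (chi j x) k"
  by (cases k) (auto simp: chi_Suc mult.commute[of "chi j x"] coeff_pCons)

lemma coeff_chi_gt: "k > j \<Longrightarrow> coeff (chi j x) k = 0" and coeff_chi_eq: "coeff (chi j x) j = 1"
proof (induction j arbitrary: k)
  case 0
  { case 1 then show ?case by (cases k) auto }
  { case 2 then show ?case by auto }
next
  case (Suc j)
  { case 1 then show ?case using Suc by (auto simp: coeff_chi_Suc) }
  { case 2 then show ?case using Suc by (auto simp: coeff_chi_Suc) }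
qed

lemma poly_chi: "poly (chi j x) t = (\<Prod>i<j. t - x i)"
  by (simp add: chi_def poly_prod algebra_simps)

lemma chi_root: 
  assumes "i < j" shows "x i ^ j = - (\<Sum>k<j. coeff (chi j x) k * x i ^ k)"
proof -
  have "poly (chi j x) (x i) = 0" unfolding poly_chi using assms by (intro prod_zero) auto
  moreover have "poly (chi j x) (x i) = (\<Sum>k\<le>j. coeff (chi j x) k * x i ^ k)"
    by (rule poly_as_sum) (rule coeff_chi_gt)
  moreover have "(\<Sum>k\<le>j. coeff (chi j x) k * x i ^ k) = x i ^ j + (\<Sum>k<j. coeff (chi j x) k * x i ^ k)"
    by (simp add: coeff_chi_eq add.commute flip: lessThan_Suc_atMost)
  ultimately show ?thesis by (simp add: eq_neg_iff_add_eq_0)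
qed

text \<open>Synthetic division of \<open>chi (Suc j) x\<close> by X - \<open>x j\<close>: the
  coefficients of the quotient are obtained from the top downwards, which is the direction of the
  induction.\<close>

lemma coeff_chi_in_adjoin:
  assumes A: "subalg A" and c: "\<And>k. coeff (chi (Suc j) x) k \<in> A" and x: "x j \<in> A"
  shows "coeff (chi j x) k \<in> A"
proof (induction "Suc j - k" arbitrary: k)
  case 0
  then show ?case by (auto simp: coeff_chi_gt intro: subalg_0[OF A])
next
  case (Suc n)
  have "coeff (chi j x) k = coeff (chi (Suc j) x) (Suc k) + x j * coeff (chi j x) (Suc k)"
    by (simp add: coeff_chi_Suc)
  then show ?case using Suc by (auto intro!: subalg_add[OF A] subalg_mult[OF A] c x)
qed

text \<open>Artin's basis: once the \<open>x i\<close> with i > j are known, \<open>x j\<close> is a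
  root of \<open>chi (Suc j) x\<close>, which has degree j + 1, so its powers up to j
  suffice.\<close>

lemma alg_artin:
  fixes x :: "nat \<Rightarrow> 'x \<Rightarrow> complex"
  shows "alg (R \<union> x ` {..<s}) \<subseteq> mspan (alg (R \<union> range (coeff (chi s x)))) {(\<Prod>i<s. x i ^ \<gamma> i) | \<gamma>. \<forall>i<s. \<gamma> i \<le> i}"
proof -
  \<comment> \<open>Interpolates between \<open>W 0\<close>, which contains the whole algebra, and
    \<open>W s\<close>, which has only \<open>R\<close> and the symmetric functions of all roots as
    generators.\<close>
  define W where "W j = alg (R \<union> range (coeff (chi j x)) \<union> x ` {j..<s})" for j
  let ?N = "\<lambda>j. {(\<Prod>i<j. x i ^ \<gamma> i) | \<gamma>. \<forall>i<j. \<gamma> i \<le> i}"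
  have "W 0 \<subseteq> mspan (W j) (?N j)" if "j \<le> s" for j
    using that
  proof (induction j)
    case 0
    show ?case by (rule subset_mspan) (auto simp: W_def)
  next
    case (Suc j)
    have subW: "subalg (W (Suc j))" by (simp add: W_def)
    have monic: "x j ^ Suc j \<in> mspan (W (Suc j)) {x j ^ k | k. k < Suc j}"
    proof -
      have "- (\<Sum>k<Suc j. coeff (chi (Suc j) x) k * x j ^ k) \<in> mspan (W (Suc j)) {x j ^ k | k. k < Suc j}"
        by (intro fv.subspace_neg[OF mspan_subspace] mspan_sum mspan_base) (auto simp: W_def intro!: alg_base)
      then show ?thesis by (subst chi_root) auto
    qed
    let ?B = "alg (W (Suc j) \<union> {x j})"
    have "coeff (chi j x) k \<in> ?B" for k
      by (rule coeff_chi_in_adjoin) (auto simp: W_def intro!: alg_base)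
    moreover have "R \<subseteq> ?B" by (auto simp: W_def intro!: alg_base)
    moreover have "x ` {j..<s} \<subseteq> ?B"
    proof safe
      fix i assume "i \<in> {j..<s}"
      then show "x i \<in> ?B" by (cases "i = j") (auto simp: W_def intro!: alg_base)
    qed
    ultimately have "W j \<subseteq> ?B" unfolding W_def[of j] by (intro alg_least) auto
    also have "\<dots> \<subseteq> mspan (W (Suc j)) {x j ^ k | k. k < Suc j}"
      by (rule alg_adjoin_monic[OF subW monic])
    finally have "mspan (W j) (?N j) \<subseteq> mspan (W (Suc j)) {m * n | m n. m \<in> {x j ^ k | k. k < Suc j} \<and> n \<in> ?N j}"
      by (rule mspan_tower[OF subW])
    also have "\<dots> \<subseteq> mspan (W (Suc j)) (?N (Suc j))"
    proof (rule mspan_mono)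
      show "{m * n | m n. m \<in> {x j ^ k | k. k < Suc j} \<and> n \<in> ?N j} \<subseteq> ?N (Suc j)"
      proof safe
        fix \<gamma> k assume "\<forall>i<j. \<gamma> i \<le> i" "k < Suc j"
        then show "\<exists>\<gamma>'. x j ^ k * (\<Prod>i<j. x i ^ \<gamma> i) = (\<Prod>i<Suc j. x i ^ \<gamma>' i) \<and> (\<forall>i<Suc j. \<gamma>' i \<le> i)"
          by (intro exI[of _ "\<gamma>(j := k)"]) (auto simp: less_Suc_eq mult.commute intro!: prod.cong arg_cong2[where f="(*)"])
      qed
    qed simp
    finally have "mspan (W j) (?N j) \<subseteq> mspan (W (Suc j)) (?N (Suc j))" .
    moreover have "W 0 \<subseteq> mspan (W j) (?N j)" using Suc by simp
    ultimately show ?case by (rule order_trans[rotated])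
  qed
  from this[of s] have "W 0 \<subseteq> mspan (W s) (?N s)" by simp
  moreover have "alg (R \<union> x ` {..<s}) \<subseteq> W 0"
    unfolding W_def by (rule alg_mono) auto
  ultimately show ?thesis by (auto simp: W_def)
qed

section \<open>Families depending polynomially on a parameter\<close>

text \<open>A family that is polynomial in the parameter a is a polynomial with functions as
  coefficients; \<open>pc\<close> embeds the scalars that depend on a. The same type serves later,
  with \<open>chi\<close> and \<open>Dp\<close>, for polynomials in a coordinate y whose
  coefficients are functions of z.\<close>

definition pc :: "complex poly \<Rightarrow> ('x \<Rightarrow> complex) poly" where
  "pc = map_poly cst"

definition pat :: "'x \<Rightarrow> ('x \<Rightarrow> complex) poly \<Rightarrow> complex poly" where
  "pat x = map_poly (\<lambda>f. f x)"

definition ev :: "complex \<Rightarrow> ('x \<Rightarrow> complex) poly \<Rightarrow> 'x \<Rightarrow> complex" where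
  "ev a p = poly p (cst a)"

lemma coeff_pc: "coeff (pc c) k = cst (coeff c k)"
  unfolding pc_def by (rule coeff_map_poly) simp

lemma coeff_pat: "coeff (pat x p) k = coeff p k x"
  unfolding pat_def by (rule coeff_map_poly) (simp add: fapp)

lemma pc_mult: "pc (c * d) = pc c * pc d"
  by (rule poly_eqI) (simp add: coeff_pc coeff_mult cst_sum cst_mult)

lemma pc_diff: "pc (c - d) = pc c - pc d" and pc_1 [simp]: "pc 1 = 1"
  and pc_0: "pc 0 = 0"
  by (rule poly_eqI, simp add: coeff_pc cst_diff coeff_1)+

lemma pc_minus_1: "pc (- 1) = - 1"
  using pc_diff[of 0 1] by (simp add: pc_0)

lemma pat_add: "pat x (p + q) = pat x p + pat x q"
  and pat_diff: "pat x (p - q) = pat x p - pat x q"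
  and pat_0 [simp]: "pat x 0 = 0"
  by (rule poly_eqI, simp add: coeff_pat fapp)+

lemma pat_mult: "pat x (p * q) = pat x p * pat x q"
  by (rule poly_eqI) (simp add: coeff_pat coeff_mult fapp)

lemma pat_pc [simp]: "pat x (pc c) = c"
  by (rule poly_eqI) (simp add: coeff_pat coeff_pc fapp)

lemma pat_pCons: "pat x (pCons f p) = pCons (f x) (pat x p)"
  by (rule poly_eqI) (simp add: coeff_pat coeff_pCons split: nat.split)

lemma ev_pat: "ev a p x = poly (pat x p) a"
  unfolding ev_def by (induction p) (auto simp: pat_pCons fapp)

lemma ev_add: "ev a (p + q) = ev a p + ev a q" and ev_mult: "ev a (p * q) = ev a p * ev a q"
  and ev_diff: "ev a (p - q) = ev a p - ev a q" and ev_sum: "ev a (\<Sum>i\<in>I. F i) = (\<Sum>i\<in>I. ev a (F i))"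
  and ev_prod: "ev a (\<Prod>i\<in>I. F i) = (\<Prod>i\<in>I. ev a (F i))" and ev_power: "ev a (p ^ k) = ev a p ^ k"
  and ev_pCons: "ev a (pCons f p) = f + cst a * ev a p"
  and ev_const: "ev a [:f:] = f" and ev_0 [simp]: "ev a 0 = 0" and ev_1 [simp]: "ev a 1 = 1"
  by (auto simp: ev_def poly_sum poly_prod)

lemma ev_pc: "ev a (pc c) = cst (poly c a)"
  by (rule ext) (simp add: ev_pat fapp)

lemma ev_at_0: "ev 0 p = coeff p 0"
  by (simp add: ev_def poly_0_coeff_0)

lemma ev_coeff_sum: "(\<And>k. k > n \<Longrightarrow> coeff p k = 0) \<Longrightarrow> ev a p = (\<Sum>k\<le>n. coeff p k * cst a ^ k)"
  unfolding ev_def by (rule poly_as_sum)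

text \<open>Gaussian elimination over the local ring at \<open>a = 0\<close>: the points in \<open>U\<close> play the role of
  the pivot columns, and the functions \<open>coeff (v i) 0\<close> are the reductions at \<open>a = 0\<close>.\<close>

lemma family_elimination:
  fixes v :: "'i \<Rightarrow> ('x \<Rightarrow> complex) poly"
  assumes "finite I" "indep I (\<lambda>i. coeff (v i) 0)"
  shows "\<exists>U B. finite B \<and> 0 \<notin> B \<and>
    (\<forall>f. \<exists>\<delta> c. coeff \<delta> 0 \<noteq> 0 \<and> (\<forall>x\<in>U. pat x (pc \<delta> * f - (\<Sum>i\<in>I. pc (c i) * v i)) = 0)) \<and>
    (\<forall>a l. a \<notin> B \<longrightarrow> (\<forall>x\<in>U. (\<Sum>i\<in>I. cst (l i) * ev a (v i)) x = 0) \<longrightarrow> (\<forall>i\<in>I. l i = 0))"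
  using assms
proof (induction I)
  case empty
  show ?case by (intro exI[of _ "{}"]) (auto intro!: exI[of _ "1 :: complex poly"])
next
  case (insert j I)
  have "indep I (\<lambda>i. coeff (v i) 0)" using insert.prems by (rule indep_subset) auto
  from insert.IH[OF this] obtain U B where B: "finite B" "0 \<notin> B"
    and solve: "\<And>f. \<exists>\<delta> c. coeff \<delta> 0 \<noteq> 0 \<and> (\<forall>x\<in>U. pat x (pc \<delta> * f - (\<Sum>i\<in>I. pc (c i) * v i)) = 0)"
    and ind: "\<And>a l. a \<notin> B \<Longrightarrow> \<forall>x\<in>U. (\<Sum>i\<in>I. cst (l i) * ev a (v i)) x = 0 \<Longrightarrow> \<forall>i\<in>I. l i = 0"
    by blast
  obtain \<delta>j cj where dj: "coeff \<delta>j 0 \<noteq> 0" "\<forall>x\<in>U. pat x (pc \<delta>j * v j - (\<Sum>i\<in>I. pc (cj i) * v i)) = 0"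
    using solve[of "v j"] by blast
  define g where "g = pc \<delta>j * v j - (\<Sum>i\<in>I. pc (cj i) * v i)"
  \<comment> \<open>Otherwise the value of \<open>g\<close> at parameter 0 would be a relation
    between the reductions in which \<open>v j\<close> has the nonzero coefficient
    \<open>coeff \<delta>j 0\<close>.\<close>
  have "coeff g 0 \<noteq> 0"
  proof
    assume g0: "coeff g 0 = 0"
    let ?c = "\<lambda>i. if i = j then coeff \<delta>j 0 else - coeff (cj i) 0"
    have "(\<Sum>i\<in>insert j I. cst (?c i) * coeff (v i) 0) = cst (coeff \<delta>j 0) * coeff (v j) 0 + (\<Sum>i\<in>I. cst (?c i) * coeff (v i) 0)"
      using insert.hyps by simp
    also have "(\<Sum>i\<in>I. cst (?c i) * coeff (v i) 0) = - (\<Sum>i\<in>I. cst (coeff (cj i) 0) * coeff (v i) 0)"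
      unfolding sum_negf[symmetric] using insert.hyps by (intro sum.cong) (auto simp: cst_uminus)
    also have "cst (coeff \<delta>j 0) * coeff (v j) 0 + \<dots> = coeff g 0"
      by (simp add: g_def coeff_mult_0 coeff_pc coeff_sum)
    finally have "(\<Sum>i\<in>insert j I. cst (?c i) * coeff (v i) 0) = 0" using g0 by simp
    from indepD[OF insert.prems _ order_refl this, of j] insert.hyps dj(1) show False by simp
  qed
  then obtain x where x: "coeff g 0 x \<noteq> 0" by (auto simp: fun_eq_iff fapp)
  \<comment> \<open>The new pivot entry, at a point where it is a unit of the local ring at
    0.\<close>
  define \<gamma> where "\<gamma> = pat x g"
  have \<gamma>0: "coeff \<gamma> 0 \<noteq> 0" using x by (simp add: \<gamma>_def coeff_pat)
  let ?B = "B \<union> {a. poly \<gamma> a = 0} \<union> {a. poly \<delta>j a = 0}"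
  show ?case
  proof (rule exI[of _ "insert x U"], rule exI[of _ ?B], intro conjI allI impI)
    have "\<gamma> \<noteq> 0" "\<delta>j \<noteq> 0" using \<gamma>0 dj(1) by auto
    then show "finite ?B" using B poly_roots_finite by auto
    show "0 \<notin> ?B" using B \<gamma>0 dj(1) by (simp add: poly_0_coeff_0)
  next
    fix f
    obtain \<delta> c where d: "coeff \<delta> 0 \<noteq> 0" "\<forall>x\<in>U. pat x (pc \<delta> * f - (\<Sum>i\<in>I. pc (c i) * v i)) = 0"
      using solve[of f] by blast
    define h where "h = pc \<delta> * f - (\<Sum>i\<in>I. pc (c i) * v i)"
    \<comment> \<open>The residue \<open>h\<close> of the solution on \<open>U\<close> is multiplied
      by the pivot, and the multiple of \<open>g\<close> that clears the column \<open>x\<close> is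
      subtracted; \<open>g\<close> vanishes on \<open>U\<close>, so the old columns stay
      clear.\<close>
    define c' where "c' = (\<lambda>i. if i = j then pat x h * \<delta>j else \<gamma> * c i - pat x h * cj i)"
    have "(\<Sum>i\<in>I. pc (c' i) * v i) = pc \<gamma> * (\<Sum>i\<in>I. pc (c i) * v i) - pc (pat x h) * (\<Sum>i\<in>I. pc (cj i) * v i)"
      unfolding sum_distrib_left sum_subtractf[symmetric] using insert.hyps
      by (intro sum.cong) (auto simp: c'_def pc_diff pc_mult algebra_simps)
    then have eq: "pc (\<gamma> * \<delta>) * f - (\<Sum>i\<in>insert j I. pc (c' i) * v i) = pc \<gamma> * h - pc (pat x h) * g"
      using insert.hyps by (simp add: h_def g_def c'_def pc_mult algebra_simps)
    have "pat u (pc \<gamma> * h - pc (pat x h) * g) = 0" if "u \<in> insert x U" for u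
      using that d(2) dj(2) by (auto simp: pat_diff[of _ "pc \<gamma> * h"] pat_mult h_def[symmetric] g_def[symmetric] \<gamma>_def[symmetric])
    then show "\<exists>\<delta> c. coeff \<delta> 0 \<noteq> 0 \<and> (\<forall>x\<in>insert x U. pat x (pc \<delta> * f - (\<Sum>i\<in>insert j I. pc (c i) * v i)) = 0)"
      using d(1) \<gamma>0 by (intro exI[of _ "\<gamma> * \<delta>"] exI[of _ c'] conjI) (auto simp: coeff_mult_0 eq)
  next
    fix a l
    assume a: "a \<notin> ?B" and l: "\<forall>u\<in>insert x U. (\<Sum>i\<in>insert j I. cst (l i) * ev a (v i)) u = 0"
    have evg: "ev a g u = 0" if "u \<in> U" for u
      using that dj(2) by (simp add: ev_pat g_def)
    have ev_j: "cst (poly \<delta>j a) * ev a (v j) = ev a g + (\<Sum>i\<in>I. cst (poly (cj i) a) * ev a (v i))"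
      by (simp add: g_def ev_diff ev_mult ev_sum ev_pc)
    \<comment> \<open>\<open>v j\<close> is replaced by \<open>g\<close> and the remaining members;
      these are the resulting coefficients. On \<open>U\<close> the term with \<open>g\<close>
      disappears, and at \<open>x\<close> it is then the only one left.\<close>
    let ?m = "\<lambda>i. poly \<delta>j a * l i + l j * poly (cj i) a"
    have "cst (poly \<delta>j a) * (\<Sum>i\<in>insert j I. cst (l i) * ev a (v i))
        = cst (l j) * (cst (poly \<delta>j a) * ev a (v j)) + (\<Sum>i\<in>I. cst (poly \<delta>j a * l i) * ev a (v i))"
      by (simp only: sum.insert[OF insert.hyps] distrib_left sum_distrib_left cst_mult mult.assoc
          mult.left_commute[of "cst (poly \<delta>j a)" "cst (l j)"])
    also have "\<dots> = cst (l j) * ev a g + ((\<Sum>i\<in>I. cst (l j) * (cst (poly (cj i) a) * ev a (v i))) + (\<Sum>i\<in>I. cst (poly \<delta>j a * l i) * ev a (v i)))"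
      by (simp only: ev_j distrib_left sum_distrib_left add.assoc)
    also have "(\<Sum>i\<in>I. cst (l j) * (cst (poly (cj i) a) * ev a (v i))) + (\<Sum>i\<in>I. cst (poly \<delta>j a * l i) * ev a (v i))
        = (\<Sum>i\<in>I. cst (?m i) * ev a (v i))"
      by (simp only: cst_mult cst_add sum.distrib[symmetric] distrib_right mult.assoc add.commute)
    finally have main: "cst (poly \<delta>j a) * (\<Sum>i\<in>insert j I. cst (l i) * ev a (v i)) =
        cst (l j) * ev a g + (\<Sum>i\<in>I. cst (?m i) * ev a (v i))" .
    have at: "l j * ev a g u + (\<Sum>i\<in>I. cst (?m i) * ev a (v i)) u = 0" if "u \<in> insert x U" for u
    proof -
      have "(\<Sum>i\<in>insert j I. cst (l i) * ev a (v i)) u = 0" using l that by blast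
      then have "(cst (l j) * ev a g + (\<Sum>i\<in>I. cst (?m i) * ev a (v i))) u = 0"
        by (simp only: main[symmetric] times_fun_apply mult_zero_right)
      then show ?thesis by (simp only: plus_fun_apply times_fun_apply cst_apply)
    qed
    have "\<forall>u\<in>U. (\<Sum>i\<in>I. cst (?m i) * ev a (v i)) u = 0"
    proof
      fix u assume "u \<in> U"
      with at[of u] evg[of u] show "(\<Sum>i\<in>I. cst (?m i) * ev a (v i)) u = 0" by simp
    qed
    with a have m: "\<forall>i\<in>I. ?m i = 0" by (intro ind) auto
    have "(\<Sum>i\<in>I. cst (?m i) * ev a (v i)) = 0"
      by (rule sum.neutral) (use m in simp)
    with at[of x] have "l j * ev a g x = 0" by (simp add: fapp)
    moreover have "ev a g x \<noteq> 0" using a by (simp add: ev_pat \<gamma>_def)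
    ultimately have lj: "l j = 0" by simp
    show "\<forall>i\<in>insert j I. l i = 0"
    proof
      fix i assume i: "i \<in> insert j I"
      show "l i = 0"
      proof (cases "i = j")
        case False
        with i m lj have "poly \<delta>j a * l i = 0" by force
        with a show ?thesis by simp
      qed (use lj in simp)
    qed
  qed
qed

lemma family_indep_cofinite:
  assumes "finite I" "indep I (\<lambda>i. coeff (v i) 0)"
  shows "\<forall>\<^sub>F a in cofinite. indep I (\<lambda>i. ev a (v i))"
proof -
  obtain U B where B: "finite B"
    and ind: "\<And>a l. a \<notin> B \<Longrightarrow> \<forall>x\<in>U. (\<Sum>i\<in>I. cst (l i) * ev a (v i)) x = 0 \<Longrightarrow> \<forall>i\<in>I. l i = 0"
    using family_elimination[OF assms] by blast
  have "indep I (\<lambda>i. ev a (v i))" if "a \<notin> B" for a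
    unfolding indep_finite_iff[OF assms(1)] using ind[OF that] by (metis zero_fun_apply)
  then have "{a. \<not> indep I (\<lambda>i. ev a (v i))} \<subseteq> B" by blast
  then show ?thesis using B unfolding eventually_cofinite by (rule finite_subset)
qed

text \<open>The closure \<open>V_shift\<close> under division by the parameter plays the role of
  Nakayama's lemma. An element of \<open>V\<close> vanishing at all pivot points has as constant
  term a combination of the reductions that vanishes there, hence 0; so it can be divided by the
  parameter, and the argument repeats until the polynomial is exhausted.\<close>

lemma family_solve:
  assumes fin: "finite I" and ind: "indep I (\<lambda>i. coeff (v i) 0)"
    and vV: "\<And>i. i \<in> I \<Longrightarrow> v i \<in> V" and V0: "0 \<in> V"
    and V_add: "\<And>p q. p \<in> V \<Longrightarrow> q \<in> V \<Longrightarrow> p + q \<in> V"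
    and V_pc: "\<And>c p. p \<in> V \<Longrightarrow> pc c * p \<in> V"
    and V_shift: "\<And>p. pCons 0 p \<in> V \<Longrightarrow> p \<in> V"
    and span: "\<And>p. p \<in> V \<Longrightarrow> coeff p 0 \<in> fv.span ((\<lambda>i. coeff (v i) 0) ` I)"
    and f: "f \<in> V"
  obtains \<delta> c where "coeff \<delta> 0 \<noteq> 0" "pc \<delta> * f = (\<Sum>i\<in>I. pc (c i) * v i)"
proof -
  obtain U B where B: "0 \<notin> B"
    and solve: "\<exists>\<delta> c. coeff \<delta> 0 \<noteq> 0 \<and> (\<forall>x\<in>U. pat x (pc \<delta> * f - (\<Sum>i\<in>I. pc (c i) * v i)) = 0)"
    and zero: "\<And>a l. a \<notin> B \<Longrightarrow> \<forall>x\<in>U. (\<Sum>i\<in>I. cst (l i) * ev a (v i)) x = 0 \<Longrightarrow> \<forall>i\<in>I. l i = 0"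
    using family_elimination[OF fin ind] by blast
  obtain \<delta> c where d: "coeff \<delta> 0 \<noteq> 0" "\<forall>x\<in>U. pat x (pc \<delta> * f - (\<Sum>i\<in>I. pc (c i) * v i)) = 0"
    using solve by blast
  have V_sum: "(\<Sum>i\<in>J. F i) \<in> V" if "\<And>i. i \<in> J \<Longrightarrow> F i \<in> V" for J F
    using that by (induction J rule: infinite_finite_induct) (auto intro: V0 V_add)
  have van: "g = 0" if "g \<in> V" "\<forall>x\<in>U. pat x g = 0" for g
    using that
  proof (induction g rule: pCons_induct)
    case (pCons b g)
    obtain l where l: "b = (\<Sum>i\<in>I. cst (l i) * coeff (v i) 0)"
      using span_family_finite[OF span[OF pCons.prems(1)] fin] by auto
    have b0: "b x = 0" if "x \<in> U" for x
      using pCons.prems(2) that by (simp add: pat_pCons)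
    have "\<forall>x\<in>U. (\<Sum>i\<in>I. cst (l i) * ev 0 (v i)) x = 0"
      using b0 by (simp add: ev_at_0 l)
    from zero[OF B this] have "b = 0" unfolding l by (intro sum.neutral) auto
    moreover have "g = 0"
      using pCons.prems \<open>b = 0\<close> by (intro pCons.IH) (auto simp: pat_pCons intro: V_shift)
    ultimately show ?case by simp
  qed simp
  have neg: "- q \<in> V" if "q \<in> V" for q
    using V_pc[OF that, of "-1"] by (simp add: pc_minus_1)
  have "(\<Sum>i\<in>I. pc (c i) * v i) \<in> V" by (rule V_sum, rule V_pc, rule vV)
  then have "pc \<delta> * f + - (\<Sum>i\<in>I. pc (c i) * v i) \<in> V"
    by (intro V_add V_pc[OF f] neg)
  from van[of "pc \<delta> * f - (\<Sum>i\<in>I. pc (c i) * v i)"] this d(2)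
  have "pc \<delta> * f - (\<Sum>i\<in>I. pc (c i) * v i) = 0" by simp
  then show ?thesis using d(1) that[of \<delta> c] by simp
qed

lemma family_solve_ev:
  assumes "pc \<delta> * f = (\<Sum>i\<in>I. pc (c i) * v i)" "poly \<delta> a \<noteq> 0"
  shows "ev a f = (\<Sum>i\<in>I. cst (poly (c i) a / poly \<delta> a) * ev a (v i))"
proof -
  have "cst (poly \<delta> a) * ev a f = (\<Sum>i\<in>I. cst (poly (c i) a) * ev a (v i))"
    using arg_cong[OF assms(1), of "ev a"] by (simp add: ev_mult ev_sum ev_pc)
  then have "cst (1 / poly \<delta> a) * (cst (poly \<delta> a) * ev a f) = (\<Sum>i\<in>I. cst (poly (c i) a / poly \<delta> a) * ev a (v i))"
    by (simp add: sum_distrib_left mult.assoc[symmetric] cst_mult[symmetric])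
  moreover have "cst (1 / poly \<delta> a) * (cst (poly \<delta> a) * ev a f) = ev a f"
    using assms(2) by (simp add: mult.assoc[symmetric] cst_mult[symmetric])
  ultimately show ?thesis by simp
qed

section \<open>Hilbert's basis theorem\<close>

definition subrng :: "'b::comm_ring_1 set \<Rightarrow> bool" where
  "subrng A \<longleftrightarrow> 0 \<in> A \<and> 1 \<in> A \<and> (\<forall>x\<in>A. - x \<in> A) \<and> (\<forall>x\<in>A. \<forall>y\<in>A. x + y \<in> A \<and> x * y \<in> A)"

definition idl_in :: "'b::comm_ring_1 set \<Rightarrow> 'b set \<Rightarrow> bool" where
  "idl_in A I \<longleftrightarrow> I \<subseteq> A \<and> 0 \<in> I \<and> (\<forall>x\<in>I. \<forall>y\<in>I. x + y \<in> I) \<and> (\<forall>a\<in>A. \<forall>x\<in>I. a * x \<in> I)"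

definition gen_by :: "'b::comm_ring_1 set \<Rightarrow> 'b set \<Rightarrow> 'b set" where
  "gen_by A G = {\<Sum>g\<in>G. c g * g | c. \<forall>g\<in>G. c g \<in> A}"

definition noeth :: "'b::comm_ring_1 set \<Rightarrow> bool" where
  "noeth A \<longleftrightarrow> (\<forall>I. idl_in A I \<longrightarrow> (\<exists>G. finite G \<and> G \<subseteq> I \<and> I \<subseteq> gen_by A G))"

context
  fixes A :: "'b::comm_ring_1 set"
  assumes A: "subrng A"
begin

lemma subrng_sum: "(\<And>i. i \<in> J \<Longrightarrow> F i \<in> A) \<Longrightarrow> (\<Sum>i\<in>J. F i) \<in> A"
  using A unfolding subrng_def by (induction J rule: infinite_finite_induct) auto

lemma gen_by_0: "0 \<in> gen_by A G"
  unfolding gen_by_def using A by (intro CollectI exI[of _ "\<lambda>_. 0"]) (auto simp: subrng_def)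

lemma gen_by_add: "x \<in> gen_by A G \<Longrightarrow> y \<in> gen_by A G \<Longrightarrow> x + y \<in> gen_by A G"
proof -
  assume "x \<in> gen_by A G" "y \<in> gen_by A G"
  then obtain c d where c: "x = (\<Sum>g\<in>G. c g * g)" "\<forall>g\<in>G. c g \<in> A" "y = (\<Sum>g\<in>G. d g * g)" "\<forall>g\<in>G. d g \<in> A"
    unfolding gen_by_def by blast
  then have "x + y = (\<Sum>g\<in>G. (c g + d g) * g)" by (simp add: sum.distrib distrib_right)
  moreover have "\<forall>g\<in>G. c g + d g \<in> A" using c A unfolding subrng_def by blast
  ultimately show ?thesis unfolding gen_by_def by (intro CollectI exI[of _ "\<lambda>g. c g + d g"]) blast
qed

lemma gen_by_mult: "a \<in> A \<Longrightarrow> x \<in> gen_by A G \<Longrightarrow> a * x \<in> gen_by A G"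
proof -
  assume a: "a \<in> A" and "x \<in> gen_by A G"
  then obtain c where c: "x = (\<Sum>g\<in>G. c g * g)" "\<forall>g\<in>G. c g \<in> A" unfolding gen_by_def by blast
  then have "a * x = (\<Sum>g\<in>G. (a * c g) * g)" by (simp add: sum_distrib_left mult.assoc)
  moreover have "\<forall>g\<in>G. a * c g \<in> A" using c a A unfolding subrng_def by blast
  ultimately show ?thesis unfolding gen_by_def by (intro CollectI exI[of _ "\<lambda>g. a * c g"]) blast
qed

lemma gen_by_base: "finite G \<Longrightarrow> g \<in> G \<Longrightarrow> g \<in> gen_by A G"
proof -
  assume "finite G" "g \<in> G"
  have "(\<Sum>h\<in>G. (if h = g then 1 else 0) * h) = (\<Sum>h\<in>G. if h = g then h else 0)"
    by (rule sum.cong) auto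
  also have "\<dots> = g" using \<open>finite G\<close> \<open>g \<in> G\<close> by simp
  finally have "g = (\<Sum>h\<in>G. (if h = g then 1 else 0) * h)" by simp
  then show ?thesis unfolding gen_by_def using A
    by (intro CollectI exI[of _ "\<lambda>h. if h = g then 1 else 0"] conjI) (auto simp: subrng_def)
qed

lemma gen_by_sum: "(\<And>i. i \<in> J \<Longrightarrow> F i \<in> gen_by A G) \<Longrightarrow> (\<Sum>i\<in>J. F i) \<in> gen_by A G"
  by (induction J rule: infinite_finite_induct) (auto intro: gen_by_0 gen_by_add)

end

lemma idl_in_sum: "idl_in A I \<Longrightarrow> (\<And>j. j \<in> J \<Longrightarrow> c j \<in> A \<and> F j \<in> I) \<Longrightarrow> (\<Sum>j\<in>J. c j * F j) \<in> I"
  unfolding idl_in_def by (induction J rule: infinite_finite_induct) auto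

definition polys_over :: "'b::comm_ring_1 set \<Rightarrow> 'b poly set" where
  "polys_over A = {p. \<forall>k. coeff p k \<in> A}"

lemma subrng_polys_over:
  assumes A: "subrng A" shows "subrng (polys_over A)"
proof -
  have "p * q \<in> polys_over A" if "p \<in> polys_over A" "q \<in> polys_over A" for p q
    using that A subrng_sum[OF A] unfolding polys_over_def coeff_mult mem_Collect_eq
    by (intro allI subrng_sum[OF A]) (auto simp: subrng_def)
  then show ?thesis using A unfolding subrng_def by (auto simp: polys_over_def coeff_1)
qed

text \<open>Hilbert's argument: the ideals \<open>L d\<close> of coefficients in degree d increase
  and become stationary at some \<open>n\<close>; lifts of generators of \<open>L 0\<close>, ...,
  \<open>L n\<close> generate the ideal.\<close>

lemma noeth_polys_over:
  fixes A :: "'b::comm_ring_1 set"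
  assumes A: "subrng A" and N: "noeth A"
  shows "noeth (polys_over A)"
  unfolding noeth_def
proof (intro allI impI)
  fix I assume I: "idl_in (polys_over A) I"
  have PA: "subrng (polys_over A)" by (rule subrng_polys_over[OF A])
  define L where "L d = {coeff p d | p. p \<in> I \<and> (\<forall>k>d. coeff p k = 0)}" for d
  have I_add: "p + q \<in> I" if "p \<in> I" "q \<in> I" for p q using I that by (auto simp: idl_in_def)
  have I_mult: "p * q \<in> I" if "p \<in> polys_over A" "q \<in> I" for p q using I that by (auto simp: idl_in_def)
  have I0: "0 \<in> I" and IA: "I \<subseteq> polys_over A" using I by (auto simp: idl_in_def)
  have monomA: "monom a k \<in> polys_over A" if "a \<in> A" for a k
    using that A by (auto simp: polys_over_def subrng_def)
  have coeff_monom_mult: "coeff (monom a k * p) m = (if m < k then 0 else a * coeff p (m - k))" for a k m and p :: "'b poly"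
    by (simp add: Polynomial.coeff_monom_mult)
  have L_idl: "idl_in A (L d)" for d
    unfolding idl_in_def
  proof (intro conjI ballI)
    show "L d \<subseteq> A" using IA by (auto simp: L_def polys_over_def)
    show "0 \<in> L d" unfolding L_def using I0 by (intro CollectI exI[of _ 0]) auto
  next
    fix x y assume "x \<in> L d" "y \<in> L d"
    then obtain p q where "x = coeff p d" "y = coeff q d" "p \<in> I" "q \<in> I" "\<forall>k>d. coeff p k = 0" "\<forall>k>d. coeff q k = 0"
      unfolding L_def by blast
    then show "x + y \<in> L d" unfolding L_def by (intro CollectI exI[of _ "p + q"]) (auto intro: I_add)
  next
    fix a x assume a: "a \<in> A" and "x \<in> L d"
    then obtain p where p: "x = coeff p d" "p \<in> I" "\<forall>k>d. coeff p k = 0" unfolding L_def by blast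
    have "monom a 0 * p \<in> I" by (intro I_mult monomA a p)
    then show "a * x \<in> L d" unfolding L_def using p
      by (intro CollectI exI[of _ "monom a 0 * p"]) (auto simp: coeff_monom_mult)
  qed
  have L_Suc: "L d \<subseteq> L (Suc d)" for d
  proof
    fix x assume "x \<in> L d"
    then obtain p where p: "x = coeff p d" "p \<in> I" "\<forall>k>d. coeff p k = 0" unfolding L_def by blast
    have "monom 1 1 * p \<in> I" using A by (intro I_mult monomA p) (auto simp: subrng_def)
    then show "x \<in> L (Suc d)" unfolding L_def using p
      by (intro CollectI exI[of _ "monom 1 1 * p"]) (auto simp: coeff_monom_mult)
  qed
  have L_mono: "L d \<subseteq> L e" if "d \<le> e" for d e
    using lift_Suc_mono_le[of L d e] L_Suc that by blast
  have "idl_in A (\<Union>d. L d)"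
    unfolding idl_in_def
  proof (intro conjI ballI)
    show "(\<Union>d. L d) \<subseteq> A" "0 \<in> (\<Union>d. L d)" using L_idl unfolding idl_in_def by blast+
  next
    fix x y assume "x \<in> (\<Union>d. L d)" "y \<in> (\<Union>d. L d)"
    then obtain d e where "x \<in> L d" "y \<in> L e" by blast
    then have "x \<in> L (max d e)" "y \<in> L (max d e)" using L_mono[of d "max d e"] L_mono[of e "max d e"] by auto
    then have "x + y \<in> L (max d e)" using L_idl[of "max d e"] by (auto simp: idl_in_def)
    then show "x + y \<in> (\<Union>d. L d)" by blast
  next
    fix a x assume "a \<in> A" "x \<in> (\<Union>d. L d)"
    then obtain d where "x \<in> L d" by blast
    then have "a * x \<in> L d" using L_idl[of d] \<open>a \<in> A\<close> by (auto simp: idl_in_def)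
    then show "a * x \<in> (\<Union>d. L d)" by blast
  qed
  then obtain F where F: "finite F" "F \<subseteq> (\<Union>d. L d)" "(\<Union>d. L d) \<subseteq> gen_by A F"
    using N unfolding noeth_def by blast
  have "\<exists>n. F \<subseteq> L n"
    using F(1,2)
  proof (induction F)
    case (insert f F)
    then obtain n d where "F \<subseteq> L n" "f \<in> L d" by blast
    then have "insert f F \<subseteq> L (max n d)" using L_mono[of n "max n d"] L_mono[of d "max n d"] by auto
    then show ?case by blast
  qed auto
  then obtain n where n: "F \<subseteq> L n" by blast
  have L_stable: "L d \<subseteq> L n" for d
  proof -
    have "gen_by A F \<subseteq> L n"
    proof
      fix x assume "x \<in> gen_by A F"
      then obtain c where c: "x = (\<Sum>g\<in>F. c g * g)" "\<forall>g\<in>F. c g \<in> A" unfolding gen_by_def by blast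
      show "x \<in> L n" unfolding c(1) by (rule idl_in_sum[OF L_idl]) (use c n in auto)
    qed
    then show ?thesis using F by blast
  qed
  define G where "G d = (SOME G. finite G \<and> G \<subseteq> L d \<and> L d \<subseteq> gen_by A G)" for d
  have "\<exists>G. finite G \<and> G \<subseteq> L d \<and> L d \<subseteq> gen_by A G" for d
    using N L_idl[of d] unfolding noeth_def by blast
  from someI_ex[OF this] have G: "finite (G d)" "G d \<subseteq> L d" "L d \<subseteq> gen_by A (G d)" for d
    unfolding G_def by blast+
  define P where "P d g = (SOME p. g = coeff p d \<and> p \<in> I \<and> (\<forall>k>d. coeff p k = 0))" for d g
  have "\<exists>p. g = coeff p d \<and> p \<in> I \<and> (\<forall>k>d. coeff p k = 0)" if "g \<in> G d" for d g
    using G(2)[of d] that unfolding L_def by blast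
  from someI_ex[OF this] have P: "g = coeff (P d g) d \<and> P d g \<in> I \<and> (\<forall>k>d. coeff (P d g) k = 0)" if "g \<in> G d" for d g
    using that unfolding P_def by blast
  define H where "H = (\<Union>d\<le>n. P d ` G d)"
  have finH: "finite H" and HI: "H \<subseteq> I" using G P by (auto simp: H_def)
  have "p \<in> gen_by (polys_over A) H" if "p \<in> I" "\<forall>k\<ge>d. coeff p k = 0" for p d
    using that
  proof (induction d arbitrary: p)
    case 0
    then have "p = 0" by (auto intro: poly_eqI)
    then show ?case using gen_by_0[OF PA] by simp
  next
    case (Suc d)
    \<comment> \<open>Above degree \<open>n\<close> the generators for \<open>L n\<close> are used,
      multiplied by the power d - \<open>n\<close> of the variable.\<close>
    let ?e = "min d n"
    have "coeff p d \<in> L d" unfolding L_def using Suc.prems by (intro CollectI exI[of _ p]) auto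
    then have "coeff p d \<in> L ?e" using L_stable[of d] by (auto simp: min_def)
    then obtain c where c: "coeff p d = (\<Sum>g\<in>G ?e. c g * g)" "\<forall>g\<in>G ?e. c g \<in> A"
      using G(3)[of ?e] unfolding gen_by_def by blast
    define q where "q = (\<Sum>g\<in>G ?e. monom (c g) (d - ?e) * P ?e g)"
    have PH: "P ?e g \<in> H" if "g \<in> G ?e" for g using that unfolding H_def by auto
    have q: "q \<in> gen_by (polys_over A) H" unfolding q_def
      using c(2) PH by (intro gen_by_sum[OF PA] gen_by_mult[OF PA] gen_by_base[OF PA] monomA finH) auto
    have qI: "q \<in> I" unfolding q_def by (rule idl_in_sum[OF I]) (use c(2) PH HI monomA in auto)
    have nqI: "- q \<in> I"
      using I_mult[of "monom (-1) 0" q] qI monomA[of "-1" 0] A by (simp add: subrng_def monom_0)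
    have qd: "coeff q d = coeff p d"
      unfolding q_def coeff_sum c(1) using P[of _ ?e] by (intro sum.cong) (auto simp: coeff_monom_mult)
    have qk: "coeff q k = 0" if "k > d" for k
      unfolding q_def coeff_sum using P[of _ ?e] that
      by (intro sum.neutral ballI) (auto simp: coeff_monom_mult)
    have "p - q \<in> gen_by (polys_over A) H"
    proof (rule Suc.IH)
      show "p - q \<in> I" using I_add[OF Suc.prems(1) nqI] by simp
      show "\<forall>k\<ge>d. coeff (p - q) k = 0"
      proof safe
        fix k assume "k \<ge> d"
        then show "coeff (p - q) k = 0" using Suc.prems(2) qd qk by (cases "k = d") auto
      qed
    qed
    from gen_by_add[OF PA this q] show ?case by simp
  qed
  moreover have "\<forall>k\<ge>Suc (degree p). coeff p k = 0" for p :: "'b poly" by (auto intro: coeff_eq_0)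
  ultimately have "I \<subseteq> gen_by (polys_over A) H" by blast
  with finH HI show "\<exists>G. finite G \<and> G \<subseteq> I \<and> I \<subseteq> gen_by (polys_over A) G" by blast
qed

text \<open>The adjunction of \<open>t\<close> is an image of the polynomial ring, and ideals are
  pulled back along the evaluation.\<close>

lemma noeth_adjoin:
  assumes A: "subrng A" and N: "noeth A"
  shows "noeth ((\<lambda>p. poly p t) ` polys_over A)"
  unfolding noeth_def
proof (intro allI impI)
  let ?B = "(\<lambda>p. poly p t) ` polys_over A"
  have PA: "subrng (polys_over A)" by (rule subrng_polys_over[OF A])
  have B: "subrng ?B"
    unfolding subrng_def
  proof (intro conjI ballI)
    have "poly 0 t \<in> ?B" "poly 1 t \<in> ?B" using PA unfolding subrng_def by blast+
    then show "0 \<in> ?B" "1 \<in> ?B" by simp_all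
  next
    fix x assume "x \<in> ?B" then show "- x \<in> ?B" using PA by (auto simp: subrng_def simp flip: poly_minus)
  next
    fix x y assume "x \<in> ?B" "y \<in> ?B"
    then show "x + y \<in> ?B" "x * y \<in> ?B" using PA by (auto simp: subrng_def simp flip: poly_add poly_mult)
  qed
  fix J assume J: "idl_in ?B J"
  define I where "I = {p \<in> polys_over A. poly p t \<in> J}"
  have "idl_in (polys_over A) I"
    using J PA unfolding idl_in_def I_def subrng_def by auto
  then obtain F where F: "finite F" "F \<subseteq> I" "I \<subseteq> gen_by (polys_over A) F"
    using noeth_polys_over[OF A N] unfolding noeth_def by blast
  let ?G = "(\<lambda>p. poly p t) ` F"
  have "J \<subseteq> gen_by ?B ?G"
  proof
    fix x assume x: "x \<in> J"
    then have "x \<in> ?B" using J by (auto simp: idl_in_def)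
    then obtain p where p: "x = poly p t" "p \<in> polys_over A" by blast
    with x have "p \<in> I" by (simp add: I_def)
    with F obtain c where c: "p = (\<Sum>f\<in>F. c f * f)" "\<forall>f\<in>F. c f \<in> polys_over A"
      unfolding gen_by_def by blast
    have "x = (\<Sum>f\<in>F. poly (c f) t * poly f t)" unfolding p c(1) by (simp add: poly_sum)
    also have "\<dots> \<in> gen_by ?B ?G"
      using c(2) F(1) by (intro gen_by_sum[OF B] gen_by_mult[OF B] gen_by_base[OF B]) auto
    finally show "x \<in> gen_by ?B ?G" .
  qed
  moreover have "finite ?G" "?G \<subseteq> J" using F by (auto simp: I_def)
  ultimately show "\<exists>G. finite G \<and> G \<subseteq> J \<and> J \<subseteq> gen_by ?B G" by blast
qed

lemma subrng_subalg: "subalg A \<Longrightarrow> subrng A"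
  unfolding subrng_def by (auto intro: subalg_0 subalg_1 subalg_uminus subalg_add subalg_mult)

lemma alg_insert: "alg (insert t U) = (\<lambda>p. poly p t) ` polys_over (alg U)"
proof
  have PA: "subrng (polys_over (alg U))" by (intro subrng_polys_over subrng_subalg subalg_alg)
  have const: "[:f:] \<in> polys_over (alg U)" if "f \<in> alg U" for f
    using that subalg_0[OF subalg_alg] by (auto simp: polys_over_def coeff_pCons split: nat.split)
  show "alg (insert t U) \<subseteq> (\<lambda>p. poly p t) ` polys_over (alg U)"
  proof (rule alg_least)
    show "subalg ((\<lambda>p. poly p t) ` polys_over (alg U))"
      unfolding subalg_def
    proof (intro conjI allI ballI)
      fix c show "cst c \<in> (\<lambda>p. poly p t) ` polys_over (alg U)"
        by (intro image_eqI[OF _ const[OF alg_cst]]) simp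
    next
      fix f g assume "f \<in> (\<lambda>p. poly p t) ` polys_over (alg U)" "g \<in> (\<lambda>p. poly p t) ` polys_over (alg U)"
      then obtain p q where "f = poly p t" "g = poly q t" "p \<in> polys_over (alg U)" "q \<in> polys_over (alg U)" by blast
      then show "f + g \<in> (\<lambda>p. poly p t) ` polys_over (alg U)" "f * g \<in> (\<lambda>p. poly p t) ` polys_over (alg U)"
        using PA by (auto simp: subrng_def simp flip: poly_add poly_mult)
    qed
    have "t = poly [:0, 1:] t" by simp
    moreover have "[:0, 1:] \<in> polys_over (alg U)"
      using subalg_0[OF subalg_alg] subalg_1[OF subalg_alg] by (auto simp: polys_over_def coeff_pCons split: nat.split)
    ultimately have "t \<in> (\<lambda>p. poly p t) ` polys_over (alg U)" by (rule image_eqI)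
    moreover have "f \<in> (\<lambda>p. poly p t) ` polys_over (alg U)" if "f \<in> U" for f
      by (intro image_eqI[OF _ const[OF alg_base[OF that]]]) simp
    ultimately show "insert t U \<subseteq> (\<lambda>p. poly p t) ` polys_over (alg U)" by blast
  qed
  show "(\<lambda>p. poly p t) ` polys_over (alg U) \<subseteq> alg (insert t U)"
  proof
    fix x assume "x \<in> (\<lambda>p. poly p t) ` polys_over (alg U)"
    then obtain p where p: "x = poly p t" "p \<in> polys_over (alg U)" by blast
    have c: "coeff p k \<in> alg (insert t U)" for k
      using p(2) alg_mono[of U "insert t U"] by (auto simp: polys_over_def)
    have t: "t \<in> alg (insert t U)" by (simp add: alg_base)
    show "x \<in> alg (insert t U)" unfolding p(1) poly_altdef
      by (intro subalg_sum[OF subalg_alg] subalg_mult[OF subalg_alg] subalg_power[OF subalg_alg] c t)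
  qed
qed

lemma noeth_alg:
  assumes "finite U" shows "noeth (alg U)"
  using assms
proof (induction U)
  case empty
  have sub: "subrng (alg {} :: ('x \<Rightarrow> complex) set)" by (intro subrng_subalg subalg_alg)
  show ?case unfolding noeth_def
  proof (intro allI impI)
    fix I :: "('x \<Rightarrow> complex) set" assume I: "idl_in (alg {}) I"
    show "\<exists>G. finite G \<and> G \<subseteq> I \<and> I \<subseteq> gen_by (alg {}) G"
    proof (cases "I = {0}")
      case True
      then show ?thesis using gen_by_0[OF sub, of "{}"] by (intro exI[of _ "{}"]) auto
    next
      case False
      then obtain x where x: "x \<in> I" "x \<noteq> 0" using I unfolding idl_in_def by blast
      have "alg {} \<subseteq> range cst"
        by (rule alg_least) (auto simp: subalg_def simp flip: cst_add cst_mult)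
      then obtain c where c: "x = cst c" using x I unfolding idl_in_def by blast
      have "cst (1 / c) * x \<in> I" using I x(1) alg_cst unfolding idl_in_def by blast
      moreover have "cst (1 / c) * x = 1" using c x(2) by (auto simp: cst_mult[symmetric])
      ultimately have 1: "1 \<in> I" by simp
      have "I \<subseteq> gen_by (alg {}) {1}"
      proof
        fix y assume "y \<in> I"
        then have "y \<in> alg {}" using I unfolding idl_in_def by blast
        then have "y * 1 \<in> gen_by (alg {}) {1}"
          by (intro gen_by_mult[OF sub] gen_by_base[OF sub]) auto
        then show "y \<in> gen_by (alg {}) {1}" by simp
      qed
      then show ?thesis using 1 by (intro exI[of _ "{1}"]) auto
    qed
  qed
next
  case (insert t U)
  then show ?case unfolding alg_insert by (intro noeth_adjoin subrng_subalg) auto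
qed

section \<open>The polynomial ring and its derivations\<close>

definition Yv :: "nat \<Rightarrow> pt \<Rightarrow> complex" where "Yv i = (\<lambda>x. fst x i)"
definition Zv :: "nat \<Rightarrow> pt \<Rightarrow> complex" where "Zv i = (\<lambda>x. snd x i)"

text \<open>Since polynomials are represented as functions, the partial derivative is the complex
  derivative along a coordinate line. On \<open>S\<close> these restrictions are polynomials, which
  is what makes the rules of a derivation available.\<close>

definition dY :: "nat \<Rightarrow> (pt \<Rightarrow> complex) \<Rightarrow> pt \<Rightarrow> complex" where
  "dY i f x = deriv (\<lambda>t. f ((fst x)(i := t), snd x)) (fst x i)"
definition dZ :: "nat \<Rightarrow> (pt \<Rightarrow> complex) \<Rightarrow> pt \<Rightarrow> complex" where
  "dZ i f x = deriv (\<lambda>t. f (fst x, (snd x)(i := t))) (snd x i)"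

text \<open>Among the terms with nonzero coefficient, the one of largest degree has nothing to
  cancel against.\<close>

lemma sum_smult_distinct_degrees:
  fixes P :: "'k \<Rightarrow> complex poly"
  assumes fin: "finite K" and inj: "inj_on (\<lambda>k. degree (P k)) K" and P: "\<And>k. k \<in> K \<Longrightarrow> P k \<noteq> 0"
    and 0: "(\<Sum>k\<in>K. smult (b k) (P k)) = 0" and k: "k \<in> K"
  shows "b k = 0"
proof (rule ccontr)
  assume "b k \<noteq> 0"
  define L where "L = {k\<in>K. b k \<noteq> 0}"
  have L: "finite L" "k \<in> L" using fin k \<open>b k \<noteq> 0\<close> by (auto simp: L_def)
  define e where "e = Max ((\<lambda>k. degree (P k)) ` L)"
  have "e \<in> (\<lambda>k. degree (P k)) ` L" unfolding e_def using L by (intro Max_in) auto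
  then obtain l where l: "l \<in> L" "e = degree (P l)" by blast
  have "coeff (\<Sum>k\<in>K. smult (b k) (P k)) e = (\<Sum>k\<in>{l}. b k * coeff (P k) e)"
    unfolding coeff_sum
  proof (rule sum.mono_neutral_cong_right)
    show "\<forall>i\<in>K - {l}. coeff (smult (b i) (P i)) e = 0"
    proof
      fix i assume i: "i \<in> K - {l}"
      show "coeff (smult (b i) (P i)) e = 0"
      proof (cases "b i = 0")
        case False
        then have "i \<in> L" using i by (simp add: L_def)
        then have "degree (P i) \<le> e" unfolding e_def using L by (intro Max_ge) auto
        moreover have "degree (P i) \<noteq> e"
          using inj i l by (auto simp: L_def dest: inj_onD)
        ultimately show ?thesis by (simp add: coeff_eq_0)
      qed simp
    qed
  qed (use l fin in \<open>auto simp: L_def\<close>)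
  then have "b l * lead_coeff (P l) = 0" using 0 l by simp
  then show False using l P by (auto simp: L_def)
qed

section \<open>Monomials and homogeneous components\<close>

locale rs =
  fixes r s :: nat
  assumes r_pos: "0 < r" and s_pos: "0 < s"
begin

definition n :: nat where "n = r + s"

text \<open>The z come before the y, because the polynomials used in a coordinate y have
  coefficients in z, and triangularity refers to earlier coordinates.\<close>

definition W :: "nat \<Rightarrow> pt \<Rightarrow> complex" where
  "W i = (if i < s then Zv i else Yv (i - s))"

definition Ix :: "(nat \<Rightarrow> nat) set" where "Ix = {m. \<forall>i\<ge>n. m i = 0}"

definition Mon :: "(nat \<Rightarrow> nat) \<Rightarrow> pt \<Rightarrow> complex" where "Mon m = (\<Prod>i<n. W i ^ m i)"

definition Sd :: "nat \<Rightarrow> (pt \<Rightarrow> complex) set" where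
  "Sd d = fv.span (Mon ` {m\<in>Ix. (\<Sum>i<n. m i) = d})"

definition S :: "(pt \<Rightarrow> complex) set" where "S = alg (W ` {..<n})"

lemma n_pos: "0 < n"
  using r_pos s_pos by (auto simp: n_def)

lemma finite_weighted_Ix:
  assumes "\<And>i m. i < n \<Longrightarrow> m \<le> e i m"
  shows "finite {m\<in>Ix. (\<Sum>i<n. e i (m i)) = d}"
proof (rule finite_subset)
  show "finite {m. \<forall>i. (i \<in> {..<n} \<longrightarrow> m i \<in> {..d}) \<and> (i \<notin> {..<n} \<longrightarrow> m i = 0)}"
    by (rule finite_set_of_finite_funs) auto
  show "{m\<in>Ix. (\<Sum>i<n. e i (m i)) = d} \<subseteq> {m. \<forall>i. (i \<in> {..<n} \<longrightarrow> m i \<in> {..d}) \<and> (i \<notin> {..<n} \<longrightarrow> m i = 0)}"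
  proof
    fix m assume m: "m \<in> {m\<in>Ix. (\<Sum>i<n. e i (m i)) = d}"
    have "m i \<le> d" if "i < n" for i
    proof -
      have "m i \<le> e i (m i)" using assms that by blast
      also have "\<dots> \<le> (\<Sum>i<n. e i (m i))" using that by (intro member_le_sum) auto
      finally show ?thesis using m by simp
    qed
    moreover have "m i = 0" if "\<not> i < n" for i using m that by (auto simp: Ix_def)
    ultimately show "m \<in> {m. \<forall>i. (i \<in> {..<n} \<longrightarrow> m i \<in> {..d}) \<and> (i \<notin> {..<n} \<longrightarrow> m i = 0)}" by auto
  qed
qed

lemma Mon_mult: "Mon m * Mon m' = Mon (\<lambda>i. m i + m' i)"
  by (simp add: Mon_def power_add prod.distrib)

lemma Sd_subspace [simp]: "fv.subspace (Sd d)"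
  unfolding Sd_def by simp

lemma Sd_mult: "f \<in> Sd d \<Longrightarrow> g \<in> Sd e \<Longrightarrow> f * g \<in> Sd (d + e)"
proof -
  assume f: "f \<in> Sd d" and g: "g \<in> Sd e"
  show ?thesis
  proof (rule span_mult_in[OF Sd_subspace _ f[unfolded Sd_def] g[unfolded Sd_def]])
    fix x y assume "x \<in> Mon ` {m \<in> Ix. (\<Sum>i<n. m i) = d}" "y \<in> Mon ` {m \<in> Ix. (\<Sum>i<n. m i) = e}"
    then obtain m m' where "x = Mon m" "y = Mon m'" "m \<in> Ix" "m' \<in> Ix" "(\<Sum>i<n. m i) = d" "(\<Sum>i<n. m' i) = e" by blast
    then show "x * y \<in> Sd (d + e)"
      unfolding Sd_def by (intro fv.span_base image_eqI[of _ _ "\<lambda>i. m i + m' i"]) (auto simp: Mon_mult Ix_def sum.distrib)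
  qed
qed

lemma Sd_add: "f \<in> Sd d \<Longrightarrow> g \<in> Sd d \<Longrightarrow> f + g \<in> Sd d"
  and Sd_diff: "f \<in> Sd d \<Longrightarrow> g \<in> Sd d \<Longrightarrow> f - g \<in> Sd d"
  and Sd_uminus: "f \<in> Sd d \<Longrightarrow> - f \<in> Sd d"
  and Sd_0: "0 \<in> Sd d"
  and Sd_cst_mult: "f \<in> Sd d \<Longrightarrow> cst c * f \<in> Sd d"
  and Sd_sum: "(\<And>i. i \<in> I \<Longrightarrow> F i \<in> Sd d) \<Longrightarrow> (\<Sum>i\<in>I. F i) \<in> Sd d"
  by (auto intro: fv.subspace_add[OF Sd_subspace] fv.subspace_diff[OF Sd_subspace] fv.subspace_neg[OF Sd_subspace]
      fv.subspace_0[OF Sd_subspace] fv.subspace_scale[OF Sd_subspace] fv.subspace_sum[OF Sd_subspace])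

lemma Sd_one: "1 \<in> Sd 0"
  unfolding Sd_def by (intro fv.span_base image_eqI[of _ _ "\<lambda>_. 0"]) (auto simp: Mon_def Ix_def)

lemma Sd_cst: "cst c \<in> Sd 0"
  using Sd_cst_mult[OF Sd_one, of c] by simp

lemma Sd_prod: "(\<And>i. i \<in> I \<Longrightarrow> F i \<in> Sd (e i)) \<Longrightarrow> (\<Prod>i\<in>I. F i) \<in> Sd (\<Sum>i\<in>I. e i)"
  by (induction I rule: infinite_finite_induct) (auto intro: Sd_one Sd_mult)

lemma Sd_power: "f \<in> Sd d \<Longrightarrow> f ^ k \<in> Sd (k * d)"
  by (induction k) (auto intro: Sd_one Sd_mult)

lemma W_Sd: "i < n \<Longrightarrow> W i \<in> Sd 1"
proof -
  assume i: "i < n"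
  have "Mon (\<lambda>j. if j = i then 1 else 0) = (\<Prod>j<n. if j = i then W i else 1)"
    unfolding Mon_def by (intro prod.cong) auto
  then have "Mon (\<lambda>j. if j = i then 1 else 0) = W i" using i by (simp add: prod.delta)
  then show ?thesis
    unfolding Sd_def using i by (intro fv.span_base image_eqI[of _ _ "\<lambda>j. if j = i then 1 else 0"]) (auto simp: Ix_def)
qed

lemma Zv_W: "i < s \<Longrightarrow> Zv i = W i" and Yv_W: "Yv i = W (s + i)"
  by (auto simp: W_def)

lemma Zv_Sd: "i < s \<Longrightarrow> Zv i \<in> Sd 1" and Yv_Sd: "i < r \<Longrightarrow> Yv i \<in> Sd 1"
  using W_Sd[of i] W_Sd[of "s + i"] by (auto simp: Zv_W Yv_W n_def)

lemma subalg_S [simp]: "subalg S"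
  by (simp add: S_def)

lemma W_S: "i < n \<Longrightarrow> W i \<in> S"
  unfolding S_def by (auto intro: alg_base)

lemma Zv_S: "i < s \<Longrightarrow> Zv i \<in> S" and Yv_S: "i < r \<Longrightarrow> Yv i \<in> S"
  using W_S[of i] W_S[of "s + i"] by (auto simp: Zv_W Yv_W n_def)

lemma Sd_S: "f \<in> Sd d \<Longrightarrow> f \<in> S"
proof -
  have "Sd d \<subseteq> S"
    unfolding Sd_def by (intro fv.span_minimal subalg_subspace) (auto simp: Mon_def intro!: subalg_prod subalg_power W_S)
  then show "f \<in> Sd d \<Longrightarrow> f \<in> S" by blast
qed

lemma S_span: "S = fv.span (Mon ` Ix)"
proof
  let ?V = "fv.span (Mon ` Ix)"
  have "Mon m * Mon m' \<in> ?V" if "m \<in> Ix" "m' \<in> Ix" for m m'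
    unfolding Mon_mult by (intro fv.span_base imageI) (use that in \<open>auto simp: Ix_def\<close>)
  then have mult: "f * g \<in> ?V" if "f \<in> ?V" "g \<in> ?V" for f g
    by (intro span_mult_in[OF _ _ that]) auto
  have Sdv: "Sd d \<subseteq> ?V" for d unfolding Sd_def by (rule fv.span_mono) auto
  have "subalg ?V"
    unfolding subalg_def using mult fv.span_add Sd_cst Sdv by blast
  then show "S \<subseteq> ?V" unfolding S_def by (rule alg_least) (use W_Sd Sdv in blast)
  show "?V \<subseteq> S"
    by (intro fv.span_minimal subalg_subspace) (auto simp: Mon_def intro!: subalg_prod subalg_power W_S)
qed

definition scl :: "complex \<Rightarrow> pt \<Rightarrow> pt" where
  "scl t x = ((\<lambda>i. t * fst x i), (\<lambda>i. t * snd x i))"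

lemma W_scl: "W i (scl t x) = t * W i x"
  by (auto simp: W_def Zv_def Yv_def scl_def)

lemma Sd_scl:
  assumes "f \<in> Sd d" shows "f (scl t x) = t ^ d * f x"
  using assms unfolding Sd_def
proof (induction rule: fv.span_induct_alt)
  case (step c m y)
  then obtain k where k: "m = Mon k" "(\<Sum>i<n. k i) = d" by blast
  have "m (scl t x) = t ^ d * m x"
    unfolding k(1) Mon_def k(2)[symmetric] by (simp add: fapp W_scl power_mult_distrib prod.distrib power_sum)
  with step show ?case by (simp add: fapp algebra_simps)
qed (simp add: fapp)

text \<open>Scaling the point by t turns the sum into a polynomial in t whose coefficients are the
  components.\<close>

lemma homogeneous_components:
  assumes "finite D" "(\<Sum>d\<in>D. h d) = 0" "\<And>d. d \<in> D \<Longrightarrow> h d \<in> Sd d" "d \<in> D"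
  shows "h d = 0"
proof
  fix x
  have "poly (\<Sum>d\<in>D. monom (h d x) d) t = 0" for t
  proof -
    have "poly (\<Sum>d\<in>D. monom (h d x) d) t = (\<Sum>d\<in>D. h d (scl t x))"
      unfolding poly_sum poly_monom
    proof (intro sum.cong refl)
      fix d assume "d \<in> D"
      from Sd_scl[OF assms(3)[OF this]] show "h d x * t ^ d = h d (scl t x)" by (simp add: mult.commute)
    qed
    also have "\<dots> = (\<Sum>d\<in>D. h d) (scl t x)" by (simp add: fapp)
    finally show ?thesis using assms(2) by (simp add: fapp)
  qed
  then have "(\<Sum>d\<in>D. monom (h d x) d) = 0" using poly_all_0_iff_0 by blast
  then have "coeff (\<Sum>d\<in>D. monom (h d x) d) d = 0" by simp
  then show "h d x = 0 x" using assms(1,4) by (simp add: coeff_sum sum.delta fapp)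
qed

lemma homogeneous_in_span:
  assumes f: "f \<in> Sd d" "f \<in> fv.span (w ` I)" and w: "\<And>i. i \<in> I \<Longrightarrow> w i \<in> Sd (e i)"
  shows "f \<in> fv.span (w ` {i\<in>I. e i = d})"
proof -
  obtain J c where J: "finite J" "J \<subseteq> I" "f = (\<Sum>j\<in>J. cst (c j) * w j)"
    using span_family_explicit[OF f(2)] .
  define D where "D = insert d (e ` J)"
  define h where "h d' = (\<Sum>j\<in>{j\<in>J. e j = d'}. cst (c j) * w j) - (if d' = d then f else 0)" for d'
  have "(\<Sum>d'\<in>D. h d') = (\<Sum>d'\<in>D. \<Sum>j\<in>{j\<in>J. e j = d'}. cst (c j) * w j) - (\<Sum>d'\<in>D. if d' = d then f else 0)"
    by (simp add: h_def sum_subtractf)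
  also have "(\<Sum>d'\<in>D. \<Sum>j\<in>{j\<in>J. e j = d'}. cst (c j) * w j) = f"
    unfolding J(3) by (rule sum.group) (use J(1) in \<open>auto simp: D_def\<close>)
  also have "(\<Sum>d'\<in>D. if d' = d then f else 0) = f" using J(1) by (simp add: D_def sum.delta)
  finally have "(\<Sum>d'\<in>D. h d') = 0" by simp
  moreover have "h d' \<in> Sd d'" for d'
    unfolding h_def using J(2) w f(1) by (auto intro!: Sd_diff Sd_sum Sd_cst_mult Sd_0)
  moreover have "finite D" "d \<in> D" using J(1) by (auto simp: D_def)
  ultimately have "h d = 0" using homogeneous_components by blast
  then have "f = (\<Sum>j\<in>{j\<in>J. e j = d}. cst (c j) * w j)" by (simp add: h_def)
  moreover have "(\<Sum>j\<in>{j\<in>J. e j = d}. cst (c j) * w j) \<in> fv.span (w ` {i\<in>I. e i = d})"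
    by (intro sum_in_span fv.span_base imageI) (use J(2) in blast)
  ultimately show ?thesis by simp
qed

definition upd :: "pt \<Rightarrow> nat \<Rightarrow> complex \<Rightarrow> pt" where
  "upd x i t = (if i < s then (fst x, (snd x)(i := t)) else ((fst x)(i - s := t), snd x))"

lemma W_upd: "W j (upd x i t) = (if j = i then t else W j x)"
  by (auto simp: W_def upd_def Zv_def Yv_def)

text \<open>Independence of products of polynomials in the successive coordinates: the \<open>i\<close>-th factor is
  monic in the \<open>i\<close>-th coordinate, with coefficients that depend on the earlier coordinates only.\<close>

lemma indep_triangular:
  fixes P :: "nat \<Rightarrow> nat \<Rightarrow> pt \<Rightarrow> complex poly"
  assumes u: "\<And>i k x. i < n \<Longrightarrow> u i k x = poly (P i k x) (W i x)"
    and P_upd: "\<And>i j k x t. i \<le> j \<Longrightarrow> j < n \<Longrightarrow> P i k (upd x j t) = P i k x"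
    and P_nz: "\<And>i k x. i < n \<Longrightarrow> P i k x \<noteq> 0"
    and inj: "\<And>i x. i < n \<Longrightarrow> inj (\<lambda>k. degree (P i k x))"
  shows "N \<le> n \<Longrightarrow> indep {m. \<forall>i\<ge>N. m i = 0} (\<lambda>m. \<Prod>i<N. u i (m i))"
proof (induction N)
  case 0
  show ?case
  proof (rule indepI)
    fix J c j assume J: "finite J" "J \<subseteq> {m. \<forall>i\<ge>0. m i = (0::nat)}" "(\<Sum>m\<in>J. cst (c m) * (\<Prod>i<0. u i (m i))) = 0" "j \<in> J"
    then have "J \<subseteq> {\<lambda>_. 0}" by auto
    then have "J = {j}" using J(4) by blast
    with J(3) have "cst (c j) = (0 :: pt \<Rightarrow> complex)" by simp
    from fun_cong[OF this] show "c j = 0" by (simp add: fapp)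
  qed
next
  case (Suc N)
  show ?case
  proof (rule indepI)
    fix J c m0 assume J: "finite J" "J \<subseteq> {m. \<forall>i\<ge>Suc N. m i = (0::nat)}"
      "(\<Sum>m\<in>J. cst (c m) * (\<Prod>i<Suc N. u i (m i))) = 0" "m0 \<in> J"
    define A where "A m = (\<Prod>i<N. u i (m i))" for m
    define K where "K = (\<lambda>m. m N) ` J"
    define B where "B k = (\<Sum>m\<in>{m\<in>J. m N = k}. cst (c m) * A m)" for k
    have B0: "B k x = 0" if "k \<in> K" for k x
    proof -
      have "(\<Sum>k\<in>K. smult (B k x) (P N k x)) = (\<Sum>k\<in>K. \<Sum>m\<in>{m\<in>J. m N = k}. smult (c m * A m x) (P N (m N) x))"
        by (intro sum.cong) (auto simp: B_def fapp smult_sum)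
      also have "\<dots> = (\<Sum>m\<in>J. smult (c m * A m x) (P N (m N) x))"
        by (rule sum.group) (use J(1) in \<open>auto simp: K_def\<close>)
      finally have eq: "(\<Sum>k\<in>K. smult (B k x) (P N k x)) = (\<Sum>m\<in>J. smult (c m * A m x) (P N (m N) x))" .
      \<comment> \<open>Replacing the coordinate with index N by t changes neither the products
        \<open>A m\<close> of earlier factors nor the polynomials \<open>P N k\<close>, so the
        relation becomes a polynomial identity in t.\<close>
      have "poly (\<Sum>k\<in>K. smult (B k x) (P N k x)) t = 0" for t
      proof -
        let ?x = "upd x N t"
        have "(\<Prod>i<N. u i (m i) ?x) = A m x" for m
          unfolding A_def fapp using Suc.prems by (intro prod.cong) (auto simp: u P_upd W_upd)
        moreover have "u N k ?x = poly (P N k x) t" for k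
          using Suc.prems by (simp add: u P_upd W_upd)
        ultimately have "(\<Sum>m\<in>J. cst (c m) * (\<Prod>i<Suc N. u i (m i))) ?x = (\<Sum>m\<in>J. c m * A m x * poly (P N (m N) x) t)"
          by (simp add: fapp mult.assoc)
        then show ?thesis unfolding eq J(3) by (simp add: poly_sum fapp)
      qed
      then have "(\<Sum>k\<in>K. smult (B k x) (P N k x)) = 0" using poly_all_0_iff_0 by blast
      moreover have "finite K" using J(1) by (simp add: K_def)
      ultimately show ?thesis
        using sum_smult_distinct_degrees[of K "\<lambda>k. P N k x" "\<lambda>k. B k x" k] that inj[of N x] P_nz Suc.prems
        by (meson Suc_le_lessD inj_on_subset subset_UNIV)
    qed
    \<comment> \<open>On indices with a prescribed exponent at N, clearing that exponent is
      injective and leaves \<open>A\<close> unchanged; this carries the induction hypothesis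
      over.\<close>
    let ?h = "\<lambda>m :: nat \<Rightarrow> nat. m(N := 0)" and ?M = "{m. (\<forall>i\<ge>Suc N. m i = 0) \<and> m N = m0 N}"
    have "inj_on ?h ?M"
    proof (rule inj_onI)
      fix m m' assume *: "m \<in> ?M" "m' \<in> ?M" "?h m = ?h m'"
      then show "m = m'" by (metis (mono_tags, lifting) fun_upd_triv fun_upd_upd mem_Collect_eq)
    qed
    moreover have "indep (?h ` ?M) A"
      unfolding A_def by (rule indep_subset[OF Suc.IH]) (use Suc.prems in \<open>auto simp: le_Suc_eq\<close>)
    moreover have "A \<circ> ?h = A"
      unfolding A_def by (rule ext) (auto intro!: prod.cong)
    ultimately have ind: "indep ?M A" using indep_reindex[of ?h ?M A] by simp
    have "B (m0 N) = 0" using B0[of "m0 N"] J(4) by (auto simp: K_def fun_eq_iff fapp)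
    then have "(\<Sum>m\<in>{m\<in>J. m N = m0 N}. cst (c m) * A m) = 0" by (simp add: B_def)
    from indepD[OF ind _ _ this, of m0] J show "c m0 = 0" by auto
  qed
qed

lemma indep_Mon: "indep Ix Mon"
proof -
  have "indep {m. \<forall>i\<ge>n. m i = 0} (\<lambda>m. \<Prod>i<n. W i ^ m i)"
    by (rule indep_triangular[where u = "\<lambda>i k. W i ^ k" and P = "\<lambda>i k x. monom 1 k"])
      (auto simp: fapp poly_monom degree_monom_eq inj_def)
  moreover have "Mon = (\<lambda>m. \<Prod>i<n. W i ^ m i)" by (rule ext) (simp add: Mon_def)
  ultimately show ?thesis by (simp add: Ix_def)
qed

text \<open>Restriction to polynomial curves is the only access to the values of \<open>S\<close>
  that is used below, both for differentiability and for identities that hold generically.\<close>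

lemma S_curve:
  assumes "f \<in> S"
  shows "\<exists>q. \<forall>t. f (\<lambda>i. poly (cy i) t, \<lambda>i. poly (cz i) t) = poly q t"
  using assms unfolding S_def
proof (induction rule: alg.induct)
  case (alg_cst c)
  show ?case by (rule exI[of _ "[:c:]"]) (simp add: fapp)
next
  case (alg_base f)
  then obtain i where "f = W i" by blast
  then show ?case by (auto simp: W_def Zv_def Yv_def)
next
  case (alg_add f g)
  then obtain p q where "\<forall>t. f (\<lambda>i. poly (cy i) t, \<lambda>i. poly (cz i) t) = poly p t" "\<forall>t. g (\<lambda>i. poly (cy i) t, \<lambda>i. poly (cz i) t) = poly q t" by blast
  then show ?case by (intro exI[of _ "p + q"]) (simp add: fapp)
next
  case (alg_mult f g)
  then obtain p q where "\<forall>t. f (\<lambda>i. poly (cy i) t, \<lambda>i. poly (cz i) t) = poly p t" "\<forall>t. g (\<lambda>i. poly (cy i) t, \<lambda>i. poly (cz i) t) = poly q t" by blast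
  then show ?case by (intro exI[of _ "p * q"]) (simp add: fapp)
qed

text \<open>Let z_j move with speed j: two of the z then coincide for finitely many t only, so the
  restriction to this line has infinitely many zeros and vanishes at t = 0 as well.\<close>

lemma S_eq_0_generic:
  assumes f: "f \<in> S" and van: "\<And>x. inj_on (snd x) {..<s} \<Longrightarrow> f x = 0"
  shows "f = 0"
proof
  fix x
  obtain q where q: "\<And>t. f (\<lambda>i. poly [:fst x i:] t, \<lambda>j. poly [:snd x j, of_nat j:] t) = poly q t"
    using S_curve[OF f, of "\<lambda>i. [:fst x i:]" "\<lambda>j. [:snd x j, of_nat j:]"] by blast
  let ?E = "(\<lambda>(j, k). (snd x j - snd x k) / (of_nat k - of_nat j)) ` ({..<s} \<times> {..<s})"
  have "poly q t = 0" if t: "t \<notin> ?E" for t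
  proof -
    have "inj_on (\<lambda>j. poly [:snd x j, of_nat j:] t) {..<s}"
    proof (rule inj_onI, rule ccontr)
      fix j k assume jk: "j \<in> {..<s}" "k \<in> {..<s}" "poly [:snd x j, of_nat j:] t = poly [:snd x k, of_nat k:] t" "j \<noteq> k"
      then have "t * (of_nat k - of_nat j) = snd x j - snd x k" by (simp add: algebra_simps)
      moreover have "of_nat k - of_nat j \<noteq> (0 :: complex)" using jk(4) by simp
      ultimately have "t = (snd x j - snd x k) / (of_nat k - of_nat j)" by (simp add: field_simps)
      then have "t \<in> ?E" using jk by force
      with t show False by blast
    qed
    then show ?thesis unfolding q[symmetric] by (intro van) simp
  qed
  then have sub: "- ?E \<subseteq> {t. poly q t = 0}" by blast
  have "finite ?E" by simp
  then have "infinite (- ?E)" using infinite_UNIV_char_0 by (simp add: Compl_eq_Diff_UNIV)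
  then have "infinite {t. poly q t = 0}" using sub finite_subset by blast
  then have "q = 0" using poly_roots_finite by blast
  then show "f x = 0 x" using q[of 0] by (simp add: fapp)
qed

section \<open>Partial derivatives on the polynomial ring\<close>

lemma S_poly_Y:
  assumes "f \<in> S" obtains q where "\<And>t. f ((fst x)(i := t), snd x) = poly q t"
proof -
  obtain q where q: "\<And>t. f (\<lambda>k. poly (if k = i then [:0,1:] else [:fst x k:]) t, \<lambda>k. poly [:snd x k:] t) = poly q t"
    using S_curve[OF assms, of "\<lambda>k. if k = i then [:0,1:] else [:fst x k:]" "\<lambda>k. [:snd x k:]"] by blast
  have "((fst x)(i := t), snd x) = (\<lambda>k. poly (if k = i then [:0,1:] else [:fst x k:]) t, \<lambda>k. poly [:snd x k:] t)" for t
    by auto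
  then show ?thesis using q by (intro that[of q]) simp
qed

lemma S_poly_Z:
  assumes "f \<in> S" obtains q where "\<And>t. f (fst x, (snd x)(i := t)) = poly q t"
proof -
  obtain q where q: "\<And>t. f (\<lambda>k. poly [:fst x k:] t, \<lambda>k. poly (if k = i then [:0,1:] else [:snd x k:]) t) = poly q t"
    using S_curve[OF assms, of "\<lambda>k. [:fst x k:]" "\<lambda>k. if k = i then [:0,1:] else [:snd x k:]"] by blast
  have "(fst x, (snd x)(i := t)) = (\<lambda>k. poly [:fst x k:] t, \<lambda>k. poly (if k = i then [:0,1:] else [:snd x k:]) t)" for t
    by auto
  then show ?thesis using q by (intro that[of q]) simp
qed

lemma S_differentiable_Y: "f \<in> S \<Longrightarrow> (\<lambda>t. f ((fst x)(i := t), snd x)) field_differentiable (at u)"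
  by (rule S_poly_Y[of f x i]) (auto simp: field_differentiable_def intro: poly_DERIV)

lemma S_differentiable_Z: "f \<in> S \<Longrightarrow> (\<lambda>t. f (fst x, (snd x)(i := t))) field_differentiable (at u)"
  by (rule S_poly_Z[of f x i]) (auto simp: field_differentiable_def intro: poly_DERIV)

lemma dY_add: "f \<in> S \<Longrightarrow> g \<in> S \<Longrightarrow> dY i (f + g) x = dY i f x + dY i g x"
  and dY_mult: "f \<in> S \<Longrightarrow> g \<in> S \<Longrightarrow> dY i (f * g) x = dY i f x * g x + f x * dY i g x"
  unfolding dY_def fapp by (simp_all add: S_differentiable_Y)

lemma dZ_add: "f \<in> S \<Longrightarrow> g \<in> S \<Longrightarrow> dZ i (f + g) x = dZ i f x + dZ i g x"
  and dZ_mult: "f \<in> S \<Longrightarrow> g \<in> S \<Longrightarrow> dZ i (f * g) x = dZ i f x * g x + f x * dZ i g x"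
  unfolding dZ_def fapp by (simp_all add: S_differentiable_Z)

lemma dY_cst [simp]: "dY i (cst c) x = 0" and dZ_cst [simp]: "dZ i (cst c) x = 0"
  by (simp_all add: dY_def dZ_def fapp)

lemma dY_0 [simp]: "dY i 0 x = 0" and dZ_0 [simp]: "dZ i 0 x = 0"
  and dY_1 [simp]: "dY i 1 x = 0" and dZ_1 [simp]: "dZ i 1 x = 0"
  using dY_cst[of i 0 x] dZ_cst[of i 0 x] dY_cst[of i 1 x] dZ_cst[of i 1 x] by simp_all

lemma dY_Yv: "dY i (Yv j) x = (if i = j then 1 else 0)" and dY_Zv [simp]: "dY i (Zv j) x = 0"
  and dZ_Zv: "dZ i (Zv j) x = (if i = j then 1 else 0)" and dZ_Yv [simp]: "dZ i (Yv j) x = 0"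
  by (auto simp: dY_def dZ_def Yv_def Zv_def)

lemma S_cst: "cst c \<in> S"
  by (rule subalg_cst[OF subalg_S])

lemma dY_cst_mult: "f \<in> S \<Longrightarrow> dY i (cst c * f) x = c * dY i f x"
  and dZ_cst_mult: "f \<in> S \<Longrightarrow> dZ i (cst c * f) x = c * dZ i f x"
  using S_cst by (simp_all add: dY_mult dZ_mult fapp)

lemma dY_sum: "(\<And>j. j \<in> J \<Longrightarrow> F j \<in> S) \<Longrightarrow> dY i (\<Sum>j\<in>J. F j) x = (\<Sum>j\<in>J. dY i (F j) x)"
  by (induction J rule: infinite_finite_induct) (auto simp: dY_add subalg_sum[OF subalg_S])

lemma dZ_sum: "(\<And>j. j \<in> J \<Longrightarrow> F j \<in> S) \<Longrightarrow> dZ i (\<Sum>j\<in>J. F j) x = (\<Sum>j\<in>J. dZ i (F j) x)"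
  by (induction J rule: infinite_finite_induct) (auto simp: dZ_add subalg_sum[OF subalg_S])

lemma dY_power: "f \<in> S \<Longrightarrow> dY i (f ^ k) x = of_nat k * f x ^ (k - 1) * dY i f x"
  and dZ_power: "f \<in> S \<Longrightarrow> dZ i (f ^ k) x = of_nat k * f x ^ (k - 1) * dZ i f x"
proof (induction k)
  case (Suc k)
  { case 1
    then have "dY i (f ^ Suc k) x = dY i f x * f x ^ k + f x * dY i (f ^ k) x"
      by (simp add: dY_mult subalg_power[OF subalg_S]) (simp add: fapp)
    with 1 Suc show ?case by (cases k) (auto simp: algebra_simps) }
  { case 2
    then have "dZ i (f ^ Suc k) x = dZ i f x * f x ^ k + f x * dZ i (f ^ k) x"
      by (simp add: dZ_mult subalg_power[OF subalg_S]) (simp add: fapp)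
    with 2 Suc show ?case by (cases k) (auto simp: algebra_simps) }
qed auto

end

section \<open>Bases at a = 0\<close>

lemma pat_sum: "pat x (\<Sum>i\<in>I. F i) = (\<Sum>i\<in>I. pat x (F i))"
  by (induction I rule: infinite_finite_induct) (auto simp: pat_add)

lemma pat_1 [simp]: "pat x 1 = 1"
  by (rule poly_eqI) (simp add: coeff_pat coeff_1 fapp)

lemma pat_monom: "pat x (monom f k) = monom (f x) k"
  by (rule poly_eqI) (simp add: coeff_pat fapp)

lemma poly_pat: "poly p f x = poly (pat x p) (f x)"
  by (induction p) (auto simp: pat_pCons fapp)

definition monicd :: "('x \<Rightarrow> complex) poly \<Rightarrow> nat \<Rightarrow> bool" where
  "monicd p d \<longleftrightarrow> coeff p d = 1 \<and> (\<forall>k>d. coeff p k = 0)"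

lemma monicd_pat:
  assumes "monicd p d" shows "degree (pat x p) = d" "pat x p \<noteq> 0"
proof -
  have c: "coeff (pat x p) d = 1" using assms by (simp add: monicd_def coeff_pat fapp)
  show "pat x p \<noteq> 0" using c by auto
  have "degree (pat x p) \<le> d" by (rule degree_le) (use assms in \<open>simp add: monicd_def coeff_pat fapp\<close>)
  moreover have "d \<le> degree (pat x p)" by (rule le_degree) (simp add: c)
  ultimately show "degree (pat x p) = d" by simp
qed

text \<open>The ring of functions has zero divisors, so degrees of products are controlled point by
  point, over the field of complex numbers.\<close>

lemma monicd_iff_pat: "monicd p d \<longleftrightarrow> (\<forall>x. degree (pat x p) = d \<and> lead_coeff (pat x p) = 1)"
proof
  assume "monicd p d"
  then show "\<forall>x. degree (pat x p) = d \<and> lead_coeff (pat x p) = 1"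
    using monicd_pat[of p d] by (simp add: monicd_def coeff_pat fapp)
next
  assume *: "\<forall>x. degree (pat x p) = d \<and> lead_coeff (pat x p) = 1"
  have "coeff p d x = 1" for x using * by (metis coeff_pat)
  moreover have "coeff p k x = 0" if "k > d" for k x using * that by (metis coeff_pat coeff_eq_0)
  ultimately show "monicd p d" by (auto simp: monicd_def fun_eq_iff fapp)
qed

lemma monicd_mult: "monicd p d \<Longrightarrow> monicd q e \<Longrightarrow> monicd (p * q) (d + e)"
  unfolding monicd_iff_pat pat_mult lead_coeff_mult
  by (metis degree_mult_eq leading_coeff_0_iff mult_1 zero_neq_one)

lemma monicd_1: "monicd 1 0"
  by (simp add: monicd_def coeff_1)

lemma monicd_power: "monicd p d \<Longrightarrow> monicd (p ^ k) (k * d)"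
  by (induction k) (auto intro: monicd_1 monicd_mult)

lemma coeff_chi_alg: "coeff (chi j x) k \<in> alg (x ` {..<j})"
proof (induction j arbitrary: k)
  case 0
  have "0 \<in> alg (x ` {..<0})" "1 \<in> alg (x ` {..<0})" by (rule subalg_0[OF subalg_alg], rule subalg_1[OF subalg_alg])
  then show ?case by (simp add: coeff_1)
next
  case (Suc j)
  have "alg (x ` {..<j}) \<subseteq> alg (x ` {..<Suc j})" by (rule alg_mono) auto
  then have "coeff (chi j x) k \<in> alg (x ` {..<Suc j})" for k using Suc by blast
  moreover have "x j \<in> alg (x ` {..<Suc j})" by (auto intro: alg_base)
  ultimately show ?case unfolding coeff_chi_Suc
    by (auto intro!: subalg_diff[OF subalg_alg] subalg_uminus[OF subalg_alg] subalg_mult[OF subalg_alg] subalg_0[OF subalg_alg])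
qed

lemma alg_monomials:
  fixes w :: "nat \<Rightarrow> 'x \<Rightarrow> complex" and k :: nat
  shows "alg (w ` {..<k}) \<subseteq> fv.span (range (\<lambda>\<kappa>. \<Prod>i<k. w i ^ \<kappa> i))"
proof (rule alg_least)
  let ?M = "\<lambda>\<kappa>. \<Prod>i<k. w i ^ \<kappa> i" let ?V = "fv.span (range ?M)"
  have M_mult: "?M \<kappa> * ?M \<kappa>' = ?M (\<lambda>i. \<kappa> i + \<kappa>' i)" for \<kappa> \<kappa>' by (simp add: power_add prod.distrib)
  have "f * g \<in> ?V" if "f \<in> ?V" "g \<in> ?V" for f g
  proof (rule span_mult_in[OF _ _ that])
    fix x y assume "x \<in> range ?M" "y \<in> range ?M"
    then show "x * y \<in> ?V" using M_mult by (auto intro!: fv.span_base)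
  qed simp
  moreover have "cst c \<in> ?V" for c
  proof -
    have "?M (\<lambda>_. 0) \<in> ?V" by (intro fv.span_base rangeI)
    then have "cst c * ?M (\<lambda>_. 0) \<in> ?V" by (rule fv.span_scale)
    then show ?thesis by simp
  qed
  ultimately show "subalg ?V" unfolding subalg_def using fv.span_add by blast
  show "w ` {..<k} \<subseteq> ?V"
  proof safe
    fix j assume "j < k"
    have "?M (\<lambda>i. if i = j then 1 else 0) = (\<Prod>i<k. if i = j then w i else 1)"
      by (intro prod.cong) auto
    also have "\<dots> = w j" using \<open>j < k\<close> by (simp add: prod.delta)
    finally have eq: "w j = ?M (\<lambda>i. if i = j then 1 else 0)" by simp
    show "w j \<in> ?V" by (subst eq) (intro fv.span_base rangeI)
  qed
qed

lemma prod_lessThan_add: "(\<Prod>i<s + r. g i) = (\<Prod>i<s. g i) * (\<Prod>i<r. g (s + i))" for r s :: nat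
  and g :: "nat \<Rightarrow> 'b::comm_monoid_mult"
  by (induction r) (auto simp: mult.assoc)

lemma sum_lessThan_add: "(\<Sum>i<s + r. g i) = (\<Sum>i<s. g i) + (\<Sum>i<r. g (s + i))" for r s :: nat
  and g :: "nat \<Rightarrow> 'b::comm_monoid_add"
  by (induction r) (auto simp: add.assoc)

context rs
begin

text \<open>Homogeneous of total degree e when the polynomial variable itself is given degree
  1.\<close>

definition hompoly :: "(pt \<Rightarrow> complex) poly \<Rightarrow> nat \<Rightarrow> bool" where
  "hompoly p e \<longleftrightarrow> (\<forall>k\<le>e. coeff p k \<in> Sd (e - k)) \<and> (\<forall>k>e. coeff p k = 0)"

lemma hompoly_mult:
  assumes "hompoly p d" "hompoly q e" shows "hompoly (p * q) (d + e)"
  unfolding hompoly_def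
proof (intro conjI allI impI)
  fix k assume k: "k \<le> d + e"
  show "coeff (p * q) k \<in> Sd (d + e - k)" unfolding coeff_mult
  proof (rule Sd_sum)
    fix i assume i: "i \<in> {..k}"
    show "coeff p i * coeff q (k - i) \<in> Sd (d + e - k)"
    proof (cases "i \<le> d \<and> k - i \<le> e")
      case True
      then have "coeff p i * coeff q (k - i) \<in> Sd ((d - i) + (e - (k - i)))"
        using assms by (intro Sd_mult) (auto simp: hompoly_def)
      moreover have "(d - i) + (e - (k - i)) = d + e - k" using True i by auto
      ultimately show ?thesis by simp
    next
      case False
      then have "coeff p i = 0 \<or> coeff q (k - i) = 0" using assms by (auto simp: hompoly_def)
      then show ?thesis by (auto simp: Sd_0)
    qed
  qed
next
  fix k assume k: "k > d + e"
  show "coeff (p * q) k = 0" unfolding coeff_mult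
  proof (intro sum.neutral ballI)
    fix i assume "i \<in> {..k}"
    then have "i > d \<or> k - i > e" using k by auto
    then show "coeff p i * coeff q (k - i) = 0" using assms by (auto simp: hompoly_def)
  qed
qed

lemma hompoly_1: "hompoly 1 0"
  by (auto simp: hompoly_def coeff_1 Sd_one)

lemma hompoly_power: "hompoly p e \<Longrightarrow> hompoly (p ^ k) (k * e)"
  by (induction k) (auto intro: hompoly_1 hompoly_mult)

lemma poly_hompoly:
  assumes "hompoly p e" "y \<in> Sd 1" shows "poly p y \<in> Sd e"
proof -
  have "poly p y = (\<Sum>k\<le>e. coeff p k * y ^ k)"
    using assms by (intro poly_as_sum) (auto simp: hompoly_def)
  also have "\<dots> \<in> Sd e"
  proof (rule Sd_sum)
    fix k assume "k \<in> {..e}"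
    then have "coeff p k * y ^ k \<in> Sd ((e - k) + k * 1)"
      using assms by (intro Sd_mult Sd_power) (auto simp: hompoly_def)
    then show "coeff p k * y ^ k \<in> Sd e" using \<open>k \<in> {..e}\<close> by simp
  qed
  finally show ?thesis .
qed

lemma coeff_chi_Sd:
  "(\<And>i. i < j \<Longrightarrow> x i \<in> Sd e) \<Longrightarrow> k \<le> j \<Longrightarrow> coeff (chi j x) k \<in> Sd ((j - k) * e)"
proof (induction j arbitrary: k)
  case 0
  then show ?case using Sd_one by (simp add: coeff_1)
next
  case (Suc j)
  have "(if k = 0 then 0 else coeff (chi j x) (k - 1)) \<in> Sd ((Suc j - k) * e)"
    using Suc.IH[of "k - 1"] Suc.prems by (auto simp: Sd_0)
  moreover have "x j * coeff (chi j x) k \<in> Sd ((Suc j - k) * e)"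
  proof (cases "k \<le> j")
    case True
    then have "x j * coeff (chi j x) k \<in> Sd (e + (j - k) * e)"
      using Suc.IH[of k] Suc.prems by (intro Sd_mult) auto
    then show ?thesis using True by (simp add: Suc_diff_le)
  qed (auto simp: coeff_chi_gt Sd_0)
  ultimately show ?case unfolding coeff_chi_Suc by (rule Sd_diff)
qed

section \<open>Polynomials in one y with critical points at all z\<close>

abbreviation Az :: "(pt \<Rightarrow> complex) set" where "Az \<equiv> alg (Zv ` {..<s})"

definition chz :: "(pt \<Rightarrow> complex) poly" where "chz = chi s Zv"

definition Cz :: "(pt \<Rightarrow> complex) set" where "Cz = alg (range (coeff chz))"

lemma subalg_Cz [simp]: "subalg Cz"
  by (simp add: Cz_def)

lemma Cz_Az: "Cz \<subseteq> Az"
  unfolding Cz_def chz_def by (rule alg_least) (use coeff_chi_alg[of s Zv] in auto)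

lemma Az_S: "Az \<subseteq> S"
  by (rule alg_least) (auto intro: Zv_S)

lemma Az_snd: assumes "f \<in> Az" "snd x = snd x'" shows "f x = f x'"
  using assms(1) by induction (auto simp: fapp Zv_def assms(2))

lemma pat_Az: "p \<in> polys_over Az \<Longrightarrow> snd x = snd x' \<Longrightarrow> pat x p = pat x' p"
  by (rule poly_eqI) (auto simp: coeff_pat polys_over_def intro: Az_snd)

lemma polys_over_mono: "A \<subseteq> B \<Longrightarrow> polys_over A \<subseteq> polys_over B"
  by (auto simp: polys_over_def)

text \<open>The condition on a polynomial with coefficients in z that puts
  \<open>poly p (Yv i)\<close> into the limit algebra. By the product rule it is closed under
  multiplication.\<close>

definition flat :: "(pt \<Rightarrow> complex) poly \<Rightarrow> bool" where
  "flat p \<longleftrightarrow> (\<forall>x. \<forall>j<s. poly (pderiv (pat x p)) (snd x j) = 0)"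

lemma flat_mult: "flat p \<Longrightarrow> flat q \<Longrightarrow> flat (p * q)"
  by (simp add: flat_def pat_mult pderiv_mult)

lemma flat_1: "flat 1"
  by (simp add: flat_def)

lemma flat_power: "flat p \<Longrightarrow> flat (p ^ k)"
  by (induction k) (auto intro: flat_1 flat_mult)

text \<open>The monic antiderivative of a multiple of \<open>y ^ (k - s - 1) * (\<Prod>j<s. y - z j)\<close>, for \<open>k > s\<close>.\<close>

definition Dp :: "nat \<Rightarrow> (pt \<Rightarrow> complex) poly" where
  "Dp k = (\<Sum>l\<le>s. monom (cst (of_nat k / of_nat (l + k - s)) * coeff chz l) (l + k - s))"

lemma coeff_Dp:
  assumes "k > s"
  shows "coeff (Dp k) m = (if k - s \<le> m \<and> m \<le> k then cst (of_nat k / of_nat m) * coeff chz (m + s - k) else 0)"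
proof -
  have "coeff (Dp k) m = (\<Sum>l\<le>s. if l + k - s = m then cst (of_nat k / of_nat m) * coeff chz l else 0)"
    unfolding Dp_def coeff_sum by (intro sum.cong) auto
  also have "\<dots> = (\<Sum>l\<le>s. if l = m + s - k \<and> k - s \<le> m then cst (of_nat k / of_nat m) * coeff chz l else 0)"
    using assms by (intro sum.cong) auto
  also have "\<dots> = (if k - s \<le> m \<and> m \<le> k then cst (of_nat k / of_nat m) * coeff chz (m + s - k) else 0)"
  proof (cases "k - s \<le> m")
    case True
    then have "(\<Sum>l\<le>s. if l = m + s - k \<and> k - s \<le> m then cst (of_nat k / of_nat m) * coeff chz l else 0)
      = (\<Sum>l\<le>s. if l = m + s - k then cst (of_nat k / of_nat m) * coeff chz l else 0)" by simp
    also have "\<dots> = (if m + s - k \<le> s then cst (of_nat k / of_nat m) * coeff chz (m + s - k) else 0)"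
      by (subst sum.delta) auto
    finally show ?thesis using True assms by auto
  qed auto
  finally show ?thesis .
qed

lemma monicd_Dp: assumes "k > s" shows "monicd (Dp k) k"
  unfolding monicd_def using assms coeff_chi_eq[of s Zv] by (auto simp: coeff_Dp chz_def)

lemma hompoly_Dp: assumes "k > s" shows "hompoly (Dp k) k"
  unfolding hompoly_def
proof (intro conjI allI impI)
  fix m assume m: "m \<le> k"
  show "coeff (Dp k) m \<in> Sd (k - m)"
  proof (cases "k - s \<le> m")
    case True
    then have "coeff chz (m + s - k) \<in> Sd ((s - (m + s - k)) * 1)"
      unfolding chz_def using m by (intro coeff_chi_Sd Zv_Sd) auto
    moreover have "s - (m + s - k) = k - m" using m True by auto
    ultimately show ?thesis using assms by (simp add: coeff_Dp Sd_cst_mult Sd_0)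
  qed (use assms in \<open>auto simp: coeff_Dp Sd_0\<close>)
qed (use assms in \<open>auto simp: coeff_Dp\<close>)

lemma Dp_Cz: "k > s \<Longrightarrow> Dp k \<in> polys_over Cz"
proof -
  assume "k > s"
  moreover have "coeff chz j \<in> Cz" for j unfolding Cz_def by (rule alg_base) simp
  ultimately show ?thesis
    by (auto simp: polys_over_def coeff_Dp intro: subalg_mult[OF subalg_Cz] subalg_cst[OF subalg_Cz] subalg_0[OF subalg_Cz])
qed

lemma chz_root: "j < s \<Longrightarrow> poly (pat x chz) (snd x j) = 0"
proof -
  assume "j < s"
  then have "poly chz (Zv j) x = 0" unfolding chz_def poly_chi fapp by (intro prod_zero) auto
  then show ?thesis by (simp add: poly_pat Zv_def)
qed

lemma flat_Dp: assumes k: "k > s" shows "flat (Dp k)"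
  unfolding flat_def
proof (intro allI impI)
  fix x j assume j: "j < s"
  have "poly (pderiv (pat x (Dp k))) (snd x j) = (\<Sum>l\<le>s. of_nat k * coeff chz l x * snd x j ^ (l + (k - s - 1)))"
    unfolding Dp_def pat_sum pderiv_sum poly_sum
  proof (intro sum.cong refl)
    fix l
    have e: "l + k - s = Suc (l + (k - s - 1))" using k by simp
    show "poly (pderiv (pat x (monom (cst (of_nat k / of_nat (l + k - s)) * coeff chz l) (l + k - s)))) (snd x j)
      = of_nat k * coeff chz l x * snd x j ^ (l + (k - s - 1))"
      unfolding e by (simp add: pat_monom pderiv_monom poly_monom fapp del: of_nat_Suc)
  qed
  also have "\<dots> = of_nat k * snd x j ^ (k - s - 1) * (\<Sum>l\<le>s. coeff (pat x chz) l * snd x j ^ l)"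
    by (simp add: sum_distrib_left power_add mult_ac coeff_pat)
  also have "(\<Sum>l\<le>s. coeff (pat x chz) l * snd x j ^ l) = poly (pat x chz) (snd x j)"
    by (rule poly_as_sum[symmetric]) (simp add: coeff_pat chz_def coeff_chi_gt fapp)
  finally show "poly (pderiv (pat x (Dp k))) (snd x j) = 0" using chz_root[OF j] by simp
qed

text \<open>One flat polynomial for every residue modulo s + 1. For a nonzero residue b the degree b
  itself cannot occur, hence the shift by s + 1.\<close>

definition eps :: "nat \<Rightarrow> (pt \<Rightarrow> complex) poly" where
  "eps b = (if b = 0 then 1 else Dp (s + 1 + b))"

text \<open>Flat monic polynomials whose degrees \<open>tdg k\<close> run through 0 and all numbers
  above s, each once. Splitting off the powers of \<open>Dp (s + 1)\<close> makes the
  \<open>eps b\<close> with b \<le> s the basis over polynomials in that element.\<close>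

definition GT :: "nat \<Rightarrow> (pt \<Rightarrow> complex) poly" where
  "GT k = Dp (s + 1) ^ (k div (s + 1)) * eps (k mod (s + 1))"

definition tdg :: "nat \<Rightarrow> nat" where
  "tdg k = (if (s + 1) dvd k then k else k + (s + 1))"

lemma tdg_eq: "tdg k = k div (s + 1) * (s + 1) + (if k mod (s + 1) = 0 then 0 else s + 1 + k mod (s + 1))"
proof -
  have "(if t dvd k then k else k + t) = k div t * t + (if k mod t = 0 then 0 else t + k mod t)" for t
    using div_mult_mod_eq[of k t] by (auto simp: dvd_eq_mod_eq_0)
  then show ?thesis unfolding tdg_def .
qed

lemma inj_tdg: "inj tdg"
proof (rule injI)
  fix k l assume *: "tdg k = tdg l"
  have "(s + 1) dvd tdg k \<longleftrightarrow> (s + 1) dvd k" for k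
    unfolding tdg_def by (simp only: dvd_add_triv_right_iff split: if_splits) blast
  with * have "(s + 1) dvd k \<longleftrightarrow> (s + 1) dvd l" by metis
  with * show "k = l" unfolding tdg_def by (auto split: if_splits)
qed

lemma monicd_GT: "monicd (GT k) (tdg k)" and hompoly_GT: "hompoly (GT k) (tdg k)"
  and flat_GT: "flat (GT k)" and GT_Cz: "GT k \<in> polys_over Cz"
proof -
  have PC: "subrng (polys_over Cz)" by (intro subrng_polys_over subrng_subalg subalg_Cz)
  have e: "monicd (eps b) (if b = 0 then 0 else s + 1 + b)" "hompoly (eps b) (if b = 0 then 0 else s + 1 + b)"
    "flat (eps b)" "eps b \<in> polys_over Cz" for b
    using PC by (auto simp: eps_def monicd_1 hompoly_1 flat_1 monicd_Dp hompoly_Dp flat_Dp Dp_Cz subrng_def)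
  show "monicd (GT k) (tdg k)"
    unfolding GT_def tdg_eq by (intro monicd_mult monicd_power monicd_Dp e) simp
  show "hompoly (GT k) (tdg k)"
    unfolding GT_def tdg_eq by (intro hompoly_mult hompoly_power hompoly_Dp e) simp
  show "flat (GT k)"
    unfolding GT_def by (intro flat_mult flat_power flat_Dp e) simp
  have "Dp (s + 1) ^ j \<in> polys_over Cz" for j
    using PC Dp_Cz[of "s + 1"] by (induction j) (auto simp: subrng_def)
  then show "GT k \<in> polys_over Cz" using PC e(4) unfolding GT_def subrng_def by blast
qed

section \<open>Parameters at a = 0 and bases over them\<close>

definition xi :: "nat \<Rightarrow> pt \<Rightarrow> complex" where "xi i = poly (Dp (s + 1)) (Yv i)"

definition chx :: "(pt \<Rightarrow> complex) poly" where "chx = chi r xi"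

definition dd :: "nat \<Rightarrow> nat" where "dd i = (if i < s then i + 1 else (s + 1) * (i - s + 1))"

text \<open>Up to sign, the elementary symmetric functions of the z, then those of the
  \<open>xi i\<close>. In particular \<open>theta0 (n - 1)\<close> is the product of all
  \<open>xi i\<close> up to sign.\<close>

definition theta0 :: "nat \<Rightarrow> pt \<Rightarrow> complex" where
  "theta0 i = (if i < s then coeff chz (s - 1 - i) else coeff chx (r - 1 - (i - s)))"

definition el :: "(nat \<Rightarrow> nat \<Rightarrow> pt \<Rightarrow> complex) \<Rightarrow> nat \<Rightarrow> nat \<Rightarrow> pt \<Rightarrow> complex" where
  "el ep i k = (if i < s then Zv i ^ k else xi (i - s) ^ (k div (s + 1)) * ep (k mod (s + 1)) (i - s))"

text \<open>One exponent vector carries three data: the quotient by \<open>dd i\<close> is the power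
  of the parameter, and the remainder is an Artin exponent of z_i or, for a y, an Artin exponent of
  its \<open>xi\<close> together with a residue modulo s + 1. With \<open>epS\<close> and
  homogeneous parameters of degrees \<open>dd i\<close>, the degree is that of the monomial with the
  same index.\<close>

definition bas :: "(nat \<Rightarrow> pt \<Rightarrow> complex) \<Rightarrow> (nat \<Rightarrow> nat \<Rightarrow> pt \<Rightarrow> complex) \<Rightarrow> (nat \<Rightarrow> nat) \<Rightarrow> pt \<Rightarrow> complex" where
  "bas th ep m = (\<Prod>i<n. th i ^ (m i div dd i) * el ep i (m i mod dd i))"

definition epS :: "nat \<Rightarrow> nat \<Rightarrow> pt \<Rightarrow> complex" where "epS b i = Yv i ^ b"
definition epT :: "nat \<Rightarrow> nat \<Rightarrow> pt \<Rightarrow> complex" where "epT b i = poly (eps b) (Yv i)"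

lemma dd_pos: "0 < dd i"
  by (simp add: dd_def)

lemma xi_Sd: "i < r \<Longrightarrow> xi i \<in> Sd (s + 1)"
  unfolding xi_def by (intro poly_hompoly hompoly_Dp Yv_Sd) auto

lemma theta0_Sd: "i < n \<Longrightarrow> theta0 i \<in> Sd (dd i)"
proof -
  assume i: "i < n"
  show ?thesis
  proof (cases "i < s")
    case True
    then have "coeff chz (s - 1 - i) \<in> Sd ((s - (s - 1 - i)) * 1)"
      unfolding chz_def by (intro coeff_chi_Sd Zv_Sd) auto
    then show ?thesis using True by (simp add: theta0_def dd_def)
  next
    case False
    then have "coeff chx (r - 1 - (i - s)) \<in> Sd ((r - (r - 1 - (i - s))) * (s + 1))"
      unfolding chx_def by (intro coeff_chi_Sd xi_Sd) auto
    moreover have "r - (r - 1 - (i - s)) = i - s + 1" using i False by (auto simp: n_def)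
    ultimately have "coeff chx (r - 1 - (i - s)) \<in> Sd ((i - s + 1) * (s + 1))" by (simp only:)
    then show ?thesis unfolding theta0_def dd_def if_not_P[OF False] by (simp only: mult.commute)
  qed
qed

lemma coeff_chz_theta0: "coeff chz k = (if k < s then theta0 (s - 1 - k) else if k = s then 1 else 0)"
  using coeff_chi_eq[of s Zv] coeff_chi_gt[of s k Zv] by (auto simp: theta0_def chz_def)

lemma coeff_chx_theta0: "coeff chx k = (if k < r then theta0 (s + (r - 1 - k)) else if k = r then 1 else 0)"
  using coeff_chi_eq[of r xi] coeff_chi_gt[of r k xi] by (auto simp: theta0_def chx_def)

lemma el_epT: "i < r \<Longrightarrow> el epT (s + i) k = poly (GT k) (Yv i)"
  by (simp add: el_def epT_def GT_def xi_def)

lemma bas_shift: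
  assumes "i < n" shows "bas th ep (m(i := m i + dd i)) = th i * bas th ep m"
proof -
  let ?g = "\<lambda>m i. th i ^ (m i div dd i) * el ep i (m i mod dd i)"
  have "bas th ep (m(i := m i + dd i)) = ?g (m(i := m i + dd i)) i * (\<Prod>j\<in>{..<n} - {i}. ?g (m(i := m i + dd i)) j)"
    unfolding bas_def using assms by (intro prod.remove) auto
  also have "(\<Prod>j\<in>{..<n} - {i}. ?g (m(i := m i + dd i)) j) = (\<Prod>j\<in>{..<n} - {i}. ?g m j)"
    by (intro prod.cong) auto
  also have "?g (m(i := m i + dd i)) i = th i * ?g m i" using dd_pos[of i] by (simp add: mult.assoc)
  also have "th i * ?g m i * (\<Prod>j\<in>{..<n} - {i}. ?g m j) = th i * (?g m i * (\<Prod>j\<in>{..<n} - {i}. ?g m j))"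
    by (simp add: mult.assoc)
  also have "?g m i * (\<Prod>j\<in>{..<n} - {i}. ?g m j) = bas th ep m"
    unfolding bas_def using assms by (intro prod.remove[symmetric]) auto
  finally show ?thesis .
qed

text \<open>Artin's basis is applied twice: to the \<open>xi\<close> over their symmetric functions
  with the z as scalars, then to the z.\<close>

lemma alg_Zv_xi:
  "alg (Zv ` {..<s} \<union> xi ` {..<r}) \<subseteq> mspan (alg (theta0 ` {..<n}))
     {mz * mx | mz mx. mz \<in> {(\<Prod>i<s. Zv i ^ \<gamma> i) | \<gamma>. \<forall>i<s. \<gamma> i \<le> i} \<and> mx \<in> {(\<Prod>i<r. xi i ^ \<gamma> i) | \<gamma>. \<forall>i<r. \<gamma> i \<le> i}}"
proof -
  let ?T = "alg (theta0 ` {..<n})"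
  let ?NZ = "{(\<Prod>i<s. Zv i ^ \<gamma> i) | \<gamma>. \<forall>i<s. \<gamma> i \<le> i}" and ?NX = "{(\<Prod>i<r. xi i ^ \<gamma> i) | \<gamma>. \<forall>i<r. \<gamma> i \<le> i}"
  have T: "0 \<in> ?T" "1 \<in> ?T" by (rule subalg_0[OF subalg_alg], rule subalg_1[OF subalg_alg])
  have th: "theta0 i \<in> ?T" if "i < n" for i using that by (intro alg_base) auto
  have "coeff chx k \<in> ?T" "coeff chz k \<in> ?T" for k
    unfolding coeff_chx_theta0 coeff_chz_theta0 using T th[of "s + (r - 1 - k)"] th[of "s - 1 - k"] by (auto simp: n_def)
  then have c: "range (coeff chx) \<subseteq> ?T" "range (coeff chz) \<subseteq> ?T" by auto
  have "alg (Zv ` {..<s} \<union> range (coeff chx)) = alg (range (coeff chx) \<union> Zv ` {..<s})" by (simp add: Un_commute)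
  also have "\<dots> \<subseteq> mspan (alg (range (coeff chx) \<union> range (coeff chz))) ?NZ"
    unfolding chz_def by (rule alg_artin)
  also have "\<dots> \<subseteq> mspan ?T ?NZ"
    using c by (intro mspan_mono alg_least) auto
  finally have "alg (Zv ` {..<s} \<union> range (coeff chx)) \<subseteq> mspan ?T ?NZ" .
  then have "mspan (alg (Zv ` {..<s} \<union> range (coeff chx))) ?NX \<subseteq> mspan ?T {mz * mx | mz mx. mz \<in> ?NZ \<and> mx \<in> ?NX}"
    by (intro mspan_tower) auto
  moreover have "alg (Zv ` {..<s} \<union> xi ` {..<r}) \<subseteq> mspan (alg (Zv ` {..<s} \<union> range (coeff chx))) ?NX"
    unfolding chx_def by (rule alg_artin)
  ultimately show ?thesis by (rule order_trans[rotated])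
qed

lemma span_bas:
  assumes f: "f \<in> alg (Zv ` {..<s} \<union> xi ` {..<r})" and \<beta>: "\<And>i. i < r \<Longrightarrow> \<beta> i \<le> s"
  shows "f * (\<Prod>i<r. ep (\<beta> i) i) \<in> fv.span (bas theta0 ep ` Ix)"
proof -
  let ?V = "fv.span (bas theta0 ep ` Ix)" and ?E = "\<Prod>i<r. ep (\<beta> i) i"
  have mono: "(\<Prod>i<n. theta0 i ^ \<kappa> i) * ((\<Prod>i<s. Zv i ^ \<gamma> i) * (\<Prod>i<r. xi i ^ \<gamma>' i) * ?E) \<in> ?V"
    if \<gamma>: "\<forall>i<s. \<gamma> i \<le> i" and \<gamma>': "\<forall>i<r. \<gamma>' i \<le> i" for \<kappa> \<gamma> \<gamma>'
  proof -
    \<comment> \<open>Artin exponent and residue are packed as quotient and remainder modulo s + 1.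
      The bounds i - s and s on the two make the result smaller than \<open>dd i\<close>.\<close>
    define e where "e i = (if i < s then \<gamma> i else \<gamma>' (i - s) * (s + 1) + \<beta> (i - s))" for i
    define m where "m i = (if i < n then \<kappa> i * dd i + e i else 0)" for i
    have e_less: "e i < dd i" if "i < n" for i
    proof (cases "i < s")
      case False
      then have i: "i - s < r" using that by (auto simp: n_def)
      have "\<gamma>' (i - s) * (s + 1) \<le> (i - s) * (s + 1)" using \<gamma>' i by (intro mult_le_mono) auto
      then have "e i \<le> (i - s) * (s + 1) + s" using \<beta>[OF i] False by (simp add: e_def)
      then show ?thesis using False by (simp add: dd_def algebra_simps)
    qed (use \<gamma> in \<open>auto simp: e_def dd_def le_imp_less_Suc\<close>)
    have "bas theta0 ep m = (\<Prod>i<n. theta0 i ^ \<kappa> i * el ep i (e i))"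
      unfolding bas_def
    proof (intro prod.cong refl)
      fix i assume "i \<in> {..<n}"
      then have i: "m i = \<kappa> i * dd i + e i" "e i < dd i" using e_less by (auto simp: m_def)
      then have "m i div dd i = \<kappa> i" "m i mod dd i = e i" using dd_pos[of i] by auto
      then show "theta0 i ^ (m i div dd i) * el ep i (m i mod dd i) = theta0 i ^ \<kappa> i * el ep i (e i)" by simp
    qed
    also have "\<dots> = (\<Prod>i<n. theta0 i ^ \<kappa> i) * (\<Prod>i<n. el ep i (e i))" by (simp add: prod.distrib)
    also have "(\<Prod>i<n. el ep i (e i)) = (\<Prod>i<s. el ep i (e i)) * (\<Prod>i<r. el ep (s + i) (e (s + i)))"
      unfolding n_def add.commute[of r s] by (rule prod_lessThan_add)
    also have "(\<Prod>i<s. el ep i (e i)) = (\<Prod>i<s. Zv i ^ \<gamma> i)"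
      by (intro prod.cong) (auto simp: el_def e_def)
    also have "(\<Prod>i<r. el ep (s + i) (e (s + i))) = (\<Prod>i<r. xi i ^ \<gamma>' i * ep (\<beta> i) i)"
    proof (intro prod.cong refl)
      fix i assume "i \<in> {..<r}"
      then have "\<beta> i < s + 1" using \<beta>[of i] by simp
      then have "(\<gamma>' i * (s + 1) + \<beta> i) div (s + 1) = \<gamma>' i" "(\<gamma>' i * (s + 1) + \<beta> i) mod (s + 1) = \<beta> i"
        by (simp_all only: div_mult_self3 mod_mult_self3 div_less mod_less)
      then show "el ep (s + i) (e (s + i)) = xi i ^ \<gamma>' i * ep (\<beta> i) i"
        by (simp add: el_def e_def)
    qed
    also have "\<dots> = (\<Prod>i<r. xi i ^ \<gamma>' i) * ?E" by (simp add: prod.distrib)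
    finally have eq: "bas theta0 ep m = (\<Prod>i<n. theta0 i ^ \<kappa> i) * ((\<Prod>i<s. Zv i ^ \<gamma> i) * (\<Prod>i<r. xi i ^ \<gamma>' i) * ?E)"
      by (simp add: mult.assoc)
    have "m \<in> Ix" by (simp add: Ix_def m_def)
    then have "bas theta0 ep m \<in> ?V" by (intro fv.span_base imageI)
    then show ?thesis by (simp only: eq)
  qed
  let ?M = "{mz * mx | mz mx. mz \<in> {(\<Prod>i<s. Zv i ^ \<gamma> i) | \<gamma>. \<forall>i<s. \<gamma> i \<le> i} \<and> mx \<in> {(\<Prod>i<r. xi i ^ \<gamma> i) | \<gamma>. \<forall>i<r. \<gamma> i \<le> i}}"
  have "mspan (alg (theta0 ` {..<n})) ?M \<subseteq> {f. f * ?E \<in> ?V}"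
  proof (rule mspan_minimal)
    fix a m assume a: "a \<in> alg (theta0 ` {..<n})" and "m \<in> ?M"
    then obtain \<gamma> \<gamma>' where m: "m = (\<Prod>i<s. Zv i ^ \<gamma> i) * (\<Prod>i<r. xi i ^ \<gamma>' i)" "\<forall>i<s. \<gamma> i \<le> i" "\<forall>i<r. \<gamma>' i \<le> i"
      by blast
    have "fv.span (range (\<lambda>\<kappa>. \<Prod>i<n. theta0 i ^ \<kappa> i)) \<subseteq> {a. a * (m * ?E) \<in> ?V}"
      using mono[OF m(2,3)] m(1) by (intro fv.span_minimal subspace_mult_preimage) auto
    then have "a * (m * ?E) \<in> ?V" using a alg_monomials[of theta0 n] by blast
    then show "a * m \<in> {f. f * ?E \<in> ?V}" by (simp add: mult.assoc)
  qed (auto intro: subspace_mult_preimage)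
  then show ?thesis using f alg_Zv_xi by blast
qed

text \<open>Same index set and degrees as \<open>bas\<close>, but a product of polynomials in single
  coordinates y with coefficients in z. For \<open>epT\<close> independence is therefore visible
  here, and it is transferred to \<open>bas\<close>.\<close>

definition Gm :: "(nat \<Rightarrow> nat \<Rightarrow> pt \<Rightarrow> complex) \<Rightarrow> (nat \<Rightarrow> nat) \<Rightarrow> pt \<Rightarrow> complex" where
  "Gm ep m = (\<Prod>i<n. el ep i (m i))"

lemma Gm_split: "Gm ep m = (\<Prod>i<s. Zv i ^ m i) * (\<Prod>i<r. el ep (s + i) (m (s + i)))"
  unfolding Gm_def n_def add.commute[of r s] prod_lessThan_add by (simp add: el_def)

lemma Gm_span: "Gm ep m \<in> fv.span (bas theta0 ep ` Ix)"
proof -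
  let ?B = "alg (Zv ` {..<s} \<union> xi ` {..<r})"
  have "(\<Prod>i<r. el ep (s + i) (m (s + i))) = (\<Prod>i<r. xi i ^ (m (s + i) div (s + 1))) * (\<Prod>i<r. ep (m (s + i) mod (s + 1)) i)"
    by (simp add: el_def prod.distrib)
  then have "Gm ep m = ((\<Prod>i<s. Zv i ^ m i) * (\<Prod>i<r. xi i ^ (m (s + i) div (s + 1)))) * (\<Prod>i<r. ep (m (s + i) mod (s + 1)) i)"
    unfolding Gm_split by (simp add: mult.assoc)
  also have "\<dots> \<in> fv.span (bas theta0 ep ` Ix)"
  proof (rule span_bas)
    show "(\<Prod>i<s. Zv i ^ m i) * (\<Prod>i<r. xi i ^ (m (s + i) div (s + 1))) \<in> ?B"
      by (intro subalg_mult[OF subalg_alg] subalg_prod[OF subalg_alg] subalg_power[OF subalg_alg] alg_base) auto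
    fix i show "m (s + i) mod (s + 1) \<le> s"
      by (metis Suc_eq_plus1 less_Suc_eq_le mod_less_divisor zero_less_Suc)
  qed
  finally show ?thesis .
qed

lemma xi_eq: "Yv i ^ (s + 1) = xi i - (\<Sum>k\<le>s. coeff (Dp (s + 1)) k * Yv i ^ k)"
proof -
  have "xi i = (\<Sum>k\<le>s + 1. coeff (Dp (s + 1)) k * Yv i ^ k)"
    unfolding xi_def by (rule poly_as_sum) (use monicd_Dp[of "s + 1"] in \<open>auto simp: monicd_def\<close>)
  then show ?thesis using monicd_Dp[of "s + 1"] by (simp add: monicd_def)
qed

text \<open>The definition of \<open>xi i\<close> is itself a monic equation of degree s + 1 for y_i
  over the z and \<open>xi\<close>.\<close>

lemma S_bas: "S \<subseteq> fv.span (bas theta0 epS ` Ix)"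
proof -
  let ?B = "alg (Zv ` {..<s} \<union> xi ` {..<r})"
  have AzB: "Az \<subseteq> ?B" by (rule alg_mono) auto
  have "W ` {..<n} \<subseteq> ?B \<union> Yv ` {..<r}"
    by (auto simp: W_def n_def intro!: alg_base)
  then have "S \<subseteq> alg (?B \<union> Yv ` {..<r})" unfolding S_def by (rule alg_mono)
  also have "\<dots> \<subseteq> mspan ?B {(\<Prod>i<r. Yv i ^ \<beta> i) | \<beta>. \<forall>i<r. \<beta> i < s + 1}"
  proof (rule alg_adjoin_monics)
    fix i assume i: "i < r"
    let ?M = "{Yv i ^ k | k. k < s + 1}"
    have "xi i * Yv i ^ 0 \<in> mspan ?B ?M" using i by (intro mspan_base alg_base CollectI exI[of _ 0]) auto
    moreover have "(\<Sum>k\<le>s. coeff (Dp (s + 1)) k * Yv i ^ k) \<in> mspan ?B ?M"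
    proof (intro mspan_sum mspan_base)
      fix k assume "k \<in> {..s}"
      show "coeff (Dp (s + 1)) k \<in> ?B" using Dp_Cz[of "s + 1"] Cz_Az AzB by (auto simp: polys_over_def)
      show "Yv i ^ k \<in> ?M" using \<open>k \<in> {..s}\<close> by (intro CollectI exI[of _ k]) auto
    qed
    ultimately show "Yv i ^ (s + 1) \<in> mspan ?B ?M"
      unfolding xi_eq by (intro fv.subspace_diff[OF mspan_subspace]) auto
  qed simp
  also have "\<dots> \<subseteq> fv.span (bas theta0 epS ` Ix)"
  proof (rule mspan_minimal)
    fix a m assume "a \<in> ?B" "m \<in> {(\<Prod>i<r. Yv i ^ \<beta> i) | \<beta>. \<forall>i<r. \<beta> i < s + 1}"
    then obtain \<beta> where "m = (\<Prod>i<r. Yv i ^ \<beta> i)" "\<forall>i<r. \<beta> i < s + 1" by blast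
    then have "m = (\<Prod>i<r. epS (\<beta> i) i)" "\<forall>i<r. \<beta> i \<le> s" by (auto simp: epS_def)
    with \<open>a \<in> ?B\<close> show "a * m \<in> fv.span (bas theta0 epS ` Ix)" using span_bas[of a \<beta> epS] by blast
  qed simp
  finally show ?thesis .
qed

definition tdeg :: "nat \<Rightarrow> nat \<Rightarrow> nat" where "tdeg i k = (if i < s then k else tdg k)"

lemma tdeg_ge: "k \<le> tdeg i k"
  by (auto simp: tdeg_def tdg_def)

lemma el_epT_Sd: "i < n \<Longrightarrow> el epT i k \<in> Sd (tdeg i k)"
proof -
  assume i: "i < n"
  show ?thesis
  proof (cases "i < s")
    case True
    then show ?thesis using Sd_power[OF Zv_Sd[OF True], of k] by (simp add: el_def tdeg_def)
  next
    case False
    then have "i - s < r" "i = s + (i - s)" using i by (auto simp: n_def)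
    then have "el epT i k = poly (GT k) (Yv (i - s))" using el_epT[of "i - s" k] by simp
    also have "\<dots> \<in> Sd (tdg k)" using \<open>i - s < r\<close> by (intro poly_hompoly hompoly_GT Yv_Sd)
    finally show ?thesis using False by (simp add: tdeg_def)
  qed
qed

text \<open>For a coordinate y, \<open>dd i\<close> is a multiple of s + 1, so reducing modulo
  \<open>dd i\<close> does not affect the divisibility that decides on the shift in
  \<open>tdg\<close>.\<close>

lemma tdeg_div_mod: "m div dd i * dd i + tdeg i (m mod dd i) = tdeg i m"
proof (cases "i < s")
  case False
  then have "(s + 1) dvd dd i" unfolding dd_def if_not_P[OF False] by (intro dvd_triv_left)
  then have "(s + 1) dvd (m mod dd i) \<longleftrightarrow> (s + 1) dvd m" by (rule dvd_mod_iff)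
  then show ?thesis using False div_mult_mod_eq[of m "dd i"] by (auto simp: tdeg_def tdg_def)
qed (use div_mult_mod_eq[of m "dd i"] in \<open>simp add: tdeg_def\<close>)

lemma bas_epT_Sd: "bas theta0 epT m \<in> Sd (\<Sum>i<n. tdeg i (m i))"
proof -
  have "bas theta0 epT m \<in> Sd (\<Sum>i<n. m i div dd i * dd i + tdeg i (m i mod dd i))"
    unfolding bas_def by (intro Sd_prod Sd_mult Sd_power theta0_Sd el_epT_Sd) auto
  then show ?thesis by (simp only: tdeg_div_mod)
qed

lemma el_epS_Sd: "i < n \<Longrightarrow> el epS i k \<in> Sd k"
proof -
  assume i: "i < n"
  show ?thesis
  proof (cases "i < s")
    case True
    then show ?thesis using Sd_power[OF Zv_Sd[OF True], of k] by (simp add: el_def)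
  next
    case False
    then have "i - s < r" using i by (auto simp: n_def)
    then have "el epS i k \<in> Sd (k div (s + 1) * (s + 1) + k mod (s + 1) * 1)"
      unfolding el_def epS_def if_not_P[OF False] by (intro Sd_mult Sd_power xi_Sd Yv_Sd)
    then show ?thesis by (simp only: mult_1_right div_mult_mod_eq)
  qed
qed

lemma bas_epS_Sd:
  assumes "\<And>i. i < n \<Longrightarrow> th i \<in> Sd (dd i)"
  shows "bas th epS m \<in> Sd (\<Sum>i<n. m i)"
proof -
  have "bas th epS m \<in> Sd (\<Sum>i<n. m i div dd i * dd i + m i mod dd i)"
    unfolding bas_def by (intro Sd_prod Sd_mult Sd_power assms el_epS_Sd) auto
  then show ?thesis by (simp only: div_mult_mod_eq)
qed

lemma indep_graded:
  assumes w: "\<And>i. i \<in> I \<Longrightarrow> w i \<in> Sd (e i)" and ind: "\<And>d. indep {i\<in>I. e i = d} w"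
  shows "indep I w"
proof (rule indepI)
  fix J c j assume J: "finite J" "J \<subseteq> I" "(\<Sum>j\<in>J. cst (c j) * w j) = 0" "j \<in> J"
  have "(\<Sum>d\<in>e ` J. \<Sum>j\<in>{j\<in>J. e j = d}. cst (c j) * w j) = (\<Sum>j\<in>J. cst (c j) * w j)"
    by (rule sum.group) (use J(1) in auto)
  then have "(\<Sum>d\<in>e ` J. \<Sum>j\<in>{j\<in>J. e j = d}. cst (c j) * w j) = 0" using J(3) by simp
  moreover have "(\<Sum>j\<in>{j\<in>J. e j = d}. cst (c j) * w j) \<in> Sd d" for d
  proof (intro Sd_sum Sd_cst_mult)
    fix j assume "j \<in> {j\<in>J. e j = d}"
    then have "j \<in> I" "e j = d" using J(2) by auto
    with w[of j] show "w j \<in> Sd d" by simp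
  qed
  ultimately have z: "(\<Sum>j\<in>{j'\<in>J. e j' = e j}. cst (c j) * w j) = 0"
    using homogeneous_components[of "e ` J" "\<lambda>d. \<Sum>j\<in>{j\<in>J. e j = d}. cst (c j) * w j" "e j"] J(1,4) by simp
  show "c j = 0" by (rule indepD[OF ind[of "e j"] _ _ z]) (use J in auto)
qed

lemma indep_Gm: "indep Ix (Gm epT)"
proof -
  define P where "P i k x = (if i < s then monom 1 k else pat x (GT k))" for i k and x :: pt
  have GTA: "GT k \<in> polys_over Az" for k using GT_Cz Cz_Az polys_over_mono by blast
  have "indep {m. \<forall>i\<ge>n. m i = 0} (\<lambda>m. \<Prod>i<n. el epT i (m i))"
  proof (rule indep_triangular[where P = P])
    fix i k x assume "i < n"
    then show "el epT i k x = poly (P i k x) (W i x)"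
      using el_epT[of "i - s" k] by (auto simp: P_def el_def W_def fapp poly_monom n_def poly_pat)
  next
    fix i j k x t assume "i \<le> j" "j < n"
    then show "P i k (upd x j t) = P i k x"
      unfolding P_def using pat_Az[OF GTA, of "upd x j t" x] by (auto simp: upd_def)
  next
    fix i k x show "P i k x \<noteq> 0" using monicd_pat(2)[OF monicd_GT] by (simp add: P_def)
  next
    fix i x show "inj (\<lambda>k. degree (P i k x))"
      using inj_tdg by (cases "i < s") (simp_all add: P_def monicd_pat(1)[OF monicd_GT] degree_monom_eq inj_def)
  qed simp
  moreover have "Gm epT = (\<lambda>m. \<Prod>i<n. el epT i (m i))" by (rule ext) (simp add: Gm_def)
  ultimately show ?thesis by (simp add: Ix_def)
qed

lemma Gm_epT_Sd: "Gm epT m \<in> Sd (\<Sum>i<n. tdeg i (m i))"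
  unfolding Gm_def by (intro Sd_prod el_epT_Sd) auto

text \<open>In each degree there are as many indices for \<open>bas\<close> as for the independent
  \<open>Gm\<close>, and the former family spans the latter.\<close>

lemma indep_bas_epT: "indep Ix (bas theta0 epT)"
proof (rule indep_graded[OF bas_epT_Sd])
  fix d
  let ?I = "{m\<in>Ix. (\<Sum>i<n. tdeg i (m i)) = d}"
  show "indep ?I (bas theta0 epT)"
  proof (rule indep_exchange)
    show "finite ?I" by (rule finite_weighted_Ix) (rule tdeg_ge)
    show "indep ?I (Gm epT)" by (rule indep_subset[OF indep_Gm]) auto
    fix m assume "m \<in> ?I"
    then have "Gm epT m \<in> Sd d" using Gm_epT_Sd[of m] by auto
    from homogeneous_in_span[OF this Gm_span bas_epT_Sd]
    show "Gm epT m \<in> fv.span (bas theta0 epT ` ?I)" .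
  qed
qed

text \<open>The comparison family in each degree is the set of monomials. It applies to arbitrary
  parameters of the right degrees, which is needed for the deformed ones.\<close>

lemma indep_bas_epS:
  assumes th: "\<And>i. i < n \<Longrightarrow> th i \<in> Sd (dd i)"
    and sp: "\<And>d. Sd d \<subseteq> fv.span (bas th epS ` {m\<in>Ix. (\<Sum>i<n. m i) = d})"
  shows "indep Ix (bas th epS)"
proof (rule indep_graded[OF bas_epS_Sd[OF th]])
  fix d
  let ?I = "{m\<in>Ix. (\<Sum>i<n. m i) = d}"
  show "indep ?I (bas th epS)"
  proof (rule indep_exchange)
    show "finite ?I" by (rule finite_weighted_Ix) simp
    show "indep ?I Mon" by (rule indep_subset[OF indep_Mon]) auto
    fix m assume "m \<in> ?I"
    then have "Mon m \<in> Sd d" unfolding Sd_def by (intro fv.span_base imageI)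
    then show "Mon m \<in> fv.span (bas th epS ` ?I)" using sp by blast
  qed
qed auto

end

section \<open>The limit algebra at a = 0\<close>

context rs
begin

text \<open>Symmetry is left out on purpose: without it a basis can be built one y at a time. The
  invariants are cut out later by averaging.\<close>

definition Tp :: "(pt \<Rightarrow> complex) set" where
  "Tp = {f\<in>S. \<forall>i<r. \<forall>j<s. \<forall>x. fst x i = snd x j \<longrightarrow> dY i f x = 0}"

lemma Tp_S: "f \<in> Tp \<Longrightarrow> f \<in> S"
  by (simp add: Tp_def)

lemma subalg_Tp [simp]: "subalg Tp"
  unfolding subalg_def
proof (intro conjI allI ballI)
  fix c show "cst c \<in> Tp" by (simp add: Tp_def S_cst)
next
  fix f g assume "f \<in> Tp" "g \<in> Tp"
  then show "f + g \<in> Tp" "f * g \<in> Tp"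
    by (simp_all add: Tp_def subalg_add[OF subalg_S] subalg_mult[OF subalg_S] dY_add dY_mult)
qed

lemma dY_const: "(\<And>t. f ((fst x)(i := t), snd x) = f x) \<Longrightarrow> dY i f x = 0"
  by (simp add: dY_def)

lemma dY_poly_Yv:
  assumes "p \<in> polys_over Az" shows "dY i (poly p (Yv i)) x = poly (pderiv (pat x p)) (fst x i)"
proof -
  have "(\<lambda>t. poly p (Yv i) ((fst x)(i := t), snd x)) = poly (pat x p)"
  proof
    fix t
    have "pat ((fst x)(i := t), snd x) p = pat x p" by (rule pat_Az[OF assms]) simp
    then show "poly p (Yv i) ((fst x)(i := t), snd x) = poly (pat x p) t"
      by (simp add: poly_pat Yv_def)
  qed
  then show ?thesis by (simp add: dY_def DERIV_imp_deriv[OF poly_DERIV])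
qed

lemma Az_Tp: "Az \<subseteq> Tp"
proof (rule alg_least)
  show "Zv ` {..<s} \<subseteq> Tp" by (auto simp: Tp_def Zv_S)
qed simp

lemma poly_S: "p \<in> polys_over S \<Longrightarrow> f \<in> S \<Longrightarrow> poly p f \<in> S"
  unfolding poly_altdef polys_over_def
  by (intro subalg_sum[OF subalg_S] subalg_mult[OF subalg_S] subalg_power[OF subalg_S]) auto

lemma poly_Yv_Tp:
  assumes p: "p \<in> polys_over Az" "flat p" and i: "i < r" shows "poly p (Yv i) \<in> Tp"
  unfolding Tp_def
proof (intro CollectI conjI allI impI)
  have "p \<in> polys_over S" using p(1) polys_over_mono[OF Az_S] by blast
  then show "poly p (Yv i) \<in> S" by (rule poly_S[OF _ Yv_S[OF i]])
next
  fix k j and x :: pt assume kj: "k < r" "j < s" "fst x k = snd x j"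
  show "dY k (poly p (Yv i)) x = 0"
  proof (cases "k = i")
    case True
    have "poly (pderiv (pat x p)) (snd x j) = 0" using p(2) kj(2) unfolding flat_def by blast
    then show ?thesis using True p(1) kj(3) by (simp add: dY_poly_Yv)
  next
    case False
    show ?thesis
    proof (rule dY_const)
      fix t
      have "pat ((fst x)(k := t), snd x) p = pat x p" by (rule pat_Az[OF p(1)]) simp
      then show "poly p (Yv i) ((fst x)(k := t), snd x) = poly p (Yv i) x"
        using False by (simp add: poly_pat Yv_def)
    qed
  qed
qed

lemma GT_Az: "GT k \<in> polys_over Az"
  using GT_Cz polys_over_mono[OF Cz_Az] by blast

lemma Dp_Az: "k > s \<Longrightarrow> Dp k \<in> polys_over Az"
  using Dp_Cz polys_over_mono[OF Cz_Az] by blast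

lemma xi_Tp: "i < r \<Longrightarrow> xi i \<in> Tp"
  unfolding xi_def by (intro poly_Yv_Tp Dp_Az flat_Dp) auto

lemma theta0_Tp: "theta0 i \<in> Tp"
proof (cases "i < s")
  case True
  have "coeff chz (s - 1 - i) \<in> Az" unfolding chz_def by (rule coeff_chi_alg)
  then show ?thesis using True Az_Tp by (auto simp: theta0_def)
next
  case False
  have "alg (xi ` {..<r}) \<subseteq> Tp" by (rule alg_least) (auto intro: xi_Tp)
  moreover have "coeff chx (r - 1 - (i - s)) \<in> alg (xi ` {..<r})" unfolding chx_def by (rule coeff_chi_alg)
  ultimately show ?thesis using False by (auto simp: theta0_def)
qed

lemma el_epT_Tp: "i < n \<Longrightarrow> el epT i k \<in> Tp"
proof -
  assume i: "i < n"
  show ?thesis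
  proof (cases "i < s")
    case True
    then have "Zv i \<in> Tp" using Az_Tp by (auto intro: alg_base)
    then show ?thesis using True by (simp add: el_def subalg_power[OF subalg_Tp])
  next
    case False
    then have "i - s < r" using i by (auto simp: n_def)
    then show ?thesis using el_epT[of "i - s" k] False poly_Yv_Tp[OF GT_Az flat_GT, of "i - s" k] by simp
  qed
qed

lemma bas_epT_Tp: "bas theta0 epT m \<in> Tp"
  unfolding bas_def
  by (intro subalg_prod[OF subalg_Tp] subalg_mult[OF subalg_Tp] subalg_power[OF subalg_Tp] theta0_Tp el_epT_Tp) auto

text \<open>Division with remainder from the top degree downwards. Exactly the degrees 1, ..., s are
  not of the form \<open>tdg l\<close>, and they form the remainder.\<close>

lemma division_GT_aux:
  assumes A: "subalg A" "Cz \<subseteq> A" and p: "p \<in> polys_over A" "\<forall>k\<ge>N. coeff p k = 0"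
  shows "\<exists>c d K. (\<forall>k. c k \<in> A) \<and> (\<forall>k. d k \<in> A) \<and> (\<forall>k\<ge>K. d k = 0) \<and>
    p = (\<Sum>k\<in>{1..s}. monom (c k) k) + (\<Sum>k<K. smult (d k) (GT k))"
  using p
proof (induction N arbitrary: p)
  case 0
  then have "p = 0" by (auto intro: poly_eqI)
  then show ?case using subalg_0[OF A(1)]
    by (intro exI[of _ "\<lambda>_. 0"] exI[of _ 0]) auto
next
  case (Suc N)
  let ?b = "coeff p N"
  have PA: "subrng (polys_over A)" by (intro subrng_polys_over subrng_subalg A)
  have pk: "coeff p k \<in> A" for k using Suc.prems by (auto simp: polys_over_def)
  show ?case
  proof (cases "1 \<le> N \<and> N \<le> s")
    case True
    have "p - monom ?b N \<in> polys_over A"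
      using pk by (auto simp: polys_over_def intro!: subalg_diff[OF A(1)] subalg_0[OF A(1)])
    moreover have "\<forall>k\<ge>N. coeff (p - monom ?b N) k = 0"
    proof safe
      fix k assume "N \<le> k"
      then show "coeff (p - monom ?b N) k = 0" using Suc.prems(2) by (cases "k = N") auto
    qed
    ultimately obtain c d K where IH: "\<forall>k. c k \<in> A" "\<forall>k. d k \<in> A" "\<forall>k\<ge>K. d k = 0"
      "p - monom ?b N = (\<Sum>k\<in>{1..s}. monom (c k) k) + (\<Sum>k<K. smult (d k) (GT k))" using Suc.IH by blast
    have "(\<Sum>k\<in>{1..s}. monom (c k + (if k = N then ?b else 0)) k) = (\<Sum>k\<in>{1..s}. monom (c k) k + (if k = N then monom ?b N else 0))"
      by (intro sum.cong) (auto simp: add_monom)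
    also have "\<dots> = (\<Sum>k\<in>{1..s}. monom (c k) k) + monom ?b N"
      using True by (simp add: sum.distrib)
    finally have "p = (\<Sum>k\<in>{1..s}. monom (c k + (if k = N then ?b else 0)) k) + (\<Sum>k<K. smult (d k) (GT k))"
      using IH(4) by (simp add: algebra_simps)
    then show ?thesis using IH pk
      by (intro exI[of _ "\<lambda>k. c k + (if k = N then ?b else 0)"] exI[of _ d] exI[of _ K])
        (auto intro: subalg_add[OF A(1)] subalg_0[OF A(1)])
  next
    case False
    \<comment> \<open>The preimage of N under \<open>tdg\<close>; it exists because N is 0 or
      greater than s here.\<close>
    define l where "l = (if (s + 1) dvd N then N else N - (s + 1))"
    have l: "tdg l = N"
    proof (cases "(s + 1) dvd N")
      case False
      with \<open>\<not> (1 \<le> N \<and> N \<le> s)\<close> have N: "N \<ge> s + 1" by (cases "N = 0") auto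
      then have "\<not> (s + 1) dvd (N - (s + 1))" using False by (metis dvd_add_triv_right_iff le_add_diff_inverse2)
      then show ?thesis using N False by (simp only: tdg_def l_def if_False le_add_diff_inverse2)
    qed (simp add: tdg_def l_def)
    have m: "monicd (GT l) N" using monicd_GT[of l] l by simp
    have GA: "coeff (GT l) k \<in> A" for k using GT_Cz[of l] A(2) by (auto simp: polys_over_def)
    have "p - smult ?b (GT l) \<in> polys_over A"
      using pk GA by (auto simp: polys_over_def intro!: subalg_diff[OF A(1)] subalg_mult[OF A(1)])
    moreover have "\<forall>k\<ge>N. coeff (p - smult ?b (GT l)) k = 0"
    proof safe
      fix k assume "N \<le> k"
      then show "coeff (p - smult ?b (GT l)) k = 0" using Suc.prems(2) m by (cases "k = N") (auto simp: monicd_def)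
    qed
    ultimately obtain c d K where IH: "\<forall>k. c k \<in> A" "\<forall>k. d k \<in> A" "\<forall>k\<ge>K. d k = 0"
      "p - smult ?b (GT l) = (\<Sum>k\<in>{1..s}. monom (c k) k) + (\<Sum>k<K. smult (d k) (GT k))" using Suc.IH by blast
    let ?K = "max K (Suc l)" and ?d = "\<lambda>k. d k + (if k = l then ?b else 0)"
    have "(\<Sum>k<?K. smult (?d k) (GT k)) = (\<Sum>k<?K. smult (d k) (GT k) + (if k = l then smult ?b (GT l) else 0))"
      by (intro sum.cong) (auto simp: smult_add_left)
    also have "\<dots> = (\<Sum>k<?K. smult (d k) (GT k)) + smult ?b (GT l)"
      by (simp add: sum.distrib)
    also have "(\<Sum>k<?K. smult (d k) (GT k)) = (\<Sum>k<K. smult (d k) (GT k))"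
      using IH(3) by (intro sum.mono_neutral_right) auto
    finally have "p = (\<Sum>k\<in>{1..s}. monom (c k) k) + (\<Sum>k<?K. smult (?d k) (GT k))"
      using IH(4) by (simp add: algebra_simps)
    then show ?thesis using IH pk
      by (intro exI[of _ c] exI[of _ ?d] exI[of _ ?K])
        (auto intro: subalg_add[OF A(1)] subalg_0[OF A(1)])
  qed
qed

lemma division_GT:
  assumes A: "subalg A" "Cz \<subseteq> A" and p: "p \<in> polys_over A"
  obtains c d K where "\<And>k. c k \<in> A" "\<And>k. d k \<in> A"
    "p = (\<Sum>k\<in>{1..s}. monom (c k) k) + (\<Sum>k<K. smult (d k) (GT k))"
proof -
  have "\<forall>k\<ge>Suc (degree p). coeff p k = 0" by (auto intro: coeff_eq_0)
  from division_GT_aux[OF A p this] show ?thesis using that by blast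
qed

text \<open>The sum is a polynomial of degree at most s - 1 evaluated at s distinct points.\<close>

lemma low_degree_zero:
  fixes c :: "nat \<Rightarrow> complex"
  assumes inj: "inj_on z {..<s}" and 0: "\<And>j. j < s \<Longrightarrow> (\<Sum>k\<in>{1..s}. c k * (of_nat k * z j ^ (k - 1))) = 0"
    and k: "k \<in> {1..s}"
  shows "c k = 0"
proof -
  define q where "q = (\<Sum>k\<in>{1..s}. monom (c k * of_nat k) (k - 1))"
  have "poly q (z j) = 0" if "j < s" for j
    using 0[OF that] by (simp add: q_def poly_sum poly_monom mult.assoc)
  then have sub: "z ` {..<s} \<subseteq> {x. poly q x = 0}" by auto
  have deg: "degree q \<le> s - 1" unfolding q_def
    by (intro degree_sum_le) (auto intro!: order_trans[OF degree_monom_le])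
  have "q = 0"
  proof (rule ccontr)
    assume "q \<noteq> 0"
    then have "card (z ` {..<s}) \<le> card {x. poly q x = 0}" using sub poly_roots_finite by (intro card_mono) auto
    also have "\<dots> \<le> degree q" by (rule card_poly_roots_bound[OF \<open>q \<noteq> 0\<close>])
    finally have "s \<le> degree q" unfolding card_image[OF inj] card_lessThan .
    then show False using deg s_pos by linarith
  qed
  then have "coeff q (k - 1) = 0" by simp
  moreover have "coeff q (k - 1) = (\<Sum>l\<in>{1..s}. if l = k then c l * of_nat l else 0)"
    unfolding q_def coeff_sum
  proof (intro sum.cong refl)
    fix l assume "l \<in> {1..s}"
    then have "l - 1 = k - 1 \<longleftrightarrow> l = k" using k by auto
    then show "coeff (monom (c l * of_nat l) (l - 1)) (k - 1) = (if l = k then c l * of_nat l else 0)"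
      by (simp only: coeff_monom)
  qed
  moreover have "\<dots> = c k * of_nat k" using k by (simp only: sum.delta finite_atLeastAtMost if_True)
  ultimately have "c k * of_nat k = 0" by metis
  then show ?thesis using k by simp
qed

abbreviation Sj :: "nat \<Rightarrow> (pt \<Rightarrow> complex) set" where "Sj j \<equiv> alg (Zv ` {..<s} \<union> Yv ` {j..<r})"

lemma Sj_indep: assumes "f \<in> Sj (Suc j)" shows "f ((fst x)(j := t), snd x) = f x"
  using assms by induction (auto simp: fapp Yv_def Zv_def)

lemma Sj_S: "Sj j \<subseteq> S"
  by (rule alg_least) (auto intro: Zv_S Yv_S)

lemma dY_upd_indep:
  assumes f: "f \<in> Sj (Suc j)" and i: "i \<noteq> j"
  shows "dY i f ((fst x)(j := t), snd x) = dY i f x"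
proof -
  have "f (((fst x)(j := t))(i := u), snd x) = f ((fst x)(i := u), snd x)" for u
    using Sj_indep[OF f, of "((fst x)(i := u), snd x)" t] i by (simp add: fun_upd_twist)
  then show ?thesis using i by (simp add: dY_def)
qed

text \<open>The y are split off one at a time. On y_j = z_l the flat part contributes nothing to the
  derivative in y_j, which forces the remainder of the division to vanish. The quotients
  \<open>d k\<close> then inherit the conditions for the other y, because the \<open>GT k\<close>
  have distinct degrees.\<close>

lemma Tp_span_aux:
  assumes "j \<le> r" "f \<in> Sj j" "\<And>i l (x :: pt). j \<le> i \<Longrightarrow> i < r \<Longrightarrow> l < s \<Longrightarrow> fst x i = snd x l \<Longrightarrow> dY i f x = 0"
  shows "f \<in> mspan Az {(\<Prod>i\<in>{j..<r}. poly (GT (la i)) (Yv i)) | la. True}"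
  using assms
proof (induction "r - j" arbitrary: j f)
  case 0
  then have "f * 1 \<in> mspan Az {(\<Prod>i\<in>{j..<r}. poly (GT (la i)) (Yv i)) | la. True}"
    by (intro mspan_base) auto
  then show ?case by simp
next
  case (Suc m)
  let ?A = "Sj (Suc j)"
  have j: "j < r" using Suc by simp
  have "{j..<r} = insert j {Suc j..<r}" using j by auto
  then have "Yv ` {j..<r} = insert (Yv j) (Yv ` {Suc j..<r})" by simp
  then have "Sj j = alg (insert (Yv j) (Zv ` {..<s} \<union> Yv ` {Suc j..<r}))" by simp
  then obtain p where p: "f = poly p (Yv j)" "p \<in> polys_over ?A" using Suc.prems(2) unfolding alg_insert by blast
  have "Az \<subseteq> ?A" by (rule alg_mono) auto
  then have CA: "Cz \<subseteq> ?A" using Cz_Az by blast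
  obtain c d K where cd: "\<And>k. c k \<in> ?A" "\<And>k. d k \<in> ?A"
    and peq: "p = (\<Sum>k\<in>{1..s}. monom (c k) k) + (\<Sum>k<K. smult (d k) (GT k))"
    using division_GT[OF _ CA p(2)] by auto
  have S1: "c k \<in> S" "d k \<in> S" for k using cd Sj_S[of "Suc j"] by auto
  have G_S: "poly (GT k) (Yv j) \<in> S" for k
    using poly_Yv_Tp[OF GT_Az flat_GT j] Tp_S by blast
  have Yk: "Yv j ^ k \<in> S" for k by (intro subalg_power[OF subalg_S] Yv_S j)
  have feq: "f = (\<Sum>k\<in>{1..s}. c k * Yv j ^ k) + (\<Sum>k<K. d k * poly (GT k) (Yv j))"
    unfolding p(1) peq by (simp add: poly_sum poly_monom)
  have d0: "dY j g x = 0" if "g \<in> ?A" for g x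
    by (rule dY_const) (rule Sj_indep[OF that])
  have c0: "c k = 0" if k: "k \<in> {1..s}" for k
  proof (rule S_eq_0_generic[OF S1(1)])
    fix x :: pt assume inj: "inj_on (snd x) {..<s}"
    show "c k x = 0"
    proof (rule low_degree_zero[OF inj _ k])
      fix l assume l: "l < s"
      \<comment> \<open>The coefficients \<open>c k\<close> do not involve y_j, so y_j may be moved
        onto z_l without changing them.\<close>
      define x' where "x' = ((fst x)(j := snd x l), snd x)"
      have cx: "c k x' = c k x" for k unfolding x'_def by (rule Sj_indep[OF cd(1)])
      have x': "fst x' j = snd x l" "snd x' l = snd x l" by (auto simp: x'_def)
      have "dY j (d k * poly (GT k) (Yv j)) x' = 0" for k
      proof -
        have "poly (pderiv (pat x' (GT k))) (snd x' l) = 0" using flat_GT[of k] l unfolding flat_def by blast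
        then show ?thesis using x' S1 G_S by (simp add: dY_mult d0[OF cd(2)] dY_poly_Yv[OF GT_Az])
      qed
      moreover have "dY j (c k * Yv j ^ k) x' = c k x * (of_nat k * snd x l ^ (k - 1))" for k
        using S1 Yk j x' by (simp add: dY_mult d0[OF cd(1)] dY_power Yv_S dY_Yv cx) (simp add: Yv_def x')
      ultimately have "dY j f x' = (\<Sum>k\<in>{1..s}. c k x * (of_nat k * snd x l ^ (k - 1)))"
        unfolding feq using S1 G_S Yk
        by (simp add: dY_add dY_sum subalg_sum[OF subalg_S] subalg_mult[OF subalg_S])
      moreover have "dY j f x' = 0" using Suc.prems(3)[of j l x'] j l x' by simp
      ultimately show "(\<Sum>k\<in>{1..s}. c k x * (of_nat k * snd x l ^ (k - 1))) = 0" by simp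
    qed
  qed
  then have feq2: "f = (\<Sum>k<K. d k * poly (GT k) (Yv j))" unfolding feq by simp
  let ?M = "\<lambda>j. {(\<Prod>i\<in>{j..<r}. poly (GT (la i)) (Yv i)) | la. True}"
  have "d k \<in> mspan Az (?M (Suc j))" if k: "k < K" for k
  proof (rule Suc.hyps(1))
    fix i l and x :: pt assume il: "Suc j \<le> i" "i < r" "l < s" "fst x i = snd x l"
    \<comment> \<open>The condition on y_i and z_l leaves y_j free; letting it run through all t
      gives a polynomial identity.\<close>
    have "poly (\<Sum>k<K. smult (dY i (d k) x) (pat x (GT k))) t = 0" for t
    proof -
      define x' where "x' = ((fst x)(j := t), snd x)"
      have "dY i (poly (GT k) (Yv j)) x' = 0" for k
      proof (rule dY_const)
        fix u
        have "pat ((fst x')(i := u), snd x') (GT k) = pat x' (GT k)" by (rule pat_Az[OF GT_Az]) simp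
        then show "poly (GT k) (Yv j) ((fst x')(i := u), snd x') = poly (GT k) (Yv j) x'"
          using il by (simp add: poly_pat Yv_def)
      qed
      moreover have "dY i (d k) x' = dY i (d k) x" for k
        unfolding x'_def using il by (intro dY_upd_indep[OF cd(2)]) auto
      moreover have "poly (GT k) (Yv j) x' = poly (pat x (GT k)) t" for k
      proof -
        have "pat x' (GT k) = pat x (GT k)" by (rule pat_Az[OF GT_Az]) (simp add: x'_def)
        then show ?thesis by (simp add: poly_pat Yv_def x'_def)
      qed
      ultimately have "dY i f x' = (\<Sum>k<K. dY i (d k) x * poly (pat x (GT k)) t)"
        unfolding feq2 using S1 G_S by (simp add: dY_sum dY_mult subalg_mult[OF subalg_S])
      moreover have "dY i f x' = 0"
        using Suc.prems(3)[of i l x'] il by (auto simp: x'_def)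
      ultimately show ?thesis by (simp add: poly_sum)
    qed
    then have "(\<Sum>k<K. smult (dY i (d k) x) (pat x (GT k))) = 0" using poly_all_0_iff_0 by blast
    moreover have "inj_on (\<lambda>k. degree (pat x (GT k))) {..<K}"
      using inj_tdg by (auto simp: monicd_pat(1)[OF monicd_GT] inj_on_def)
    ultimately show "dY i (d k) x = 0"
      using sum_smult_distinct_degrees[of "{..<K}" "\<lambda>k. pat x (GT k)" "\<lambda>k. dY i (d k) x" k]
        monicd_pat(2)[OF monicd_GT] k by auto
  qed (use Suc.hyps(2) j cd in auto)
  moreover have "mspan Az (?M (Suc j)) \<subseteq> {g. g * poly (GT k) (Yv j) \<in> mspan Az (?M j)}" for k
  proof (rule mspan_minimal)
    fix a m assume a: "a \<in> Az" and "m \<in> ?M (Suc j)"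
    then obtain la where m: "m = (\<Prod>i\<in>{Suc j..<r}. poly (GT (la i)) (Yv i))" by blast
    have "(\<Prod>i\<in>{j..<r}. poly (GT ((la(j := k)) i)) (Yv i)) = poly (GT k) (Yv j) * (\<Prod>i\<in>{Suc j..<r}. poly (GT ((la(j := k)) i)) (Yv i))"
      using j by (subst prod.atLeast_Suc_lessThan) auto
    also have "(\<Prod>i\<in>{Suc j..<r}. poly (GT ((la(j := k)) i)) (Yv i)) = m"
      unfolding m by (intro prod.cong) auto
    finally have "m * poly (GT k) (Yv j) = (\<Prod>i\<in>{j..<r}. poly (GT ((la(j := k)) i)) (Yv i))"
      by (simp only: mult.commute)
    then have "m * poly (GT k) (Yv j) \<in> ?M j" by blast
    then have "a * (m * poly (GT k) (Yv j)) \<in> mspan Az (?M j)" by (rule mspan_base[OF a])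
    then show "a * m \<in> {g. g * poly (GT k) (Yv j) \<in> mspan Az (?M j)}" by (simp add: mult.assoc)
  qed (rule subspace_mult_preimage[OF mspan_subspace])
  ultimately show ?case unfolding feq2 by (intro mspan_sum) blast
qed

lemma Tp_Gm: "Tp \<subseteq> fv.span (range (Gm epT))"
proof
  let ?V = "fv.span (range (Gm epT))"
  fix f assume f: "f \<in> Tp"
  have "W ` {..<n} \<subseteq> Zv ` {..<s} \<union> Yv ` {0..<r}" by (auto simp: W_def n_def)
  then have "S \<subseteq> Sj 0" unfolding S_def by (rule alg_mono)
  then have "f \<in> mspan Az {(\<Prod>i\<in>{0..<r}. poly (GT (la i)) (Yv i)) | la. True}"
    using f by (intro Tp_span_aux) (auto simp: Tp_def)
  moreover have "mspan Az {(\<Prod>i\<in>{0..<r}. poly (GT (la i)) (Yv i)) | la. True} \<subseteq> ?V"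
  proof (rule mspan_minimal)
    fix a m assume a: "a \<in> Az" and "m \<in> {(\<Prod>i\<in>{0..<r}. poly (GT (la i)) (Yv i)) | la. True}"
    then obtain la where m: "m = (\<Prod>i<r. poly (GT (la i)) (Yv i))" by (auto simp: atLeast0LessThan)
    have "fv.span (range (\<lambda>\<kappa>. \<Prod>i<s. Zv i ^ \<kappa> i)) \<subseteq> {a. a * m \<in> ?V}"
    proof (intro fv.span_minimal subspace_mult_preimage image_subsetI)
      fix \<kappa>
      define k where "k i = (if i < s then \<kappa> i else la (i - s))" for i
      have "(\<Prod>i<s. Zv i ^ \<kappa> i) * m = Gm epT k"
        unfolding Gm_split m by (intro arg_cong2[where f = "(*)"] prod.cong) (auto simp: k_def el_epT)
      then show "(\<Prod>i<s. Zv i ^ \<kappa> i) \<in> {a. a * m \<in> ?V}" using fv.span_base[of "Gm epT k" "range (Gm epT)"] by simp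
    qed simp
    then show "a * m \<in> ?V" using a alg_monomials[of Zv s] by blast
  qed simp
  ultimately show "f \<in> ?V" by blast
qed

lemma Tp_bas: "Tp \<subseteq> fv.span (bas theta0 epT ` Ix)"
proof -
  have "fv.span (range (Gm epT)) \<subseteq> fv.span (bas theta0 epT ` Ix)"
    using Gm_span by (intro fv.span_minimal image_subsetI) auto
  then show ?thesis using Tp_Gm by blast
qed

subsection \<open>Symmetrization\<close>

definition act :: "(nat \<Rightarrow> nat) \<Rightarrow> (nat \<Rightarrow> nat) \<Rightarrow> (pt \<Rightarrow> complex) \<Rightarrow> pt \<Rightarrow> complex" where
  "act \<sigma> \<tau> f = (\<lambda>x. f (fst x \<circ> \<sigma>, snd x \<circ> \<tau>))"

definition Sym :: "(pt \<Rightarrow> complex) set" where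
  "Sym = {f. \<forall>\<sigma> \<tau>. \<sigma> permutes {..<r} \<longrightarrow> \<tau> permutes {..<s} \<longrightarrow> act \<sigma> \<tau> f = f}"

text \<open>The Reynolds operator: a projection onto the invariants that is linear over them and
  preserves degrees and the limit algebra.\<close>

definition rho :: "(pt \<Rightarrow> complex) \<Rightarrow> pt \<Rightarrow> complex" where
  "rho f = cst (1 / (fact r * fact s)) * (\<Sum>\<sigma> | \<sigma> permutes {..<r}. \<Sum>\<tau> | \<tau> permutes {..<s}. act \<sigma> \<tau> f)"

lemma act_add: "act \<sigma> \<tau> (f + g) = act \<sigma> \<tau> f + act \<sigma> \<tau> g" and act_mult: "act \<sigma> \<tau> (f * g) = act \<sigma> \<tau> f * act \<sigma> \<tau> g"
  and act_cst [simp]: "act \<sigma> \<tau> (cst c) = cst c"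
  and act_sum: "act \<sigma> \<tau> (\<Sum>i\<in>I. F i) = (\<Sum>i\<in>I. act \<sigma> \<tau> (F i))"
  and act_prod: "act \<sigma> \<tau> (\<Prod>i\<in>I. F i) = (\<Prod>i\<in>I. act \<sigma> \<tau> (F i))"
  and act_power: "act \<sigma> \<tau> (f ^ k) = act \<sigma> \<tau> f ^ k"
  by (auto simp: act_def fun_eq_iff fapp)

lemma act_Yv: "act \<sigma> \<tau> (Yv i) = Yv (\<sigma> i)" and act_Zv: "act \<sigma> \<tau> (Zv i) = Zv (\<tau> i)"
  by (auto simp: act_def Yv_def Zv_def)

lemma act_act: "act \<sigma> \<tau> (act \<sigma>' \<tau>' f) = act (\<sigma> \<circ> \<sigma>') (\<tau> \<circ> \<tau>') f"
  by (simp add: act_def o_assoc)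

lemma subalg_Sym [simp]: "subalg Sym"
  unfolding subalg_def by (auto simp: Sym_def act_add act_mult)

lemma rho_add: "rho (f + g) = rho f + rho g"
  by (simp add: rho_def act_add sum.distrib distrib_left)

lemma rho_mult: "g \<in> Sym \<Longrightarrow> rho (g * f) = g * rho f"
proof -
  assume g: "g \<in> Sym"
  have "(\<Sum>\<sigma> | \<sigma> permutes {..<r}. \<Sum>\<tau> | \<tau> permutes {..<s}. act \<sigma> \<tau> (g * f))
     = (\<Sum>\<sigma> | \<sigma> permutes {..<r}. \<Sum>\<tau> | \<tau> permutes {..<s}. g * act \<sigma> \<tau> f)"
    using g by (intro sum.cong) (auto simp: act_mult Sym_def)
  then show ?thesis by (simp add: rho_def sum_distrib_left mult.left_commute)
qed

lemma rho_cst_mult: "rho (cst c * f) = cst c * rho f"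
  by (rule rho_mult) (rule subalg_cst[OF subalg_Sym])

lemma rho_Sym: "g \<in> Sym \<Longrightarrow> rho g = g"
proof -
  assume g: "g \<in> Sym"
  have "(\<Sum>\<sigma> | \<sigma> permutes {..<r}. \<Sum>\<tau> | \<tau> permutes {..<s}. act \<sigma> \<tau> g)
     = (\<Sum>\<sigma> | \<sigma> permutes {..<r}. \<Sum>\<tau> | \<tau> permutes {..<s}. g)"
    using g by (intro sum.cong) (auto simp: Sym_def)
  also have "\<dots> = of_nat (fact r * fact s) * g"
    by (simp add: card_permutations mult.assoc)
  also have "\<dots> = cst (of_nat (fact r * fact s)) * g" unfolding of_nat_fun cst_def by simp
  finally show ?thesis by (simp add: rho_def mult.assoc[symmetric] cst_mult[symmetric])
qed

lemma rho_in_Sym: "rho f \<in> Sym"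
  unfolding Sym_def
proof (intro CollectI allI impI)
  fix \<sigma> \<tau> assume \<sigma>: "\<sigma> permutes {..<r}" and \<tau>: "\<tau> permutes {..<s}"
  have "act \<sigma> \<tau> (\<Sum>\<sigma>' | \<sigma>' permutes {..<r}. \<Sum>\<tau>' | \<tau>' permutes {..<s}. act \<sigma>' \<tau>' f)
     = (\<Sum>\<sigma>' | \<sigma>' permutes {..<r}. \<Sum>\<tau>' | \<tau>' permutes {..<s}. act (\<sigma> \<circ> \<sigma>') (\<tau> \<circ> \<tau>') f)"
    by (simp add: act_sum act_act)
  also have "\<dots> = (\<Sum>\<sigma>' | \<sigma>' permutes {..<r}. \<Sum>\<tau>' | \<tau>' permutes {..<s}. act (\<sigma> \<circ> \<sigma>') \<tau>' f)"
    by (intro sum.cong refl setum_permutations_compose_left[OF \<tau>, symmetric])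
  also have "\<dots> = (\<Sum>\<sigma>' | \<sigma>' permutes {..<r}. \<Sum>\<tau>' | \<tau>' permutes {..<s}. act \<sigma>' \<tau>' f)"
    by (rule setum_permutations_compose_left[OF \<sigma>, symmetric])
  finally show "act \<sigma> \<tau> (rho f) = rho f" by (simp add: rho_def act_mult)
qed

lemma act_Sd:
  assumes \<sigma>: "\<sigma> permutes {..<r}" and \<tau>: "\<tau> permutes {..<s}" and f: "f \<in> Sd d"
  shows "act \<sigma> \<tau> f \<in> Sd d"
  using f unfolding Sd_def
proof (induction rule: fv.span_induct_alt)
  case base
  have "act \<sigma> \<tau> (cst 0) = cst 0" by (rule act_cst)
  then show ?case by (simp add: fv.span_zero)
next
  case (step c m y)
  then obtain k where k: "m = Mon k" "(\<Sum>i<n. k i) = d" by blast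
  have "act \<sigma> \<tau> (W i) \<in> Sd 1" if i: "i < n" for i
  proof (cases "i < s")
    case True
    then have "\<tau> i < s" using permutes_in_image[OF \<tau>, of i] by simp
    then show ?thesis using True by (simp only: W_def if_True act_Zv Zv_Sd)
  next
    case False
    then have "\<sigma> (i - s) < r" using permutes_in_image[OF \<sigma>, of "i - s"] i by (auto simp: n_def)
    then show ?thesis using False by (simp only: W_def if_False act_Yv Yv_Sd)
  qed
  then have "act \<sigma> \<tau> m \<in> Sd (\<Sum>i<n. k i * 1)"
    unfolding k Mon_def act_prod act_power by (intro Sd_prod Sd_power) auto
  then have "act \<sigma> \<tau> m \<in> Sd d" using k(2) by simp
  with step(2) show ?case unfolding act_add act_mult act_cst Sd_def[symmetric]
    by (intro Sd_add Sd_cst_mult)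
qed

lemma rho_Sd: "f \<in> Sd d \<Longrightarrow> rho f \<in> Sd d"
  unfolding rho_def by (intro Sd_cst_mult Sd_sum act_Sd) auto

lemma act_S:
  assumes \<sigma>: "\<sigma> permutes {..<r}" and \<tau>: "\<tau> permutes {..<s}" and f: "f \<in> S"
  shows "act \<sigma> \<tau> f \<in> S"
  using f unfolding S_def
proof (induction rule: alg.induct)
  case (alg_base f)
  then obtain i where i: "f = W i" "i < n" by blast
  then have "act \<sigma> \<tau> f \<in> Sd 1" using act_Sd[OF \<sigma> \<tau> W_Sd[OF i(2)]] by simp
  then show ?case using Sd_S S_def by blast
qed (auto simp: act_add act_mult intro: alg.intros)

lemma act_Tp:
  assumes \<sigma>: "\<sigma> permutes {..<r}" and \<tau>: "\<tau> permutes {..<s}" and f: "f \<in> Tp"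
  shows "act \<sigma> \<tau> f \<in> Tp"
  unfolding Tp_def
proof (intro CollectI conjI allI impI)
  show "act \<sigma> \<tau> f \<in> S" by (intro act_S \<sigma> \<tau> Tp_S f)
next
  fix i j and x :: pt assume ij: "i < r" "j < s" "fst x i = snd x j"
  obtain i' where i': "i' < r" "\<sigma> i' = i"
    using permutes_surj[OF \<sigma>] permutes_in_image[OF \<sigma>] ij(1) by (metis lessThan_iff surjD)
  obtain j' where j': "j' < s" "\<tau> j' = j"
    using permutes_surj[OF \<tau>] permutes_in_image[OF \<tau>] ij(2) by (metis lessThan_iff surjD)
  have "(fst x)(i := t) \<circ> \<sigma> = (fst x \<circ> \<sigma>)(i' := t)" for t
    using i'(2) permutes_inj[OF \<sigma>] by (auto simp: fun_eq_iff inj_def)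
  then have "dY i (act \<sigma> \<tau> f) x = dY i' f (fst x \<circ> \<sigma>, snd x \<circ> \<tau>)"
    by (simp add: dY_def act_def i'(2))
  also have "\<dots> = 0" using f i' j' ij by (auto simp: Tp_def)
  finally show "dY i (act \<sigma> \<tau> f) x = 0" .
qed

lemma rho_Tp: "f \<in> Tp \<Longrightarrow> rho f \<in> Tp"
  unfolding rho_def
  by (intro subalg_mult[OF subalg_Tp] subalg_cst[OF subalg_Tp] subalg_sum[OF subalg_Tp] act_Tp) auto

lemma coeff_chi_act:
  assumes \<pi>: "\<pi> permutes {..<j}" and x: "\<And>i. i < j \<Longrightarrow> act \<sigma> \<tau> (x i) = x (\<pi> i)"
  shows "act \<sigma> \<tau> (coeff (chi j x) k) = coeff (chi j x) k"
proof
  fix u :: pt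
  let ?u = "(fst u \<circ> \<sigma>, snd u \<circ> \<tau>)"
  have pc: "pat v (chi j x) = (\<Prod>i<j. [:- x i v, 1:])" for v
  proof (induction j)
    case (Suc j)
    have "pat v [:- x j, 1:] = [:- x j v, 1:]" by (simp add: pat_pCons fapp)
    then show ?case by (simp only: chi_Suc pat_mult Suc prod.lessThan_Suc)
  qed simp
  have "pat ?u (chi j x) = (\<Prod>i<j. [:- x (\<pi> i) u, 1:])"
    unfolding pc using x by (intro prod.cong) (auto simp: act_def fun_eq_iff)
  also have "\<dots> = pat u (chi j x)"
    unfolding pc by (rule prod.permute[OF \<pi>, unfolded o_def, symmetric])
  finally have "coeff (pat ?u (chi j x)) k = coeff (pat u (chi j x)) k" by simp
  then show "act \<sigma> \<tau> (coeff (chi j x) k) u = coeff (chi j x) k u" by (simp add: act_def coeff_pat)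
qed

lemma Cz_Sym: "Cz \<subseteq> Sym"
  unfolding Cz_def
proof (rule alg_least)
  show "range (coeff chz) \<subseteq> Sym"
    unfolding chz_def Sym_def by (auto intro!: coeff_chi_act simp: act_Zv)
qed simp

lemma act_xi: "\<sigma> permutes {..<r} \<Longrightarrow> \<tau> permutes {..<s} \<Longrightarrow> act \<sigma> \<tau> (xi i) = xi (\<sigma> i)"
proof
  fix x :: pt assume \<sigma>: "\<sigma> permutes {..<r}" and \<tau>: "\<tau> permutes {..<s}"
  let ?x = "(fst x \<circ> \<sigma>, snd x \<circ> \<tau>)" and ?D = "Dp (s + 1)"
  have "coeff ?D k \<in> Sym" for k using Dp_Cz[of "s + 1"] Cz_Sym by (auto simp: polys_over_def)
  then have "act \<sigma> \<tau> (coeff ?D k) x = coeff ?D k x" for k using \<sigma> \<tau> by (simp add: Sym_def)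
  then have "pat ?x ?D = pat x ?D" by (intro poly_eqI) (simp add: coeff_pat act_def)
  then show "act \<sigma> \<tau> (xi i) x = xi (\<sigma> i) x" by (simp add: act_def xi_def poly_pat Yv_def)
qed

lemma theta0_Sym: "theta0 i \<in> Sym"
proof -
  have "coeff chx k \<in> Sym" for k
    unfolding chx_def Sym_def by (auto intro!: coeff_chi_act simp: act_xi)
  moreover have "coeff chz k \<in> Sym" for k
    using Cz_Sym unfolding Cz_def by (auto intro: alg_base)
  ultimately show ?thesis by (simp add: theta0_def)
qed

end

section \<open>A free basis of the invariants at a = 0\<close>

lemma choose_spanning_indep:
  assumes "finite L"
  shows "\<exists>K\<subseteq>L. indep K v \<and> (\<forall>l\<in>L. v l \<in> fv.span (v ` K))"
  using assms
proof (induction L)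
  case empty
  show ?case by (auto simp: indep_def)
next
  case (insert l L)
  then obtain K where K: "K \<subseteq> L" "indep K v" "\<forall>l\<in>L. v l \<in> fv.span (v ` K)" by blast
  show ?case
  proof (cases "v l \<in> fv.span (v ` K)")
    case True
    then show ?thesis using K by (intro exI[of _ K]) auto
  next
    case False
    have fin: "finite K" using K(1) insert.hyps(1) finite_subset by blast
    have lK: "l \<notin> K" using K(1) insert.hyps(2) by blast
    have "indep (insert l K) v"
      unfolding indep_finite_iff[OF finite.insertI[OF fin]]
    proof (intro allI impI)
      fix c assume "(\<Sum>j\<in>insert l K. cst (c j) * v j) = 0"
      then have eq: "cst (c l) * v l + (\<Sum>j\<in>K. cst (c j) * v j) = 0" using fin lK by simp
      have "c l = 0"
      proof (rule ccontr)
        assume nz: "c l \<noteq> 0"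
        have "cst (c l) * v l = - (\<Sum>j\<in>K. cst (c j) * v j)" using eq by (simp add: eq_neg_iff_add_eq_0)
        moreover have "- (\<Sum>j\<in>K. cst (c j) * v j) \<in> fv.span (v ` K)"
          by (intro fv.span_neg sum_in_span fv.span_base imageI)
        ultimately have "cst (c l) * v l \<in> fv.span (v ` K)" by simp
        then have "cst (1 / c l) * (cst (c l) * v l) \<in> fv.span (v ` K)" by (rule fv.span_scale)
        moreover have "cst (1 / c l) * (cst (c l) * v l) = v l"
          using nz by (simp add: mult.assoc[symmetric] cst_mult[symmetric])
        ultimately show False using False by simp
      qed
      moreover from this have "(\<Sum>j\<in>K. cst (c j) * v j) = 0" using eq by simp
      then have "\<forall>j\<in>K. c j = 0" using indepD[OF K(2) fin order_refl] by blast
      ultimately show "\<forall>j\<in>insert l K. c j = 0" by simp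
    qed
    moreover have "fv.span (v ` K) \<subseteq> fv.span (v ` insert l K)" by (rule fv.span_mono) auto
    then have "\<forall>l'\<in>insert l L. v l' \<in> fv.span (v ` insert l K)"
      using K(3) fv.span_base[of "v l" "v ` insert l K"] by auto
    ultimately show ?thesis using K(1) by (intro exI[of _ "insert l K"]) auto
  qed
qed

context rs
begin

section \<open>Exponents: the parameter part and the reduced part\<close>

definition L :: "(nat \<Rightarrow> nat) set" where "L = {m\<in>Ix. \<forall>i<n. m i < dd i}"

definition kap :: "(nat \<Rightarrow> nat) \<Rightarrow> nat \<Rightarrow> nat" where "kap m i = m i div dd i"
definition red :: "(nat \<Rightarrow> nat) \<Rightarrow> nat \<Rightarrow> nat" where "red m i = m i mod dd i"

definition thp :: "(nat \<Rightarrow> pt \<Rightarrow> complex) \<Rightarrow> (nat \<Rightarrow> nat) \<Rightarrow> pt \<Rightarrow> complex" where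
  "thp th \<kappa> = (\<Prod>i<n. th i ^ \<kappa> i)"

definition comb :: "(nat \<Rightarrow> nat) \<Rightarrow> (nat \<Rightarrow> nat) \<Rightarrow> nat \<Rightarrow> nat" where
  "comb \<kappa> m i = \<kappa> i * dd i + m i"

lemma finite_L: "finite L"
proof (rule finite_subset)
  show "finite {m. \<forall>i. (i \<in> {..<n} \<longrightarrow> m i \<in> {..<Max (dd ` {..<n})}) \<and> (i \<notin> {..<n} \<longrightarrow> m i = 0)}"
    by (rule finite_set_of_finite_funs) auto
  show "L \<subseteq> {m. \<forall>i. (i \<in> {..<n} \<longrightarrow> m i \<in> {..<Max (dd ` {..<n})}) \<and> (i \<notin> {..<n} \<longrightarrow> m i = 0)}"
  proof
    fix m assume m: "m \<in> L"
    have "m i < Max (dd ` {..<n})" if "i < n" for i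
    proof -
      have "m i < dd i" using m that by (simp add: L_def)
      also have "dd i \<le> Max (dd ` {..<n})" using that by (intro Max_ge) auto
      finally show ?thesis .
    qed
    then show "m \<in> {m. \<forall>i. (i \<in> {..<n} \<longrightarrow> m i \<in> {..<Max (dd ` {..<n})}) \<and> (i \<notin> {..<n} \<longrightarrow> m i = 0)}"
      using m by (auto simp: L_def Ix_def)
  qed
qed

lemma L_Ix: "m \<in> L \<Longrightarrow> m \<in> Ix"
  by (simp add: L_def)

lemma kap_Ix: "m \<in> Ix \<Longrightarrow> kap m \<in> Ix" and red_L: "m \<in> Ix \<Longrightarrow> red m \<in> L"
  using dd_pos by (auto simp: Ix_def L_def kap_def red_def)

lemma comb_kap_red: "comb (kap m) (red m) = m"
  by (rule ext) (simp only: comb_def kap_def red_def div_mult_mod_eq)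

lemma kap_comb: "kap (comb \<kappa> m) i = \<kappa> i + kap m i" and red_comb: "red (comb \<kappa> m) = red m"
  using dd_pos by (auto simp: kap_def red_def comb_def fun_eq_iff)

lemma comb_Ix: "\<kappa> \<in> Ix \<Longrightarrow> m \<in> Ix \<Longrightarrow> comb \<kappa> m \<in> Ix"
  by (simp add: Ix_def comb_def)

lemma red_eq: "m \<in> Ix \<Longrightarrow> (\<And>i. i < n \<Longrightarrow> kap m i = 0) \<Longrightarrow> red m = m"
proof
  fix i assume *: "m \<in> Ix" "\<And>i. i < n \<Longrightarrow> kap m i = 0"
  show "red m i = m i"
  proof (cases "i < n")
    case True
    then show ?thesis using *(2)[OF True] div_mult_mod_eq[of "m i" "dd i"] by (simp add: red_def kap_def)
  qed (use * in \<open>simp add: Ix_def red_def\<close>)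
qed

lemma bas_comb: "bas th ep (comb \<kappa> m) = thp th \<kappa> * bas th ep m"
proof -
  have "(\<kappa> i * dd i + m i) div dd i = \<kappa> i + m i div dd i" "(\<kappa> i * dd i + m i) mod dd i = m i mod dd i" for i
    using dd_pos[of i] by auto
  then show ?thesis by (simp add: bas_def thp_def comb_def power_add prod.distrib mult_ac)
qed

lemma bas_red: "bas th ep m = thp th (kap m) * bas th ep (red m)"
  using bas_comb[of th ep "kap m" "red m"] by (simp add: comb_kap_red)

lemma thp_add: "thp th \<kappa> * thp th \<mu> = thp th (\<lambda>i. \<kappa> i + \<mu> i)"
  by (simp add: thp_def power_add prod.distrib)

lemma thp_0: "(\<And>i. i < n \<Longrightarrow> \<kappa> i = 0) \<Longrightarrow> thp th \<kappa> = 1"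
  by (simp add: thp_def)

text \<open>Coefficient extraction: the terms whose parameters with index in \<open>E\<close> have
  exponents \<open>\<mu>\<close> are kept, and then all parameters are removed. For
  \<open>\<mu>\<close> = 0 this is reduction modulo the parameters in \<open>E\<close> with the
  others set to 1. Being a chosen linear extension, it has these values once \<open>bas\<close> is
  independent.\<close>

definition Phi :: "(nat \<Rightarrow> pt \<Rightarrow> complex) \<Rightarrow> (nat \<Rightarrow> nat \<Rightarrow> pt \<Rightarrow> complex) \<Rightarrow> nat set \<Rightarrow> (nat \<Rightarrow> nat)
    \<Rightarrow> (pt \<Rightarrow> complex) \<Rightarrow> pt \<Rightarrow> complex" where
  "Phi th ep E \<mu> = (SOME \<phi>. (\<forall>f g. \<phi> (f + g) = \<phi> f + \<phi> g) \<and> (\<forall>c f. \<phi> (cst c * f) = cst c * \<phi> f) \<and>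
     (\<forall>m\<in>Ix. \<phi> (bas th ep m) = (if \<forall>i\<in>E. kap m i = \<mu> i then bas th ep (red m) else 0)))"

lemma Phi_cong: "(\<And>i. i \<in> E \<Longrightarrow> \<mu> i = \<mu>' i) \<Longrightarrow> Phi th ep E \<mu> = Phi th ep E \<mu>'"
  unfolding Phi_def by simp

context
  fixes th ep
  assumes ind: "indep Ix (bas th ep)"
begin

lemma Phi_props:
  "Phi th ep E \<mu> (f + g) = Phi th ep E \<mu> f + Phi th ep E \<mu> g"
  "Phi th ep E \<mu> (cst c * f) = cst c * Phi th ep E \<mu> f"
  "m \<in> Ix \<Longrightarrow> Phi th ep E \<mu> (bas th ep m) = (if \<forall>i\<in>E. kap m i = \<mu> i then bas th ep (red m) else 0)"
proof -
  let ?h = "\<lambda>m. if \<forall>i\<in>E. kap m i = \<mu> i then bas th ep (red m) else 0"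
  have "\<exists>\<phi>. (\<forall>f g. \<phi> (f + g) = \<phi> f + \<phi> g) \<and> (\<forall>c f. \<phi> (cst c * f) = cst c * \<phi> f) \<and>
     (\<forall>m\<in>Ix. \<phi> (bas th ep m) = ?h m)"
    by (rule linear_extension[OF ind, of ?h]) blast
  from someI_ex[OF this, folded Phi_def] show
    "Phi th ep E \<mu> (f + g) = Phi th ep E \<mu> f + Phi th ep E \<mu> g"
    "Phi th ep E \<mu> (cst c * f) = cst c * Phi th ep E \<mu> f"
    "m \<in> Ix \<Longrightarrow> Phi th ep E \<mu> (bas th ep m) = ?h m"
    by blast+
qed

lemma Phi_sum: "Phi th ep E \<mu> (\<Sum>j\<in>J. cst (c j) * v j) = (\<Sum>j\<in>J. cst (c j) * Phi th ep E \<mu> (v j))"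
  by (rule linear_map_sum) (rule Phi_props)+

lemma Phi_0: "Phi th ep E \<mu> 0 = 0"
  using Phi_props(2)[of E \<mu> 0 0] by simp

lemma Phi_thp:
  assumes f: "f \<in> fv.span (bas th ep ` Ix)" and \<kappa>: "\<kappa> \<in> Ix"
  shows "Phi th ep E \<mu> (thp th \<kappa> * f) = (if \<forall>i\<in>E. \<kappa> i \<le> \<mu> i then Phi th ep E (\<lambda>i. \<mu> i - \<kappa> i) f else 0)"
  using f
proof (induction rule: fv.span_induct_alt)
  case base
  then show ?case by (simp add: Phi_0)
next
  case (step c x y)
  then obtain m where m: "x = bas th ep m" "m \<in> Ix" by blast
  have x: "Phi th ep E \<mu> (thp th \<kappa> * x) = (if \<forall>i\<in>E. \<kappa> i \<le> \<mu> i then Phi th ep E (\<lambda>i. \<mu> i - \<kappa> i) x else 0)"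
  proof -
    have iff: "(\<forall>i\<in>E. \<kappa> i + kap m i = \<mu> i) \<longleftrightarrow> (\<forall>i\<in>E. \<kappa> i \<le> \<mu> i) \<and> (\<forall>i\<in>E. kap m i = \<mu> i - \<kappa> i)" by force
    have "Phi th ep E \<mu> (thp th \<kappa> * x) = (if \<forall>i\<in>E. \<kappa> i + kap m i = \<mu> i then bas th ep (red m) else 0)"
      unfolding m(1) bas_comb[symmetric] Phi_props(3)[OF comb_Ix[OF \<kappa> m(2)]] kap_comb red_comb ..
    also have "\<dots> = (if \<forall>i\<in>E. \<kappa> i \<le> \<mu> i then Phi th ep E (\<lambda>i. \<mu> i - \<kappa> i) x else 0)"
      unfolding iff m(1) Phi_props(3)[OF m(2)] by auto
    finally show ?thesis .
  qed
  have "thp th \<kappa> * (cst c * x + y) = cst c * (thp th \<kappa> * x) + thp th \<kappa> * y"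
    by (simp add: distrib_left mult.left_commute)
  then have "Phi th ep E \<mu> (thp th \<kappa> * (cst c * x + y)) = cst c * Phi th ep E \<mu> (thp th \<kappa> * x) + Phi th ep E \<mu> (thp th \<kappa> * y)"
    by (simp only: Phi_props(1,2))
  then show ?case unfolding x step.IH by (simp add: Phi_props(1,2))
qed

text \<open>The filtration by powers of the ideal generated by \<open>th i\<close>, \<open>i \<in> E\<close>, reduces linear independence
  of the \<open>g k\<close> over the polynomials in \<open>th\<close> to linear independence of their leading parts.\<close>

lemma relation_coefficients:
  assumes finA: "finite A" "A \<subseteq> Ix" and finK: "finite K"
    and g: "\<And>k. k \<in> K \<Longrightarrow> g k \<in> fv.span (bas th ep ` Ix)" and finE: "finite E"
    and indg: "indep K (\<lambda>k. Phi th ep E (\<lambda>_. 0) (g k))"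
    and rel: "(\<Sum>\<kappa>\<in>A. \<Sum>k\<in>K. cst (c \<kappa> k) * (thp th \<kappa> * g k)) = 0"
    and k: "k \<in> K"
  shows "(\<Sum>\<kappa>\<in>{\<kappa>\<in>A. \<forall>i\<in>E. \<kappa> i = \<mu> i}. c \<kappa> k) = 0"
  using k
proof (induction "\<Sum>i\<in>E. \<mu> i" arbitrary: \<mu> k rule: less_induct)
  case less
  \<comment> \<open>Exponent vectors are grouped by their restriction to \<open>E\<close>, which is
    all that \<open>Phi\<close> sees.\<close>
  define \<rho> where "\<rho> \<kappa> = (\<lambda>i. if i \<in> E then \<kappa> i else 0)" for \<kappa> :: "nat \<Rightarrow> nat"
  define F where "F \<kappa> = (\<Sum>k\<in>K. cst (c \<kappa> k) * Phi th ep E \<mu> (thp th \<kappa> * g k))" for \<kappa>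
  have cls: "{\<kappa>\<in>A. \<rho> \<kappa> = \<rho> \<nu>} = {\<kappa>\<in>A. \<forall>i\<in>E. \<kappa> i = \<nu> i}" for \<nu>
    unfolding \<rho>_def by (auto simp: fun_eq_iff)
  have lin0: "Phi th ep E \<mu> (\<Sum>\<kappa>\<in>A. \<Sum>k\<in>K. cst (c \<kappa> k) * (thp th \<kappa> * g k)) = (\<Sum>\<kappa>\<in>A. F \<kappa>)"
  proof -
    have "(\<Sum>\<kappa>\<in>A. \<Sum>k\<in>K. cst (c \<kappa> k) * (thp th \<kappa> * g k)) = (\<Sum>\<kappa>\<in>A. cst 1 * (\<Sum>k\<in>K. cst (c \<kappa> k) * (thp th \<kappa> * g k)))" by simp
    then have "Phi th ep E \<mu> (\<Sum>\<kappa>\<in>A. \<Sum>k\<in>K. cst (c \<kappa> k) * (thp th \<kappa> * g k))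
      = (\<Sum>\<kappa>\<in>A. cst 1 * Phi th ep E \<mu> (\<Sum>k\<in>K. cst (c \<kappa> k) * (thp th \<kappa> * g k)))" by (simp only: Phi_sum)
    then show ?thesis by (simp add: F_def Phi_sum)
  qed
  then have "(\<Sum>\<kappa>\<in>A. F \<kappa>) = 0" unfolding rel Phi_0 by simp
  moreover have "(\<Sum>\<nu>\<in>\<rho> ` A. \<Sum>\<kappa>\<in>{\<kappa>\<in>A. \<rho> \<kappa> = \<nu>}. F \<kappa>) = (\<Sum>\<kappa>\<in>A. F \<kappa>)"
    by (rule sum.group) (use finA in auto)
  ultimately have total: "(\<Sum>\<nu>\<in>\<rho> ` A. \<Sum>\<kappa>\<in>{\<kappa>\<in>A. \<rho> \<kappa> = \<nu>}. F \<kappa>) = 0" by simp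
  have Fcls: "(\<Sum>\<kappa>\<in>{\<kappa>\<in>A. \<rho> \<kappa> = \<rho> \<nu>}. F \<kappa>) =
      (if \<forall>i\<in>E. \<nu> i \<le> \<mu> i then \<Sum>k\<in>K. cst (\<Sum>\<kappa>\<in>{\<kappa>\<in>A. \<rho> \<kappa> = \<rho> \<nu>}. c \<kappa> k) * Phi th ep E (\<lambda>i. \<mu> i - \<nu> i) (g k) else 0)" for \<nu>
  proof -
    have "F \<kappa> = (if \<forall>i\<in>E. \<nu> i \<le> \<mu> i then \<Sum>k\<in>K. cst (c \<kappa> k) * Phi th ep E (\<lambda>i. \<mu> i - \<nu> i) (g k) else 0)"
      if \<kappa>: "\<kappa> \<in> {\<kappa>\<in>A. \<rho> \<kappa> = \<rho> \<nu>}" for \<kappa>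
    proof -
      have eq: "\<kappa> i = \<nu> i" if "i \<in> E" for i using \<kappa> that unfolding cls by blast
      have le: "(\<forall>i\<in>E. \<kappa> i \<le> \<mu> i) \<longleftrightarrow> (\<forall>i\<in>E. \<nu> i \<le> \<mu> i)" using eq by simp
      have cong: "Phi th ep E (\<lambda>i. \<mu> i - \<kappa> i) = Phi th ep E (\<lambda>i. \<mu> i - \<nu> i)" by (rule Phi_cong) (simp add: eq)
      have \<kappa>I: "\<kappa> \<in> Ix" using \<kappa> finA(2) by auto
      have Feq: "F \<kappa> = (\<Sum>k\<in>K. cst (c \<kappa> k) * (if \<forall>i\<in>E. \<nu> i \<le> \<mu> i then Phi th ep E (\<lambda>i. \<mu> i - \<nu> i) (g k) else 0))"
        unfolding F_def by (intro sum.cong refl) (simp only: Phi_thp[OF g \<kappa>I] le cong)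
      show ?thesis
      proof (cases "\<forall>i\<in>E. \<nu> i \<le> \<mu> i")
        case True
        show ?thesis unfolding Feq if_P[OF True] ..
      next
        case False
        show ?thesis unfolding Feq if_not_P[OF False] by simp
      qed
    qed
    then have "(\<Sum>\<kappa>\<in>{\<kappa>\<in>A. \<rho> \<kappa> = \<rho> \<nu>}. F \<kappa>) = (\<Sum>\<kappa>\<in>{\<kappa>\<in>A. \<rho> \<kappa> = \<rho> \<nu>}. if \<forall>i\<in>E. \<nu> i \<le> \<mu> i then
        \<Sum>k\<in>K. cst (c \<kappa> k) * Phi th ep E (\<lambda>i. \<mu> i - \<nu> i) (g k) else 0)"
      by (rule sum.cong[OF refl])
    also have "\<dots> = (if \<forall>i\<in>E. \<nu> i \<le> \<mu> i then
        \<Sum>\<kappa>\<in>{\<kappa>\<in>A. \<rho> \<kappa> = \<rho> \<nu>}. \<Sum>k\<in>K. cst (c \<kappa> k) * Phi th ep E (\<lambda>i. \<mu> i - \<nu> i) (g k) else 0)"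
    proof (cases "\<forall>i\<in>E. \<nu> i \<le> \<mu> i")
      case True
      show ?thesis unfolding if_P[OF True] ..
    next
      case False
      show ?thesis unfolding if_not_P[OF False] by simp
    qed
    also have "(\<Sum>\<kappa>\<in>{\<kappa>\<in>A. \<rho> \<kappa> = \<rho> \<nu>}. \<Sum>k\<in>K. cst (c \<kappa> k) * Phi th ep E (\<lambda>i. \<mu> i - \<nu> i) (g k))
      = (\<Sum>k\<in>K. cst (\<Sum>\<kappa>\<in>{\<kappa>\<in>A. \<rho> \<kappa> = \<rho> \<nu>}. c \<kappa> k) * Phi th ep E (\<lambda>i. \<mu> i - \<nu> i) (g k))"
      unfolding cst_sum sum_distrib_right by (rule sum.swap)
    finally show ?thesis .
  qed
  \<comment> \<open>A class strictly below \<open>\<mu>\<close> on \<open>E\<close> has vanishing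
    coefficient sums by induction; a class not below \<open>\<mu>\<close> is annihilated by the
    extraction.\<close>
  have small: "(\<Sum>\<kappa>\<in>{\<kappa>\<in>A. \<rho> \<kappa> = \<nu>}. F \<kappa>) = 0" if nu: "\<nu> \<in> \<rho> ` A" "\<nu> \<noteq> \<rho> \<mu>" for \<nu>
  proof -
    obtain \<kappa>0 where \<kappa>0: "\<nu> = \<rho> \<kappa>0" using nu(1) by blast
    show ?thesis
    proof (cases "\<forall>i\<in>E. \<kappa>0 i \<le> \<mu> i")
      case True
      obtain i where i: "i \<in> E" "\<kappa>0 i \<noteq> \<mu> i"
        using nu(2) unfolding \<kappa>0 \<rho>_def fun_eq_iff by metis
      then have "\<kappa>0 i < \<mu> i" using True le_neq_implies_less by blast
      then have "(\<Sum>i\<in>E. \<kappa>0 i) < (\<Sum>i\<in>E. \<mu> i)"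
        using finE True i(1) by (intro sum_strict_mono_ex1) auto
      then have "(\<Sum>\<kappa>\<in>{\<kappa>\<in>A. \<rho> \<kappa> = \<rho> \<kappa>0}. c \<kappa> k) = 0" if "k \<in> K" for k
        unfolding cls using less.hyps that by blast
      then show ?thesis unfolding \<kappa>0 Fcls by simp
    next
      case False
      show ?thesis unfolding \<kappa>0 Fcls by (simp only: False if_False)
    qed
  qed
  have "(\<Sum>\<kappa>\<in>{\<kappa>\<in>A. \<rho> \<kappa> = \<rho> \<mu>}. F \<kappa>) = 0"
  proof (cases "\<rho> \<mu> \<in> \<rho> ` A")
    case True
    have "(\<Sum>\<nu>\<in>\<rho> ` A. \<Sum>\<kappa>\<in>{\<kappa>\<in>A. \<rho> \<kappa> = \<nu>}. F \<kappa>)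
      = (\<Sum>\<kappa>\<in>{\<kappa>\<in>A. \<rho> \<kappa> = \<rho> \<mu>}. F \<kappa>) + (\<Sum>\<nu>\<in>\<rho> ` A - {\<rho> \<mu>}. \<Sum>\<kappa>\<in>{\<kappa>\<in>A. \<rho> \<kappa> = \<nu>}. F \<kappa>)"
      using finA True by (intro sum.remove) auto
    also have "(\<Sum>\<nu>\<in>\<rho> ` A - {\<rho> \<mu>}. \<Sum>\<kappa>\<in>{\<kappa>\<in>A. \<rho> \<kappa> = \<nu>}. F \<kappa>) = 0"
      by (intro sum.neutral ballI small) auto
    finally show ?thesis using total by simp
  next
    case False
    then have "{\<kappa>\<in>A. \<rho> \<kappa> = \<rho> \<mu>} = {}" by (metis (mono_tags, lifting) Collect_empty_eq imageI)
    then show ?thesis by (simp only: sum.empty)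
  qed
  then have "(\<Sum>k\<in>K. cst (\<Sum>\<kappa>\<in>{\<kappa>\<in>A. \<rho> \<kappa> = \<rho> \<mu>}. c \<kappa> k) * Phi th ep E (\<lambda>i. 0) (g k)) = 0"
    unfolding Fcls by simp
  from indepD[OF indg finK order_refl this less.prems] show ?case unfolding cls .
qed

end

subsection \<open>The invariants at \<open>a = 0\<close>\<close>

abbreviation tbas :: "(nat \<Rightarrow> nat) \<Rightarrow> pt \<Rightarrow> complex" where "tbas \<equiv> bas theta0 epT"

definition g0 :: "(nat \<Rightarrow> nat) \<Rightarrow> pt \<Rightarrow> complex" where "g0 m = rho (tbas m)"

abbreviation phiT :: "(pt \<Rightarrow> complex) \<Rightarrow> pt \<Rightarrow> complex" where "phiT \<equiv> Phi theta0 epT {..<n} (\<lambda>_. 0)"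

definition wT :: "(nat \<Rightarrow> nat) \<Rightarrow> nat" where "wT m = (\<Sum>i<n. tdeg i (m i))"

text \<open>A selection of symmetrized basis elements that is a basis modulo all parameters. By
  graded Nakayama it generates the invariants over the parameters.\<close>

definition KK :: "(nat \<Rightarrow> nat) set" where
  "KK = (SOME K. K \<subseteq> L \<and> indep K (\<lambda>m. phiT (g0 m)) \<and> (\<forall>m\<in>L. phiT (g0 m) \<in> fv.span ((\<lambda>m. phiT (g0 m)) ` K)))"

lemma KK: "KK \<subseteq> L" "indep KK (\<lambda>m. phiT (g0 m))" "m \<in> L \<Longrightarrow> phiT (g0 m) \<in> fv.span ((\<lambda>m. phiT (g0 m)) ` KK)"
proof -
  have "\<exists>K. K \<subseteq> L \<and> indep K (\<lambda>m. phiT (g0 m)) \<and> (\<forall>m\<in>L. phiT (g0 m) \<in> fv.span ((\<lambda>m. phiT (g0 m)) ` K))"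
    using choose_spanning_indep[OF finite_L] by blast
  from someI_ex[OF this, folded KK_def]
  show "KK \<subseteq> L" "indep KK (\<lambda>m. phiT (g0 m))" "m \<in> L \<Longrightarrow> phiT (g0 m) \<in> fv.span ((\<lambda>m. phiT (g0 m)) ` KK)"
    by blast+
qed

lemma finite_KK: "finite KK"
  using KK(1) finite_L finite_subset by blast

lemma g0_Tp: "g0 m \<in> Tp" and g0_Sym: "g0 m \<in> Sym" and g0_Sd: "g0 m \<in> Sd (wT m)"
  unfolding g0_def wT_def by (intro rho_Tp bas_epT_Tp, intro rho_in_Sym, intro rho_Sd bas_epT_Sd)

lemma tbas_Sd: "tbas m \<in> Sd (wT m)"
  unfolding wT_def by (rule bas_epT_Sd)

lemma wT_red: "wT m = (\<Sum>i<n. kap m i * dd i) + wT (red m)"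
  unfolding wT_def kap_def red_def by (simp only: sum.distrib[symmetric] tdeg_div_mod)

definition Vg :: "(pt \<Rightarrow> complex) set" where
  "Vg = fv.span ((\<lambda>(\<kappa>, k). thp theta0 \<kappa> * g0 k) ` (Ix \<times> KK))"

lemma Vg_base: "\<kappa> \<in> Ix \<Longrightarrow> k \<in> KK \<Longrightarrow> thp theta0 \<kappa> * g0 k \<in> Vg"
  unfolding Vg_def by (intro fv.span_base image_eqI[of _ _ "(\<kappa>, k)"]) auto

lemma Vg_thp: assumes "\<kappa> \<in> Ix" "f \<in> Vg" shows "thp theta0 \<kappa> * f \<in> Vg"
proof -
  have "Vg \<subseteq> {f. f * thp theta0 \<kappa> \<in> Vg}"
    unfolding Vg_def
  proof (intro fv.span_minimal subspace_mult_preimage image_subsetI)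
    fix p assume "p \<in> Ix \<times> KK"
    then obtain \<mu> k where p: "p = (\<mu>, k)" "\<mu> \<in> Ix" "k \<in> KK" by blast
    have "thp theta0 (\<lambda>i. \<mu> i + \<kappa> i) * g0 k \<in> Vg" using p assms(1) by (intro Vg_base) (auto simp: Ix_def)
    then show "(case p of (\<kappa>, k) \<Rightarrow> thp theta0 \<kappa> * g0 k) \<in> {f. f * thp theta0 \<kappa> \<in> fv.span ((\<lambda>(\<kappa>, k). thp theta0 \<kappa> * g0 k) ` (Ix \<times> KK))}"
      unfolding p Vg_def[symmetric] by (simp add: thp_add[symmetric] mult_ac)
  qed simp
  then show ?thesis using assms(2) by (auto simp: mult.commute)
qed

lemma thp_Sym: "thp theta0 \<kappa> \<in> Sym"
  unfolding thp_def by (intro subalg_prod[OF subalg_Sym] subalg_power[OF subalg_Sym] theta0_Sym)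

lemma rho_tbas: "rho (tbas m) = thp theta0 (kap m) * g0 (red m)"
  unfolding g0_def bas_red[of theta0 epT m] by (rule rho_mult[OF thp_Sym])

text \<open>Graded Nakayama, by induction on the degree: an index with a nontrivial parameter part
  reduces to a lower degree, and a reduced one is corrected by members of \<open>KK\<close> of the
  same degree until only such indices remain.\<close>

lemma rho_tbas_Vg: "m \<in> Ix \<Longrightarrow> wT m = d \<Longrightarrow> rho (tbas m) \<in> Vg"
proof (induction d arbitrary: m rule: less_induct)
  case (less d)
  have big: "rho (tbas m) \<in> Vg" if m: "m \<in> Ix" "wT m = d" "i < n" "kap m i \<noteq> 0" for m i
  proof -
    have "dd i \<le> kap m i * dd i" using m(4) by simp
    also have "\<dots> \<le> (\<Sum>i<n. kap m i * dd i)" using m(3) by (intro member_le_sum) auto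
    finally have "wT (red m) < d" using wT_red[of m] m(2) dd_pos[of i] by linarith
    then have "rho (tbas (red m)) \<in> Vg" using m(1) by (intro less.IH) (auto intro: L_Ix red_L)
    then have "g0 (red m) \<in> Vg" by (simp only: g0_def)
    then show ?thesis unfolding rho_tbas[of m] by (rule Vg_thp[OF kap_Ix[OF m(1)]])
  qed
  show ?case
  proof (cases "\<exists>i<n. kap m i \<noteq> 0")
    case True
    then show ?thesis using big less.prems by blast
  next
    case False
    then have mr: "red m = m" using less.prems(1) by (intro red_eq) auto
    then have mL: "m \<in> L" using red_L[OF less.prems(1)] by simp
    let ?I = "\<lambda>d. {m\<in>Ix. wT m = d}"
    have finI: "finite (?I d)" unfolding wT_def by (rule finite_weighted_Ix) (rule tdeg_ge)
    have phi_Sd: "phiT f \<in> Sd e" if f: "f \<in> Tp" "f \<in> Sd e" for f e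
    proof -
      have "f \<in> fv.span (tbas ` ?I e)"
        using Tp_bas f by (intro homogeneous_in_span[OF f(2) _ tbas_Sd]) blast
      then obtain J c where J: "finite J" "J \<subseteq> ?I e" "f = (\<Sum>m\<in>J. cst (c m) * tbas m)"
        by (rule span_family_explicit)
      have "phiT (tbas m) \<in> Sd e" if "m \<in> J" for m
      proof (cases "\<forall>i\<in>{..<n}. kap m i = 0")
        case True
        have mI: "m \<in> Ix" "wT m = e" using that J(2) by auto
        then have "red m = m" using True by (intro red_eq) auto
        then have "phiT (tbas m) = tbas m" using True Phi_props(3)[OF indep_bas_epT mI(1), of "{..<n}" "\<lambda>_. 0"] by simp
        then show ?thesis using tbas_Sd[of m] mI(2) by simp
      next
        case False
        have mI: "m \<in> Ix" using that J(2) by auto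
        show ?thesis unfolding Phi_props(3)[OF indep_bas_epT mI] if_not_P[OF False] by (rule Sd_0)
      qed
      then show ?thesis unfolding J(3) Phi_sum[OF indep_bas_epT] by (intro Sd_sum Sd_cst_mult)
    qed
    have "phiT (g0 m) \<in> Sd d" using less.prems(2) g0_Sd[of m] g0_Tp[of m] by (intro phi_Sd) auto
    moreover have "phiT (g0 k) \<in> Sd (wT k)" for k by (intro phi_Sd g0_Tp g0_Sd)
    ultimately have "phiT (g0 m) \<in> fv.span ((\<lambda>k. phiT (g0 k)) ` {k\<in>KK. wT k = d})"
      using homogeneous_in_span[OF _ KK(3)[OF mL], of d wT] by blast
    then obtain J c where J: "finite J" "J \<subseteq> {k\<in>KK. wT k = d}" "phiT (g0 m) = (\<Sum>k\<in>J. cst (c k) * phiT (g0 k))"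
      by (rule span_family_explicit)
    \<comment> \<open>Invariant, homogeneous and zero modulo the parameters. Its expansion thus
      involves only indices with a nontrivial parameter part, to which \<open>big\<close> applies
      after averaging.\<close>
    define h where "h = g0 m - (\<Sum>k\<in>J. cst (c k) * g0 k)"
    have h_Tp: "h \<in> Tp" unfolding h_def
      by (intro subalg_diff[OF subalg_Tp] subalg_sum[OF subalg_Tp] subalg_mult[OF subalg_Tp] subalg_cst[OF subalg_Tp] g0_Tp)
    have h_Sym: "h \<in> Sym" unfolding h_def
      by (intro subalg_diff[OF subalg_Sym] subalg_sum[OF subalg_Sym] subalg_mult[OF subalg_Sym] subalg_cst[OF subalg_Sym] g0_Sym)
    have h_Sd: "h \<in> Sd d" unfolding h_def
    proof (intro Sd_diff Sd_sum Sd_cst_mult)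
      show "g0 m \<in> Sd d" using g0_Sd[of m] less.prems(2) by simp
      fix k assume "k \<in> J" then show "g0 k \<in> Sd d" using g0_Sd[of k] J(2) by auto
    qed
    have "h = g0 m + cst (-1) * (\<Sum>k\<in>J. cst (c k) * g0 k)" by (simp add: h_def cst_neg1)
    then have "phiT h = phiT (g0 m) + cst (-1) * phiT (\<Sum>k\<in>J. cst (c k) * g0 k)"
      by (simp only: Phi_props(1,2)[OF indep_bas_epT])
    then have phih: "phiT h = 0" unfolding Phi_sum[OF indep_bas_epT] J(3) by (simp add: cst_neg1)
    have "h \<in> fv.span (tbas ` ?I d)"
      using Tp_bas h_Tp by (intro homogeneous_in_span[OF h_Sd _ tbas_Sd]) blast
    then obtain b where b: "h = (\<Sum>m\<in>?I d. cst (b m) * tbas m)" using span_family_finite[OF _ finI] by blast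
    have phit: "phiT (tbas m) = (if \<forall>i<n. kap m i = 0 then tbas m else 0)" if "m \<in> Ix" for m
    proof (cases "\<forall>i<n. kap m i = 0")
      case True
      then have "red m = m" using that by (intro red_eq) auto
      then show ?thesis using True Phi_props(3)[OF indep_bas_epT that, of "{..<n}" "\<lambda>_. 0"] by simp
    next
      case False
      then show ?thesis using Phi_props(3)[OF indep_bas_epT that, of "{..<n}" "\<lambda>_. 0"] by auto
    qed
    have "(\<Sum>m\<in>?I d. cst (if \<forall>i<n. kap m i = 0 then b m else 0) * tbas m) = (\<Sum>m\<in>?I d. cst (b m) * phiT (tbas m))"
      by (intro sum.cong refl) (auto simp: phit)
    also have "\<dots> = 0" using phih unfolding b Phi_sum[OF indep_bas_epT] .
    finally have "(if \<forall>i<n. kap m i = 0 then b m else 0) = 0" if "m \<in> ?I d" for m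
      using indepD[OF indep_bas_epT finI, of "\<lambda>m. if \<forall>i<n. kap m i = 0 then b m else 0" m] that by auto
    then have b0: "b m = 0" if "m \<in> ?I d" "\<forall>i<n. kap m i = 0" for m using that by presburger
    have "cst (b m) * rho (tbas m) \<in> Vg" if "m \<in> ?I d" for m
    proof (cases "\<forall>i<n. kap m i = 0")
      case True
      then show ?thesis using b0[OF that True] by (simp add: Vg_def fv.span_zero)
    next
      case False
      then have "rho (tbas m) \<in> Vg" using big that by blast
      then show ?thesis unfolding Vg_def by (rule fv.span_scale)
    qed
    then have "rho h \<in> Vg" unfolding b linear_map_sum[of rho, OF rho_add rho_cst_mult]
      unfolding Vg_def by (intro fv.span_sum)
    then have hV: "h \<in> Vg" using rho_Sym[OF h_Sym] by simp
    have gk: "g0 k \<in> Vg" if "k \<in> KK" for k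
      using Vg_base[of "\<lambda>_. 0" k] that by (simp add: thp_0 Ix_def)
    have "(\<Sum>k\<in>J. cst (c k) * g0 k) \<in> Vg"
      unfolding Vg_def by (intro sum_in_span) (use J(2) gk in \<open>auto simp: Vg_def\<close>)
    then have "h + (\<Sum>k\<in>J. cst (c k) * g0 k) \<in> Vg" using hV unfolding Vg_def by (intro fv.span_add)
    then show ?thesis by (simp add: h_def g0_def)
  qed
qed

lemma rho_Tp_Vg: "f \<in> Tp \<Longrightarrow> rho f \<in> Vg"
proof -
  assume "f \<in> Tp"
  then have "f \<in> fv.span (tbas ` Ix)" using Tp_bas by blast
  then obtain J c where J: "finite J" "J \<subseteq> Ix" "f = (\<Sum>m\<in>J. cst (c m) * tbas m)" by (rule span_family_explicit)
  show ?thesis unfolding J(3) linear_map_sum[of rho, OF rho_add rho_cst_mult]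
    unfolding Vg_def by (intro sum_in_span, fold Vg_def) (use J(2) rho_tbas_Vg in blast)
qed

lemma indep_of_relation:
  assumes "\<forall>A c. finite A \<longrightarrow> A \<subseteq> I \<longrightarrow> (\<Sum>\<kappa>\<in>A. \<Sum>k\<in>K. cst (c \<kappa> k) * v \<kappa> k) = 0 \<longrightarrow> (\<forall>\<kappa>\<in>A. \<forall>k\<in>K. c \<kappa> k = 0)"
    and "finite K"
  shows "indep (I \<times> K) (\<lambda>(\<kappa>, k). v \<kappa> k)"
proof (rule indepI)
  fix J c j assume J: "finite J" "J \<subseteq> I \<times> K" "(\<Sum>j\<in>J. cst (c j) * (case j of (\<kappa>, k) \<Rightarrow> v \<kappa> k)) = 0" "j \<in> J"
  define A where "A = fst ` J"
  define c' where "c' \<kappa> k = (if (\<kappa>, k) \<in> J then c (\<kappa>, k) else 0)" for \<kappa> k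
  have A: "finite A" "A \<subseteq> I" using J by (auto simp: A_def)
  have "(\<Sum>\<kappa>\<in>A. \<Sum>k\<in>K. cst (c' \<kappa> k) * v \<kappa> k) = (\<Sum>j\<in>A \<times> K. cst (c' (fst j) (snd j)) * v (fst j) (snd j))"
    by (simp add: sum.cartesian_product split_def)
  also have "\<dots> = (\<Sum>j\<in>J. cst (c j) * (case j of (\<kappa>, k) \<Rightarrow> v \<kappa> k))"
  proof (rule sum.mono_neutral_cong_right)
    show "finite (A \<times> K)" using A assms(2) by simp
    show "J \<subseteq> A \<times> K" using J(2) by (force simp: A_def)
  qed (auto simp: c'_def)
  finally have "(\<Sum>\<kappa>\<in>A. \<Sum>k\<in>K. cst (c' \<kappa> k) * v \<kappa> k) = 0" using J(3) by simp
  from assms(1)[THEN spec, THEN spec, THEN mp, THEN mp, THEN mp, OF A this] J(2,4)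
  have "c' (fst j) (snd j) = 0" by (force simp: A_def)
  then show "c j = 0" using J(4) by (simp add: c'_def)
qed

lemma Ix_eq: "\<kappa> \<in> Ix \<Longrightarrow> \<mu> \<in> Ix \<Longrightarrow> (\<forall>i<n. \<kappa> i = \<mu> i) \<longleftrightarrow> \<kappa> = \<mu>"
  unfolding Ix_def fun_eq_iff by (metis (mono_tags) mem_Collect_eq not_le)

text \<open>With all parameters in \<open>E\<close>, each class of exponents in
  \<open>relation_coefficients\<close> consists of one element, so its sum is the coefficient
  itself.\<close>

lemma indep_Vg: "indep (Ix \<times> KK) (\<lambda>(\<kappa>, k). thp theta0 \<kappa> * g0 k)"
proof (rule indep_of_relation[OF _ finite_KK], intro allI impI)
  fix A c
  assume A: "finite A" "A \<subseteq> Ix" "(\<Sum>\<kappa>\<in>A. \<Sum>k\<in>KK. cst (c \<kappa> k) * (thp theta0 \<kappa> * g0 k)) = 0"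
  show "\<forall>\<kappa>\<in>A. \<forall>k\<in>KK. c \<kappa> k = 0"
  proof (intro ballI)
  fix \<kappa> k assume \<kappa>: "\<kappa> \<in> A" and k: "k \<in> KK"
  have g: "g0 k \<in> fv.span (tbas ` Ix)" for k using Tp_bas g0_Tp[of k] by (rule subsetD)
  have s: "(\<Sum>\<kappa>'\<in>{\<kappa>'\<in>A. \<forall>i\<in>{..<n}. \<kappa>' i = \<kappa> i}. c \<kappa>' k) = 0"
    by (rule relation_coefficients[where g = g0 and c = c and K = KK and \<mu> = \<kappa> and E = "{..<n}",
          OF indep_bas_epT A(1,2) finite_KK g finite_lessThan KK(2) A(3) k])
  have "\<kappa>' = \<kappa>" if "\<kappa>' \<in> A" "\<forall>i\<in>{..<n}. \<kappa>' i = \<kappa> i" for \<kappa>'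
    using Ix_eq[OF subsetD[OF A(2) that(1)] subsetD[OF A(2) \<kappa>]] that(2) by simp
  then have "{\<kappa>'\<in>A. \<forall>i\<in>{..<n}. \<kappa>' i = \<kappa> i} = {\<kappa>}"
    using \<kappa> by (intro equalityI subsetI) auto
  with s have "(\<Sum>\<kappa>'\<in>{\<kappa>}. c \<kappa>' k) = 0" by (simp only:)
  then show "c \<kappa> k = 0" by simp
  qed
qed

end

section \<open>Independence modulo the parameters at a = 0\<close>

context rs
begin

text \<open>Values of the parameters: the first n - 1 vanish, while the last one, to be made
  invertible, is 1.\<close>

definition tau :: "nat \<Rightarrow> complex" where "tau i = (if i = n - 1 then 1 else 0)"

definition GG :: "(pt \<Rightarrow> complex) set" where "GG = (\<lambda>i. theta0 i - cst (tau i)) ` {..<n}"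

definition zz :: "nat \<Rightarrow> pt \<Rightarrow> complex" where "zz j = poly (Dp (s + 1)) (Zv j)"

text \<open>An element of the conductor of \<open>Tp\<close> in \<open>S\<close> which is invertible modulo \<open>GG\<close>.\<close>

definition vv :: "pt \<Rightarrow> complex" where "vv = (\<Prod>j<s. poly chx (zz j))"

lemma poly_subalg: "subalg A \<Longrightarrow> p \<in> polys_over A \<Longrightarrow> f \<in> A \<Longrightarrow> poly p f \<in> A"
  unfolding poly_altdef polys_over_def
  by (intro subalg_sum subalg_mult subalg_power) auto

lemma zz_Az: "j < s \<Longrightarrow> zz j \<in> Az"
  unfolding zz_def by (intro poly_subalg subalg_alg Dp_Az alg_base) auto

lemma dY_Az: "f \<in> Az \<Longrightarrow> dY i f x = 0"
  by (rule dY_const) (auto intro: Az_snd)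

text \<open>\<open>vv\<close> is the product of all \<open>zz j - xi i\<close>. On y_i = z_j the
  factor with these indices vanishes together with its derivative in y_i, and so does that
  derivative of every multiple of \<open>vv\<close>.\<close>

lemma vv_mult_Tp:
  assumes f: "f \<in> S" shows "vv * f \<in> Tp"
  unfolding Tp_def
proof (intro CollectI conjI allI impI)
  have xiS: "xi i \<in> S" if "i < r" for i using xi_Tp[OF that] by (rule Tp_S)
  have zS: "zz j \<in> S" if "j < s" for j using zz_Az[OF that] Az_S by blast
  have fac: "zz j - xi i \<in> S" if "i < r" "j < s" for i j
    using that by (intro subalg_diff[OF subalg_S] xiS zS)
  have vv: "vv = (\<Prod>j<s. \<Prod>i<r. zz j - xi i)" by (simp add: vv_def chx_def poly_chi)
  show "vv * f \<in> S" unfolding vv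
    by (intro subalg_mult[OF subalg_S] subalg_prod[OF subalg_S] fac f) auto
  fix i j and x :: pt assume ij: "i < r" "j < s" "fst x i = snd x j"
  let ?w = "zz j - xi i"
  define u where "u = (\<Prod>i'\<in>{..<r} - {i}. zz j - xi i') * (\<Prod>j'\<in>{..<s} - {j}. \<Prod>i<r. zz j' - xi i) * f"
  have "vv = (\<Prod>i<r. zz j - xi i) * (\<Prod>j'\<in>{..<s} - {j}. \<Prod>i<r. zz j' - xi i)"
    unfolding vv using ij by (intro prod.remove) auto
  also have "(\<Prod>i<r. zz j - xi i) = ?w * (\<Prod>i'\<in>{..<r} - {i}. zz j - xi i')"
    using ij by (intro prod.remove) auto
  finally have eq: "vv * f = ?w * u" by (simp add: u_def mult.assoc)
  have uS: "u \<in> S" unfolding u_def using ij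
    by (intro subalg_mult[OF subalg_S] subalg_prod[OF subalg_S] fac f) auto
  have w0: "?w x = 0"
    using ij by (simp add: fapp zz_def xi_def poly_pat Yv_def Zv_def)
  have "poly (pderiv (pat x (Dp (s + 1)))) (snd x j) = 0"
    using flat_Dp[of "s + 1"] ij(2) unfolding flat_def by (metis less_add_one)
  then have "dY i (xi i) x = 0" unfolding xi_def using ij(3) by (simp add: dY_poly_Yv[OF Dp_Az])
  moreover have "?w = zz j + cst (-1) * xi i" by (simp add: cst_neg1)
  ultimately have "dY i ?w x = 0"
    using dY_add[OF zS[OF ij(2)] subalg_mult[OF subalg_S S_cst xiS[OF ij(1)]], of i "-1" x]
      dY_Az[OF zz_Az[OF ij(2)], of i x] dY_cst_mult[OF xiS[OF ij(1)], of i "-1" x]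
    by (simp only: mult_zero_right add_0_right)
  then show "dY i (vv * f) x = 0" unfolding eq using dY_mult[OF fac[OF ij(1,2)] uS] w0 by simp
qed

text \<open>The lower coefficients of \<open>Dp (s + 1)\<close> are 0 or multiples of parameters in
  z, and the leading power of z_j is rewritten by the equation of z_j, whose lower coefficients are
  such parameters too.\<close>

lemma zz_ideal: "j < s \<Longrightarrow> zz j \<in> mspan Tp (theta0 ` {..<s})"
proof -
  assume j: "j < s"
  let ?I = "mspan Tp (theta0 ` {..<s})"
  have Z: "Zv j \<in> Tp" using j Az_Tp by (auto intro: alg_base)
  have c: "a * coeff chz k \<in> ?I" if "a \<in> Tp" "k < s" for a k
    using that by (auto simp: coeff_chz_theta0 intro!: mspan_base)
  have "zz j = (\<Sum>m\<le>s + 1. coeff (Dp (s + 1)) m * Zv j ^ m)"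
    unfolding zz_def by (rule poly_as_sum) (use monicd_Dp[of "s + 1"] in \<open>auto simp: monicd_def\<close>)
  also have "\<dots> = (\<Sum>m\<le>s. coeff (Dp (s + 1)) m * Zv j ^ m) + Zv j * Zv j ^ s"
    using monicd_Dp[of "s + 1"] by (simp add: monicd_def)
  also have "Zv j * Zv j ^ s = - (\<Sum>k<s. (Zv j * Zv j ^ k) * coeff chz k)"
    unfolding chi_root[OF j, of Zv, folded chz_def] by (simp add: sum_distrib_left mult_ac)
  also have "(\<Sum>m\<le>s. coeff (Dp (s + 1)) m * Zv j ^ m) + - (\<Sum>k<s. (Zv j * Zv j ^ k) * coeff chz k) \<in> ?I"
  proof (intro mspan_add mspan_sum fv.subspace_neg[OF mspan_subspace])
    fix m assume m: "m \<in> {..s}"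
    show "coeff (Dp (s + 1)) m * Zv j ^ m \<in> ?I"
    proof (cases "m = 0")
      case True
      then have "coeff (Dp (s + 1)) m = 0" using coeff_Dp[of "s + 1" m] by simp
      then show ?thesis by (simp add: fv.subspace_0[OF mspan_subspace])
    next
      case False
      then have "coeff (Dp (s + 1)) m = cst (of_nat (s + 1) / of_nat m) * coeff chz (m - 1)"
        using coeff_Dp[of "s + 1" m] m by auto
      then have "coeff (Dp (s + 1)) m * Zv j ^ m = (cst (of_nat (s + 1) / of_nat m) * Zv j ^ m) * coeff chz (m - 1)"
        by (simp only: mult_ac)
      also have "\<dots> \<in> ?I" using m False
        by (intro c subalg_mult[OF subalg_Tp] subalg_cst[OF subalg_Tp] subalg_power[OF subalg_Tp] Z) auto
      finally show ?thesis .
    qed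
  next
    fix k assume "k \<in> {..<s}"
    then show "Zv j * Zv j ^ k * coeff chz k \<in> ?I"
      by (intro c subalg_mult[OF subalg_Tp] subalg_power[OF subalg_Tp] Z) auto
  qed
  finally show ?thesis .
qed

text \<open>Modulo the parameters in z the argument \<open>zz j\<close> is 0, so only the constant
  term of \<open>chx\<close> survives, which is the last parameter.\<close>

lemma chx_zz_ideal: "j < s \<Longrightarrow> poly chx (zz j) - theta0 (n - 1) \<in> mspan Tp (theta0 ` {..<s})"
proof -
  assume j: "j < s"
  let ?I = "mspan Tp (theta0 ` {..<s})"
  have z: "zz j \<in> Tp" using zz_Az[OF j] Az_Tp by blast
  have c: "coeff chx k \<in> Tp" for k
    by (auto simp: coeff_chx_theta0 intro: theta0_Tp subalg_0[OF subalg_Tp] subalg_1[OF subalg_Tp])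
  have "poly chx (zz j) = (\<Sum>k\<le>r. coeff chx k * zz j ^ k)"
    by (rule poly_as_sum) (simp add: chx_def coeff_chi_gt)
  also have "\<dots> = coeff chx 0 + (\<Sum>k\<in>{1..r}. coeff chx k * zz j ^ k)"
    by (simp add: sum.atMost_shift sum.atLeast1_atMost_eq)
  also have "coeff chx 0 = theta0 (n - 1)" using r_pos by (simp add: coeff_chx_theta0 n_def add.commute)
  finally have "poly chx (zz j) - theta0 (n - 1) = (\<Sum>k\<in>{1..r}. coeff chx k * zz j ^ k)" by simp
  also have "\<dots> \<in> ?I"
  proof (rule mspan_sum)
    fix k assume "k \<in> {1..r}"
    then have "coeff chx k * zz j ^ k = (coeff chx k * zz j ^ (k - 1)) * zz j"
      by (cases k) (auto simp: mult_ac)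
    also have "\<dots> \<in> ?I"
      by (intro mspan_mult[OF subalg_Tp] zz_ideal j subalg_mult[OF subalg_Tp] subalg_power[OF subalg_Tp] c z)
    finally show "coeff chx k * zz j ^ k \<in> ?I" .
  qed
  finally show ?thesis .
qed

lemma vv_ideal: "vv - theta0 (n - 1) ^ s \<in> mspan Tp (theta0 ` {..<s})"
proof -
  let ?I = "mspan Tp (theta0 ` {..<s})" and ?t = "theta0 (n - 1)"
  have p: "poly chx (zz j) \<in> Tp" if "j < s" for j
  proof -
    have "coeff chx k \<in> Tp" for k
      by (auto simp: coeff_chx_theta0 intro: theta0_Tp subalg_0[OF subalg_Tp] subalg_1[OF subalg_Tp])
    then show ?thesis using zz_Az[OF that] Az_Tp by (intro poly_subalg subalg_Tp) (auto simp: polys_over_def)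
  qed
  have "(\<Prod>j<k. poly chx (zz j)) - ?t ^ k \<in> ?I" if "k \<le> s" for k
    using that
  proof (induction k)
    case 0
    then show ?case by (simp add: fv.subspace_0[OF mspan_subspace])
  next
    case (Suc k)
    let ?p = "poly chx (zz k)" and ?P = "\<Prod>j<k. poly chx (zz j)"
    have "?P * ?p - ?t ^ Suc k = ?p * (?P - ?t ^ k) + ?t ^ k * (?p - ?t)"
      by (simp add: algebra_simps)
    also have "\<dots> \<in> ?I" using Suc
      by (intro mspan_add mspan_mult[OF subalg_Tp] p chx_zz_ideal subalg_power[OF subalg_Tp] theta0_Tp) auto
    finally show ?case by simp
  qed
  then show ?thesis by (simp add: vv_def)
qed

lemma theta0_GG: "i < n - 1 \<Longrightarrow> theta0 i \<in> GG"
  unfolding GG_def by (rule image_eqI[of _ _ i]) (auto simp: tau_def)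

lemma theta0_last_GG: "theta0 (n - 1) - 1 \<in> GG"
  unfolding GG_def using n_pos by (intro image_eqI[of _ _ "n - 1"]) (auto simp: tau_def)

lemma power_minus_1_mspan:
  assumes "subalg A" "t \<in> A" "t - 1 \<in> M" shows "t ^ k - 1 \<in> mspan A M"
proof (induction k)
  case 0
  then show ?case by (simp add: fv.subspace_0[OF mspan_subspace])
next
  case (Suc k)
  have "1 * (t - 1) \<in> mspan A M" using assms by (intro mspan_base subalg_1)
  then have "t * (t ^ k - 1) + (t - 1) \<in> mspan A M" using Suc assms by (intro mspan_add mspan_mult) auto
  then show ?case by (simp add: algebra_simps)
qed

text \<open>Multiplication by the conductor element \<open>vv\<close> carries the ideal of
  \<open>S\<close> into that of \<open>Tp\<close>. Modulo \<open>GG\<close>, \<open>vv\<close> is a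
  power of the last parameter and hence 1, so this multiplication can be undone.\<close>

lemma Tp_GG:
  assumes f: "f \<in> Tp" "f \<in> mspan S GG" shows "f \<in> mspan Tp GG"
proof -
  let ?J = "mspan Tp GG"
  have "mspan S GG \<subseteq> {f. f * vv \<in> ?J}"
  proof (intro mspan_minimal subspace_mult_preimage mspan_subspace)
    fix a m assume "a \<in> S" "m \<in> GG"
    then have "(vv * a) * m \<in> ?J" by (intro mspan_base vv_mult_Tp)
    then show "a * m \<in> {f. f * vv \<in> ?J}" by (simp add: mult_ac)
  qed
  then have 1: "vv * f \<in> ?J" using f(2) by (auto simp: mult.commute)
  have "theta0 i \<in> GG" if "i < s" for i
    using that r_pos by (intro theta0_GG) (auto simp: n_def)
  then have "mspan Tp (theta0 ` {..<s}) \<subseteq> ?J" by (intro mspan_mono) auto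
  then have 2: "f * (vv - theta0 (n - 1) ^ s) \<in> ?J"
    using vv_ideal by (intro mspan_mult[OF subalg_Tp f(1)]) auto
  have 3: "f * (theta0 (n - 1) ^ s - 1) \<in> ?J"
    by (intro mspan_mult[OF subalg_Tp f(1)] power_minus_1_mspan subalg_Tp theta0_Tp theta0_last_GG)
  have "f = vv * f - (f * (vv - theta0 (n - 1) ^ s) + f * (theta0 (n - 1) ^ s - 1))"
    by (simp add: algebra_simps)
  also have "\<dots> \<in> ?J" using 1 2 3
    by (intro fv.subspace_diff[OF mspan_subspace] mspan_add)
  finally show ?thesis .
qed

lemma indep_bas_epS_0: "indep Ix (bas theta0 epS)"
proof (rule indep_bas_epS[OF theta0_Sd])
  fix d
  show "Sd d \<subseteq> fv.span (bas theta0 epS ` {m \<in> Ix. (\<Sum>i<n. m i) = d})"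
  proof
    fix f assume f: "f \<in> Sd d"
    then have "f \<in> fv.span (bas theta0 epS ` Ix)" using Sd_S S_bas by blast
    from homogeneous_in_span[OF f this bas_epS_Sd[OF theta0_Sd]]
    show "f \<in> fv.span (bas theta0 epS ` {m \<in> Ix. (\<Sum>i<n. m i) = d})" by blast
  qed
qed

abbreviation phiS :: "(nat \<Rightarrow> pt \<Rightarrow> complex) \<Rightarrow> (pt \<Rightarrow> complex) \<Rightarrow> pt \<Rightarrow> complex" where
  "phiS th \<equiv> Phi th epS {..<n - 1} (\<lambda>_. 0)"

text \<open>Modulo \<open>GG\<close> the first n - 1 parameters become 0 and the last becomes 1,
  which is what \<open>phiS\<close> does to every basis element.\<close>

lemma phiS_mod_GG: "f \<in> S \<Longrightarrow> f - phiS theta0 f \<in> mspan S GG"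
proof -
  let ?J = "mspan S GG"
  note P = Phi_props[OF indep_bas_epS_0]
  have bS: "bas theta0 epS m \<in> S" for m using bas_epS_Sd[OF theta0_Sd] Sd_S by blast
  have base: "bas theta0 epS m - phiS theta0 (bas theta0 epS m) \<in> ?J" if m: "m \<in> Ix" for m
  proof (cases "\<forall>i\<in>{..<n - 1}. kap m i = 0")
    case True
    have "thp theta0 (kap m) = (\<Prod>i\<in>{n - 1}. theta0 i ^ kap m i)"
      unfolding thp_def using True n_pos by (intro prod.mono_neutral_right) auto
    then have "bas theta0 epS m = theta0 (n - 1) ^ kap m (n - 1) * bas theta0 epS (red m)"
      using bas_red[of theta0 epS m] by simp
    then have "bas theta0 epS m - phiS theta0 (bas theta0 epS m) = bas theta0 epS (red m) * (theta0 (n - 1) ^ kap m (n - 1) - 1)"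
      unfolding P(3)[OF m] using True by (simp add: algebra_simps)
    also have "\<dots> \<in> ?J"
      using theta0_Tp Tp_S by (intro mspan_mult[OF subalg_S] bS power_minus_1_mspan subalg_S theta0_last_GG) blast
    finally show ?thesis .
  next
    case False
    then obtain i where i: "i < n - 1" "kap m i \<noteq> 0" by blast
    define m' where "m' = m(i := m i - dd i)"
    have "dd i \<le> m i" using i(2) dd_pos[of i] unfolding kap_def by (metis div_less not_less)
    then have "m = m'(i := m' i + dd i)" by (auto simp: m'_def)
    then have "bas theta0 epS m = theta0 i * bas theta0 epS m'"
      using bas_shift[of i theta0 epS m'] i(1) by simp
    moreover have "bas theta0 epS m' * theta0 i \<in> ?J" by (intro mspan_base bS theta0_GG i)
    ultimately show ?thesis unfolding P(3)[OF m] if_not_P[OF False] by (simp add: mult.commute)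
  qed
  assume "f \<in> S"
  then have "f \<in> fv.span (bas theta0 epS ` Ix)" using S_bas by blast
  then show ?thesis
  proof (induction rule: fv.span_induct_alt)
    case base
    then show ?case using Phi_0[OF indep_bas_epS_0] by (simp add: fv.subspace_0[OF mspan_subspace])
  next
    case (step c x y)
    then have "cst c * (x - phiS theta0 x) + (y - phiS theta0 y) \<in> ?J"
      using base by (intro mspan_add fv.subspace_scale[OF mspan_subspace]) auto
    moreover have "phiS theta0 (cst c * x + y) = cst c * phiS theta0 x + phiS theta0 y" by (simp only: P(1,2))
    ultimately show ?case by (simp only:) (simp add: algebra_simps)
  qed
qed

text \<open>A relation puts a combination \<open>f\<close> of the \<open>g0 k\<close> into the ideal
  generated by \<open>GG\<close> in \<open>S\<close>, then in \<open>Tp\<close> by the conductor,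
  then in the invariants by averaging. There the \<open>g0 k\<close> are free over the parameters,
  so specializing the parameters forces \<open>f\<close> to vanish.\<close>

lemma indep_g0_phiS: "indep KK (\<lambda>k. phiS theta0 (g0 k))"
  unfolding indep_finite_iff[OF finite_KK]
proof (intro allI impI)
  fix c assume z: "(\<Sum>k\<in>KK. cst (c k) * phiS theta0 (g0 k)) = 0"
  define f where "f = (\<Sum>k\<in>KK. cst (c k) * g0 k)"
  have fT: "f \<in> Tp" unfolding f_def
    by (intro subalg_sum[OF subalg_Tp] subalg_mult[OF subalg_Tp] subalg_cst[OF subalg_Tp] g0_Tp)
  have fSym: "f \<in> Sym" unfolding f_def
    by (intro subalg_sum[OF subalg_Sym] subalg_mult[OF subalg_Sym] subalg_cst[OF subalg_Sym] g0_Sym)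
  have "phiS theta0 f = 0" using z unfolding f_def Phi_sum[OF indep_bas_epS_0] .
  then have "f \<in> mspan S GG" using phiS_mod_GG[OF Tp_S[OF fT]] by simp
  then have fJ: "f \<in> mspan Tp GG" by (rule Tp_GG[OF fT])
  have GGSym: "GG \<subseteq> Sym"
    unfolding GG_def by (auto intro!: subalg_diff[OF subalg_Sym] theta0_Sym subalg_cst[OF subalg_Sym])
  have "mspan Tp GG \<subseteq> {f. rho f \<in> mspan Vg GG}"
  proof (rule mspan_minimal)
    have rho0: "rho 0 = 0" using rho_cst_mult[of 0 0] by simp
    show "fv.subspace {f. rho f \<in> mspan Vg GG}"
      unfolding fv.subspace_def
      by (auto simp: rho_add rho_cst_mult rho0 intro: mspan_add fv.subspace_0[OF mspan_subspace] fv.subspace_scale[OF mspan_subspace])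
    fix a m assume am: "a \<in> Tp" "m \<in> GG"
    have "rho (m * a) = m * rho a" using am(2) GGSym by (intro rho_mult) auto
    moreover have "rho a * m \<in> mspan Vg GG" using am by (intro mspan_base rho_Tp_Vg)
    ultimately show "a * m \<in> {f. rho f \<in> mspan Vg GG}" by (simp add: mult.commute)
  qed
  then have fV: "f \<in> mspan Vg GG" using fJ rho_Sym[OF fSym] by auto
  \<comment> \<open>Specialization of the parameters at \<open>tau\<close>, written on the free
    basis: it kills all multiples of \<open>GG\<close> and fixes each \<open>g0 k\<close>.\<close>
  let ?h = "\<lambda>(\<kappa> :: nat \<Rightarrow> nat, k). if \<forall>i<n - 1. \<kappa> i = 0 then g0 k else 0"
  obtain \<psi> :: "(pt \<Rightarrow> complex) \<Rightarrow> pt \<Rightarrow> complex" where \<psi>: "\<And>f g. \<psi> (f + g) = \<psi> f + \<psi> g" "\<And>c f. \<psi> (cst c * f) = cst c * \<psi> f"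
    "\<And>p. p \<in> Ix \<times> KK \<Longrightarrow> \<psi> ((\<lambda>(\<kappa>, k). thp theta0 \<kappa> * g0 k) p) = ?h p"
    using linear_extension[OF indep_Vg, of ?h] by blast
  have \<psi>0: "\<psi> 0 = 0" using \<psi>(2)[of 0 0] by simp
  have \<psi>g: "\<psi> (thp theta0 \<kappa> * g0 k) = (if \<forall>i<n - 1. \<kappa> i = 0 then g0 k else 0)" if "\<kappa> \<in> Ix" "k \<in> KK" for \<kappa> k
    using \<psi>(3)[of "(\<kappa>, k)"] that by simp
  have sub\<psi>: "fv.subspace {f. \<psi> (f * u) = 0}" for u
    unfolding fv.subspace_def by (auto simp: distrib_right mult.assoc \<psi>(1,2) \<psi>0)
  have "mspan Vg GG \<subseteq> {f. \<psi> (f * 1) = 0}"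
  proof (rule mspan_minimal[OF sub\<psi>])
    fix a u assume a: "a \<in> Vg" and "u \<in> GG"
    then obtain i where i: "i < n" "u = theta0 i - cst (tau i)" by (auto simp: GG_def)
    have "Vg \<subseteq> {f. \<psi> (f * u) = 0}"
      unfolding Vg_def
    proof (intro fv.span_minimal sub\<psi> image_subsetI)
      fix p assume "p \<in> Ix \<times> KK"
      then obtain \<kappa> k where p: "p = (\<kappa>, k)" "\<kappa> \<in> Ix" "k \<in> KK" by blast
      define \<mu> where "\<mu> j = (if j = i then 1 else 0 :: nat)" for j
      have "theta0 i = thp theta0 \<mu>"
      proof -
        have "thp theta0 \<mu> = (\<Prod>j<n. if j = i then theta0 i else 1)"
          unfolding thp_def by (intro prod.cong) (auto simp: \<mu>_def)
        then show ?thesis using i(1) by (simp add: prod.delta)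
      qed
      then have "thp theta0 \<kappa> * g0 k * u = thp theta0 (\<lambda>j. \<kappa> j + \<mu> j) * g0 k + cst (- tau i) * (thp theta0 \<kappa> * g0 k)"
        unfolding i(2) thp_add[symmetric] by (simp add: cst_uminus algebra_simps)
      then have "\<psi> (thp theta0 \<kappa> * g0 k * u) = \<psi> (thp theta0 (\<lambda>j. \<kappa> j + \<mu> j) * g0 k) + cst (- tau i) * \<psi> (thp theta0 \<kappa> * g0 k)"
        by (simp only: \<psi>(1,2))
      moreover have "(\<lambda>j. \<kappa> j + \<mu> j) \<in> Ix" using p(2) i(1) by (auto simp: Ix_def \<mu>_def)
      ultimately have eq: "\<psi> (thp theta0 \<kappa> * g0 k * u) = (if \<forall>j<n - 1. \<kappa> j + \<mu> j = 0 then g0 k else 0)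
          + cst (- tau i) * (if \<forall>j<n - 1. \<kappa> j = 0 then g0 k else 0)"
        using p by (simp only: \<psi>g)
      have "\<psi> (thp theta0 \<kappa> * g0 k * u) = 0"
      proof (cases "i = n - 1")
        case True
        then have "\<mu> j = 0" if "j < n - 1" for j using that by (simp add: \<mu>_def)
        then show ?thesis unfolding eq using True by (simp add: tau_def cst_uminus)
      next
        case False
        then have "i < n - 1" "\<mu> i = 1" using i(1) by (auto simp: \<mu>_def)
        then have "\<not> (\<forall>j<n - 1. \<kappa> j + \<mu> j = 0)" by force
        then show ?thesis unfolding eq if_not_P[OF \<open>\<not> (\<forall>j<n - 1. \<kappa> j + \<mu> j = 0)\<close>] using False by (simp add: tau_def)
      qed
      then show "(case p of (\<kappa>, k) \<Rightarrow> thp theta0 \<kappa> * g0 k) \<in> {f. \<psi> (f * u) = 0}" by (simp add: p)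
    qed
    then show "a * u \<in> {f. \<psi> (f * 1) = 0}" using a by auto
  qed
  then have "\<psi> f = 0" using fV by auto
  moreover have "\<psi> f = (\<Sum>k\<in>KK. cst (c k) * g0 k)"
  proof -
    have "\<psi> (g0 k) = g0 k" if "k \<in> KK" for k
      using \<psi>g[of "\<lambda>_. 0" k] that by (simp add: thp_0 Ix_def)
    then show ?thesis unfolding f_def linear_map_sum[of \<psi>, OF \<psi>(1,2)] by (intro sum.cong) auto
  qed
  ultimately have f0: "(\<Sum>k\<in>KK. cst (c k) * g0 k) = 0" by simp
  have "indep KK g0"
  proof -
    have inj: "inj_on (\<lambda>k. (\<lambda>_. 0 :: nat, k)) KK" by (auto intro: inj_onI)
    have "indep ((\<lambda>k. (\<lambda>_. 0 :: nat, k)) ` KK) (\<lambda>(\<kappa>, k). thp theta0 \<kappa> * g0 k)"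
      by (rule indep_subset[OF indep_Vg]) (auto simp: Ix_def)
    then have "indep KK ((\<lambda>(\<kappa>, k). thp theta0 \<kappa> * g0 k) \<circ> (\<lambda>k. (\<lambda>_. 0, k)))"
      unfolding indep_reindex[OF inj] .
    moreover have "(\<lambda>(\<kappa>, k). thp theta0 \<kappa> * g0 k) \<circ> (\<lambda>k. (\<lambda>_. 0, k)) = g0"
      by (rule ext) (simp add: thp_0)
    ultimately show ?thesis by simp
  qed
  from indepD[OF this finite_KK order_refl f0] show "\<forall>k\<in>KK. c k = 0" by blast
qed

end

section \<open>Families in the deformed algebras and their limits\<close>

lemma poly_eq_0_off_0:
  fixes q :: "complex poly"
  assumes "\<And>a. a \<noteq> 0 \<Longrightarrow> poly q a = 0" shows "q = 0"
proof -
  have "infinite (- {0 :: complex})" using infinite_UNIV_char_0 by (simp add: Compl_eq_Diff_UNIV)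
  moreover have "- {0} \<subseteq> {a. poly q a = 0}" using assms by auto
  ultimately have "infinite {a. poly q a = 0}" using finite_subset by blast
  then show ?thesis using poly_roots_finite by blast
qed

text \<open>The permanent of the N by N matrix \<open>\<psi>\<close>. With row i given by the powers
  \<open>Zv j ^ m i\<close>, it is a multiple of the symmetrized monomial.\<close>

definition Pol :: "nat \<Rightarrow> (nat \<Rightarrow> nat \<Rightarrow> 'x \<Rightarrow> complex) \<Rightarrow> 'x \<Rightarrow> complex" where
  "Pol N \<psi> = (\<Sum>\<sigma> | \<sigma> permutes {..<N}. \<Prod>i<N. \<psi> i (\<sigma> i))"

lemma Pol_cong: "(\<And>i j. i < N \<Longrightarrow> j < N \<Longrightarrow> \<psi> i j = \<psi>' i j) \<Longrightarrow> Pol N \<psi> = Pol N \<psi>'"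
proof -
  assume *: "\<And>i j. i < N \<Longrightarrow> j < N \<Longrightarrow> \<psi> i j = \<psi>' i j"
  show ?thesis unfolding Pol_def
  proof (intro sum.cong prod.cong refl)
    fix \<sigma> i assume "\<sigma> \<in> {\<sigma>. \<sigma> permutes {..<N}}" "i \<in> {..<N}"
    then have "i < N" "\<sigma> i < N" using permutes_in_image[of \<sigma> "{..<N}" i] by auto
    then show "\<psi> i (\<sigma> i) = \<psi>' i (\<sigma> i)" by (rule *)
  qed
qed

lemma Pol_permute:
  assumes "\<pi> permutes {..<N}" shows "Pol N (\<lambda>i. \<psi> (\<pi> i)) = Pol N \<psi>"
proof -
  have "Pol N (\<lambda>i. \<psi> (\<pi> i)) = (\<Sum>\<sigma> | \<sigma> permutes {..<N}. \<Prod>i<N. \<psi> (\<pi> i) ((\<sigma> \<circ> \<pi>) i))"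
    unfolding Pol_def by (rule sum_permutations_compose_right[OF assms])
  also have "\<dots> = Pol N \<psi>" unfolding Pol_def
  proof (intro sum.cong refl)
    fix \<sigma>
    have "(\<Prod>i<N. \<psi> i (\<sigma> i)) = (\<Prod>i<N. ((\<lambda>i. \<psi> i (\<sigma> i)) \<circ> \<pi>) i)"
      using prod.permute[OF assms, of "\<lambda>i. \<psi> i (\<sigma> i)"] by simp
    then show "(\<Prod>i<N. \<psi> (\<pi> i) ((\<sigma> \<circ> \<pi>) i)) = (\<Prod>i<N. \<psi> i (\<sigma> i))" by simp
  qed
  finally show ?thesis .
qed

text \<open>For each permutation the sum of the \<open>\<phi> j\<close> is reindexed by it, and the
  term belonging to k is absorbed into the factor with index k.\<close>

lemma Pol_times_sum:
  "Pol N \<psi> * (\<Sum>j<N. \<phi> j) = (\<Sum>k<N. Pol N (\<psi>(k := \<lambda>j. \<psi> k j * \<phi> j)))"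
proof -
  have "(\<Prod>i<N. \<psi> i (\<sigma> i)) * (\<Sum>j<N. \<phi> j) = (\<Sum>k<N. \<Prod>i<N. (\<psi>(k := \<lambda>j. \<psi> k j * \<phi> j)) i (\<sigma> i))"
    if "\<sigma> permutes {..<N}" for \<sigma>
  proof -
    have "(\<Sum>j<N. \<phi> j) = (\<Sum>k<N. \<phi> (\<sigma> k))" using sum.permute[OF that, of \<phi>] by (simp add: o_def)
    then have "(\<Prod>i<N. \<psi> i (\<sigma> i)) * (\<Sum>j<N. \<phi> j) = (\<Sum>k<N. (\<Prod>i<N. \<psi> i (\<sigma> i)) * \<phi> (\<sigma> k))"
      by (simp add: sum_distrib_left)
    also have "\<dots> = (\<Sum>k<N. \<Prod>i<N. (\<psi>(k := \<lambda>j. \<psi> k j * \<phi> j)) i (\<sigma> i))"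
    proof (intro sum.cong refl)
      fix k assume k: "k \<in> {..<N}"
      let ?\<psi> = "\<psi>(k := \<lambda>j. \<psi> k j * \<phi> j)"
      have "(\<Prod>i<N. ?\<psi> i (\<sigma> i)) = ?\<psi> k (\<sigma> k) * (\<Prod>i\<in>{..<N} - {k}. ?\<psi> i (\<sigma> i))"
        using k by (intro prod.remove) auto
      also have "(\<Prod>i\<in>{..<N} - {k}. ?\<psi> i (\<sigma> i)) = (\<Prod>i\<in>{..<N} - {k}. \<psi> i (\<sigma> i))"
        by (intro prod.cong) auto
      also have "?\<psi> k (\<sigma> k) * (\<Prod>i\<in>{..<N} - {k}. \<psi> i (\<sigma> i)) = (\<psi> k (\<sigma> k) * (\<Prod>i\<in>{..<N} - {k}. \<psi> i (\<sigma> i))) * \<phi> (\<sigma> k)"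
        by (simp add: mult_ac)
      also have "\<psi> k (\<sigma> k) * (\<Prod>i\<in>{..<N} - {k}. \<psi> i (\<sigma> i)) = (\<Prod>i<N. \<psi> i (\<sigma> i))"
        using k by (intro prod.remove[symmetric]) auto
      finally show "(\<Prod>i<N. \<psi> i (\<sigma> i)) * \<phi> (\<sigma> k) = (\<Prod>i<N. ?\<psi> i (\<sigma> i))" by simp
    qed
    finally show ?thesis .
  qed
  then have "Pol N \<psi> * (\<Sum>j<N. \<phi> j) = (\<Sum>\<sigma> | \<sigma> permutes {..<N}. \<Sum>k<N. \<Prod>i<N. (\<psi>(k := \<lambda>j. \<psi> k j * \<phi> j)) i (\<sigma> i))"
    unfolding Pol_def sum_distrib_right by (intro sum.cong) auto
  also have "\<dots> = (\<Sum>k<N. Pol N (\<psi>(k := \<lambda>j. \<psi> k j * \<phi> j)))"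
    unfolding Pol_def by (rule sum.swap)
  finally show ?thesis .
qed

text \<open>Polarization: in characteristic zero, the symmetrized products of elements of a class closed under
  multiplication are polynomials in the power sums of that class. All degrees are bounded by \<open>D\<close>.\<close>

lemma polarization:
  fixes T :: "nat \<Rightarrow> ('x \<Rightarrow> complex) set"
  assumes T_sub: "\<And>d. fv.subspace (T d)" and T_1: "1 \<in> T 0"
    and T_mult: "\<And>d e f g. f \<in> T d \<Longrightarrow> g \<in> T e \<Longrightarrow> f * g \<in> T (d + e)"
    and C_mult: "\<And>d e f g. C d f \<Longrightarrow> C e g \<Longrightarrow> C (d + e) (\<lambda>j. f j * g j)"
    and C_1: "C 0 (\<lambda>_. 1)"
    and C_T: "\<And>e f. C e f \<Longrightarrow> e \<le> D \<Longrightarrow> (\<Sum>j<N. f j) \<in> T e"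
    and \<psi>: "\<And>i. i < N \<Longrightarrow> C (e i) (\<psi> i)" and D: "(\<Sum>i<N. e i) \<le> D"
  shows "Pol N \<psi> \<in> T (\<Sum>i<N. e i)"
proof -
  have "Pol N \<psi> \<in> T (\<Sum>i<N. e i)"
    if "m \<le> N" "\<And>i. i < N \<Longrightarrow> C (e i) (\<psi> i)" "(\<Sum>i<N. e i) \<le> D"
      "\<And>i. m \<le> i \<Longrightarrow> i < N \<Longrightarrow> \<psi> i = (\<lambda>_. 1) \<and> e i = 0" for m \<psi> e
    using that
  proof (induction m arbitrary: \<psi> e)
    case 0
    have "Pol N \<psi> = (\<Sum>\<sigma> | \<sigma> permutes {..<N}. 1)"
      unfolding Pol_def using 0 by (intro sum.cong prod.neutral) auto
    also have "\<dots> = cst (of_nat (fact N)) * 1"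
      by (simp add: card_permutations of_nat_fun cst_def)
    finally have "Pol N \<psi> \<in> T 0" using T_1 fv.subspace_scale[OF T_sub] by metis
    moreover have "(\<Sum>i<N. e i) = 0" using 0 by (intro sum.neutral) auto
    ultimately show ?case by simp
  next
    case (Suc m)
    \<comment> \<open>The factor m is taken out and multiplied back as its power sum. The result is
      a sum of permanents in which it has been absorbed by each of the N factors.\<close>
    define \<psi>1 where "\<psi>1 = \<psi>(m := \<lambda>_. 1)"
    define e1 where "e1 = e(m := 0)"
    have m: "m < N" using Suc.prems(1) by simp
    have sum_e: "(\<Sum>i<N. e i) = e m + (\<Sum>i<N. e1 i)"
    proof -
      have "(\<Sum>i<N. e i) = e m + (\<Sum>i\<in>{..<N} - {m}. e i)" using m by (intro sum.remove) auto
      moreover have "(\<Sum>i<N. e1 i) = e1 m + (\<Sum>i\<in>{..<N} - {m}. e1 i)" using m by (intro sum.remove) auto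
      moreover have "(\<Sum>i\<in>{..<N} - {m}. e1 i) = (\<Sum>i\<in>{..<N} - {m}. e i)" by (intro sum.cong) (auto simp: e1_def)
      ultimately show ?thesis by (simp add: e1_def)
    qed
    have C1: "C (e1 i) (\<psi>1 i)" if "i < N" for i
      using Suc.prems(2)[OF that] C_1 by (auto simp: e1_def \<psi>1_def)
    have P1: "Pol N \<psi>1 \<in> T (\<Sum>i<N. e1 i)"
    proof (rule Suc.IH)
      show "m \<le> N" using m by simp
      show "(\<Sum>i<N. e1 i) \<le> D" using Suc.prems(3) sum_e by simp
      show "\<psi>1 i = (\<lambda>_. 1) \<and> e1 i = 0" if "m \<le> i" "i < N" for i
        using Suc.prems(4)[of i] that by (cases "i = m") (auto simp: \<psi>1_def e1_def)
    qed (rule C1)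
    have "e m \<le> D" using Suc.prems(3) sum_e by simp
    then have "(\<Sum>j<N. \<psi> m j) \<in> T (e m)" using C_T Suc.prems(2)[OF m] by blast
    then have prod: "Pol N \<psi>1 * (\<Sum>j<N. \<psi> m j) \<in> T (\<Sum>i<N. e i)"
      using T_mult[OF P1] sum_e by (simp add: add.commute)
    let ?q = "\<lambda>k. Pol N (\<psi>1(k := \<lambda>j. \<psi>1 k j * \<psi> m j))"
    have small: "?q k \<in> T (\<Sum>i<N. e i)" if k: "k < m" for k
    proof -
      have kN: "k < N" using k m by simp
      let ?e = "e1(k := e1 k + e m)"
      have "(\<Sum>i<N. ?e i) = ?e k + (\<Sum>i\<in>{..<N} - {k}. ?e i)" using kN by (intro sum.remove) auto
      moreover have "(\<Sum>i\<in>{..<N} - {k}. ?e i) = (\<Sum>i\<in>{..<N} - {k}. e1 i)" by (intro sum.cong) auto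
      moreover have "(\<Sum>i<N. e1 i) = e1 k + (\<Sum>i\<in>{..<N} - {k}. e1 i)" using kN by (intro sum.remove) auto
      ultimately have se: "(\<Sum>i<N. ?e i) = (\<Sum>i<N. e i)" using sum_e by simp
      have "?q k \<in> T (\<Sum>i<N. ?e i)"
      proof (rule Suc.IH)
        show "m \<le> N" using m by simp
        show "(\<Sum>i<N. ?e i) \<le> D" using se Suc.prems(3) by simp
        fix i assume i: "i < N"
        show "C (?e i) ((\<psi>1(k := \<lambda>j. \<psi>1 k j * \<psi> m j)) i)"
          using C1[OF i] C_mult[OF C1[OF kN] Suc.prems(2)[OF m]] by auto
        show "(\<psi>1(k := \<lambda>j. \<psi>1 k j * \<psi> m j)) i = (\<lambda>_. 1) \<and> ?e i = 0" if "m \<le> i"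
          using Suc.prems(4)[of i] that i k by (cases "i = m") (auto simp: \<psi>1_def e1_def)
      qed
      then show ?thesis by (simp only: se)
    qed
    \<comment> \<open>Absorbed by a trivial factor, it yields a permutation of the rows of
      \<open>\<psi>\<close>. This happens N - m times, whence the division by N - m.\<close>
    have large: "?q k = Pol N \<psi>" if k: "m \<le> k" "k < N" for k
    proof -
      let ?\<pi> = "Transposition.transpose m k"
      have \<pi>: "?\<pi> permutes {..<N}" using m k by (intro permutes_swap_id) auto
      have \<psi>1k: "\<psi>1 k = (\<lambda>_. 1)" using Suc.prems(4)[of k] k by (cases "k = m") (auto simp: \<psi>1_def)
      have "?q k = Pol N (\<lambda>i. \<psi> (?\<pi> i))"
      proof (rule Pol_cong)
        fix i j assume ij: "i < N"
        show "(\<psi>1(k := \<lambda>j. \<psi>1 k j * \<psi> m j)) i j = \<psi> (?\<pi> i) j"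
        proof (cases "i = k")
          case True
          then show ?thesis by (simp add: \<psi>1k)
        next
          case False
          show ?thesis
          proof (cases "i = m")
            case True
            then have "k \<noteq> m" "Suc m \<le> k" using False k by auto
            then have "\<psi> k = (\<lambda>_. 1)" using Suc.prems(4)[of k] k(2) by blast
            then show ?thesis using True False by (simp add: \<psi>1_def)
          qed (use False in \<open>simp add: \<psi>1_def Transposition.transpose_def\<close>)
        qed
      qed
      then show ?thesis using Pol_permute[OF \<pi>, of \<psi>] by simp
    qed
    have "{..<m} \<union> {m..<N} = {..<N}" using m by (intro ivl_disj_un) simp
    moreover have "sum ?q ({..<m} \<union> {m..<N}) = (\<Sum>k<m. ?q k) + (\<Sum>k\<in>{m..<N}. ?q k)"
      by (rule sum.union_disjoint) (simp_all only: finite_lessThan finite_atLeastLessThan ivl_disj_int)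
    ultimately have "(\<Sum>k<N. ?q k) = (\<Sum>k<m. ?q k) + (\<Sum>k\<in>{m..<N}. ?q k)"
      by (simp only:)
    also have "(\<Sum>k\<in>{m..<N}. ?q k) = (\<Sum>k\<in>{m..<N}. Pol N \<psi>)" by (intro sum.cong) (auto simp: large)
    also have "\<dots> = cst (of_nat (N - m)) * Pol N \<psi>" by (simp add: of_nat_fun cst_def)
    finally have "cst (of_nat (N - m)) * Pol N \<psi> = Pol N \<psi>1 * (\<Sum>j<N. \<psi> m j) - (\<Sum>k<m. ?q k)"
      using Pol_times_sum[of N \<psi>1 "\<psi> m"] by (simp only: eq_diff_eq add.commute)
    also have "\<dots> \<in> T (\<Sum>i<N. e i)"
      by (intro fv.subspace_diff[OF T_sub] prod fv.subspace_sum[OF T_sub] small) auto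
    finally have "cst (1 / of_nat (N - m)) * (cst (of_nat (N - m)) * Pol N \<psi>) \<in> T (\<Sum>i<N. e i)"
      by (rule fv.subspace_scale[OF T_sub])
    moreover have "(of_nat (N - m) :: complex) \<noteq> 0" using m by simp
    then have "cst (1 / of_nat (N - m)) * (cst (of_nat (N - m)) * Pol N \<psi>) = Pol N \<psi>"
      by (simp only: mult.assoc[symmetric] cst_mult[symmetric] nonzero_divide_eq_eq times_divide_eq_left mult_1_left divide_self cst_1 not_False_eq_True)
    ultimately show ?case by simp
  qed
  from this[of N e \<psi>] \<psi> D show ?thesis by simp
qed

context rs
begin

section \<open>Families with values in the deformed algebras\<close>

definition pz :: "nat \<Rightarrow> pt \<Rightarrow> complex" where "pz k = (\<Sum>j<s. Zv j ^ k)"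
definition py :: "nat \<Rightarrow> pt \<Rightarrow> complex" where "py k = (\<Sum>j<r. Yv j ^ k)"

lemma pz_Sd: "pz k \<in> Sd k" and py_Sd: "py k \<in> Sd k"
  unfolding pz_def py_def using Sd_power[OF Zv_Sd] Sd_power[OF Yv_Sd] by (auto intro!: Sd_sum)

lemma Q_eq: "Q r s a k = cst a * py k + pz k"
  by (rule ext) (auto simp: Q_def fapp py_def pz_def Yv_def Zv_def)

definition QF :: "nat \<Rightarrow> (pt \<Rightarrow> complex) poly" where "QF k = [:pz k, py k:]"

lemma ev_QF: "ev a (QF k) = Q r s a k"
  unfolding Q_eq QF_def ev_def by (simp add: mult.commute add.commute)

lemma Lam_alg: "Lam r s a = alg (Q r s a ` {1..})"
proof
  show "Lam r s a \<subseteq> alg (Q r s a ` {1..})"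
  proof
    fix f assume "f \<in> Lam r s a"
    then show "f \<in> alg (Q r s a ` {1..})"
    proof induction
      case (Lam_const c)
      show ?case using alg_cst[of c] by (simp add: cst_def)
    next
      case (Lam_gen i)
      then show ?case by (intro alg_base) auto
    next
      case (Lam_add f g)
      then show ?case using alg_add[of f _ g] by (simp add: plus_fun_def)
    next
      case (Lam_mult f g)
      then show ?case using alg_mult[of f _ g] by (simp add: times_fun_def)
    qed
  qed
  have "subalg (Lam r s a)"
    unfolding subalg_def
    using Lam_const[of _ r s a] Lam_add[of _ r s a] Lam_mult[of _ r s a]
    by (simp add: cst_def plus_fun_def times_fun_def)
  then show "alg (Q r s a ` {1..}) \<subseteq> Lam r s a"
    by (rule alg_least) (auto intro: Lam_gen)
qed

lemma subalg_Lam [simp]: "subalg (Lam r s a)"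
  by (simp add: Lam_alg)

lemma Q_Lam: "1 \<le> k \<Longrightarrow> Q r s a k \<in> Lam r s a"
  by (rule Lam_gen)

text \<open>The value at a = 0 is left unconstrained so that families may be divided by a; the
  limits then reach beyond the algebra at a = 0, which is generated by the power sums of the z
  alone.\<close>

definition LF :: "nat \<Rightarrow> (pt \<Rightarrow> complex) poly set" where
  "LF d = {p. (\<forall>k. coeff p k \<in> Sd d) \<and> (\<forall>a. a \<noteq> 0 \<longrightarrow> ev a p \<in> Lam r s a)}"

lemma LF_0: "0 \<in> LF d"
  by (auto simp: LF_def Sd_0 intro: subalg_0[OF subalg_Lam])

lemma LF_add: "p \<in> LF d \<Longrightarrow> q \<in> LF d \<Longrightarrow> p + q \<in> LF d"
  by (auto simp: LF_def ev_add intro: Sd_add subalg_add[OF subalg_Lam])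

lemma LF_mult: "p \<in> LF d \<Longrightarrow> q \<in> LF e \<Longrightarrow> p * q \<in> LF (d + e)"
  by (auto simp: LF_def ev_mult coeff_mult intro!: Sd_sum Sd_mult subalg_mult[OF subalg_Lam])

lemma LF_pc: "p \<in> LF d \<Longrightarrow> pc c * p \<in> LF d"
  by (auto simp: LF_def ev_mult ev_pc coeff_mult coeff_pc intro!: Sd_sum Sd_cst_mult subalg_mult[OF subalg_Lam] subalg_cst[OF subalg_Lam])

lemma LF_1: "1 \<in> LF 0"
  by (auto simp: LF_def coeff_1 Sd_one Sd_0 intro: subalg_1[OF subalg_Lam])

lemma LF_diff: "p \<in> LF d \<Longrightarrow> q \<in> LF d \<Longrightarrow> p - q \<in> LF d"
  by (auto simp: LF_def ev_diff intro: Sd_diff subalg_diff[OF subalg_Lam])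

lemma LF_shift: "pCons 0 p \<in> LF d \<Longrightarrow> p \<in> LF d"
proof -
  assume p: "pCons 0 p \<in> LF d"
  have "coeff p k \<in> Sd d" for k
  proof -
    have "coeff (pCons 0 p) (Suc k) \<in> Sd d" using p unfolding LF_def by blast
    then show ?thesis by simp
  qed
  moreover have "ev a p \<in> Lam r s a" if "a \<noteq> 0" for a
  proof -
    have "ev a (pCons 0 p) \<in> Lam r s a" using p that unfolding LF_def by blast
    then have "cst a * ev a p \<in> Lam r s a" by (simp add: ev_pCons)
    then have "cst (1 / a) * (cst a * ev a p) \<in> Lam r s a"
      by (rule subalg_mult[OF subalg_Lam subalg_cst[OF subalg_Lam]])
    moreover have "cst (1 / a) * (cst a * ev a p) = ev a p"
      using that by (simp add: mult.assoc[symmetric] cst_mult[symmetric])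
    ultimately show ?thesis by (simp only:)
  qed
  ultimately show ?thesis by (simp add: LF_def)
qed

lemma QF_LF: "1 \<le> k \<Longrightarrow> QF k \<in> LF k"
  unfolding LF_def mem_Collect_eq ev_QF
  by (auto simp: QF_def coeff_pCons pz_Sd py_Sd Sd_0 Q_Lam split: nat.split)

definition Ll :: "nat \<Rightarrow> (pt \<Rightarrow> complex) set" where "Ll d = (\<lambda>p. coeff p 0) ` LF d"

lemma LlI: "p \<in> LF d \<Longrightarrow> coeff p 0 \<in> Ll d"
  by (simp add: Ll_def)

lemma Ll_subspace: "fv.subspace (Ll d)"
  unfolding fv.subspace_def
proof (intro conjI ballI allI)
  show "0 \<in> Ll d" using LlI[OF LF_0] by simp
next
  fix x y assume "x \<in> Ll d" "y \<in> Ll d"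
  then obtain p q where "x = coeff p 0" "y = coeff q 0" "p \<in> LF d" "q \<in> LF d" by (auto simp: Ll_def)
  then show "x + y \<in> Ll d" using LlI[OF LF_add, of p d q] by simp
next
  fix c x assume "x \<in> Ll d"
  then obtain p where "x = coeff p 0" "p \<in> LF d" by (auto simp: Ll_def)
  then show "cst c * x \<in> Ll d" using LlI[OF LF_pc, of p d "[:c:]"] by (simp add: coeff_mult_0 coeff_pc)
qed

lemma Ll_mult: "f \<in> Ll d \<Longrightarrow> g \<in> Ll e \<Longrightarrow> f * g \<in> Ll (d + e)"
proof -
  assume "f \<in> Ll d" "g \<in> Ll e"
  then obtain p q where "f = coeff p 0" "g = coeff q 0" "p \<in> LF d" "q \<in> LF e" by (auto simp: Ll_def)
  then show ?thesis using LlI[OF LF_mult, of p d q e] by (simp add: coeff_mult_0)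
qed

lemma Ll_1: "1 \<in> Ll 0"
  using LlI[OF LF_1] by simp

definition QI :: "complex \<Rightarrow> (pt \<Rightarrow> complex) set" where
  "QI a = {f\<in>S. \<forall>i<r. \<forall>j<s. \<forall>x. fst x i = snd x j \<longrightarrow> dY i f x = a * dZ j f x}"

text \<open>On y_i = z_j both sides of the condition satisfy the product rule, so quasi-invariants
  form an algebra; for \<open>Q r s a k\<close> both sides equal a times k times the power k - 1 of
  the common coordinate.\<close>

lemma Lam_QI: "Lam r s a \<subseteq> QI a" and Lam_Sym: "Lam r s a \<subseteq> Sym" and Lam_S: "Lam r s a \<subseteq> S"
proof -
  have "subalg (QI a)"
    unfolding subalg_def
  proof (intro conjI allI ballI)
    fix c show "cst c \<in> QI a" by (simp add: QI_def S_cst)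
  next
    fix f g assume fg: "f \<in> QI a" "g \<in> QI a"
    then have S: "f \<in> S" "g \<in> S" by (auto simp: QI_def)
    show "f + g \<in> QI a"
      using fg S by (simp add: QI_def subalg_add[OF subalg_S] dY_add dZ_add distrib_left)
    show "f * g \<in> QI a"
      using fg S by (simp add: QI_def subalg_mult[OF subalg_S] dY_mult dZ_mult algebra_simps)
  qed
  moreover have "Q r s a k \<in> QI a" for k
  proof -
    have Yv_apply: "Yv j x = fst x j" and Zv_apply: "Zv j x = snd x j" for j and x :: pt
      by (simp_all add: Yv_def Zv_def)
    have Yk: "Yv j ^ k \<in> S" if "j < r" for j using that by (intro subalg_power[OF subalg_S] Yv_S)
    have Zk: "Zv j ^ k \<in> S" if "j < s" for j using that by (intro subalg_power[OF subalg_S] Zv_S)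
    have S: "py k \<in> S" "pz k \<in> S" using py_Sd pz_Sd Sd_S by blast+
    have dY: "dY i (py k) x = of_nat k * fst x i ^ (k - 1)" if "i < r" for i x
    proof -
      have "dY i (py k) x = (\<Sum>j<r. dY i (Yv j ^ k) x)" unfolding py_def using Yk by (intro dY_sum) auto
      also have "\<dots> = (\<Sum>j<r. if j = i then of_nat k * fst x i ^ (k - 1) else 0)"
        by (intro sum.cong refl) (auto simp: dY_power Yv_S dY_Yv Yv_apply)
      finally have "dY i (py k) x = (\<Sum>j<r. if j = i then of_nat k * fst x i ^ (k - 1) else 0)" .
      then show ?thesis using that by (simp add: sum.delta)
    qed
    have dZ: "dZ i (pz k) x = of_nat k * snd x i ^ (k - 1)" if "i < s" for i x
    proof -
      have "dZ i (pz k) x = (\<Sum>j<s. dZ i (Zv j ^ k) x)" unfolding pz_def using Zk by (intro dZ_sum) auto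
      also have "\<dots> = (\<Sum>j<s. if j = i then of_nat k * snd x i ^ (k - 1) else 0)"
        by (intro sum.cong refl) (auto simp: dZ_power Zv_S dZ_Zv Zv_apply)
      finally have "dZ i (pz k) x = (\<Sum>j<s. if j = i then of_nat k * snd x i ^ (k - 1) else 0)" .
      then show ?thesis using that by (simp add: sum.delta)
    qed
    have d0: "dY i (pz k) x = 0" "dZ j (py k) x = 0" for i j x
      by (simp_all add: dY_def dZ_def py_def pz_def Yv_def Zv_def fapp)
    have cS: "cst a * py k \<in> S" using S by (intro subalg_mult[OF subalg_S] S_cst)
    show ?thesis unfolding QI_def Q_eq using S cS
      by (auto simp: subalg_add[OF subalg_S] dY_add dZ_add dY_cst_mult dZ_cst_mult dY dZ d0)
  qed
  ultimately show "Lam r s a \<subseteq> QI a" unfolding Lam_alg by (intro alg_least) auto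
  then show "Lam r s a \<subseteq> S" by (auto simp: QI_def)
  have "Q r s a k \<in> Sym" for k
    unfolding Sym_def
  proof (intro CollectI allI impI)
    fix \<sigma> \<tau> assume \<sigma>: "\<sigma> permutes {..<r}" and \<tau>: "\<tau> permutes {..<s}"
    have "act \<sigma> \<tau> (py k) = py k" unfolding py_def act_sum act_power act_Yv
      using sum.permute[OF \<sigma>, of "\<lambda>j. Yv j ^ k"] by (simp add: o_def)
    moreover have "act \<sigma> \<tau> (pz k) = pz k" unfolding pz_def act_sum act_power act_Zv
      using sum.permute[OF \<tau>, of "\<lambda>j. Zv j ^ k"] by (simp add: o_def)
    ultimately show "act \<sigma> \<tau> (Q r s a k) = Q r s a k" by (simp add: Q_eq act_add act_mult)
  qed
  then show "Lam r s a \<subseteq> Sym" unfolding Lam_alg by (intro alg_least) auto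
qed

text \<open>At each point the conditions for a \<noteq> 0 are identities between polynomials in a
  with infinitely many zeros, so they persist for the constant terms.\<close>

lemma Ll_limit: assumes "f \<in> Ll d" shows "f \<in> Tp" "f \<in> Sym" "f \<in> Sd d"
proof -
  obtain p where p: "f = coeff p 0" "p \<in> LF d" using assms by (auto simp: Ll_def)
  have cS: "coeff p k \<in> Sd d" for k using p(2) by (simp add: LF_def)
  have cS': "coeff p k \<in> S" for k using cS Sd_S by blast
  have L: "ev a p \<in> Lam r s a" if "a \<noteq> 0" for a using p(2) that by (simp add: LF_def)
  show "f \<in> Sd d" using cS p(1) by simp
  have ev: "ev a p = (\<Sum>k\<le>degree p. cst (a ^ k) * coeff p k)" for a
    by (subst ev_coeff_sum[of "degree p"]) (auto simp: coeff_eq_0 cst_power mult.commute)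
  show "f \<in> Tp" unfolding Tp_def
  proof (intro CollectI conjI allI impI)
    show "f \<in> S" using cS' p(1) by simp
    fix i j and x :: pt assume ij: "i < r" "j < s" "fst x i = snd x j"
    define A where "A = (\<Sum>k\<le>degree p. monom (dY i (coeff p k) x) k)"
    define B where "B = (\<Sum>k\<le>degree p. monom (dZ j (coeff p k) x) k)"
    \<comment> \<open>\<open>pCons 0 B\<close> is a times the derivative in z_j, so it has no
      constant term and the limit condition loses its right-hand side.\<close>
    have "A - pCons 0 B = 0"
    proof (rule poly_eq_0_off_0)
      fix a :: complex assume a: "a \<noteq> 0"
      have "poly A a = (\<Sum>k\<le>degree p. a ^ k * dY i (coeff p k) x)" "poly B a = (\<Sum>k\<le>degree p. a ^ k * dZ j (coeff p k) x)"
        by (simp_all add: A_def B_def poly_sum poly_monom mult.commute)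
      moreover have "dY i (ev a p) x = (\<Sum>k\<le>degree p. a ^ k * dY i (coeff p k) x)"
        "dZ j (ev a p) x = (\<Sum>k\<le>degree p. a ^ k * dZ j (coeff p k) x)"
        unfolding ev using cS'
        by (simp_all add: dY_sum dZ_sum subalg_mult[OF subalg_S] S_cst dY_cst_mult dZ_cst_mult)
      moreover have "dY i (ev a p) x = a * dZ j (ev a p) x"
        using L[OF a] Lam_QI[of a] ij unfolding QI_def by blast
      ultimately show "poly (A - pCons 0 B) a = 0" by simp
    qed
    then have "coeff A 0 = coeff (pCons 0 B) 0" by simp
    moreover have "coeff A 0 = dY i f x" by (simp add: A_def coeff_sum p(1) sum.delta)
    ultimately show "dY i f x = 0" by simp
  qed
  show "f \<in> Sym" unfolding Sym_def
  proof (intro CollectI allI impI)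
    fix \<sigma> \<tau> assume \<sigma>: "\<sigma> permutes {..<r}" and \<tau>: "\<tau> permutes {..<s}"
    show "act \<sigma> \<tau> f = f"
    proof
      fix x :: pt
      let ?x = "(fst x \<circ> \<sigma>, snd x \<circ> \<tau>)"
      have "pat ?x p - pat x p = 0"
      proof (rule poly_eq_0_off_0)
        fix a :: complex assume "a \<noteq> 0"
        then have "act \<sigma> \<tau> (ev a p) = ev a p" using L[of a] Lam_Sym[of a] \<sigma> \<tau> unfolding Sym_def by blast
        from fun_cong[OF this, of x] show "poly (pat ?x p - pat x p) a = 0"
          by (simp add: act_def ev_pat)
      qed
      then have "coeff (pat ?x p) 0 = coeff (pat x p) 0" by simp
      then show "act \<sigma> \<tau> f x = f x" by (simp add: coeff_pat act_def p(1))
    qed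
  qed
qed

subsection \<open>Lifting the invariants at \<open>a = 0\<close>\<close>

definition Bz :: "(pt \<Rightarrow> complex) set" where "Bz = Az \<inter> Sym"

lemma subalg_Bz [simp]: "subalg Bz"
  using subalg_alg[of "Zv ` {..<s}"] subalg_Sym unfolding subalg_def Bz_def by blast

lemma Cz_Bz: "Cz \<subseteq> Bz"
  using Cz_Az Cz_Sym by (auto simp: Bz_def)

lemma Bz_in_graded:
  assumes T_sub: "fv.subspace T" and f: "f \<in> Bz" "f \<in> Sd d"
    and T: "\<And>m. (\<Sum>i<s. m i) = d \<Longrightarrow> Pol s (\<lambda>i j. Zv j ^ m i) \<in> T"
  shows "f \<in> T"
proof -
  let ?M = "\<lambda>m. \<Prod>i<s. Zv i ^ m i"
  have MSd: "?M m \<in> Sd (\<Sum>i<s. m i)" for m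
  proof -
    have "?M m \<in> Sd (\<Sum>i<s. m i * 1)" by (intro Sd_prod Sd_power Zv_Sd) auto
    then show ?thesis by simp
  qed
  have "f \<in> fv.span (range ?M)" using f(1) alg_monomials[of Zv s] by (auto simp: Bz_def)
  then have "f \<in> fv.span (?M ` {m\<in>UNIV. (\<Sum>i<s. m i) = d})" by (intro homogeneous_in_span f(2) MSd)
  then obtain J c where J: "J \<subseteq> {m\<in>UNIV. (\<Sum>i<s. m i) = d}" "f = (\<Sum>m\<in>J. cst (c m) * ?M m)"
    by (rule span_family_explicit) blast
  have rhoM: "rho (?M m) = cst (1 / fact s) * Pol s (\<lambda>i j. Zv j ^ m i)" for m
  proof -
    have "(\<Sum>\<sigma> | \<sigma> permutes {..<r}. \<Sum>\<tau> | \<tau> permutes {..<s}. act \<sigma> \<tau> (?M m)) = cst (of_nat (fact r)) * Pol s (\<lambda>i j. Zv j ^ m i)"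
      unfolding act_prod act_power act_Zv Pol_def[symmetric]
      by (simp add: card_permutations of_nat_fun cst_def Pol_def)
    then show ?thesis unfolding rho_def by (simp add: mult.assoc[symmetric] cst_mult[symmetric])
  qed
  have "f = rho f" using rho_Sym f(1) by (simp add: Bz_def)
  also have "\<dots> = (\<Sum>m\<in>J. cst (c m) * rho (?M m))"
    unfolding J(2) by (rule linear_map_sum[of rho, OF rho_add rho_cst_mult])
  also have "\<dots> \<in> T"
    unfolding rhoM using J(1) T by (intro fv.subspace_sum[OF T_sub] fv.subspace_scale[OF T_sub]) auto
  finally show ?thesis .
qed

text \<open>Families in the algebra generated by \<open>QF 1, \<dots>, QF s\<close>, of which only the expansion up to first
  order in \<open>a\<close> matters.\<close>

definition PP :: "nat \<Rightarrow> (pt \<Rightarrow> complex) poly set" where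
  "PP d = {p\<in>LF d. coeff p 0 \<in> Bz \<and> (\<exists>c. (\<forall>m. c m \<in> Bz \<and> (m \<le> d \<longrightarrow> c m \<in> Sd (d - m)) \<and> (m > d \<longrightarrow> c m = 0)) \<and>
     coeff p 1 = (\<Sum>m\<in>{1..s}. c m * py m))}"

definition T1 :: "nat \<Rightarrow> (pt \<Rightarrow> complex) set" where "T1 d = (\<lambda>p. coeff p 0) ` PP d"

lemma pz_Bz: "pz k \<in> Bz"
proof -
  have "pz k \<in> Az" unfolding pz_def by (intro subalg_sum[OF subalg_alg] subalg_power[OF subalg_alg] alg_base) auto
  moreover have "pz k \<in> Sym" unfolding Sym_def
  proof (intro CollectI allI impI)
    fix \<sigma> \<tau> assume \<tau>: "\<tau> permutes {..<s}"
    show "act \<sigma> \<tau> (pz k) = pz k" unfolding pz_def act_sum act_power act_Zv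
      using sum.permute[OF \<tau>, of "\<lambda>j. Zv j ^ k"] by (simp add: o_def)
  qed
  ultimately show ?thesis by (simp add: Bz_def)
qed

lemma QF_PP: assumes "1 \<le> k" "k \<le> s" shows "QF k \<in> PP k"
  unfolding PP_def
proof (intro CollectI conjI exI[of _ "\<lambda>m. if m = k then 1 else 0"] allI)
  show "QF k \<in> LF k" using assms by (intro QF_LF)
  show "coeff (QF k) 0 \<in> Bz" by (simp add: QF_def pz_Bz)
  show "coeff (QF k) 1 = (\<Sum>m\<in>{1..s}. (if m = k then 1 else 0) * py m)"
    using assms by (simp add: QF_def if_distrib[of "\<lambda>f. f * _"] sum.delta cong: if_cong)
qed (auto simp: subalg_0[OF subalg_Bz] subalg_1[OF subalg_Bz] Sd_one Sd_0)

lemma PP_add: assumes "p \<in> PP d" "q \<in> PP d" shows "p + q \<in> PP d"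
proof -
  obtain c where c: "p \<in> LF d" "coeff p 0 \<in> Bz" "\<And>m. c m \<in> Bz \<and> (m \<le> d \<longrightarrow> c m \<in> Sd (d - m)) \<and> (m > d \<longrightarrow> c m = 0)"
    "coeff p 1 = (\<Sum>m\<in>{1..s}. c m * py m)" using assms(1) unfolding PP_def by blast
  obtain b where b: "q \<in> LF d" "coeff q 0 \<in> Bz" "\<And>m. b m \<in> Bz \<and> (m \<le> d \<longrightarrow> b m \<in> Sd (d - m)) \<and> (m > d \<longrightarrow> b m = 0)"
    "coeff q 1 = (\<Sum>m\<in>{1..s}. b m * py m)" using assms(2) unfolding PP_def by blast
  show ?thesis unfolding PP_def
  proof (intro CollectI conjI exI[of _ "\<lambda>m. c m + b m"] allI)
    show "p + q \<in> LF d" by (intro LF_add c b)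
    show "coeff (p + q) 0 \<in> Bz" using c b by (simp add: subalg_add[OF subalg_Bz])
    show "coeff (p + q) 1 = (\<Sum>m\<in>{1..s}. (c m + b m) * py m)"
      unfolding coeff_add c(4) b(4) distrib_right sum.distrib ..
    fix m
    show "c m + b m \<in> Bz" "m \<le> d \<longrightarrow> c m + b m \<in> Sd (d - m)" "d < m \<longrightarrow> c m + b m = 0"
      using c(3)[of m] b(3)[of m] by (auto intro: subalg_add[OF subalg_Bz] Sd_add)
  qed
qed

lemma PP_mult: assumes "p \<in> PP d" "q \<in> PP e" shows "p * q \<in> PP (d + e)"
proof -
  obtain c where c: "p \<in> LF d" "coeff p 0 \<in> Bz" "\<And>m. c m \<in> Bz \<and> (m \<le> d \<longrightarrow> c m \<in> Sd (d - m)) \<and> (m > d \<longrightarrow> c m = 0)"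
    "coeff p 1 = (\<Sum>m\<in>{1..s}. c m * py m)" using assms(1) unfolding PP_def by blast
  obtain b where b: "q \<in> LF e" "coeff q 0 \<in> Bz" "\<And>m. b m \<in> Bz \<and> (m \<le> e \<longrightarrow> b m \<in> Sd (e - m)) \<and> (m > e \<longrightarrow> b m = 0)"
    "coeff q 1 = (\<Sum>m\<in>{1..s}. b m * py m)" using assms(2) unfolding PP_def by blast
  have S: "coeff p 0 \<in> Sd d" "coeff q 0 \<in> Sd e" using c(1) b(1) by (auto simp: LF_def)
  let ?c = "\<lambda>m. coeff p 0 * b m + coeff q 0 * c m"
  show ?thesis unfolding PP_def
  proof (intro CollectI conjI exI[of _ ?c] allI)
    show "p * q \<in> LF (d + e)" by (intro LF_mult c b)
    show "coeff (p * q) 0 \<in> Bz" using c b by (simp add: coeff_mult_0 subalg_mult[OF subalg_Bz])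
    have "coeff (p * q) 1 = coeff p 0 * coeff q 1 + coeff q 0 * coeff p 1"
      by (simp add: coeff_mult mult.commute)
    also have "\<dots> = (\<Sum>m\<in>{1..s}. ?c m * py m)"
      unfolding c(4) b(4) sum_distrib_left distrib_right sum.distrib mult.assoc ..
    finally show "coeff (p * q) 1 = (\<Sum>m\<in>{1..s}. ?c m * py m)" .
    fix m
    show "?c m \<in> Bz" using c b by (intro subalg_add[OF subalg_Bz] subalg_mult[OF subalg_Bz]) auto
    show "d + e < m \<longrightarrow> ?c m = 0" using c(3)[of m] b(3)[of m] by auto
    show "m \<le> d + e \<longrightarrow> ?c m \<in> Sd (d + e - m)"
    proof
      assume "m \<le> d + e"
      have "coeff p 0 * b m \<in> Sd (d + e - m)"
      proof (cases "m \<le> e")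
        case True
        then have "coeff p 0 * b m \<in> Sd (d + (e - m))" using S b(3) by (intro Sd_mult) auto
        then show ?thesis using True by simp
      qed (use b(3)[of m] in \<open>simp add: Sd_0\<close>)
      moreover have "coeff q 0 * c m \<in> Sd (d + e - m)"
      proof (cases "m \<le> d")
        case True
        then have "coeff q 0 * c m \<in> Sd (e + (d - m))" using S c(3) by (intro Sd_mult) auto
        moreover have "e + (d - m) = d + e - m" using True by simp
        ultimately show ?thesis by simp
      qed (use c(3)[of m] in \<open>simp add: Sd_0\<close>)
      ultimately show "?c m \<in> Sd (d + e - m)" by (rule Sd_add)
    qed
  qed
qed

lemma PP_const: "[:cst b:] \<in> PP 0"
  unfolding PP_def
proof (intro CollectI conjI exI[of _ "\<lambda>m. 0"] allI)
  have "[:cst b:] = (pc [:b:] :: (pt \<Rightarrow> complex) poly)" by (rule poly_eqI) (simp add: coeff_pc coeff_pCons split: nat.split)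
  then show "[:cst b:] \<in> LF 0" using LF_pc[OF LF_1, of "[:b:]"] by (simp only: mult_1_right)
qed (auto simp: subalg_cst[OF subalg_Bz] subalg_0[OF subalg_Bz] Sd_0)

lemma PP_0: "0 \<in> PP d"
  unfolding PP_def
  by (intro CollectI conjI exI[of _ "\<lambda>m. 0"] allI) (auto simp: subalg_0[OF subalg_Bz] Sd_0 LF_0)

lemma T1_subspace: "fv.subspace (T1 d)"
  unfolding fv.subspace_def
proof (intro conjI ballI allI)
  have "coeff 0 0 \<in> T1 d" unfolding T1_def by (intro imageI PP_0)
  then show "0 \<in> T1 d" by simp
next
  fix x y assume "x \<in> T1 d" "y \<in> T1 d"
  then obtain p q where *: "x = coeff p 0" "y = coeff q 0" "p \<in> PP d" "q \<in> PP d" by (auto simp: T1_def)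
  then have "coeff (p + q) 0 \<in> T1 d" unfolding T1_def by (intro imageI PP_add)
  then show "x + y \<in> T1 d" using * by simp
next
  fix c x assume "x \<in> T1 d"
  then obtain p where *: "x = coeff p 0" "p \<in> PP d" by (auto simp: T1_def)
  then have "[:cst c:] * p \<in> PP (0 + d)" by (intro PP_mult PP_const)
  then have "coeff ([:cst c:] * p) 0 \<in> T1 d" unfolding T1_def by (intro imageI) simp
  then show "cst c * x \<in> T1 d" using * by (simp add: coeff_mult_0)
qed

lemma T1_mult: "f \<in> T1 d \<Longrightarrow> g \<in> T1 e \<Longrightarrow> f * g \<in> T1 (d + e)"
proof -
  assume "f \<in> T1 d" "g \<in> T1 e"
  then obtain p q where *: "f = coeff p 0" "g = coeff q 0" "p \<in> PP d" "q \<in> PP e" by (auto simp: T1_def)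
  then have "coeff (p * q) 0 \<in> T1 (d + e)" unfolding T1_def by (intro imageI PP_mult)
  then show ?thesis using * by (simp add: coeff_mult_0)
qed

lemma T1_1: "1 \<in> T1 0"
proof -
  have "coeff [:cst 1:] 0 \<in> T1 0" unfolding T1_def by (intro imageI PP_const)
  then show ?thesis by simp
qed

text \<open>The bound D avoids a circle: power sums beyond s are obtained from the coefficients of
  \<open>chz\<close>, and those require power sums up to s only.\<close>

lemma Bz_T1_bounded:
  assumes pzT: "\<And>k. 1 \<le> k \<Longrightarrow> k \<le> D \<Longrightarrow> pz k \<in> T1 k" and f: "f \<in> Bz" "f \<in> Sd d" "d \<le> D"
  shows "f \<in> T1 d"
proof (rule Bz_in_graded[OF T1_subspace f(1,2)])
  fix m assume m: "(\<Sum>i<s. m i) = d"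
  have "Pol s (\<lambda>i j. Zv j ^ m i) \<in> T1 (\<Sum>i<s. m i)"
  proof (rule polarization[where C = "\<lambda>e f. f = (\<lambda>j. Zv j ^ e)" and D = D])
    fix e f assume *: "f = (\<lambda>j. Zv j ^ e)" "e \<le> D"
    show "(\<Sum>j<s. f j) \<in> T1 e"
    proof (cases "e = 0")
      case True
      have "(\<Sum>j<s. f j) = cst (of_nat s) * 1" unfolding * True by (simp add: of_nat_fun cst_def)
      then show ?thesis using True T1_1 fv.subspace_scale[OF T1_subspace] by metis
    next
      case False
      then show ?thesis using pzT[of e] * by (simp add: pz_def)
    qed
  qed (use m f(3) in \<open>auto simp: power_add T1_1 intro: T1_subspace T1_mult\<close>)
  then show "Pol s (\<lambda>i j. Zv j ^ m i) \<in> T1 d" by (simp only: m)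
qed

text \<open>For k > s the equation of degree s satisfied by the z is multiplied by the power k - s
  and summed, which gives a recursion with coefficients already in \<open>T1\<close>.\<close>

lemma pz_T1: "1 \<le> k \<Longrightarrow> pz k \<in> T1 k"
proof (induction k rule: less_induct)
  case (less k)
  have low: "pz k \<in> T1 k" if "1 \<le> k" "k \<le> s" for k
  proof -
    have "coeff (QF k) 0 \<in> T1 k" unfolding T1_def using that by (intro imageI QF_PP)
    then show ?thesis by (simp add: QF_def)
  qed
  show ?case
  proof (cases "k \<le> s")
    case False
    have c: "coeff chz j \<in> T1 (s - j)" if "j < s" for j
    proof (rule Bz_T1_bounded[of s])
      show "coeff chz j \<in> Bz" using Cz_Bz unfolding Cz_def by (auto intro: alg_base)
      have "coeff chz j \<in> Sd ((s - j) * 1)" unfolding chz_def using that by (intro coeff_chi_Sd Zv_Sd) auto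
      then show "coeff chz j \<in> Sd (s - j)" by simp
    qed (auto intro: low)
    have "pz k = (\<Sum>i<s. Zv i ^ (k - s) * Zv i ^ s)"
      unfolding pz_def using False by (simp flip: power_add)
    also have "\<dots> = (\<Sum>i<s. - (\<Sum>j<s. coeff chz j * Zv i ^ (k - s + j)))"
    proof (intro sum.cong refl)
      fix i assume "i \<in> {..<s}"
      then have "Zv i ^ s = - (\<Sum>j<s. coeff chz j * Zv i ^ j)" using chi_root[of i s Zv] by (simp add: chz_def)
      then show "Zv i ^ (k - s) * Zv i ^ s = - (\<Sum>j<s. coeff chz j * Zv i ^ (k - s + j))"
        by (simp only: mult_minus_right sum_distrib_left power_add mult.left_commute)
    qed
    also have "\<dots> = - (\<Sum>j<s. coeff chz j * pz (k - s + j))"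
      unfolding sum_negf pz_def sum_distrib_left by (subst sum.swap) (rule refl)
    also have "\<dots> \<in> T1 k"
    proof (intro fv.subspace_neg[OF T1_subspace] fv.subspace_sum[OF T1_subspace])
      fix j assume j: "j \<in> {..<s}"
      have "pz (k - s + j) \<in> T1 (k - s + j)" using False j by (intro less.IH) auto
      then have "coeff chz j * pz (k - s + j) \<in> T1 ((s - j) + (k - s + j))" using c j by (intro T1_mult) auto
      moreover have "(s - j) + (k - s + j) = k" using False j by auto
      ultimately show "coeff chz j * pz (k - s + j) \<in> T1 k" by simp
    qed
    finally show ?thesis .
  qed (use low less in auto)
qed

lemma Bz_T1: "f \<in> Bz \<Longrightarrow> f \<in> Sd d \<Longrightarrow> f \<in> T1 d"
  using Bz_T1_bounded[of d f d] pz_T1 by blast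

lemma T1_Ll: "T1 d \<subseteq> Ll d"
  by (auto simp: T1_def Ll_def PP_def)

lemma Bz_Ll: "f \<in> Bz \<Longrightarrow> f \<in> Sd d \<Longrightarrow> f \<in> Ll d"
  using Bz_T1 T1_Ll by blast

lemma Bz_Az_polys: "p \<in> polys_over Bz \<Longrightarrow> p \<in> polys_over Az"
  by (auto simp: polys_over_def Bz_def)

text \<open>\<open>QF k\<close> and a family \<open>p\<close> from the algebra of
  \<open>QF 1\<close>, ..., \<open>QF s\<close> have the same limit \<open>pz k\<close>, so their
  difference can be divided by a. The new limit is the sum over all y of q = y^k minus the terms
  \<open>c m\<close> y^m with m \<le> s. That q is flat need not be computed: the limit satisfies
  the derivative condition.\<close>

lemma lift_flat:
  assumes k: "s < k"
  obtains q where "monicd q k" "hompoly q k" "flat q" "q \<in> polys_over Bz" "(\<Sum>j<r. poly q (Yv j)) \<in> Ll k"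
proof -
  have "pz k \<in> T1 k" using k by (intro pz_T1) simp
  then obtain p where p: "p \<in> PP k" "coeff p 0 = pz k" by (auto simp: T1_def)
  then obtain c where c: "p \<in> LF k" "\<And>m. c m \<in> Bz \<and> (m \<le> k \<longrightarrow> c m \<in> Sd (k - m)) \<and> (m > k \<longrightarrow> c m = 0)"
    "coeff p 1 = (\<Sum>m\<in>{1..s}. c m * py m)" unfolding PP_def by blast
  define u where "u = QF k - p"
  have u: "u \<in> LF k" unfolding u_def using k c(1) by (intro LF_diff QF_LF) auto
  have "coeff u 0 = 0" by (simp add: u_def QF_def p(2))
  then obtain u' where u': "u = pCons 0 u'" by (cases u) auto
  then have u'L: "coeff u' 0 \<in> Ll k" using u LF_shift LlI by blast
  define q where "q = monom 1 k - (\<Sum>m\<in>{1..s}. monom (c m) m)"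
  have cq: "coeff q m = (if m = k then 1 else 0) - (if 1 \<le> m \<and> m \<le> s then c m else 0)" for m
    by (simp add: q_def coeff_sum sum.delta' eq_commute[of m])
  have "coeff u' 0 = coeff u 1" by (simp add: u')
  also have "\<dots> = py k - (\<Sum>m\<in>{1..s}. c m * py m)" by (simp add: u_def QF_def c(3)[simplified])
  also have "\<dots> = (\<Sum>j<r. poly q (Yv j))"
    unfolding q_def py_def sum_distrib_left
    by (subst sum.swap) (simp add: poly_sum poly_monom sum_subtractf)
  finally have sumq: "(\<Sum>j<r. poly q (Yv j)) \<in> Ll k" using u'L by simp
  have qB: "q \<in> polys_over Bz"
    using c(2) by (auto simp: polys_over_def cq intro!: subalg_diff[OF subalg_Bz] subalg_uminus[OF subalg_Bz] subalg_0[OF subalg_Bz] subalg_1[OF subalg_Bz])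
  have qA: "q \<in> polys_over Az" by (rule Bz_Az_polys[OF qB])
  have "flat q" unfolding flat_def
  proof (intro allI impI)
    fix x :: pt and l assume l: "l < s"
    \<comment> \<open>With y_0 placed at z_l, only the summand with j = 0 contributes to the
      derivative in y_0, which isolates the derivative of \<open>q\<close> at z_l.\<close>
    define x' where "x' = ((fst x)(0 := snd x l), snd x)"
    have S: "poly q (Yv j) \<in> S" if "j < r" for j
      using qA polys_over_mono[OF Az_S] by (intro poly_S Yv_S that) blast
    have d0: "dY 0 (poly q (Yv j)) x' = 0" if "j \<noteq> 0" for j
    proof (rule dY_const)
      fix t
      have "pat ((fst x')(0 := t), snd x') q = pat x' q" by (rule pat_Az[OF qA]) simp
      then show "poly q (Yv j) ((fst x')(0 := t), snd x') = poly q (Yv j) x'"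
        using that by (simp add: poly_pat Yv_def)
    qed
    have "dY 0 (\<Sum>j<r. poly q (Yv j)) x' = (\<Sum>j<r. dY 0 (poly q (Yv j)) x')"
      by (intro dY_sum S) auto
    also have "\<dots> = (\<Sum>j<r. if j = 0 then dY 0 (poly q (Yv 0)) x' else 0)"
      by (intro sum.cong refl) (use d0 in \<open>auto simp del: sum.delta\<close>)
    also have "\<dots> = dY 0 (poly q (Yv 0)) x'" using r_pos by (simp add: sum.delta)
    also have "\<dots> = poly (pderiv (pat x' q)) (snd x l)"
      by (simp add: dY_poly_Yv[OF qA]) (simp add: x'_def)
    also have "pat x' q = pat x q" by (rule pat_Az[OF qA]) (simp add: x'_def)
    finally have "dY 0 (\<Sum>j<r. poly q (Yv j)) x' = poly (pderiv (pat x q)) (snd x l)" .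
    moreover have "dY 0 (\<Sum>j<r. poly q (Yv j)) x' = 0"
      using Ll_limit(1)[OF sumq] r_pos l unfolding Tp_def by (auto simp: x'_def)
    ultimately show "poly (pderiv (pat x q)) (snd x l) = 0" by simp
  qed
  moreover have "monicd q k" using k by (auto simp: monicd_def cq)
  moreover have "hompoly q k" using k c(2) by (auto simp: hompoly_def cq Sd_one Sd_0 intro!: Sd_diff Sd_uminus)
  ultimately show ?thesis using that qB sumq by blast
qed

lemma flat_smult_diff: "flat p \<Longrightarrow> flat q \<Longrightarrow> flat (p - smult b q)"
proof -
  have "pat x (p - smult b q) = pat x p - smult (b x) (pat x q)" for x
    by (rule poly_eqI) (simp add: coeff_pat fapp)
  then show "flat p \<Longrightarrow> flat q \<Longrightarrow> flat (p - smult b q)" by (simp add: flat_def pderiv_diff pderiv_smult)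
qed

text \<open>A top term of degree above s is removed by the flat polynomial of that degree from
  \<open>lift_flat\<close>. Once the degree is at most s, the derivative has degree below s but s
  roots, so the polynomial is constant in y.\<close>

lemma flat_power_sum_Ll:
  assumes "q \<in> polys_over Bz" "hompoly q e" "flat q" "\<forall>k\<ge>N. coeff q k = 0"
  shows "(\<Sum>j<r. poly q (Yv j)) \<in> Ll e"
  using assms
proof (induction N arbitrary: q)
  case 0
  then have "q = 0" by (auto intro: poly_eqI)
  then show ?case using fv.subspace_0[OF Ll_subspace] by simp
next
  case (Suc m)
  let ?b = "coeff q m"
  have qB: "coeff q k \<in> Bz" for k using Suc.prems(1) by (simp add: polys_over_def)
  have hq: "k \<le> e \<Longrightarrow> coeff q k \<in> Sd (e - k)" "k > e \<Longrightarrow> coeff q k = 0" for k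
    using Suc.prems(2) by (auto simp: hompoly_def)
  show ?case
  proof (cases "m \<le> s")
    case True
    have qS: "coeff q k \<in> S" for k using qB[of k] Az_S by (auto simp: Bz_def)
    have z: "coeff q k = 0" if k: "k \<in> {1..s}" for k
    proof (rule S_eq_0_generic[OF qS])
      fix x :: pt assume inj: "inj_on (snd x) {..<s}"
      show "coeff q k x = 0"
      proof (rule low_degree_zero[OF inj _ k])
        fix l assume l: "l < s"
        have deg: "coeff q i = 0" if "i > s" for i using Suc.prems(4) True that by auto
        have "pat x q = (\<Sum>i\<le>s. monom (coeff q i x) i)"
          by (rule poly_eqI) (auto simp: coeff_sum coeff_pat sum.delta deg fapp)
        then have "poly (pderiv (pat x q)) (snd x l) = (\<Sum>i\<le>s. of_nat i * coeff q i x * snd x l ^ (i - 1))"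
          by (simp add: pderiv_sum pderiv_monom poly_sum poly_monom)
        also have "\<dots> = (\<Sum>i\<in>{1..s}. of_nat i * coeff q i x * snd x l ^ (i - 1))"
          by (rule sum.mono_neutral_right) (auto simp: not_less_eq_eq)
        also have "\<dots> = (\<Sum>k\<in>{1..s}. coeff q k x * (of_nat k * snd x l ^ (k - 1)))"
          by (intro sum.cong) auto
        finally show "(\<Sum>k\<in>{1..s}. coeff q k x * (of_nat k * snd x l ^ (k - 1))) = 0"
          using Suc.prems(3) l unfolding flat_def by metis
      qed
    qed
    have "q = [:coeff q 0:]"
    proof (rule poly_eqI)
      fix k
      show "coeff q k = coeff [:coeff q 0:] k"
      proof (cases "k \<in> {1..s}")
        case True
        then show ?thesis using z[OF True] by (cases k) auto
      next
        case False
        then have "k = 0 \<or> k \<ge> Suc m" using \<open>m \<le> s\<close> by auto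
        then show ?thesis using Suc.prems(4) by (cases k) auto
      qed
    qed
    then have "poly q (Yv j) = coeff q 0" for j by (metis mult_zero_right add.right_neutral poly_0 poly_pCons)
    then have "(\<Sum>j<r. poly q (Yv j)) = cst (of_nat r) * coeff q 0" by (simp add: of_nat_fun cst_def)
    also have "\<dots> \<in> Ll e"
      using Bz_Ll[OF qB hq(1), of 0] by (intro fv.subspace_scale[OF Ll_subspace]) simp
    finally show ?thesis .
  next
    case False
    show ?thesis
    proof (cases "m \<le> e")
      case True
      obtain p where p: "monicd p m" "hompoly p m" "flat p" "p \<in> polys_over Bz" "(\<Sum>j<r. poly p (Yv j)) \<in> Ll m"
        using lift_flat[of m] False by auto
      have "(\<Sum>j<r. poly (q - smult ?b p) (Yv j)) \<in> Ll e"
      proof (rule Suc.IH)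
        show "q - smult ?b p \<in> polys_over Bz"
          using qB p(4) by (auto simp: polys_over_def intro!: subalg_diff[OF subalg_Bz] subalg_mult[OF subalg_Bz])
        show "flat (q - smult ?b p)" by (intro flat_smult_diff Suc.prems p)
        show "hompoly (q - smult ?b p) e" unfolding hompoly_def
        proof (intro conjI allI impI)
          fix k assume ke: "k \<le> e"
          have "?b * coeff p k \<in> Sd (e - k)"
          proof (cases "k \<le> m")
            case kl: True
            then have "?b * coeff p k \<in> Sd ((e - m) + (m - k))"
              using p(2) True by (intro Sd_mult hq) (auto simp: hompoly_def)
            moreover have "(e - m) + (m - k) = e - k" using kl True by simp
            ultimately show ?thesis by simp
          qed (use p(2) in \<open>simp add: hompoly_def Sd_0\<close>)
          then show "coeff (q - smult ?b p) k \<in> Sd (e - k)" using hq(1)[OF ke] by (simp add: Sd_diff)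
        next
          fix k assume "e < k"
          then show "coeff (q - smult ?b p) k = 0" using hq(2) p(2) True by (simp add: hompoly_def)
        qed
        show "\<forall>k\<ge>m. coeff (q - smult ?b p) k = 0"
        proof safe
          fix k assume "m \<le> k"
          then show "coeff (q - smult ?b p) k = 0" using Suc.prems(4) p(1) by (cases "k = m") (auto simp: monicd_def)
        qed
      qed
      moreover have "?b * (\<Sum>j<r. poly p (Yv j)) \<in> Ll ((e - m) + m)"
        by (intro Ll_mult Bz_Ll qB hq p True)
      ultimately have "(\<Sum>j<r. poly (q - smult ?b p) (Yv j)) + ?b * (\<Sum>j<r. poly p (Yv j)) \<in> Ll e"
        using True by (intro fv.subspace_add[OF Ll_subspace]) simp_all
      then show ?thesis by (simp add: sum_subtractf sum_distrib_left)
    next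
      case False
      have "\<forall>k\<ge>m. coeff q k = 0" using hq(2) False by auto
      then show ?thesis using Suc by blast
    qed
  qed
qed

text \<open>The average is, up to a constant, a permanent in the z times a permanent in the y, and
  polarization applies to each.\<close>

lemma rho_Gm_Ll: "rho (Gm epT m) \<in> Ll (\<Sum>i<n. tdeg i (m i))"
proof -
  define \<psi> where "\<psi> i j = poly (GT (m (s + i))) (Yv j)" for i j
  define \<zeta> where "\<zeta> i j = Zv j ^ m i" for i j
  \<comment> \<open>The class consists of the values at all y of one flat homogeneous polynomial
    with coefficients symmetric in z. It is closed under products, and its power sums are
    limits.\<close>
  have y: "Pol r \<psi> \<in> Ll (\<Sum>i<r. tdg (m (s + i)))"
  proof (rule polarization[where D = "\<Sum>i<r. tdg (m (s + i))"
        and C = "\<lambda>e f. \<exists>q. q \<in> polys_over Bz \<and> hompoly q e \<and> flat q \<and> f = (\<lambda>j. poly q (Yv j))"])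
    fix d e f g
    assume "\<exists>q. q \<in> polys_over Bz \<and> hompoly q d \<and> flat q \<and> f = (\<lambda>j. poly q (Yv j))"
      "\<exists>q. q \<in> polys_over Bz \<and> hompoly q e \<and> flat q \<and> g = (\<lambda>j. poly q (Yv j))"
    then obtain p q where pq: "p \<in> polys_over Bz" "hompoly p d" "flat p" "f = (\<lambda>j. poly p (Yv j))"
      "q \<in> polys_over Bz" "hompoly q e" "flat q" "g = (\<lambda>j. poly q (Yv j))" by blast
    have "subrng (polys_over Bz)" by (intro subrng_polys_over subrng_subalg subalg_Bz)
    then have "p * q \<in> polys_over Bz" using pq(1,5) unfolding subrng_def by blast
    then show "\<exists>q. q \<in> polys_over Bz \<and> hompoly q (d + e) \<and> flat q \<and> (\<lambda>j. f j * g j) = (\<lambda>j. poly q (Yv j))"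
      using pq by (intro exI[of _ "p * q"]) (simp add: hompoly_mult flat_mult)
  next
    have "subrng (polys_over Bz)" by (intro subrng_polys_over subrng_subalg subalg_Bz)
    then have "1 \<in> polys_over Bz" unfolding subrng_def by blast
    then show "\<exists>q. q \<in> polys_over Bz \<and> hompoly q 0 \<and> flat q \<and> (\<lambda>_. 1) = (\<lambda>j. poly q (Yv j))"
      by (intro exI[of _ 1]) (simp add: hompoly_1 flat_1)
  next
    fix e f assume "\<exists>q. q \<in> polys_over Bz \<and> hompoly q e \<and> flat q \<and> f = (\<lambda>j. poly q (Yv j))"
    then obtain q where q: "q \<in> polys_over Bz" "hompoly q e" "flat q" "f = (\<lambda>j. poly q (Yv j))" by blast
    have "\<forall>k\<ge>Suc (degree q). coeff q k = 0" by (auto intro: coeff_eq_0)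
    from flat_power_sum_Ll[OF q(1-3) this] show "(\<Sum>j<r. f j) \<in> Ll e" by (simp add: q(4))
  next
    fix i
    have "GT (m (s + i)) \<in> polys_over Bz" using GT_Cz polys_over_mono[OF Cz_Bz] by blast
    then show "\<exists>q. q \<in> polys_over Bz \<and> hompoly q (tdg (m (s + i))) \<and> flat q \<and> \<psi> i = (\<lambda>j. poly q (Yv j))"
      by (intro exI[of _ "GT (m (s + i))"]) (simp add: hompoly_GT flat_GT \<psi>_def fun_eq_iff)
  qed (auto intro: Ll_subspace Ll_1 Ll_mult)
  have z: "Pol s \<zeta> \<in> Ll (\<Sum>i<s. m i)"
  proof (rule polarization[where C = "\<lambda>e f. f = (\<lambda>j. Zv j ^ e)" and D = "\<Sum>i<s. m i"])
    fix e f assume *: "f = (\<lambda>j. Zv j ^ e)"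
    show "(\<Sum>j<s. f j) \<in> Ll e" using Bz_Ll[OF pz_Bz pz_Sd, of e] by (simp add: * pz_def)
  qed (auto simp: power_add Ll_1 \<zeta>_def intro: Ll_subspace Ll_mult)
  have actG: "act \<sigma> \<tau> (Gm epT m) = (\<Prod>i<s. \<zeta> i (\<tau> i)) * (\<Prod>i<r. \<psi> i (\<sigma> i))"
    if \<sigma>: "\<sigma> permutes {..<r}" and \<tau>: "\<tau> permutes {..<s}" for \<sigma> \<tau>
  proof -
    have "act \<sigma> \<tau> (poly (GT k) (Yv i)) = poly (GT k) (Yv (\<sigma> i))" for k i
    proof -
      have "coeff (GT k) l \<in> Sym" for l using GT_Cz[of k] Cz_Sym by (auto simp: polys_over_def)
      then have "act \<sigma> \<tau> (coeff (GT k) l) = coeff (GT k) l" for l using \<sigma> \<tau> by (simp add: Sym_def)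
      then show ?thesis unfolding poly_altdef act_sum act_mult act_power act_Yv by simp
    qed
    then show ?thesis unfolding Gm_split act_mult act_prod act_power act_Zv \<zeta>_def \<psi>_def
      by (simp add: el_epT)
  qed
  have "(\<Sum>\<sigma> | \<sigma> permutes {..<r}. \<Sum>\<tau> | \<tau> permutes {..<s}. act \<sigma> \<tau> (Gm epT m))
     = (\<Sum>\<sigma> | \<sigma> permutes {..<r}. \<Sum>\<tau> | \<tau> permutes {..<s}. (\<Prod>i<s. \<zeta> i (\<tau> i)) * (\<Prod>i<r. \<psi> i (\<sigma> i)))"
    by (intro sum.cong) (auto simp: actG)
  also have "\<dots> = Pol s \<zeta> * Pol r \<psi>"
    unfolding Pol_def sum_product by (rule sum.swap)
  finally have "rho (Gm epT m) = cst (1 / (fact r * fact s)) * (Pol s \<zeta> * Pol r \<psi>)" by (simp add: rho_def)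
  also have "\<dots> \<in> Ll ((\<Sum>i<s. m i) + (\<Sum>i<r. tdg (m (s + i))))"
    by (intro fv.subspace_scale[OF Ll_subspace] Ll_mult y z)
  also have "(\<Sum>i<s. m i) + (\<Sum>i<r. tdg (m (s + i))) = (\<Sum>i<n. tdeg i (m i))"
    unfolding n_def add.commute[of r s] sum_lessThan_add by (simp add: tdeg_def)
  finally show ?thesis .
qed

theorem Ll_eq: "Ll d = Tp \<inter> Sym \<inter> Sd d"
proof
  show "Ll d \<subseteq> Tp \<inter> Sym \<inter> Sd d" using Ll_limit by blast
  show "Tp \<inter> Sym \<inter> Sd d \<subseteq> Ll d"
  proof
    fix f assume f: "f \<in> Tp \<inter> Sym \<inter> Sd d"
    then have "f \<in> fv.span (Gm epT ` {m\<in>UNIV. (\<Sum>i<n. tdeg i (m i)) = d})"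
      using Tp_Gm by (intro homogeneous_in_span Gm_epT_Sd) auto
    then obtain J c where J: "J \<subseteq> {m\<in>UNIV. (\<Sum>i<n. tdeg i (m i)) = d}" "f = (\<Sum>m\<in>J. cst (c m) * Gm epT m)"
      by (rule span_family_explicit) blast
    have "f = rho f" using f rho_Sym by simp
    also have "\<dots> = (\<Sum>m\<in>J. cst (c m) * rho (Gm epT m))"
      unfolding J(2) by (rule linear_map_sum[of rho, OF rho_add rho_cst_mult])
    also have "\<dots> \<in> Ll d"
      using J(1) rho_Gm_Ll by (intro fv.subspace_sum[OF Ll_subspace] fv.subspace_scale[OF Ll_subspace]) auto
    finally show "f \<in> Ll d" .
  qed
qed

end

section \<open>Free bases for almost all a\<close>

text \<open>Determinant trick: the matrix \<open>w\<close> - \<open>c\<close> annihilates the vector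
  \<open>v\<close>, hence so does its determinant by the adjugate, and the entry 1 of
  \<open>v\<close> makes the determinant itself vanish. The degree N is the number of
  generators.\<close>

lemma integral_bounded:
  fixes A :: "'b::comm_ring_1 set"
  assumes A: "subrng A" and c: "\<And>i j. i < N \<Longrightarrow> j < N \<Longrightarrow> c i j \<in> A"
    and w: "\<And>i. i < N \<Longrightarrow> w * v i = (\<Sum>j<N. c i j * v j)" and i0: "i0 < N" "v i0 = 1"
  obtains p where "p \<in> polys_over A" "coeff p N = 1" "\<And>k. k > N \<Longrightarrow> coeff p k = 0" "poly p w = 0"
proof -
  define C where "C = Matrix.mat N N (\<lambda>(i, j). c i j)"
  have C: "C \<in> carrier_mat N N" by (simp add: C_def)
  define p where "p = char_poly C"
  have entry: "char_poly_matrix C $$ (i, j) = (if i = j then [:0, 1:] else 0) + [:- c i j:]" if "i < N" "j < N" for i j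
    using that by (simp add: char_poly_matrix_def C_def)
  have AA: "subrng (polys_over A)" by (rule subrng_polys_over[OF A])
  have AA': "0 \<in> polys_over A" "1 \<in> polys_over A" "\<And>x y. x \<in> polys_over A \<Longrightarrow> y \<in> polys_over A \<Longrightarrow> x * y \<in> polys_over A"
    "\<And>x. x \<in> polys_over A \<Longrightarrow> - x \<in> polys_over A" "\<And>x y. x \<in> polys_over A \<Longrightarrow> y \<in> polys_over A \<Longrightarrow> x + y \<in> polys_over A"
    using AA by (auto simp: subrng_def)
  have entry_in: "char_poly_matrix C $$ (i, j) \<in> polys_over A" if "i < N" "j < N" for i j
  proof -
    have "[:0, 1:] \<in> polys_over A" "[:- c i j:] \<in> polys_over A"
      using A c[OF that] by (auto simp: polys_over_def coeff_pCons subrng_def split: nat.split)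
    moreover from this have "(if i = j then [:0, 1:] else 0) \<in> polys_over A" using AA'(1) by simp
    ultimately show ?thesis unfolding entry[OF that] by (intro AA'(5))
  qed
  have prod_in: "(\<Prod>i\<in>I. F i) \<in> polys_over A" if "\<And>i. i \<in> I \<Longrightarrow> F i \<in> polys_over A" for I :: "nat set" and F
    using that by (induction I rule: infinite_finite_induct) (auto intro: AA')
  have pA: "p \<in> polys_over A"
    unfolding p_def char_poly_def det_def'[OF char_poly_matrix_closed[OF C]]
  proof (rule subrng_sum[OF AA])
    fix q assume "q \<in> {q. q permutes {0..<N}}"
    then have "q i < N" if "i < N" for i using permutes_in_image[of q "{0..<N}" i] that by auto
    then have "(\<Prod>i = 0..<N. char_poly_matrix C $$ (i, q i)) \<in> polys_over A" by (intro prod_in entry_in) auto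
    moreover have "(signof q :: 'b poly) = 1 \<or> (signof q :: 'b poly) = - 1" by (simp add: sign_def)
    ultimately show "signof q * (\<Prod>i = 0..<N. char_poly_matrix C $$ (i, q i)) \<in> polys_over A"
      by (auto intro: AA')
  qed
  define M where "M = map_mat (\<lambda>p. poly p w) (char_poly_matrix C)"
  have M: "M \<in> carrier_mat N N" using C by (simp add: M_def)
  have detM: "Determinant.det M = poly p w"
    unfolding p_def char_poly_def det_def'[OF M] det_def'[OF char_poly_matrix_closed[OF C]] poly_sum poly_mult poly_prod
  proof (rule sum.cong[OF refl])
    fix q assume "q \<in> {q. q permutes {0..<N}}"
    then have q: "q i < N" if "i < N" for i using permutes_in_image[of q "{0..<N}" i] that by auto
    have "(\<Prod>i = 0..<N. M $$ (i, q i)) = (\<Prod>i = 0..<N. poly (char_poly_matrix C $$ (i, q i)) w)"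
      unfolding M_def using q carrier_matD[OF char_poly_matrix_closed[OF C]] by (intro prod.cong refl index_map_mat) auto
    moreover have "poly (signof q :: 'b poly) w = signof q" by (simp add: sign_def)
    ultimately show "signof q * (\<Prod>i = 0..<N. M $$ (i, q i)) =
        poly (signof q) w * (\<Prod>i = 0..<N. poly (char_poly_matrix C $$ (i, q i)) w)"
      by (simp only:)
  qed
  define u where "u = Matrix.vec N v"
  have u: "u \<in> carrier_vec N" by (simp add: u_def)
  have Mu: "M *\<^sub>v u = 0\<^sub>v N"
  proof (rule eq_vecI)
    fix i assume "i < dim_vec (0\<^sub>v N :: 'b Matrix.vec)"
    then have i: "i < N" by simp
    have "vec_index (M *\<^sub>v u) i = (\<Sum>j = 0..<N. M $$ (i, j) * v j)"
      using i M by (simp add: mult_mat_vec_def scalar_prod_def u_def)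
    also have "\<dots> = (\<Sum>j<N. (if i = j then w * v j else 0) - c i j * v j)"
    proof (rule sum.cong)
      fix j assume "j \<in> {..<N}"
      then have j: "j < N" by simp
      have "M $$ (i, j) = poly (char_poly_matrix C $$ (i, j)) w"
        unfolding M_def using i j carrier_matD[OF char_poly_matrix_closed[OF C]] by (intro index_map_mat) auto
      then have "M $$ (i, j) = (if i = j then w else 0) - c i j"
        unfolding entry[OF i j] by auto
      then show "M $$ (i, j) * v j = (if i = j then w * v j else 0) - c i j * v j"
        by (simp add: left_diff_distrib)
    qed auto
    also have "\<dots> = 0" using i w[OF i] by (simp add: sum_subtractf sum.delta)
    finally show "vec_index (M *\<^sub>v u) i = vec_index (0\<^sub>v N) i" using i by simp
  qed (use M in simp)
  have "(adj_mat M * M) *\<^sub>v u = adj_mat M *\<^sub>v (M *\<^sub>v u)"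
    by (rule assoc_mult_mat_vec[OF adj_mat(1)[OF M] M u])
  also have "\<dots> = 0\<^sub>v N" unfolding Mu using adj_mat(1)[OF M] by (intro eq_vecI) (auto simp: mult_mat_vec_def scalar_prod_def)
  finally have "(Determinant.det M \<cdot>\<^sub>m 1\<^sub>m N) *\<^sub>v u = 0\<^sub>v N" unfolding adj_mat(3)[OF M] .
  moreover have "vec_index ((Determinant.det M \<cdot>\<^sub>m 1\<^sub>m N) *\<^sub>v u) i0 = (\<Sum>j = 0..<N. Determinant.det M * (if j = i0 then 1 else 0) * v j)"
    using i0 by (simp add: mult_mat_vec_def scalar_prod_def u_def)
  moreover have "\<dots> = (\<Sum>j = 0..<N. if j = i0 then Determinant.det M * v j else 0)" by (intro sum.cong) auto
  ultimately have "Determinant.det M = 0" using i0 by (simp add: sum.delta)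
  then have "poly p w = 0" by (simp add: detM)
  moreover have "degree p = N" "coeff p N = 1" using degree_monic_char_poly[OF C] by (auto simp: p_def)
  ultimately show ?thesis using pA by (intro that[of p]) (auto intro: coeff_eq_0)
qed

lemma poly_nonzero_cofinite:
  fixes \<delta> :: "complex poly"
  assumes "coeff \<delta> 0 \<noteq> 0" shows "\<forall>\<^sub>F a in cofinite. poly \<delta> a \<noteq> 0"
proof -
  have "\<delta> \<noteq> 0" using assms by auto
  then show ?thesis unfolding eventually_cofinite using poly_roots_finite by simp
qed

lemma family_solve_cofinite:
  assumes "finite I" "indep I (\<lambda>i. coeff (v i) 0)"
    and "\<And>i. i \<in> I \<Longrightarrow> v i \<in> V" "0 \<in> V" "\<And>p q. p \<in> V \<Longrightarrow> q \<in> V \<Longrightarrow> p + q \<in> V"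
    and "\<And>c p. p \<in> V \<Longrightarrow> pc c * p \<in> V" "\<And>p. pCons 0 p \<in> V \<Longrightarrow> p \<in> V"
    and "\<And>p. p \<in> V \<Longrightarrow> coeff p 0 \<in> fv.span ((\<lambda>i. coeff (v i) 0) ` I)"
    and "f \<in> V"
  shows "\<forall>\<^sub>F a in cofinite. ev a f \<in> fv.span ((\<lambda>i. ev a (v i)) ` I)"
proof -
  obtain \<delta> c where d: "coeff \<delta> 0 \<noteq> 0" "pc \<delta> * f = (\<Sum>i\<in>I. pc (c i) * v i)"
    using assms by (rule family_solve)
  show ?thesis
  proof (rule eventually_mono[OF poly_nonzero_cofinite[OF d(1)]])
    fix a assume "poly \<delta> a \<noteq> 0"
    then show "ev a f \<in> fv.span ((\<lambda>i. ev a (v i)) ` I)"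
      unfolding family_solve_ev[OF d(2) \<open>poly \<delta> a \<noteq> 0\<close>] by (intro sum_in_span fv.span_base imageI)
  qed
qed

lemma indep_scale:
  assumes "indep I (\<lambda>i. cst (d i) * u i)" shows "finite I \<Longrightarrow> indep I u"
  using assms by (intro indep_exchange[of I _ u]) (auto intro!: fv.span_scale[OF fv.span_base])

context rs
begin

section \<open>Lifts of parameters and generators to families\<close>

definition HF :: "nat \<Rightarrow> (pt \<Rightarrow> complex) poly set" where "HF d = {p. \<forall>k. coeff p k \<in> Sd d}"

lemma HF_0: "0 \<in> HF d" and HF_add: "p \<in> HF d \<Longrightarrow> q \<in> HF d \<Longrightarrow> p + q \<in> HF d"
  by (auto simp: HF_def Sd_0 Sd_add)

lemma HF_mult: "p \<in> HF d \<Longrightarrow> q \<in> HF e \<Longrightarrow> p * q \<in> HF (d + e)"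
  by (auto simp: HF_def coeff_mult intro!: Sd_sum Sd_mult)

lemma HF_const: "f \<in> Sd d \<Longrightarrow> [:f:] \<in> HF d"
  by (auto simp: HF_def coeff_pCons Sd_0 split: nat.split)

lemma HF_1: "1 \<in> HF 0"
  using HF_const[OF Sd_one] by (simp add: one_pCons)

lemma HF_prod: "(\<And>i. i \<in> I \<Longrightarrow> F i \<in> HF (e i)) \<Longrightarrow> (\<Prod>i\<in>I. F i) \<in> HF (\<Sum>i\<in>I. e i)"
  by (induction I rule: infinite_finite_induct) (auto intro: HF_1 HF_mult)

lemma HF_power: "f \<in> HF d \<Longrightarrow> f ^ k \<in> HF (k * d)"
  by (induction k) (auto intro: HF_1 HF_mult)

lemma HF_pc: "p \<in> HF d \<Longrightarrow> pc c * p \<in> HF d"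
  by (auto simp: HF_def coeff_mult coeff_pc intro!: Sd_sum Sd_cst_mult)

lemma HF_shift: "pCons 0 p \<in> HF d \<Longrightarrow> p \<in> HF d"
proof -
  assume p: "pCons 0 p \<in> HF d"
  have "coeff p k \<in> Sd d" for k
  proof -
    have "coeff (pCons 0 p) (Suc k) \<in> Sd d" using p unfolding HF_def by blast
    then show ?thesis by simp
  qed
  then show ?thesis by (simp add: HF_def)
qed

lemma HF_ev: assumes "p \<in> HF d" shows "ev a p \<in> Sd d"
proof -
  have "ev a p = (\<Sum>k\<le>degree p. cst (a ^ k) * coeff p k)"
    by (subst ev_coeff_sum[of "degree p"]) (auto simp: coeff_eq_0 cst_power mult.commute)
  also have "\<dots> \<in> Sd d" using assms by (intro Sd_sum Sd_cst_mult) (auto simp: HF_def)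
  finally show ?thesis .
qed

lemma LF_HF: "p \<in> LF d \<Longrightarrow> p \<in> HF d"
  by (simp add: LF_def HF_def)

lemma LF_prod: "(\<And>i. i \<in> I \<Longrightarrow> F i \<in> LF (e i)) \<Longrightarrow> (\<Prod>i\<in>I. F i) \<in> LF (\<Sum>i\<in>I. e i)"
  by (induction I rule: infinite_finite_induct) (auto intro: LF_1 LF_mult)

lemma LF_power: "f \<in> LF d \<Longrightarrow> f ^ k \<in> LF (k * d)"
  by (induction k) (auto intro: LF_1 LF_mult)

lemma LF_ev: "p \<in> LF d \<Longrightarrow> a \<noteq> 0 \<Longrightarrow> ev a p \<in> Lam r s a"
  by (simp add: LF_def)

lemma Ll_lift: "f \<in> Ll d \<Longrightarrow> \<exists>p. p \<in> LF d \<and> coeff p 0 = f"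
  unfolding Ll_def by blast

text \<open>The constant default for i \<ge> n makes \<open>thA 0 = theta0\<close> an equality of
  functions on all indices.\<close>

definition Theta :: "nat \<Rightarrow> (pt \<Rightarrow> complex) poly" where
  "Theta i = (if i < n then SOME p. p \<in> LF (dd i) \<and> coeff p 0 = theta0 i else [:theta0 i:])"

definition Gk :: "(nat \<Rightarrow> nat) \<Rightarrow> (pt \<Rightarrow> complex) poly" where
  "Gk k = (SOME p. p \<in> LF (wT k) \<and> coeff p 0 = g0 k)"

lemma Theta_LF: "i < n \<Longrightarrow> Theta i \<in> LF (dd i)" and coeff_Theta_0: "coeff (Theta i) 0 = theta0 i"
proof -
  have *: "Theta i \<in> LF (dd i) \<and> coeff (Theta i) 0 = theta0 i" if i: "i < n"
  proof -
    have "theta0 i \<in> Ll (dd i)" unfolding Ll_eq using theta0_Tp theta0_Sym theta0_Sd[OF i] by blast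
    from someI_ex[OF Ll_lift[OF this]] show ?thesis using i by (simp add: Theta_def)
  qed
  then show "i < n \<Longrightarrow> Theta i \<in> LF (dd i)" by blast
  show "coeff (Theta i) 0 = theta0 i" using * by (cases "i < n") (auto simp: Theta_def)
qed

lemma Gk_LF: "Gk k \<in> LF (wT k)" and coeff_Gk_0: "coeff (Gk k) 0 = g0 k"
proof -
  have "g0 k \<in> Ll (wT k)" unfolding Ll_eq using g0_Tp g0_Sym g0_Sd by blast
  from someI_ex[OF Ll_lift[OF this], folded Gk_def] show "Gk k \<in> LF (wT k)" "coeff (Gk k) 0 = g0 k" by blast+
qed

definition thA :: "complex \<Rightarrow> nat \<Rightarrow> pt \<Rightarrow> complex" where "thA a i = ev a (Theta i)"
definition gA :: "complex \<Rightarrow> (nat \<Rightarrow> nat) \<Rightarrow> pt \<Rightarrow> complex" where "gA a k = ev a (Gk k)"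

lemma thA_0: "thA 0 = theta0" and gA_0: "gA 0 = g0"
  by (simp_all add: fun_eq_iff thA_def gA_def ev_at_0 coeff_Theta_0 coeff_Gk_0)

lemma thA_Sd: "i < n \<Longrightarrow> thA a i \<in> Sd (dd i)" and gA_Sd: "gA a k \<in> Sd (wT k)"
  unfolding thA_def gA_def by (intro HF_ev LF_HF Theta_LF, assumption) (intro HF_ev LF_HF Gk_LF)

lemma thA_Lam: "a \<noteq> 0 \<Longrightarrow> i < n \<Longrightarrow> thA a i \<in> Lam r s a" and gA_Lam: "a \<noteq> 0 \<Longrightarrow> gA a k \<in> Lam r s a"
  unfolding thA_def gA_def by (rule LF_ev[OF Theta_LF]; assumption) (rule LF_ev[OF Gk_LF])

definition basP :: "(nat \<Rightarrow> nat) \<Rightarrow> (pt \<Rightarrow> complex) poly" where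
  "basP m = (\<Prod>i<n. Theta i ^ (m i div dd i) * [:el epS i (m i mod dd i):])"

definition thP :: "(nat \<Rightarrow> nat) \<Rightarrow> (pt \<Rightarrow> complex) poly" where
  "thP \<kappa> = (\<Prod>i<n. Theta i ^ \<kappa> i)"

lemma ev_basP: "ev a (basP m) = bas (thA a) epS m"
  unfolding basP_def bas_def thA_def by (simp only: ev_prod ev_mult ev_power ev_const)

lemma ev_thP: "ev a (thP \<kappa>) = thp (thA a) \<kappa>"
  unfolding thP_def thp_def thA_def by (simp add: ev_prod ev_power)

lemma coeff_basP_0: "coeff (basP m) 0 = bas theta0 epS m"
  using ev_basP[of 0 m] by (simp add: ev_at_0 thA_0)

lemma coeff_thP_Gk_0: "coeff (thP \<kappa> * Gk k) 0 = thp theta0 \<kappa> * g0 k"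
  using ev_mult[of 0 "thP \<kappa>" "Gk k"] by (simp add: ev_at_0 ev_thP thA_0 coeff_Gk_0)

lemma basP_HF: "basP m \<in> HF (\<Sum>i<n. m i)"
proof -
  have "basP m \<in> HF (\<Sum>i<n. m i div dd i * dd i + m i mod dd i)"
    unfolding basP_def by (intro HF_prod HF_mult HF_power HF_const el_epS_Sd LF_HF[OF Theta_LF]) auto
  then show ?thesis by (simp only: div_mult_mod_eq)
qed

lemma thP_LF: "thP \<kappa> \<in> LF (\<Sum>i<n. \<kappa> i * dd i)"
  unfolding thP_def by (intro LF_prod LF_power Theta_LF) auto

abbreviation Dm :: "nat \<Rightarrow> (nat \<Rightarrow> nat) set" where "Dm d \<equiv> {m\<in>Ix. (\<Sum>i<n. m i) = d}"

lemma finite_Dm: "finite (Dm d)"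
  by (rule finite_weighted_Ix) simp

lemma indep_basP_0: "indep (Dm d) (\<lambda>m. coeff (basP m) 0)"
  unfolding coeff_basP_0 by (rule indep_subset[OF indep_bas_epS_0]) auto

lemma span_basP_0:
  assumes "f \<in> Sd d" shows "f \<in> fv.span ((\<lambda>m. coeff (basP m) 0) ` Dm d)"
proof -
  have "f \<in> fv.span (bas theta0 epS ` Ix)" using Sd_S[OF assms] S_bas by blast
  from homogeneous_in_span[OF assms this bas_epS_Sd[OF theta0_Sd]] show ?thesis
    unfolding coeff_basP_0 .
qed

lemma solve_basP:
  assumes "f \<in> HF d"
  obtains \<delta> c where "coeff \<delta> 0 \<noteq> 0" "pc \<delta> * f = (\<Sum>m\<in>Dm d. pc (c m) * basP m)"
proof (rule family_solve[where I = "Dm d" and v = basP and V = "HF d" and f = f, OF finite_Dm indep_basP_0])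
  fix m assume "m \<in> Dm d"
  then show "basP m \<in> HF d" using basP_HF[of m] by auto
next
  fix p assume "p \<in> HF d"
  then show "coeff p 0 \<in> fv.span ((\<lambda>m. coeff (basP m) 0) ` Dm d)" by (intro span_basP_0) (simp add: HF_def)
qed (use assms HF_0 HF_add HF_pc HF_shift that in blast)+

lemma Sd_span_cofinite: "\<forall>\<^sub>F a in cofinite. Sd d \<subseteq> fv.span (bas (thA a) epS ` Dm d)"
proof -
  have "\<forall>\<^sub>F a in cofinite. Mon m \<in> fv.span (bas (thA a) epS ` Dm d)" if m: "m \<in> Dm d" for m
  proof -
    have "Mon m \<in> Sd d" unfolding Sd_def using m by (intro fv.span_base imageI)
    then have "[:Mon m:] \<in> HF d" by (rule HF_const)
    then obtain \<delta> c where d: "coeff \<delta> 0 \<noteq> 0" "pc \<delta> * [:Mon m:] = (\<Sum>m\<in>Dm d. pc (c m) * basP m)"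
      by (rule solve_basP)
    show ?thesis
    proof (rule eventually_mono[OF poly_nonzero_cofinite[OF d(1)]])
      fix a assume a: "poly \<delta> a \<noteq> 0"
      have "ev a [:Mon m:] \<in> fv.span (bas (thA a) epS ` Dm d)"
        unfolding family_solve_ev[OF d(2) a] ev_basP by (intro sum_in_span fv.span_base imageI)
      then show "Mon m \<in> fv.span (bas (thA a) epS ` Dm d)" by (simp only: ev_const)
    qed
  qed
  then have "\<forall>\<^sub>F a in cofinite. \<forall>m\<in>Dm d. Mon m \<in> fv.span (bas (thA a) epS ` Dm d)"
    by (intro eventually_ball_finite finite_Dm) blast
  then show ?thesis
  proof (rule eventually_mono)
    fix a assume *: "\<forall>m\<in>Dm d. Mon m \<in> fv.span (bas (thA a) epS ` Dm d)"
    show "Sd d \<subseteq> fv.span (bas (thA a) epS ` Dm d)"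
      unfolding Sd_def using * by (intro fv.span_minimal fv.subspace_span) blast
  qed
qed

text \<open>The form in which freeness of \<open>S\<close> over parameters is checked: by counting,
  spanning in every degree already makes \<open>bas th epS\<close> a basis.\<close>

definition good :: "(nat \<Rightarrow> pt \<Rightarrow> complex) \<Rightarrow> bool" where
  "good th \<longleftrightarrow> (\<forall>i<n. th i \<in> Sd (dd i)) \<and> (\<forall>d. Sd d \<subseteq> fv.span (bas th epS ` Dm d))"

lemma span_thp_mult:
  assumes "\<kappa> \<in> Ix" "f \<in> fv.span (bas th ep ` Ix)" shows "thp th \<kappa> * f \<in> fv.span (bas th ep ` Ix)"
proof -
  have "fv.span (bas th ep ` Ix) \<subseteq> {f. f * thp th \<kappa> \<in> fv.span (bas th ep ` Ix)}"
  proof (intro fv.span_minimal subspace_mult_preimage fv.subspace_span image_subsetI)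
    fix m assume "m \<in> Ix"
    then have "bas th ep (comb \<kappa> m) \<in> fv.span (bas th ep ` Ix)" using assms(1) by (intro fv.span_base imageI comb_Ix)
    then show "bas th ep m \<in> {f. f * thp th \<kappa> \<in> fv.span (bas th ep ` Ix)}"
      unfolding bas_comb by (simp add: mult.commute)
  qed
  then show ?thesis using assms(2) by (auto simp: mult.commute)
qed

text \<open>A reduced basis element has degree at most the sum of the \<open>dd i\<close>, so its
  product with a coordinate is covered by the tested degrees; powers of the parameters are pulled
  out. Hence the span contains 1 and is stable under all coordinates.\<close>

lemma good_of_bounded:
  assumes th: "\<And>i. i < n \<Longrightarrow> th i \<in> Sd (dd i)"
    and sp: "\<And>d. d \<le> Suc (\<Sum>i<n. dd i) \<Longrightarrow> Sd d \<subseteq> fv.span (bas th epS ` Dm d)"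
  shows "good th"
proof -
  let ?V = "fv.span (bas th epS ` Ix)"
  have sp': "Sd d \<subseteq> ?V" if "d \<le> Suc (\<Sum>i<n. dd i)" for d
  proof -
    have "fv.span (bas th epS ` Dm d) \<subseteq> ?V" by (rule fv.span_mono) auto
    then show ?thesis using sp[OF that] by (rule order_trans[rotated])
  qed
  have W_bas: "bas th epS m * W i \<in> ?V" if m: "m \<in> Ix" and i: "i < n" for m i
  proof -
    have "red m \<in> L" using red_L[OF m] .
    then have "(\<Sum>j<n. red m j) \<le> (\<Sum>j<n. dd j)" by (intro sum_mono) (auto simp: L_def less_imp_le)
    moreover have "bas th epS (red m) * W i \<in> Sd ((\<Sum>j<n. red m j) + 1)"
      by (intro Sd_mult bas_epS_Sd th W_Sd i)
    ultimately have "bas th epS (red m) * W i \<in> ?V" using sp'[of "(\<Sum>j<n. red m j) + 1"] by auto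
    then have "thp th (kap m) * (bas th epS (red m) * W i) \<in> ?V" by (rule span_thp_mult[OF kap_Ix[OF m]])
    then show ?thesis using bas_red[of th epS m] by (simp add: mult.assoc)
  qed
  define B where "B = {f. \<forall>v\<in>?V. v * f \<in> ?V}"
  have "subalg B" unfolding subalg_def B_def
    by (auto simp: distrib_left mult.assoc[symmetric] mult.commute[of _ "cst _"] intro: fv.span_add fv.span_scale)
  moreover have "W i \<in> B" if i: "i < n" for i
  proof -
    have "?V \<subseteq> {f. f * W i \<in> ?V}"
      using W_bas[OF _ i] by (intro fv.span_minimal subspace_mult_preimage fv.subspace_span image_subsetI) simp
    then show ?thesis by (auto simp: B_def)
  qed
  ultimately have SB: "S \<subseteq> B" unfolding S_def by (intro alg_least) auto
  have "1 \<in> ?V" using sp'[of 0] Sd_one by auto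
  then have SV: "S \<subseteq> ?V" using SB by (force simp: B_def)
  have "Sd d \<subseteq> fv.span (bas th epS ` Dm d)" for d
  proof
    fix f assume f: "f \<in> Sd d"
    then have "f \<in> ?V" using SV Sd_S by blast
    from homogeneous_in_span[OF f this bas_epS_Sd[OF th]] show "f \<in> fv.span (bas th epS ` Dm d)" .
  qed
  then show ?thesis using th by (simp add: good_def)
qed

lemma good_cofinite: "\<forall>\<^sub>F a in cofinite. good (thA a)"
proof -
  have "\<forall>\<^sub>F a in cofinite. \<forall>d\<in>{..Suc (\<Sum>i<n. dd i)}. Sd d \<subseteq> fv.span (bas (thA a) epS ` Dm d)"
    by (intro eventually_ball_finite ballI Sd_span_cofinite) auto
  then show ?thesis
    by (rule eventually_mono) (intro good_of_bounded thA_Sd, auto)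
qed

lemma good_indep: "good th \<Longrightarrow> indep Ix (bas th epS)"
  by (rule indep_bas_epS) (auto simp: good_def)

lemma good_S: "good th \<Longrightarrow> S \<subseteq> fv.span (bas th epS ` Ix)"
proof -
  assume "good th"
  have "Mon m \<in> fv.span (bas th epS ` Ix)" if "m \<in> Ix" for m
  proof -
    have "Mon m \<in> Sd (\<Sum>i<n. m i)" unfolding Sd_def using that by (intro fv.span_base imageI) simp
    moreover have "fv.span (bas th epS ` Dm (\<Sum>i<n. m i)) \<subseteq> fv.span (bas th epS ` Ix)" by (rule fv.span_mono) auto
    ultimately show ?thesis using \<open>good th\<close> unfolding good_def by blast
  qed
  then show ?thesis unfolding S_span by (intro fv.span_minimal fv.subspace_span) auto
qed

lemma good_theta0: "good theta0"
  unfolding good_def using theta0_Sd span_basP_0 unfolding coeff_basP_0 by blast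

text \<open>The degree of the integral equation does not depend on \<open>th\<close>.\<close>

lemma good_integral:
  assumes "good th" "i < n"
  obtains p where "p \<in> polys_over (alg (th ` {..<n}))" "monicd p (card L)" "poly p (W i) = 0"
proof -
  let ?A = "alg (th ` {..<n})"
  define h where "h = (SOME h. bij_betw h {..<card L} L)"
  have "\<exists>h. bij_betw h {..<card L} L" using ex_bij_betw_nat_finite[OF finite_L] by (simp add: atLeast0LessThan)
  from someI_ex[OF this] have h: "bij_betw h {..<card L} L" by (simp add: h_def)
  have AS: "thp th \<kappa> \<in> ?A" for \<kappa>
    unfolding thp_def by (intro subalg_prod[OF subalg_alg] subalg_power[OF subalg_alg] alg_base) auto
  have "\<exists>c. (\<forall>l\<in>L. c l \<in> ?A) \<and> f = (\<Sum>l\<in>L. c l * bas th epS l)" if "f \<in> S" for f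
  proof -
    have "f \<in> fv.span (bas th epS ` Ix)" using that good_S[OF assms(1)] by blast
    then obtain J c where J: "finite J" "J \<subseteq> Ix" "f = (\<Sum>m\<in>J. cst (c m) * bas th epS m)" by (rule span_family_explicit)
    define c' where "c' l = (\<Sum>m\<in>{m\<in>J. red m = l}. cst (c m) * thp th (kap m))" for l
    have "(\<Sum>l\<in>L. c' l * bas th epS l) = (\<Sum>l\<in>L. \<Sum>m\<in>{m\<in>J. red m = l}. cst (c m) * bas th epS m)"
    proof (rule sum.cong[OF refl])
      fix l
      show "c' l * bas th epS l = (\<Sum>m\<in>{m\<in>J. red m = l}. cst (c m) * bas th epS m)"
        unfolding c'_def sum_distrib_right
      proof (rule sum.cong[OF refl])
        fix m assume "m \<in> {m\<in>J. red m = l}"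
        then have "red m = l" by simp
        then show "cst (c m) * thp th (kap m) * bas th epS l = cst (c m) * bas th epS m"
          using bas_red[of th epS m] by (simp add: mult.assoc)
      qed
    qed
    also have "\<dots> = f" unfolding J(3) using J(1,2) finite_L red_L by (intro sum.group) auto
    finally have "f = (\<Sum>l\<in>L. c' l * bas th epS l)" ..
    moreover have "c' l \<in> ?A" for l unfolding c'_def
      by (intro subalg_sum[OF subalg_alg] subalg_mult[OF subalg_alg] alg_cst AS)
    ultimately show ?thesis by (intro exI[of _ c'] conjI ballI)
  qed
  note ex = this
  have bS: "bas th epS l \<in> S" for l using bas_epS_Sd[of th l] assms(1) Sd_S by (auto simp: good_def)
  have "\<forall>j. \<exists>c. (\<forall>l\<in>L. c l \<in> ?A) \<and> W i * bas th epS (h j) = (\<Sum>l\<in>L. c l * bas th epS l)"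
    by (intro allI ex subalg_mult[OF subalg_S] W_S assms(2) bS)
  from choice[OF this] obtain c where
    "\<forall>j. (\<forall>l\<in>L. c j l \<in> ?A) \<and> W i * bas th epS (h j) = (\<Sum>l\<in>L. c j l * bas th epS l)" by (elim exE)
  then have c: "l \<in> L \<Longrightarrow> c j l \<in> ?A" "W i * bas th epS (h j) = (\<Sum>l\<in>L. c j l * bas th epS l)" for j l
    by simp_all
  have hL: "h j \<in> L" if "j < card L" for j using bij_betwE[OF h] that by auto
  have w: "W i * bas th epS (h j) = (\<Sum>l<card L. c j (h l) * bas th epS (h l))" for j
    unfolding c(2) by (rule sum.reindex_bij_betw[OF h, symmetric])
  \<comment> \<open>The zero index belongs to the basis element 1, the entry required by the
    determinant trick.\<close>
  have "(\<lambda>_. 0) \<in> L" using dd_pos by (simp add: L_def Ix_def)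
  then have "(\<lambda>_. 0) \<in> h ` {..<card L}" by (simp only: bij_betw_imp_surj_on[OF h])
  then obtain i0 where "(\<lambda>_. 0) = h i0" "i0 \<in> {..<card L}" by (rule imageE)
  then have i0: "i0 < card L" "h i0 = (\<lambda>_. 0)" by simp_all
  have "bas th epS (h i0) = 1" unfolding i0(2) bas_def by (intro prod.neutral) (auto simp: el_def epS_def)
  from integral_bounded[where A = ?A and v = "\<lambda>j. bas th epS (h j)" and c = "\<lambda>i j. c i (h j)" and w = "W i" and N = "card L",
      OF subrng_subalg[OF subalg_alg] c(1)[OF hL] w i0(1) this]
  obtain p where "p \<in> polys_over ?A" "coeff p (card L) = 1" "\<And>k. k > card L \<Longrightarrow> coeff p k = 0" "poly p (W i) = 0"
    by blast
  then show ?thesis using that by (simp add: monicd_def)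
qed

lemma Q_sum_W: "Q r s a k = (\<Sum>i<n. cst (if i < s then 1 else a) * W i ^ k)"
proof -
  have "(\<Sum>i<s + r. cst (if i < s then 1 else a) * W i ^ k) = pz k + cst a * py k"
    unfolding sum_lessThan_add pz_def py_def sum_distrib_left by (simp add: W_def)
  then show ?thesis unfolding Q_eq by (simp add: n_def add.commute)
qed

text \<open>\<open>Q r s a k\<close> is a weighted power sum of the coordinates. The product of
  their integral equations is monic of degree n N and vanishes at every coordinate, which yields a
  linear recursion for the power sums.\<close>

lemma Q_recursion:
  assumes A: "subalg A" and p: "\<And>i. i < n \<Longrightarrow> p i \<in> polys_over A" "\<And>i. i < n \<Longrightarrow> monicd (p i) N"
      "\<And>i. i < n \<Longrightarrow> poly (p i) (W i) = 0"
    and M: "fv.subspace M" "\<And>f g. f \<in> A \<Longrightarrow> g \<in> M \<Longrightarrow> f * g \<in> M"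
    and Q: "\<And>k. 1 \<le> k \<Longrightarrow> k \<le> n * N \<Longrightarrow> Q r s a k \<in> M" and k: "1 \<le> k"
  shows "Q r s a k \<in> M"
  using k
proof (induction k rule: less_induct)
  case (less k)
  show ?case
  proof (cases "k \<le> n * N")
    case False
    define P where "P = (\<Prod>i<n. p i)"
    have PA: "(\<Prod>i<j. p i) \<in> polys_over A \<and> monicd (\<Prod>i<j. p i) (j * N)" if "j \<le> n" for j
      using that
    proof (induction j)
      case 0
      have "1 \<in> polys_over A" using subrng_polys_over[OF subrng_subalg[OF A]] by (simp add: subrng_def)
      then show ?case by (simp add: monicd_1)
    next
      case (Suc j)
      then have "(\<Prod>i<j. p i) \<in> polys_over A" "monicd (\<Prod>i<j. p i) (j * N)" by auto
      then have "(\<Prod>i<j. p i) * p j \<in> polys_over A" "monicd ((\<Prod>i<j. p i) * p j) (j * N + N)"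
        using subrng_polys_over[OF subrng_subalg[OF A]] p(1)[of j] p(2)[of j] Suc.prems by (auto simp: subrng_def intro: monicd_mult)
      then show ?case by (simp add: add.commute)
    qed
    then have P: "P \<in> polys_over A" "monicd P (n * N)" by (auto simp: P_def)
    have PW: "poly P (W i) = 0" if "i < n" for i
      unfolding P_def poly_prod using p(3)[OF that] that by (intro prod_zero) auto
    let ?D = "n * N"
    \<comment> \<open>At least 1, so that the recursion only refers to power sums of positive
      index.\<close>
    define k' where "k' = k - ?D"
    have k': "k = k' + ?D" "1 \<le> k'" using False by (auto simp: k'_def)
    have Ps: "poly P x = (\<Sum>j<?D. coeff P j * x ^ j) + x ^ ?D" for x
    proof -
      have "poly P x = (\<Sum>j\<le>?D. coeff P j * x ^ j)" using P(2) by (intro poly_as_sum) (auto simp: monicd_def)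
      then show ?thesis using P(2) by (simp add: monicd_def lessThan_Suc_atMost[symmetric])
    qed
    let ?u = "\<lambda>i. cst (if i < s then 1 else a)"
    have "0 = (\<Sum>i<n. ?u i * W i ^ k' * poly P (W i))" using PW by simp
    also have "\<dots> = (\<Sum>i<n. (\<Sum>j<?D. coeff P j * (?u i * W i ^ (k' + j))) + ?u i * W i ^ k)"
      unfolding Ps k'(1) by (simp only: distrib_left sum_distrib_left power_add mult_ac)
    also have "\<dots> = (\<Sum>j<?D. coeff P j * Q r s a (k' + j)) + Q r s a k"
      unfolding Q_sum_W sum.distrib sum_distrib_left by (subst sum.swap) simp
    finally have "Q r s a k = 0 - (\<Sum>j<?D. coeff P j * Q r s a (k' + j))" by (simp add: eq_neg_iff_add_eq_0 add.commute)
    also have "\<dots> \<in> M"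
      using P(1) k' by (intro fv.subspace_diff[OF M(1)] fv.subspace_0[OF M(1)] fv.subspace_sum[OF M(1)] M(2) less.IH)
        (auto simp: polys_over_def)
    finally show ?thesis .
  qed (use Q less.prems in blast)
qed

section \<open>The deformed algebra as a free module\<close>

abbreviation wI :: "(nat \<Rightarrow> nat) \<times> (nat \<Rightarrow> nat) \<Rightarrow> nat" where
  "wI \<equiv> \<lambda>(\<kappa>, k). (\<Sum>i<n. \<kappa> i * dd i) + wT k"

abbreviation tg :: "(nat \<Rightarrow> pt \<Rightarrow> complex) \<Rightarrow> ((nat \<Rightarrow> nat) \<Rightarrow> pt \<Rightarrow> complex) \<Rightarrow> (nat \<Rightarrow> nat) \<times> (nat \<Rightarrow> nat) \<Rightarrow> pt \<Rightarrow> complex" where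
  "tg th g \<equiv> \<lambda>(\<kappa>, k). thp th \<kappa> * g k"

lemma finite_wI: "finite {p\<in>Ix \<times> KK. wI p = d}"
proof (rule finite_subset)
  show "{p\<in>Ix \<times> KK. wI p = d} \<subseteq> (\<Union>e\<in>{..d}. {\<kappa>\<in>Ix. (\<Sum>i<n. \<kappa> i * dd i) = e}) \<times> KK" by auto
  have "finite {\<kappa>\<in>Ix. (\<Sum>i<n. \<kappa> i * dd i) = e}" for e
    using dd_pos by (intro finite_weighted_Ix[of "\<lambda>i m. m * dd i"]) (simp add: Suc_leI)
  then show "finite ((\<Union>e\<in>{..d}. {\<kappa>\<in>Ix. (\<Sum>i<n. \<kappa> i * dd i) = e}) \<times> KK)" using finite_KK by simp
qed

lemma tg_Sd: "(\<And>i. i < n \<Longrightarrow> th i \<in> Sd (dd i)) \<Longrightarrow> (\<And>k. g k \<in> Sd (wT k)) \<Longrightarrow> tg th g p \<in> Sd (wI p)"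
  unfolding thp_def split_def by (intro Sd_mult Sd_prod Sd_power) auto

lemma Ll_span:
  assumes "f \<in> Ll d" shows "f \<in> fv.span (tg theta0 g0 ` {p\<in>Ix \<times> KK. wI p = d})"
proof -
  have f: "f \<in> Tp" "f \<in> Sym" "f \<in> Sd d" using assms by (auto simp: Ll_eq)
  have "f \<in> fv.span (tg theta0 g0 ` (Ix \<times> KK))" using rho_Tp_Vg[OF f(1)] rho_Sym[OF f(2)] by (simp add: Vg_def)
  from homogeneous_in_span[OF f(3) this tg_Sd[OF theta0_Sd g0_Sd]] show ?thesis .
qed

abbreviation Ma :: "complex \<Rightarrow> (pt \<Rightarrow> complex) set" where
  "Ma a \<equiv> fv.span (tg (thA a) (gA a) ` (Ix \<times> KK))"

text \<open>The exceptional values of a depend on \<open>f\<close>; this is why membership may be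
  tested for finitely many families only.\<close>

lemma LF_Ma_cofinite:
  assumes "f \<in> LF d" shows "\<forall>\<^sub>F a in cofinite. ev a f \<in> Ma a"
proof -
  let ?I = "{p\<in>Ix \<times> KK. wI p = d}"
  let ?v = "\<lambda>(\<kappa>, k). thP \<kappa> * Gk k"
  have c0: "(\<lambda>p. coeff (?v p) 0) = tg theta0 g0" by (auto simp: fun_eq_iff coeff_thP_Gk_0)
  have "\<forall>\<^sub>F a in cofinite. ev a f \<in> fv.span ((\<lambda>p. ev a (?v p)) ` ?I)"
  proof (rule family_solve_cofinite[where V = "LF d"])
    show "indep ?I (\<lambda>p. coeff (?v p) 0)" unfolding c0 by (rule indep_subset[OF indep_Vg]) auto
  next
    fix p assume "p \<in> ?I"
    then obtain \<kappa> k where p: "p = (\<kappa>, k)" "(\<Sum>i<n. \<kappa> i * dd i) + wT k = d" by auto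
    show "?v p \<in> LF d" unfolding p(1) using LF_mult[OF thP_LF[of \<kappa>] Gk_LF[of k]] by (simp add: p(2))
  next
    fix p assume "p \<in> LF d"
    from Ll_span[OF LlI[OF this]] show "coeff p 0 \<in> fv.span ((\<lambda>p. coeff (?v p) 0) ` ?I)" unfolding c0 .
  qed (use assms finite_wI LF_0 LF_add LF_pc LF_shift in blast)+
  then show ?thesis
  proof (rule eventually_mono)
    fix a assume *: "ev a f \<in> fv.span ((\<lambda>p. ev a (?v p)) ` ?I)"
    have "(\<lambda>p. ev a (?v p)) = tg (thA a) (gA a)" by (auto simp: fun_eq_iff ev_mult ev_thP gA_def)
    then have "ev a f \<in> fv.span (tg (thA a) (gA a) ` ?I)" using * by (simp only:)
    moreover have "fv.span (tg (thA a) (gA a) ` ?I) \<subseteq> Ma a" by (rule fv.span_mono) auto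
    ultimately show "ev a f \<in> Ma a" by blast
  qed
qed

lemma tg_span_mult:
  assumes "p \<in> alg (th ` {..<n})" "f \<in> fv.span (tg th g ` (Ix \<times> KK))"
  shows "p * f \<in> fv.span (tg th g ` (Ix \<times> KK))"
proof -
  let ?M = "fv.span (tg th g ` (Ix \<times> KK))"
  have th: "tg th g q * th i \<in> ?M" if q: "q \<in> Ix \<times> KK" and i: "i < n" for q i
  proof -
    obtain \<kappa> k where p: "q = (\<kappa>, k)" "\<kappa> \<in> Ix" "k \<in> KK" using q by blast
    have "thp th (\<lambda>j. if j = i then 1 else 0) = (\<Prod>j<n. if j = i then th i else 1)"
      unfolding thp_def by (intro prod.cong) auto
    then have "thp th (\<lambda>j. if j = i then 1 else 0) = th i" using i by (simp add: prod.delta)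
    then have "tg th g q * th i = tg th g (\<lambda>j. \<kappa> j + (if j = i then 1 else 0), k)"
      using thp_add[of th \<kappa> "\<lambda>j. if j = i then 1 else 0"] by (simp add: p(1) mult_ac)
    also have "\<dots> \<in> ?M" using p i by (intro fv.span_base imageI) (auto simp: Ix_def)
    finally show ?thesis .
  qed
  define B where "B = {f. \<forall>v\<in>?M. v * f \<in> ?M}"
  have "subalg B" unfolding subalg_def B_def
    by (auto simp: distrib_left mult.assoc[symmetric] mult.commute[of _ "cst _"] intro: fv.span_add fv.span_scale)
  moreover have "th i \<in> B" if i: "i < n" for i
  proof -
    have "?M \<subseteq> {f. f * th i \<in> ?M}"
      using th[OF _ i] by (intro fv.span_minimal subspace_mult_preimage fv.subspace_span image_subsetI) blast
    then show ?thesis by (auto simp: B_def)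
  qed
  ultimately have "alg (th ` {..<n}) \<subseteq> B" by (intro alg_least) auto
  then show ?thesis using assms by (auto simp: B_def mult.commute)
qed

lemma thp_alg: "thp th \<kappa> \<in> alg (th ` {..<n})"
  unfolding thp_def by (intro subalg_prod[OF subalg_alg] subalg_power[OF subalg_alg] alg_base) auto

text \<open>It suffices to test 1, the products of two generators and \<open>Q\<close> up to n times
  \<open>card L\<close>. That bound is uniform in a because the integral equations of the
  coordinates have degree \<open>card L\<close> for every good parameter system.\<close>

lemma Lam_eq_Ma_cofinite: "\<forall>\<^sub>F a in cofinite. Lam r s a = Ma a"
proof -
  have 1: "\<forall>\<^sub>F a in cofinite. 1 \<in> Ma a" using LF_Ma_cofinite[OF LF_1] by simp
  have g: "\<forall>\<^sub>F a in cofinite. \<forall>p\<in>KK \<times> KK. ev a (Gk (fst p) * Gk (snd p)) \<in> Ma a"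
    by (intro eventually_ball_finite ballI LF_Ma_cofinite[OF LF_mult[OF Gk_LF Gk_LF]]) (simp add: finite_KK)
  have q: "\<forall>\<^sub>F a in cofinite. \<forall>k\<in>{1..n * card L}. ev a (QF k) \<in> Ma a"
    by (intro eventually_ball_finite ballI LF_Ma_cofinite[OF QF_LF]) auto
  have nz: "\<forall>\<^sub>F a in cofinite. a \<noteq> (0::complex)" by (simp add: eventually_cofinite)
  show ?thesis using 1 g q nz good_cofinite
  proof eventually_elim
    fix a :: complex
    assume 1: "1 \<in> Ma a" and g: "\<forall>p\<in>KK \<times> KK. ev a (Gk (fst p) * Gk (snd p)) \<in> Ma a"
      and q: "\<forall>k\<in>{1..n * card L}. ev a (QF k) \<in> Ma a" and a: "a \<noteq> 0" and good: "good (thA a)"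
    have gg: "gA a k * gA a l \<in> Ma a" if "k \<in> KK" "l \<in> KK" for k l
      using g that by (auto simp: ev_mult gA_def)
    have sub: "subalg (Ma a)" unfolding subalg_def
    proof (intro conjI allI ballI)
      fix c show "cst c \<in> Ma a" using fv.span_scale[OF 1, of c] by simp
    next
      fix f h assume fh: "f \<in> Ma a" "h \<in> Ma a"
      then show "f + h \<in> Ma a" by (rule fv.span_add)
      show "f * h \<in> Ma a"
      proof (rule span_mult_in[OF fv.subspace_span _ fh])
        fix x y assume "x \<in> tg (thA a) (gA a) ` (Ix \<times> KK)" "y \<in> tg (thA a) (gA a) ` (Ix \<times> KK)"
        then obtain \<kappa> k \<mu> l where "x = thp (thA a) \<kappa> * gA a k" "y = thp (thA a) \<mu> * gA a l" "k \<in> KK" "l \<in> KK" by auto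
        moreover have "(thp (thA a) \<kappa> * thp (thA a) \<mu>) * (gA a k * gA a l) \<in> Ma a"
          using calculation by (intro tg_span_mult gg subalg_mult[OF subalg_alg] thp_alg)
        ultimately show "x * y \<in> Ma a" by (simp add: mult_ac)
      qed
    qed
    have "\<forall>i\<in>{..<n}. \<exists>p. p \<in> polys_over (alg (thA a ` {..<n})) \<and> monicd p (card L) \<and> poly p (W i) = 0"
      using good_integral[OF good] by (metis lessThan_iff)
    then obtain p where p: "\<And>i. i < n \<Longrightarrow> p i \<in> polys_over (alg (thA a ` {..<n}))"
      "\<And>i. i < n \<Longrightarrow> monicd (p i) (card L)" "\<And>i. i < n \<Longrightarrow> poly (p i) (W i) = 0" by (metis lessThan_iff)
    have "Q r s a k \<in> Ma a" if k: "1 \<le> k" for k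
    proof (rule Q_recursion[OF subalg_alg p fv.subspace_span tg_span_mult _ k])
      fix k assume "1 \<le> k" "k \<le> n * card L"
      then show "Q r s a k \<in> Ma a" using q by (simp add: ev_QF)
    qed
    then have le: "Lam r s a \<subseteq> Ma a" unfolding Lam_alg by (intro alg_least[OF sub]) auto
    have "Ma a \<subseteq> Lam r s a"
    proof (rule fv.span_minimal[OF _ subalg_subspace[OF subalg_Lam]], rule image_subsetI)
      fix q assume "q \<in> Ix \<times> KK"
      then show "tg (thA a) (gA a) q \<in> Lam r s a"
        unfolding thp_def split_def
        by (intro subalg_mult[OF subalg_Lam] subalg_prod[OF subalg_Lam] subalg_power[OF subalg_Lam] thA_Lam gA_Lam a) auto
    qed
    with le show "Lam r s a = Ma a" by blast
  qed
qed

text \<open>The map \<open>phiS (thA a)\<close> is not given as a polynomial in a. After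
  multiplication by the denominators \<open>\<delta> k\<close>, the expansion of \<open>Gk k\<close>
  in \<open>basP\<close> has polynomial coefficients, and applying the extraction termwise gives
  genuine families \<open>u k\<close>, whose independence at 0 spreads to almost all a.\<close>

lemma indep_phiS_cofinite: "\<forall>\<^sub>F a in cofinite. indep KK (\<lambda>k. phiS (thA a) (gA a k))"
proof -
  have "\<forall>k. \<exists>\<delta> c. coeff \<delta> 0 \<noteq> 0 \<and> pc \<delta> * Gk k = (\<Sum>m\<in>Dm (wT k). pc (c m) * basP m)"
  proof
    fix k
    obtain \<delta> c where "coeff \<delta> 0 \<noteq> 0" "pc \<delta> * Gk k = (\<Sum>m\<in>Dm (wT k). pc (c m) * basP m)"
      by (rule solve_basP[OF LF_HF[OF Gk_LF]])
    then show "\<exists>\<delta> c. coeff \<delta> 0 \<noteq> 0 \<and> pc \<delta> * Gk k = (\<Sum>m\<in>Dm (wT k). pc (c m) * basP m)" by blast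
  qed
  from choice[OF this] obtain \<delta> where
    "\<forall>k. \<exists>c. coeff (\<delta> k) 0 \<noteq> 0 \<and> pc (\<delta> k) * Gk k = (\<Sum>m\<in>Dm (wT k). pc (c m) * basP m)" by (elim exE)
  from choice[OF this] obtain c where
    dc: "\<forall>k. coeff (\<delta> k) 0 \<noteq> 0 \<and> pc (\<delta> k) * Gk k = (\<Sum>m\<in>Dm (wT k). pc (c k m) * basP m)" by (elim exE)
  have d: "coeff (\<delta> k) 0 \<noteq> 0" "pc (\<delta> k) * Gk k = (\<Sum>m\<in>Dm (wT k). pc (c k m) * basP m)" for k
    using spec[OF dc, of k] by (rule conjunct1, rule conjunct2)
  define u where "u k = (\<Sum>m\<in>Dm (wT k). if \<forall>i\<in>{..<n - 1}. kap m i = 0 then pc (c k m) * basP (red m) else 0)" for k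
  have ev_u: "ev a (u k) = cst (poly (\<delta> k) a) * phiS (thA a) (gA a k)" if good: "good (thA a)" for a k
  proof -
    note P = Phi_props[OF good_indep[OF good]]
    have "cst (poly (\<delta> k) a) * gA a k = (\<Sum>m\<in>Dm (wT k). cst (poly (c k m) a) * bas (thA a) epS m)"
      using arg_cong[OF d(2)[of k], of "ev a"] by (simp add: ev_mult ev_sum ev_pc ev_basP gA_def)
    then have "phiS (thA a) (cst (poly (\<delta> k) a) * gA a k) = (\<Sum>m\<in>Dm (wT k). cst (poly (c k m) a) * phiS (thA a) (bas (thA a) epS m))"
      by (simp only: Phi_sum[OF good_indep[OF good]])
    also have "\<dots> = ev a (u k)" unfolding u_def ev_sum
    proof (rule sum.cong[OF refl])
      fix m assume "m \<in> Dm (wT k)"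
      then have m: "m \<in> Ix" by simp
      show "cst (poly (c k m) a) * phiS (thA a) (bas (thA a) epS m)
          = ev a (if \<forall>i\<in>{..<n - 1}. kap m i = 0 then pc (c k m) * basP (red m) else 0)"
      proof (cases "\<forall>i\<in>{..<n - 1}. kap m i = 0")
        case True
        show ?thesis unfolding P(3)[OF m] if_P[OF True] ev_mult ev_pc ev_basP ..
      next
        case False
        show ?thesis unfolding P(3)[OF m] if_not_P[OF False] ev_0 mult_zero_right ..
      qed
    qed
    finally show ?thesis by (simp only: P(2))
  qed
  have "indep KK (\<lambda>k. coeff (u k) 0)"
  proof (rule indep_exchange[OF finite_KK indep_g0_phiS])
    fix k assume k: "k \<in> KK"
    have "coeff (u k) 0 = cst (coeff (\<delta> k) 0) * phiS theta0 (g0 k)"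
      using ev_u[of 0 k] good_theta0 by (simp add: thA_0 gA_0 ev_at_0 poly_0_coeff_0)
    then have "cst (1 / coeff (\<delta> k) 0) * coeff (u k) 0 = phiS theta0 (g0 k)"
      using d(1)[of k] by (simp add: mult.assoc[symmetric] cst_mult[symmetric])
    moreover have "cst (1 / coeff (\<delta> k) 0) * coeff (u k) 0 \<in> fv.span ((\<lambda>k. coeff (u k) 0) ` KK)"
      using k by (intro fv.span_scale[OF fv.span_base] imageI)
    ultimately show "phiS theta0 (g0 k) \<in> fv.span ((\<lambda>k. coeff (u k) 0) ` KK)" by simp
  qed
  from family_indep_cofinite[OF finite_KK this] good_cofinite show ?thesis
  proof eventually_elim
    fix a assume "indep KK (\<lambda>k. ev a (u k))" and good: "good (thA a)"
    then have "indep KK (\<lambda>k. cst (poly (\<delta> k) a) * phiS (thA a) (gA a k))" by (simp only: ev_u[OF good])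
    then show "indep KK (\<lambda>k. phiS (thA a) (gA a k))" by (rule indep_scale[OF _ finite_KK])
  qed
qed

text \<open>Within one degree, the exponent of \<open>th (n - 1)\<close> is determined by the other exponents.\<close>

lemma indep_tg:
  assumes good: "good th" and g: "\<And>k. g k \<in> Sd (wT k)" and ind: "indep KK (\<lambda>k. phiS th (g k))"
  shows "indep (Ix \<times> KK) (tg th g)"
proof (rule indep_graded[where e = wI])
  show "tg th g p \<in> Sd (wI p)" for p using good g by (intro tg_Sd) (auto simp: good_def)
next
  fix d
  show "indep {p\<in>Ix \<times> KK. wI p = d} (tg th g)"
  proof (rule indepI)
    fix J c j assume J: "finite J" "J \<subseteq> {p\<in>Ix \<times> KK. wI p = d}" "(\<Sum>j\<in>J. cst (c j) * tg th g j) = 0" "j \<in> J"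
    define A where "A = fst ` J"
    define c' where "c' \<kappa> k = (if (\<kappa>, k) \<in> J then c (\<kappa>, k) else 0)" for \<kappa> k
    have A: "finite A" "A \<subseteq> Ix" using J(1,2) by (auto simp: A_def)
    have "(\<Sum>\<kappa>\<in>A. \<Sum>k\<in>KK. cst (c' \<kappa> k) * (thp th \<kappa> * g k)) = (\<Sum>j\<in>A \<times> KK. cst (c' (fst j) (snd j)) * (thp th (fst j) * g (snd j)))"
      by (simp add: sum.cartesian_product split_def)
    also have "\<dots> = (\<Sum>j\<in>J. cst (c j) * tg th g j)"
    proof (rule sum.mono_neutral_cong_right)
      show "finite (A \<times> KK)" using A finite_KK by simp
      show "J \<subseteq> A \<times> KK" using J(2) by (force simp: A_def)
    qed (auto simp: c'_def)
    finally have rel: "(\<Sum>\<kappa>\<in>A. \<Sum>k\<in>KK. cst (c' \<kappa> k) * (thp th \<kappa> * g k)) = 0" using J(3) by simp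
    obtain \<mu> k where j: "j = (\<mu>, k)" "\<mu> \<in> Ix" "k \<in> KK" "wI (\<mu>, k) = d" using J(2,4) by blast
    have gS: "g k \<in> fv.span (bas th epS ` Ix)" for k using good_S[OF good] Sd_S[OF g[of k]] by (rule subsetD)
    have z: "(\<Sum>\<kappa>\<in>{\<kappa>\<in>A. \<forall>i\<in>{..<n - 1}. \<kappa> i = \<mu> i}. c' \<kappa> k) = 0"
      by (rule relation_coefficients[where g = g and c = c' and K = KK and \<mu> = \<mu> and E = "{..<n - 1}",
          OF good_indep[OF good] A finite_KK gS finite_lessThan ind rel j(3)])
    have "c' \<kappa> k = 0" if \<kappa>: "\<kappa> \<in> A" "\<forall>i\<in>{..<n - 1}. \<kappa> i = \<mu> i" "\<kappa> \<noteq> \<mu>" for \<kappa>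
    proof (rule ccontr)
      assume "c' \<kappa> k \<noteq> 0"
      then have "(\<kappa>, k) \<in> J" by (auto simp: c'_def split: if_splits)
      then have "\<kappa> \<in> Ix" "wI (\<kappa>, k) = d" using J(2) by auto
      then have eq: "(\<Sum>i<n. \<kappa> i * dd i) = (\<Sum>i<n. \<mu> i * dd i)" using j(4) by simp
      have n: "n = Suc (n - 1)" using n_pos by simp
      have "(\<Sum>i<n - 1. \<kappa> i * dd i) = (\<Sum>i<n - 1. \<mu> i * dd i)" using \<kappa>(2) by (intro sum.cong) auto
      moreover have "(\<Sum>i<n. h i) = (\<Sum>i<n - 1. h i) + h (n - 1)" for h :: "nat \<Rightarrow> nat"
        by (subst n) simp
      ultimately have "\<kappa> (n - 1) * dd (n - 1) = \<mu> (n - 1) * dd (n - 1)" using eq by simp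
      then have "\<kappa> (n - 1) = \<mu> (n - 1)" using dd_pos[of "n - 1"] by simp
      moreover have "i < n - 1 \<or> i = n - 1" if "i < n" for i using that by auto
      ultimately have "\<forall>i<n. \<kappa> i = \<mu> i" using \<kappa>(2) by (metis lessThan_iff)
      then show False using Ix_eq[OF \<open>\<kappa> \<in> Ix\<close> j(2)] \<kappa>(3) by simp
    qed
    moreover have "\<mu> \<in> A" using J(4) j(1) by (force simp: A_def)
    ultimately have "(\<Sum>\<kappa>\<in>{\<kappa>\<in>A. \<forall>i\<in>{..<n - 1}. \<kappa> i = \<mu> i}. c' \<kappa> k) = (\<Sum>\<kappa>\<in>{\<mu>}. c' \<kappa> k)"
      using A(1) by (intro sum.mono_neutral_right) auto
    then have "c' \<mu> k = 0" using z by simp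
    then show "c j = 0" using J(4) j(1) by (simp add: c'_def)
  qed
qed

lemma Lam_free_cofinite:
  "\<forall>\<^sub>F a in cofinite. \<exists>th g. (\<forall>i<n. th i \<in> Lam r s a) \<and> (\<forall>k\<in>KK. g k \<in> Lam r s a) \<and>
     Lam r s a = fv.span (tg th g ` (Ix \<times> KK)) \<and> indep (Ix \<times> KK) (tg th g)"
proof -
  have nz: "\<forall>\<^sub>F a in cofinite. a \<noteq> (0::complex)" by (simp add: eventually_cofinite)
  show ?thesis using nz good_cofinite indep_phiS_cofinite Lam_eq_Ma_cofinite
  proof eventually_elim
    fix a :: complex
    assume "a \<noteq> 0" "good (thA a)" "indep KK (\<lambda>k. phiS (thA a) (gA a k))" "Lam r s a = Ma a"
    then show "\<exists>th g. (\<forall>i<n. th i \<in> Lam r s a) \<and> (\<forall>k\<in>KK. g k \<in> Lam r s a) \<and>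
        Lam r s a = fv.span (tg th g ` (Ix \<times> KK)) \<and> indep (Ix \<times> KK) (tg th g)"
      by (intro exI[of _ "thA a"] exI[of _ "gA a"] conjI allI impI ballI thA_Lam gA_Lam indep_tg gA_Sd)
  qed
qed

end

section \<open>Grade and height\<close>

definition fring :: "('x \<Rightarrow> complex) set \<Rightarrow> ('x \<Rightarrow> complex) ring" where
  "fring A = \<lparr>carrier = A, monoid.mult = (*), one = 1, ring.zero = 0, ring.add = (+)\<rparr>"

lemma fring_simps [simp]: "carrier (fring A) = A" "f \<otimes>\<^bsub>fring A\<^esub> g = f * g" "\<one>\<^bsub>fring A\<^esub> = 1"
  "\<zero>\<^bsub>fring A\<^esub> = 0" "f \<oplus>\<^bsub>fring A\<^esub> g = f + g"
  by (simp_all add: fring_def)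

lemma Lambda_ring_fring: "Lambda_ring r s a = fring (Lam r s a)"
  unfolding Lambda_ring_def fring_def by (simp add: fun_eq_iff fapp)

definition prime_in :: "('x \<Rightarrow> complex) set \<Rightarrow> ('x \<Rightarrow> complex) set \<Rightarrow> bool" where
  "prime_in A P \<longleftrightarrow> idl_in A P \<and> 1 \<notin> P \<and> (\<forall>a\<in>A. \<forall>b\<in>A. a * b \<in> P \<longrightarrow> a \<in> P \<or> b \<in> P)"

context
  fixes A :: "('x \<Rightarrow> complex) set"
  assumes A: "subalg A"
begin

lemma cring_fring: "cring (fring A)"
proof (rule cringI)
  show "abelian_group (fring A)"
  proof (rule abelian_groupI)
    fix x assume "x \<in> carrier (fring A)"
    then show "\<exists>y\<in>carrier (fring A). y \<oplus>\<^bsub>fring A\<^esub> x = \<zero>\<^bsub>fring A\<^esub>"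
      using subalg_uminus[OF A, of x] by (intro bexI[of _ "- x"]) auto
  qed (auto simp: subalg_add[OF A] subalg_0[OF A] add_ac)
  show "Group.comm_monoid (fring A)"
    by (rule comm_monoidI) (auto simp: subalg_mult[OF A] subalg_1[OF A] mult_ac)
qed (simp add: distrib_right)

lemma idl_in_one: "idl_in A I \<Longrightarrow> 1 \<in> I \<Longrightarrow> I = A"
  unfolding idl_in_def by (metis mult_1_right subset_antisym subsetI)

lemma ideal_fring: "ideal I (fring A) \<longleftrightarrow> idl_in A I"
proof
  assume "ideal I (fring A)"
  then interpret ideal I "fring A" .
  show "idl_in A I"
    unfolding idl_in_def using a_subset additive_subgroup.zero_closed[OF additive_subgroup_axioms]
      additive_subgroup.a_closed[OF additive_subgroup_axioms] I_l_closed by auto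
next
  assume I: "idl_in A I"
  interpret cring "fring A" by (rule cring_fring)
  have neg: "\<ominus>\<^bsub>fring A\<^esub> x \<in> I" if "x \<in> I" for x
  proof -
    have x: "x \<in> A" using I that by (auto simp: idl_in_def)
    then have "\<ominus>\<^bsub>fring A\<^esub> x = - x" using subalg_uminus[OF A x] by (intro minus_equality) auto
    moreover have "cst (- 1) * x \<in> I" using I that subalg_cst[OF A] by (simp only: idl_in_def)
    ultimately show ?thesis by (simp add: cst_neg1)
  qed
  show "ideal I (fring A)"
  proof (rule idealI)
    show "subgroup I (add_monoid (fring A))"
      using I neg by (intro subgroup.intro) (auto simp: idl_in_def a_inv_def)
    show "ring (fring A)" by (rule ring_axioms)
    fix a x assume "a \<in> I" "x \<in> carrier (fring A)"
    then have "x * a \<in> I" using I by (simp add: idl_in_def)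
    then show "x \<otimes>\<^bsub>fring A\<^esub> a \<in> I" "a \<otimes>\<^bsub>fring A\<^esub> x \<in> I" by (simp_all add: mult.commute[of a x])
  qed
qed

lemma prime_in_fring: "primeideal P (fring A) \<longleftrightarrow> prime_in A P"
proof
  assume "primeideal P (fring A)"
  then interpret primeideal P "fring A" .
  have "idl_in A P" using is_ideal ideal_fring by simp
  moreover have "1 \<notin> P" using idl_in_one[OF calculation] I_notcarr by auto
  ultimately show "prime_in A P" using I_prime by (auto simp: prime_in_def)
next
  assume P: "prime_in A P"
  then have "P \<noteq> A" using subalg_1[OF A] by (auto simp: prime_in_def)
  then show "primeideal P (fring A)"
    using P cring_fring ideal_fring by (intro primeidealI) (auto simp: prime_in_def)
qed

lemma genideal_fring:
  assumes G: "finite G" "G \<subseteq> A" shows "genideal (fring A) G = gen_by A G"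
proof
  interpret cring "fring A" by (rule cring_fring)
  note B = subrng_subalg[OF A]
  have "gen_by A G \<subseteq> A" unfolding gen_by_def
    using G(2) by (auto intro!: subalg_sum[OF A] subalg_mult[OF A])
  then have "idl_in A (gen_by A G)"
    unfolding idl_in_def using gen_by_0[OF B] gen_by_add[OF B] gen_by_mult[OF B] by blast
  then show "genideal (fring A) G \<subseteq> gen_by A G"
    using gen_by_base[OF B G(1)] by (intro genideal_minimal) (auto simp: ideal_fring)
  have "idl_in A (genideal (fring A) G)" using genideal_ideal[of G] G(2) ideal_fring by simp
  moreover have "G \<subseteq> genideal (fring A) G" using genideal_self[of G] G(2) by simp
  ultimately show "gen_by A G \<subseteq> genideal (fring A) G"
    unfolding gen_by_def by (auto intro!: idl_in_sum)
qed

lemma noetherian_fring: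
  assumes "noeth A" shows "noetherian_ring (fring A)"
proof -
  interpret cring "fring A" by (rule cring_fring)
  show ?thesis
  proof (rule noetherian_ringI)
    fix I assume "ideal I (fring A)"
    then have I: "idl_in A I" by (simp add: ideal_fring)
    then obtain G where G: "finite G" "G \<subseteq> I" "I \<subseteq> gen_by A G" using assms by (auto simp: noeth_def)
    have GA: "G \<subseteq> A" using G(2) I by (auto simp: idl_in_def)
    have "gen_by A G \<subseteq> I" unfolding gen_by_def using I G(2) by (auto intro!: idl_in_sum)
    then have "I = genideal (fring A) G" using G(3) genideal_fring[OF G(1) GA] by auto
    then show "\<exists>G\<subseteq>carrier (fring A). finite G \<and> I = genideal (fring A) G" using G(1) GA by auto
  qed
qed

lemma idl_in_adjoin:
  assumes P: "idl_in A P" and a: "a \<in> A"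
  shows "idl_in A {p + q * a | p q. p \<in> P \<and> q \<in> A}" "P \<subseteq> {p + q * a | p q. p \<in> P \<and> q \<in> A}"
    "a \<in> {p + q * a | p q. p \<in> P \<and> q \<in> A}"
proof -
  let ?J = "{p + q * a | p q. p \<in> P \<and> q \<in> A}"
  have P': "P \<subseteq> A" "0 \<in> P" "\<And>x y. x \<in> P \<Longrightarrow> y \<in> P \<Longrightarrow> x + y \<in> P" "\<And>x y. x \<in> A \<Longrightarrow> y \<in> P \<Longrightarrow> x * y \<in> P"
    using P by (auto simp: idl_in_def)
  show PJ: "P \<subseteq> ?J"
  proof
    fix p assume "p \<in> P"
    then show "p \<in> ?J" using subalg_0[OF A] by (intro CollectI exI[of _ p] exI[of _ 0]) simp
  qed
  show "a \<in> ?J" using subalg_1[OF A] P'(2) by (intro CollectI exI[of _ 0] exI[of _ 1]) simp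
  show "idl_in A ?J" unfolding idl_in_def
  proof (intro conjI ballI)
    show "?J \<subseteq> A" using P'(1) a by (auto intro!: subalg_add[OF A] subalg_mult[OF A])
    show "0 \<in> ?J" using PJ P'(2) by (rule subsetD)
  next
    fix x y assume "x \<in> ?J" "y \<in> ?J"
    then obtain p q p' q' where "x = p + q * a" "y = p' + q' * a" "p \<in> P" "q \<in> A" "p' \<in> P" "q' \<in> A" by blast
    then show "x + y \<in> ?J"
      by (intro CollectI exI[of _ "p + p'"] exI[of _ "q + q'"]) (auto simp: algebra_simps P' subalg_add[OF A])
  next
    fix b x assume b: "b \<in> A" and "x \<in> ?J"
    then obtain p q where "x = p + q * a" "p \<in> P" "q \<in> A" by blast
    then show "b * x \<in> ?J" using b
      by (intro CollectI exI[of _ "b * p"] exI[of _ "b * q"]) (auto simp: algebra_simps P' subalg_mult[OF A])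
  qed
qed

text \<open>An ideal that is maximal among those avoiding a multiplicative set is prime; Zorn's
  lemma provides one.\<close>

lemma prime_avoiding:
  assumes I: "idl_in A I" and M: "1 \<in> M" "\<And>x y. x \<in> M \<Longrightarrow> y \<in> M \<Longrightarrow> x * y \<in> M" and IM: "I \<inter> M = {}"
  obtains P where "prime_in A P" "I \<subseteq> P" "P \<inter> M = {}"
proof -
  define F where "F = {J. idl_in A J \<and> I \<subseteq> J \<and> J \<inter> M = {}}"
  have "\<exists>P\<in>F. \<forall>J\<in>F. P \<subseteq> J \<longrightarrow> J = P"
  proof (rule subset_Zorn_nonempty)
    show "F \<noteq> {}" using I IM by (auto simp: F_def)
    fix C assume C: "C \<noteq> {}" "subset.chain F C"
    then have CF: "C \<subseteq> F" and lin: "\<And>U V. U \<in> C \<Longrightarrow> V \<in> C \<Longrightarrow> U \<subseteq> V \<or> V \<subseteq> U" by (auto simp: subset_chain_def)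
    have CI: "idl_in A U" "I \<subseteq> U" "U \<inter> M = {}" if "U \<in> C" for U using CF that by (auto simp: F_def)
    have "idl_in A (\<Union>C)" unfolding idl_in_def
    proof (intro conjI ballI)
      show "\<Union>C \<subseteq> A" using CI(1) unfolding idl_in_def by blast
      show "0 \<in> \<Union>C" using C(1) CI(1) by (auto simp: idl_in_def)
    next
      fix x y assume "x \<in> \<Union>C" "y \<in> \<Union>C"
      then obtain U V where UV: "U \<in> C" "V \<in> C" "x \<in> U" "y \<in> V" by blast
      have "\<exists>Z\<in>C. x \<in> Z \<and> y \<in> Z" using lin[OF UV(1,2)] UV by blast
      then show "x + y \<in> \<Union>C" using CI(1) by (auto simp: idl_in_def)
    next
      fix b x assume "b \<in> A" "x \<in> \<Union>C"
      then show "b * x \<in> \<Union>C" using CI(1) unfolding idl_in_def by blast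
    qed
    then show "\<Union>C \<in> F" using C(1) CI(2,3) by (auto simp: F_def)
  qed
  then obtain P where P: "idl_in A P" "I \<subseteq> P" "P \<inter> M = {}" and max: "\<And>J. J \<in> F \<Longrightarrow> P \<subseteq> J \<Longrightarrow> J = P"
    by (auto simp: F_def)
  have P': "P \<subseteq> A" "0 \<in> P" "\<And>x y. x \<in> P \<Longrightarrow> y \<in> P \<Longrightarrow> x + y \<in> P" "\<And>x y. x \<in> A \<Longrightarrow> y \<in> P \<Longrightarrow> x * y \<in> P"
    using P(1) by (auto simp: idl_in_def)
  have meet: "\<exists>p q. p \<in> P \<and> q \<in> A \<and> p + q * a \<in> M" if a: "a \<in> A" "a \<notin> P" for a
  proof (rule ccontr)
    assume no: "\<nexists>p q. p \<in> P \<and> q \<in> A \<and> p + q * a \<in> M"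
    let ?J = "{p + q * a | p q. p \<in> P \<and> q \<in> A}"
    have "?J \<in> F" unfolding F_def using idl_in_adjoin[OF P(1) a(1)] P(2) no by blast
    then have "?J = P" using idl_in_adjoin(2)[OF P(1) a(1)] by (rule max)
    then show False using idl_in_adjoin(3)[OF P(1) a(1)] a(2) by simp
  qed
  have "prime_in A P" unfolding prime_in_def
  proof (intro conjI ballI impI)
    show "1 \<notin> P" using M(1) P(3) by blast
    fix a b assume ab: "a \<in> A" "b \<in> A" "a * b \<in> P"
    show "a \<in> P \<or> b \<in> P"
    proof (rule ccontr)
      assume "\<not> (a \<in> P \<or> b \<in> P)"
      then obtain p q p' q' where m: "p \<in> P" "q \<in> A" "p + q * a \<in> M" "p' \<in> P" "q' \<in> A" "p' + q' * b \<in> M"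
        using meet[OF ab(1)] meet[OF ab(2)] by blast
      have "(p + q * a) * (p' + q' * b) = (p' + q' * b) * p + (q * a * p' + (q * q') * (a * b))"
        by (simp add: algebra_simps)
      also have "\<dots> \<in> P"
      proof (intro P'(3))
        show "(p' + q' * b) * p \<in> P" using m ab P'(1) by (intro P'(4) subalg_add[OF A] subalg_mult[OF A]) auto
        show "q * a * p' \<in> P" using m ab by (intro P'(4) subalg_mult[OF A])
        show "q * q' * (a * b) \<in> P" by (rule P'(4)[OF subalg_mult[OF A m(2,5)] ab(3)])
      qed
      finally show False using M(2)[OF m(3,6)] P(3) by blast
    qed
  qed (rule P(1))
  then show ?thesis using P(2,3) by (rule that)
qed

text \<open>The multiplicative set \<open>M\<close> is generated by the complement of
  \<open>P\<close> and the next element x of the sequence. It avoids the ideal of the earlier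
  elements because x is regular modulo that ideal. A prime over this ideal that avoids
  \<open>M\<close> lies in \<open>P\<close> and misses x.\<close>

lemma regular_seq_prime_below:
  assumes reg: "regular_seq (fring A) xs" and k: "k < length xs"
    and P: "prime_in A P" "set (take (Suc k) xs) \<subseteq> P"
  obtains P' where "prime_in A P'" "set (take k xs) \<subseteq> P'" "P' \<subset> P"
proof -
  let ?I = "genideal (fring A) (set (take k xs))" and ?x = "xs ! k"
  have xsA: "set xs \<subseteq> A" using reg by (simp add: regular_seq_def)
  then have G: "finite (set (take k xs))" "set (take k xs) \<subseteq> A" using set_take_subset[of k xs] by auto
  have xA: "?x \<in> A" using xsA k by auto
  have r: "b \<in> ?I" if "b \<in> A" "?x * b \<in> ?I" for b
    using reg k that by (auto simp: regular_seq_def)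
  interpret cring "fring A" by (rule cring_fring)
  have I: "idl_in A ?I" using genideal_ideal[of "set (take k xs)"] G(2) ideal_fring by simp
  have GI: "set (take k xs) \<subseteq> ?I" using genideal_self[of "set (take k xs)"] G(2) by simp
  have sub: "set (take k xs) \<subseteq> P" "?x \<in> P"
    using P(2) k by (auto simp: take_Suc_conv_app_nth)
  have Pi: "idl_in A P" and P1: "1 \<notin> P" and Pp: "\<And>a b. a \<in> A \<Longrightarrow> b \<in> A \<Longrightarrow> a * b \<in> P \<Longrightarrow> a \<in> P \<or> b \<in> P"
    using P(1) by (auto simp: prime_in_def)
  have IP: "?I \<subseteq> P" using sub(1) Pi ideal_fring by (intro genideal_minimal) auto
  define M where "M = {?x ^ i * t | i t. t \<in> A \<and> t \<notin> P}"
  have M1: "t \<in> M" if "t \<in> A" "t \<notin> P" for t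
    unfolding M_def using that by (intro CollectI exI[of _ 0] exI[of _ t]) simp
  have pw: "t \<in> ?I" if "t \<in> A" "?x ^ i * t \<in> ?I" for i t
    using that(2)
  proof (induction i)
    case (Suc i)
    have "?x ^ i * t \<in> A" by (intro subalg_mult[OF A] subalg_power[OF A] xA that(1))
    then show ?case using r[of "?x ^ i * t"] Suc by (simp add: mult.assoc)
  qed simp
  have "?I \<inter> M = {}" using pw IP by (auto simp: M_def)
  moreover have "x * y \<in> M" if "x \<in> M" "y \<in> M" for x y
  proof -
    obtain i t j u where *: "x = ?x ^ i * t" "y = ?x ^ j * u" "t \<in> A" "t \<notin> P" "u \<in> A" "u \<notin> P"
      using \<open>x \<in> M\<close> \<open>y \<in> M\<close> unfolding M_def by blast
    have "t * u \<notin> P" using Pp *(3-6) by blast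
    then show ?thesis unfolding M_def using *
      by (intro CollectI exI[of _ "i + j"] exI[of _ "t * u"]) (auto simp: power_add mult_ac subalg_mult[OF A])
  qed
  moreover have "1 \<in> M" using M1[OF subalg_1[OF A] P1] .
  ultimately obtain P' where P': "prime_in A P'" "?I \<subseteq> P'" "P' \<inter> M = {}"
    using prime_avoiding[OF I] by metis
  have "P' \<subseteq> A" using P'(1) by (auto simp: prime_in_def idl_in_def)
  then have "P' \<subseteq> P" using M1 P'(3) by blast
  moreover have "?x \<in> M" unfolding M_def using subalg_1[OF A] P1
    by (intro CollectI exI[of _ 1] exI[of _ 1]) simp
  ultimately have "P' \<subset> P" using sub(2) P'(3) by blast
  then show ?thesis using that[of P'] P'(1,2) GI by blast
qed

lemma regular_seq_chain:
  assumes reg: "regular_seq (fring A) xs" and P: "prime_in A P" "set (take k xs) \<subseteq> P" and k: "k \<le> length xs"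
  shows "\<exists>Pc. (\<forall>i\<le>k. prime_in A (Pc i)) \<and> (\<forall>i<k. Pc i \<subset> Pc (Suc i)) \<and> Pc k = P"
  using P k
proof (induction k arbitrary: P)
  case 0
  then show ?case by (intro exI[of _ "\<lambda>_. P"]) auto
next
  case (Suc k)
  then have kl: "k < length xs" by simp
  obtain P' where P': "prime_in A P'" "set (take k xs) \<subseteq> P'" "P' \<subset> P"
    by (rule regular_seq_prime_below[OF reg kl Suc.prems(1,2)])
  from Suc.IH[OF P'(1,2)] kl obtain Pc where Pc: "\<forall>i\<le>k. prime_in A (Pc i)" "\<forall>i<k. Pc i \<subset> Pc (Suc i)" "Pc k = P'"
    by auto
  show ?case
  proof (intro exI[of _ "Pc(Suc k := P)"] conjI allI impI)
    fix i assume "i \<le> Suc k"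
    then show "prime_in A ((Pc(Suc k := P)) i)" using Pc(1) Suc.prems(1) by (cases "i = Suc k") auto
  next
    fix i assume "i < Suc k"
    then show "(Pc(Suc k := P)) i \<subset> (Pc(Suc k := P)) (Suc i)" using Pc(2,3) P'(3) by (cases "i = k") auto
  qed simp
qed

lemma grade_le_height:
  assumes m: "primeideal m (fring A)" shows "grade (fring A) m \<le> height (fring A) m"
  unfolding grade_def
proof (rule Sup_least)
  fix e assume "e \<in> {enat (length xs) | xs. regular_seq (fring A) xs \<and> set xs \<subseteq> m}"
  then obtain xs where xs: "e = enat (length xs)" "regular_seq (fring A) xs" "set xs \<subseteq> m" by blast
  have "\<exists>Pc. (\<forall>i\<le>length xs. prime_in A (Pc i)) \<and> (\<forall>i<length xs. Pc i \<subset> Pc (Suc i)) \<and> Pc (length xs) = m"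
    using m xs(3) by (intro regular_seq_chain[OF xs(2)]) (auto simp: prime_in_fring)
  then show "e \<le> height (fring A) m"
    unfolding height_def xs(1) prime_in_fring by (intro Sup_upper) blast
qed

text \<open>An algebraic relation between \<open>x 0, \<dots>, x (N - 1)\<close> is divided by the least power of \<open>x 0\<close> and then
  reduced modulo \<open>x 0\<close>, and so on; the remaining coefficient is a nonzero constant in \<open>P N\<close>.\<close>

lemma chain_no_relation:
  assumes P: "\<And>i. i \<le> N \<Longrightarrow> prime_in A (P i)" and mono: "\<And>i. i < N \<Longrightarrow> P i \<subseteq> P (Suc i)"
    and x: "\<And>i. i < N \<Longrightarrow> x i \<in> P (Suc i)" "\<And>i. i < N \<Longrightarrow> x i \<notin> P i"
    and B: "finite B" "B \<subseteq> {..<N} \<rightarrow>\<^sub>E UNIV" "B \<noteq> {}" and c: "\<And>\<beta>. \<beta> \<in> B \<Longrightarrow> c \<beta> \<noteq> 0"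
    and rel: "(\<Sum>\<beta>\<in>B. cst (c \<beta>) * (\<Prod>i<N. x i ^ \<beta> i)) = 0"
  shows False
proof -
  have PA: "P i \<subseteq> A" "0 \<in> P i" "1 \<notin> P i" "\<And>x y. x \<in> P i \<Longrightarrow> y \<in> P i \<Longrightarrow> x + y \<in> P i"
    "\<And>x y. x \<in> A \<Longrightarrow> y \<in> P i \<Longrightarrow> x * y \<in> P i" "\<And>a b. a \<in> A \<Longrightarrow> b \<in> A \<Longrightarrow> a * b \<in> P i \<Longrightarrow> a \<in> P i \<or> b \<in> P i" if "i \<le> N" for i
    using P[OF that] by (auto simp: prime_in_def idl_in_def)
  have P_sum: "(\<Sum>j\<in>J. F j) \<in> P i" if "i \<le> N" "\<And>j. j \<in> J \<Longrightarrow> F j \<in> P i" for i J F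
    using that(2) by (induction J rule: infinite_finite_induct) (auto intro: PA[OF that(1)])
  have xA: "x i \<in> A" if "i < N" for i
  proof -
    have "P (Suc i) \<subseteq> A" by (rule PA(1)) (use that in simp)
    then show ?thesis using x(1)[OF that] by (rule subsetD)
  qed
  have "\<exists>B'\<subseteq>B. B' \<noteq> {} \<and> (\<forall>\<beta>\<in>B'. \<forall>\<gamma>\<in>B'. \<forall>i<j. \<beta> i = \<gamma> i) \<and>
      (\<Sum>\<beta>\<in>B'. cst (c \<beta>) * (\<Prod>i\<in>{j..<N}. x i ^ \<beta> i)) \<in> P j" if "j \<le> N" for j
    using that
  proof (induction j)
    case 0
    show ?case using B(3) rel PA(2)[of 0] by (intro exI[of _ B]) (auto simp: atLeast0LessThan)
  next
    case (Suc j)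
    then have j: "j < N" "j \<le> N" by auto
    obtain B' where B': "B' \<subseteq> B" "B' \<noteq> {}" "\<forall>\<beta>\<in>B'. \<forall>\<gamma>\<in>B'. \<forall>i<j. \<beta> i = \<gamma> i"
      "(\<Sum>\<beta>\<in>B'. cst (c \<beta>) * (\<Prod>i\<in>{j..<N}. x i ^ \<beta> i)) \<in> P j" using Suc by auto
    \<comment> \<open>This power of \<open>x j\<close> can be cancelled, since \<open>x j\<close> is
      outside the prime \<open>P j\<close>; afterwards some term is free of \<open>x j\<close>, and
      the others lie in \<open>P (Suc j)\<close>.\<close>
    define e where "e = (LEAST e. \<exists>\<beta>\<in>B'. \<beta> j = e)"
    have "\<exists>e. \<exists>\<beta>\<in>B'. \<beta> j = e" using B'(2) by blast
    then have e1: "\<exists>\<beta>\<in>B'. \<beta> j = e" unfolding e_def by (rule LeastI_ex)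
    have e2: "e \<le> \<beta> j" if "\<beta> \<in> B'" for \<beta> unfolding e_def using that by (intro Least_le) blast
    let ?R = "\<lambda>\<beta>. \<Prod>i\<in>{Suc j..<N}. x i ^ \<beta> i"
    have R: "(\<Prod>i\<in>{j..<N}. x i ^ \<beta> i) = x j ^ \<beta> j * ?R \<beta>" for \<beta> using j by (simp add: prod.atLeast_Suc_lessThan)
    have RA: "?R \<beta> \<in> A" for \<beta> using xA by (intro subalg_prod[OF A] subalg_power[OF A]) auto
    define F where "F = (\<Sum>\<beta>\<in>B'. cst (c \<beta>) * (x j ^ (\<beta> j - e) * ?R \<beta>))"
    have FA: "F \<in> A" unfolding F_def
      by (intro subalg_sum[OF A] subalg_mult[OF A] subalg_cst[OF A] subalg_power[OF A] RA xA j)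
    have "(\<Sum>\<beta>\<in>B'. cst (c \<beta>) * (\<Prod>i\<in>{j..<N}. x i ^ \<beta> i)) = x j ^ e * F"
      unfolding F_def sum_distrib_left R
    proof (rule sum.cong[OF refl])
      fix \<beta> assume "\<beta> \<in> B'"
      then have "x j ^ \<beta> j = x j ^ e * x j ^ (\<beta> j - e)" using e2[of \<beta>] by (simp add: power_add[symmetric])
      then show "cst (c \<beta>) * (x j ^ \<beta> j * ?R \<beta>) = x j ^ e * (cst (c \<beta>) * (x j ^ (\<beta> j - e) * ?R \<beta>))"
        by (simp only: mult_ac)
    qed
    then have "x j ^ e * F \<in> P j" using B'(4) by simp
    then have "F \<in> P j"
    proof (induction e)
      case (Suc e)
      have "x j ^ e * F \<in> A" by (intro subalg_mult[OF A] subalg_power[OF A] xA FA j)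
      then show ?case using PA(6)[OF j(2) xA[OF j(1)], of "x j ^ e * F"] Suc x(2)[OF j(1)] by (simp add: mult.assoc)
    qed simp
    then have FP: "F \<in> P (Suc j)" using mono[OF j(1)] by blast
    let ?B = "{\<beta>\<in>B'. \<beta> j = e}"
    have finB': "finite B'" using B(1) B'(1) finite_subset by blast
    have split: "F = (\<Sum>\<beta>\<in>?B. cst (c \<beta>) * ?R \<beta>) + (\<Sum>\<beta>\<in>B' - ?B. cst (c \<beta>) * (x j ^ (\<beta> j - e) * ?R \<beta>))"
    proof -
      have "F = (\<Sum>\<beta>\<in>?B. cst (c \<beta>) * (x j ^ (\<beta> j - e) * ?R \<beta>)) + (\<Sum>\<beta>\<in>B' - ?B. cst (c \<beta>) * (x j ^ (\<beta> j - e) * ?R \<beta>))"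
        unfolding F_def by (subst add.commute, rule sum.subset_diff) (use finB' in auto)
      also have "(\<Sum>\<beta>\<in>?B. cst (c \<beta>) * (x j ^ (\<beta> j - e) * ?R \<beta>)) = (\<Sum>\<beta>\<in>?B. cst (c \<beta>) * ?R \<beta>)"
        by (intro sum.cong refl) simp
      finally show ?thesis .
    qed
    have rest: "(\<Sum>\<beta>\<in>B' - ?B. cst (c \<beta>) * (x j ^ (\<beta> j - e) * ?R \<beta>)) \<in> P (Suc j)"
    proof (rule P_sum[OF Suc.prems])
      fix \<beta> assume \<beta>: "\<beta> \<in> B' - ?B"
      then have "\<beta> j - e = Suc (\<beta> j - e - 1)" using e2[of \<beta>] by auto
      then have pw: "x j ^ (\<beta> j - e) = x j * x j ^ (\<beta> j - e - 1)" by (metis power_Suc)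
      have "(cst (c \<beta>) * (x j ^ (\<beta> j - e - 1) * ?R \<beta>)) * x j \<in> P (Suc j)"
        by (intro PA(5)[OF Suc.prems] x(1) j subalg_mult[OF A] subalg_cst[OF A] subalg_power[OF A] RA xA)
      then show "cst (c \<beta>) * (x j ^ (\<beta> j - e) * ?R \<beta>) \<in> P (Suc j)" unfolding pw by (simp only: mult_ac)
    qed
    have "cst (- 1) * (\<Sum>\<beta>\<in>B' - ?B. cst (c \<beta>) * (x j ^ (\<beta> j - e) * ?R \<beta>)) \<in> P (Suc j)"
      by (rule PA(5)[OF Suc.prems subalg_cst[OF A] rest])
    from PA(4)[OF Suc.prems FP this] have "(\<Sum>\<beta>\<in>?B. cst (c \<beta>) * ?R \<beta>) \<in> P (Suc j)"
      unfolding split by (simp add: cst_neg1)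
    moreover have "\<forall>\<beta>\<in>?B. \<forall>\<gamma>\<in>?B. \<forall>i<Suc j. \<beta> i = \<gamma> i" using B'(3) by (auto simp: less_Suc_eq)
    ultimately show ?case using B'(1) e1 by (intro exI[of _ ?B]) blast
  qed
  from this[OF order_refl] obtain B' where B': "B' \<subseteq> B" "B' \<noteq> {}" "\<forall>\<beta>\<in>B'. \<forall>\<gamma>\<in>B'. \<forall>i<N. \<beta> i = \<gamma> i"
    "(\<Sum>\<beta>\<in>B'. cst (c \<beta>) * (\<Prod>i\<in>{N..<N}. x i ^ \<beta> i)) \<in> P N" by blast
  obtain \<beta> where \<beta>: "\<beta> \<in> B'" using B'(2) by blast
  have "\<gamma> = \<beta>" if "\<gamma> \<in> B'" for \<gamma>
  proof (rule PiE_ext[of _ "{..<N}" "\<lambda>_. UNIV"])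
    show "\<gamma> \<in> {..<N} \<rightarrow>\<^sub>E UNIV" "\<beta> \<in> {..<N} \<rightarrow>\<^sub>E UNIV" using B(2) B'(1) that \<beta> by blast+
    fix i assume "i \<in> {..<N}"
    then show "\<gamma> i = \<beta> i" using B'(3) that \<beta> by blast
  qed
  then have "B' = {\<beta>}" using \<beta> by blast
  then have "cst (c \<beta>) \<in> P N" using B'(4) by simp
  then have "cst (1 / c \<beta>) * cst (c \<beta>) \<in> P N" by (intro PA(5)[OF order_refl] subalg_cst[OF A])
  then have "1 \<in> P N" using c[of \<beta>] \<beta> B'(1) by (auto simp: cst_mult[symmetric])
  then show False using PA(3)[OF order_refl] by simp
qed

text \<open>Over the complex numbers \<open>q\<close> splits into linear factors; a prime ideal
  containing the product contains one of them, as it contains no nonzero constant.\<close>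

lemma prime_poly_root:
  fixes q :: "complex poly"
  assumes P: "prime_in A P" and th: "\<theta> \<in> A" and q: "q \<noteq> 0" "poly (pc q) \<theta> \<in> P"
  shows "\<exists>c. \<theta> - cst c \<in> P"
  using q
proof (induction "degree q" arbitrary: q)
  case 0
  then obtain b where b: "q = [:b:]" "b \<noteq> 0" by (auto elim!: degree_eq_zeroE)
  have "(pc [:b:] :: ('x \<Rightarrow> complex) poly) = [:cst b:]" by (rule poly_eqI) (simp add: coeff_pc coeff_pCons split: nat.split)
  then have "cst b \<in> P" using 0 b by simp
  then have "cst (1 / b) * cst b \<in> P" using P subalg_cst[OF A] by (simp only: prime_in_def idl_in_def)
  then have "1 \<in> P" using b(2) by (simp add: cst_mult[symmetric])
  then show ?case using P by (simp add: prime_in_def)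
next
  case (Suc d)
  then have "\<not> constant (poly q)" by (simp add: constant_degree)
  from fundamental_theorem_of_algebra[OF this] obtain c where "poly q c = 0" by blast
  then obtain q' where q': "q = [:- c, 1:] * q'" by (auto simp: poly_eq_0_iff_dvd elim: dvdE)
  have q0: "q' \<noteq> 0" using Suc.prems q' by auto
  have "degree q = degree [:- c, 1:] + degree q'" unfolding q' by (rule degree_mult_eq) (use q0 in auto)
  then have d: "d = degree q'" using Suc.hyps(2) by simp
  have lin: "pc [:- c, 1:] = [:- cst c, 1:]"
    by (rule poly_eqI) (auto simp: coeff_pc coeff_pCons cst_uminus split: nat.split)
  have "poly (pc q) \<theta> = (\<theta> - cst c) * poly (pc q') \<theta>" unfolding q' pc_mult lin by (simp add: left_diff_distrib)
  moreover have "poly (pc q') \<theta> \<in> A"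
    unfolding poly_altdef by (intro subalg_sum[OF A] subalg_mult[OF A] subalg_power[OF A] th) (simp add: coeff_pc subalg_cst[OF A])
  moreover have "\<theta> - cst c \<in> A" by (intro subalg_diff[OF A] th subalg_cst[OF A])
  ultimately have "\<theta> - cst c \<in> P \<or> poly (pc q') \<theta> \<in> P" using Suc.prems(2) P unfolding prime_in_def by metis
  then show ?case using Suc.hyps(1)[OF d q0] by blast
qed

end

context rs
begin

section \<open>Counting monomials in boxes bounds the height\<close>

definition Bx :: "nat \<Rightarrow> (nat \<Rightarrow> nat) set" where "Bx E = ({..<n} \<rightarrow>\<^sub>E {..E})"

lemma finite_Bx: "finite (Bx E)" and card_Bx: "card (Mon ` Bx E) \<le> Suc E ^ n"
proof -
  show f: "finite (Bx E)" unfolding Bx_def by (intro finite_PiE) auto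
  have "card (Bx E) = Suc E ^ n" unfolding Bx_def by (simp add: card_PiE)
  then show "card (Mon ` Bx E) \<le> Suc E ^ n" using card_image_le[OF f, of Mon] by simp
qed

lemma Mon_Bx: assumes "\<And>i. i < n \<Longrightarrow> m i \<le> E" shows "Mon m \<in> Mon ` Bx E"
proof (rule image_eqI[of _ _ "restrict m {..<n}"])
  show "Mon m = Mon (restrict m {..<n})" unfolding Mon_def by (intro prod.cong) auto
  show "restrict m {..<n} \<in> Bx E" using assms by (auto simp: Bx_def)
qed

lemma Bx_mult:
  assumes "f \<in> fv.span (Mon ` Bx E)" "g \<in> fv.span (Mon ` Bx F)" shows "f * g \<in> fv.span (Mon ` Bx (E + F))"
proof (rule span_mult_in[OF fv.subspace_span _ assms])
  fix x y assume "x \<in> Mon ` Bx E" "y \<in> Mon ` Bx F"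
  then obtain m m' where m: "x = Mon m" "y = Mon m'" "m \<in> Bx E" "m' \<in> Bx F" by blast
  have "Mon (\<lambda>i. m i + m' i) \<in> Mon ` Bx (E + F)"
    using m(3,4) by (intro Mon_Bx add_mono) (auto simp: Bx_def PiE_def Pi_def)
  then show "x * y \<in> fv.span (Mon ` Bx (E + F))" unfolding m Mon_mult by (rule fv.span_base)
qed

lemma Bx_mono: "E \<le> F \<Longrightarrow> fv.span (Mon ` Bx E) \<subseteq> fv.span (Mon ` Bx F)"
  unfolding Bx_def by (intro fv.span_mono image_mono PiE_mono) auto

lemma Bx_1: "1 \<in> fv.span (Mon ` Bx 0)"
  using Mon_Bx[of "\<lambda>_. 0" 0] by (intro fv.span_base) (simp add: Mon_def)

lemma Bx_prod:
  fixes I :: "nat set"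
  assumes "\<And>i. i \<in> I \<Longrightarrow> f i \<in> fv.span (Mon ` Bx (E i))"
  shows "(\<Prod>i\<in>I. f i) \<in> fv.span (Mon ` Bx (\<Sum>i\<in>I. E i))"
  using assms by (induction I rule: infinite_finite_induct) (auto intro: Bx_1 Bx_mult)

lemma Bx_power: "f \<in> fv.span (Mon ` Bx E) \<Longrightarrow> f ^ k \<in> fv.span (Mon ` Bx (k * E))"
  by (induction k) (auto intro: Bx_1 Bx_mult)

lemma S_Bx: "f \<in> S \<Longrightarrow> \<exists>E. f \<in> fv.span (Mon ` Bx E)"
proof -
  define B where "B = {f. \<exists>E. f \<in> fv.span (Mon ` Bx E)}"
  have "subalg B" unfolding subalg_def
  proof (intro conjI allI ballI)
    fix c
    have "cst c * 1 \<in> fv.span (Mon ` Bx 0)" by (rule fv.span_scale[OF Bx_1])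
    then show "cst c \<in> B" by (auto simp: B_def)
  next
    fix f g assume "f \<in> B" "g \<in> B"
    then obtain E F where E: "f \<in> fv.span (Mon ` Bx E)" "g \<in> fv.span (Mon ` Bx F)" by (auto simp: B_def)
    have "f \<in> fv.span (Mon ` Bx (E + F))" "g \<in> fv.span (Mon ` Bx (E + F))"
      using E Bx_mono[of E "E + F"] Bx_mono[of F "E + F"] by auto
    then have "f + g \<in> fv.span (Mon ` Bx (E + F))" by (rule fv.span_add)
    then show "f + g \<in> B" unfolding B_def by blast
    show "f * g \<in> B" unfolding B_def using Bx_mult[OF E] by blast
  qed
  moreover have "W i \<in> B" if i: "i < n" for i
  proof -
    have "Mon (\<lambda>j. if j = i then 1 else 0) = (\<Prod>j<n. if j = i then W i else 1)"
      unfolding Mon_def by (intro prod.cong) auto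
    then have "Mon (\<lambda>j. if j = i then 1 else 0) = W i" using i by (simp add: prod.delta)
    then have "W i \<in> Mon ` Bx 1" using Mon_Bx[of "\<lambda>j. if j = i then 1 else 0" 1] by simp
    then show ?thesis unfolding B_def by (blast intro: fv.span_base)
  qed
  ultimately have "S \<subseteq> B" unfolding S_def by (intro alg_least) auto
  then show "f \<in> S \<Longrightarrow> \<exists>E. f \<in> fv.span (Mon ` Bx E)" by (auto simp: B_def)
qed

text \<open>The power products of n + 1 elements with exponents up to T number (T + 1)^(n + 1), but
  they lie in a space whose dimension grows only like T^n.\<close>

lemma algebraic_relation:
  assumes x: "\<And>i. i < Suc n \<Longrightarrow> x i \<in> S"
  shows "\<exists>B c. finite B \<and> B \<subseteq> {..<Suc n} \<rightarrow>\<^sub>E UNIV \<and> B \<noteq> {} \<and> (\<forall>\<beta>\<in>B. c \<beta> \<noteq> 0) \<and>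
    (\<Sum>\<beta>\<in>B. cst (c \<beta>) * (\<Prod>i<Suc n. x i ^ \<beta> i)) = 0"
proof -
  have "\<exists>E. \<forall>i<Suc n. x i \<in> fv.span (Mon ` Bx E)"
  proof -
    have "\<forall>i. \<exists>E. i < Suc n \<longrightarrow> x i \<in> fv.span (Mon ` Bx E)" using S_Bx x by blast
    from choice[OF this] obtain E where E: "\<forall>i. i < Suc n \<longrightarrow> x i \<in> fv.span (Mon ` Bx (E i))" by (elim exE)
    show ?thesis
    proof (intro exI[of _ "\<Sum>i<Suc n. E i"] allI impI)
      fix i assume i: "i < Suc n"
      have "E i \<le> (\<Sum>i<Suc n. E i)" by (rule member_le_sum) (use i in auto)
      from Bx_mono[OF this] E i show "x i \<in> fv.span (Mon ` Bx (\<Sum>i<Suc n. E i))" by blast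
    qed
  qed
  then obtain E where E: "\<And>i. i < Suc n \<Longrightarrow> x i \<in> fv.span (Mon ` Bx E)" by blast
  \<comment> \<open>\<open>C\<close> is chosen so that the target box of size (n + 1) T E fits into
    C (T + 1), and \<open>T\<close> = C^n so that (C (T + 1))^n = T (T + 1)^n stays below (T + 1)^(n
    + 1).\<close>
  define C where "C = Suc n * E + 1"
  define T where "T = C ^ n"
  define I where "I = ({..<Suc n} \<rightarrow>\<^sub>E {..T})"
  let ?v = "\<lambda>\<beta>. \<Prod>i<Suc n. x i ^ \<beta> i"
  let ?F = "Suc n * (T * E)"
  have finI: "finite I" unfolding I_def by (intro finite_PiE) auto
  have cardI: "card I = Suc T ^ Suc n" unfolding I_def by (simp add: card_PiE)
  have v: "?v \<beta> \<in> fv.span (Mon ` Bx ?F)" if "\<beta> \<in> I" for \<beta>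
  proof -
    have "?v \<beta> \<in> fv.span (Mon ` Bx (\<Sum>i<Suc n. \<beta> i * E))" by (intro Bx_prod Bx_power E) auto
    moreover have "(\<Sum>i<Suc n. \<beta> i * E) \<le> (\<Sum>i<Suc n. T * E)"
      using that by (intro sum_mono mult_right_mono) (auto simp: I_def PiE_def Pi_def)
    then have "(\<Sum>i<Suc n. \<beta> i * E) \<le> ?F" by simp
    ultimately show ?thesis using Bx_mono by blast
  qed
  have "Suc ?F \<le> C * Suc T" by (simp add: C_def algebra_simps)
  then have "Suc ?F ^ n \<le> (C * Suc T) ^ n" by (rule power_mono) simp
  also have "\<dots> = T * Suc T ^ n" by (simp only: power_mult_distrib T_def)
  also have "\<dots> < Suc T * Suc T ^ n" by simp
  finally have "card (Mon ` Bx ?F) < card I" unfolding cardI using card_Bx[of ?F] by (simp only: power_Suc)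
  from dependent_of_card[where v = ?v, OF finI finite_imageI[OF finite_Bx] v this]
  have "\<exists>c. (\<Sum>\<beta>\<in>I. cst (c \<beta>) * ?v \<beta>) = 0 \<and> (\<exists>\<beta>\<in>I. c \<beta> \<noteq> 0)" by simp
  then obtain c where c: "(\<Sum>\<beta>\<in>I. cst (c \<beta>) * ?v \<beta>) = 0" "\<exists>\<beta>\<in>I. c \<beta> \<noteq> 0" by (elim exE conjE)
  let ?B = "{\<beta>\<in>I. c \<beta> \<noteq> 0}"
  have "(\<Sum>\<beta>\<in>?B. cst (c \<beta>) * ?v \<beta>) = (\<Sum>\<beta>\<in>I. cst (c \<beta>) * ?v \<beta>)"
    using finI by (intro sum.mono_neutral_left) auto
  then have "(\<Sum>\<beta>\<in>?B. cst (c \<beta>) * ?v \<beta>) = 0" using c(1) by simp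
  moreover have "I \<subseteq> {..<Suc n} \<rightarrow>\<^sub>E UNIV" unfolding I_def by (rule PiE_mono) auto
  ultimately show ?thesis using c(2) finI by (intro exI[of _ ?B] exI[of _ c]) auto
qed

lemma height_le:
  assumes A: "subalg A" "A \<subseteq> S" shows "height (fring A) m \<le> enat n"
  unfolding height_def prime_in_fring[OF A(1)]
proof (rule Sup_least)
  fix e assume "e \<in> {enat N | N. \<exists>P. (\<forall>i\<le>N. prime_in A (P i)) \<and> (\<forall>i<N. P i \<subset> P (Suc i)) \<and> P N = m}"
  then obtain N P where e: "e = enat N" and P: "\<And>i. i \<le> N \<Longrightarrow> prime_in A (P i)" "\<And>i. i < N \<Longrightarrow> P i \<subset> P (Suc i)" by blast
  have "N \<le> n"
  proof (rule ccontr)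
    assume "\<not> N \<le> n"
    then have N: "Suc n \<le> N" by simp
    have "\<exists>y. i < Suc n \<longrightarrow> y \<in> P (Suc i) \<and> y \<notin> P i" for i
    proof (cases "i < Suc n")
      case True
      then have "P i \<subset> P (Suc i)" using P(2)[of i] N by simp
      then show ?thesis by blast
    qed simp
    then have "\<forall>i. \<exists>y. i < Suc n \<longrightarrow> y \<in> P (Suc i) \<and> y \<notin> P i" ..
    from choice[OF this] obtain x where x: "\<forall>i. i < Suc n \<longrightarrow> x i \<in> P (Suc i) \<and> x i \<notin> P i" by (elim exE)
    have xS: "x i \<in> S" if i: "i < Suc n" for i
    proof -
      have "prime_in A (P (Suc i))" using P(1) N i by simp
      then have "P (Suc i) \<subseteq> A" by (simp add: prime_in_def idl_in_def)
      then show ?thesis using x i A(2) by blast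
    qed
    have "\<exists>B c. finite B \<and> B \<subseteq> {..<Suc n} \<rightarrow>\<^sub>E UNIV \<and> B \<noteq> {} \<and> (\<forall>\<beta>\<in>B. c \<beta> \<noteq> 0) \<and>
        (\<Sum>\<beta>\<in>B. cst (c \<beta>) * (\<Prod>i<Suc n. x i ^ \<beta> i)) = 0"
      by (rule algebraic_relation) (rule xS)
    then obtain B c where B: "finite B" "B \<subseteq> {..<Suc n} \<rightarrow>\<^sub>E UNIV" "B \<noteq> {}" "\<forall>\<beta>\<in>B. c \<beta> \<noteq> 0"
      "(\<Sum>\<beta>\<in>B. cst (c \<beta>) * (\<Prod>i<Suc n. x i ^ \<beta> i)) = 0" by (elim exE conjE)
    show False
    proof (rule chain_no_relation[OF A(1) _ _ _ _ B(1-3) bspec[OF B(4)] B(5), of P])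
      fix i assume "i \<le> Suc n" then show "prime_in A (P i)" using P(1) N by simp
    next
      fix i assume i: "i < Suc n"
      then show "P i \<subseteq> P (Suc i)" using P(2)[of i] N by auto
      show "x i \<in> P (Suc i)" "x i \<notin> P i" using x i by auto
    qed
  qed
  then show "e \<le> enat n" by (simp add: e)
qed

text \<open>If no \<open>\<theta> - c\<close> were in the maximal ideal \<open>m\<close>, the inverses of the \<open>\<theta> - c\<close> modulo \<open>m\<close> would be
  uncountably many elements of a space of countable dimension; clearing denominators in a linear relation
  between them yields a polynomial in \<open>\<theta>\<close> in \<open>m\<close>.\<close>

lemma maximal_value:
  assumes A: "subalg A" "A \<subseteq> S" and m: "maximalideal m (fring A)" and th: "\<theta> \<in> A"
  shows "\<exists>c. \<theta> - cst c \<in> m"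
proof (rule ccontr)
  assume no: "\<nexists>c. \<theta> - cst c \<in> m"
  interpret cring "fring A" by (rule cring_fring[OF A(1)])
  have P: "prime_in A m" using maximalideal_prime[OF m] prime_in_fring[OF A(1)] by simp
  then have mi: "idl_in A m" by (simp add: prime_in_def)
  then have m': "m \<subseteq> A" "0 \<in> m" "\<And>x y. x \<in> m \<Longrightarrow> y \<in> m \<Longrightarrow> x + y \<in> m" "\<And>x y. x \<in> A \<Longrightarrow> y \<in> m \<Longrightarrow> x * y \<in> m"
    by (auto simp: idl_in_def)
  have tA: "\<theta> - cst c \<in> A" for c by (intro subalg_diff[OF A(1)] th subalg_cst[OF A(1)])
  have "\<exists>u. u \<in> A \<and> 1 - u * (\<theta> - cst c) \<in> m" for c
  proof -
    define J where "J = {p + q * (\<theta> - cst c) | p q. p \<in> m \<and> q \<in> A}"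
    note JJ = idl_in_adjoin[OF A(1) mi tA[of c], folded J_def]
    have "J = m \<or> J = carrier (fring A)"
      using JJ(1,2) ideal_fring[OF A(1)] by (intro maximalideal.I_maximal[OF m]) (auto simp: idl_in_def)
    then have "1 \<in> J" using JJ(3) no subalg_1[OF A(1)] by auto
    then obtain p q where "1 = p + q * (\<theta> - cst c)" "p \<in> m" "q \<in> A" unfolding J_def by blast
    then show ?thesis by (intro exI[of _ q]) (simp add: algebra_simps)
  qed
  then have "\<forall>c. \<exists>u. u \<in> A \<and> 1 - u * (\<theta> - cst c) \<in> m" by blast
  from choice[OF this] obtain u where u: "\<And>c. u c \<in> A" "\<And>c. 1 - u c * (\<theta> - cst c) \<in> m" by blast
  \<comment> \<open>The boxes are countable in number and cover all \<open>u c\<close>, while c runs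
    through an uncountable field.\<close>
  have "\<exists>E. infinite {c. u c \<in> fv.span (Mon ` Bx E)}"
  proof (rule ccontr)
    assume "\<nexists>E. infinite {c. u c \<in> fv.span (Mon ` Bx E)}"
    then have "countable (\<Union>E. {c. u c \<in> fv.span (Mon ` Bx E)})" by (intro countable_UN) (auto intro: countable_finite)
    moreover have "(\<Union>E. {c. u c \<in> fv.span (Mon ` Bx E)}) = UNIV" using S_Bx u(1) A(2) by blast
    ultimately have "countable (range Re)" by (simp del: range_eqI) 
    moreover have "range Re = UNIV" by (metis Re_complex_of_real surjI)
    ultimately show False using uncountable_UNIV_real by simp
  qed
  then obtain E where E: "infinite {c. u c \<in> fv.span (Mon ` Bx E)}" by blast
  obtain C where C: "finite C" "card C = Suc (card (Mon ` Bx E))" "C \<subseteq> {c. u c \<in> fv.span (Mon ` Bx E)}"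
    using infinite_arbitrarily_large[OF E] by blast
  have "\<exists>a. (\<Sum>c\<in>C. cst (a c) * u c) = 0 \<and> (\<exists>c\<in>C. a c \<noteq> 0)"
    using C by (intro dependent_of_card[OF C(1) finite_imageI[OF finite_Bx]]) auto
  then obtain a c0 where a: "(\<Sum>c\<in>C. cst (a c) * u c) = 0" "c0 \<in> C" "a c0 \<noteq> 0" by blast
  \<comment> \<open>The relation between the formal inverses of the \<open>\<theta> - cst c\<close>,
    multiplied by the product of all of them. At \<open>c0\<close> all summands but one vanish, so
    \<open>q\<close> is not zero.\<close>
  define q where "q = (\<Sum>c\<in>C. smult (a c) (\<Prod>d\<in>C - {c}. [:- d, 1:]))"
  have "poly q c0 = (\<Sum>c\<in>C. if c = c0 then a c0 * (\<Prod>d\<in>C - {c0}. c0 - d) else 0)"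
    unfolding q_def poly_sum poly_smult poly_prod
  proof (rule sum.cong[OF refl])
    fix c assume "c \<in> C"
    show "a c * (\<Prod>d\<in>C - {c}. poly [:- d, 1:] c0) = (if c = c0 then a c0 * (\<Prod>d\<in>C - {c0}. c0 - d) else 0)"
    proof (cases "c = c0")
      case False
      then have "(\<Prod>d\<in>C - {c}. poly [:- d, 1:] c0) = 0" using a(2) C(1) by (intro prod_zero) (auto intro!: bexI[of _ c0])
      then show ?thesis using False by simp
    qed simp
  qed
  then have "poly q c0 = a c0 * (\<Prod>d\<in>C - {c0}. c0 - d)" using a(2) C(1) by (simp add: sum.delta)
  then have "poly q c0 \<noteq> 0" using a(3) C(1) by simp
  then have q0: "q \<noteq> 0" by auto
  let ?t = "\<lambda>c. \<theta> - cst c"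
  have lin: "pc [:- c, 1:] = [:- cst c, 1:]" for c
    by (rule poly_eqI) (auto simp: coeff_pc coeff_pCons cst_uminus split: nat.split)
  have pc_add: "pc (p + q) = pc p + pc q" for p q by (rule poly_eqI) (simp add: coeff_pc cst_add)
  have pc_sum: "pc (\<Sum>i\<in>I. F i) = (\<Sum>i\<in>I. pc (F i))" and pc_prod: "pc (\<Prod>i\<in>I. F i) = (\<Prod>i\<in>I. pc (F i))" for I :: "complex set" and F
    by (induction I rule: infinite_finite_induct) (auto simp: pc_mult pc_0 pc_add)
  have pcs: "pc (smult b p) = smult (cst b) (pc p)" for b p by (rule poly_eqI) (simp add: coeff_pc cst_mult)
  have qt: "poly (pc q) \<theta> = (\<Sum>c\<in>C. cst (a c) * (\<Prod>d\<in>C - {c}. ?t d))"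
    unfolding q_def pc_sum pcs pc_prod lin poly_sum poly_smult poly_prod by simp
  also have "\<dots> = (\<Sum>c\<in>C. cst (a c) * ((\<Prod>d\<in>C - {c}. ?t d) * (1 - u c * ?t c))) + (\<Sum>c\<in>C. cst (a c) * u c) * (\<Prod>d\<in>C. ?t d)"
    unfolding sum_distrib_right sum.distrib[symmetric]
  proof (rule sum.cong[OF refl])
    fix c assume "c \<in> C"
    then have "(\<Prod>d\<in>C. ?t d) = ?t c * (\<Prod>d\<in>C - {c}. ?t d)" using C(1) by (intro prod.remove) auto
    then show "cst (a c) * (\<Prod>d\<in>C - {c}. ?t d)
        = cst (a c) * ((\<Prod>d\<in>C - {c}. ?t d) * (1 - u c * ?t c)) + cst (a c) * u c * (\<Prod>d\<in>C. ?t d)"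
      by (simp only:) (simp add: algebra_simps)
  qed
  also have "\<dots> = (\<Sum>c\<in>C. cst (a c) * ((\<Prod>d\<in>C - {c}. ?t d) * (1 - u c * ?t c)))" using a(1) by simp
  finally have "poly (pc q) \<theta> = (\<Sum>c\<in>C. cst (a c) * ((\<Prod>d\<in>C - {c}. ?t d) * (1 - u c * ?t c)))" .
  moreover have "\<dots> \<in> m"
  proof -
    have "cst (a c) * ((\<Prod>d\<in>C - {c}. ?t d) * (1 - u c * ?t c)) \<in> m" for c
      by (intro m'(4) u(2) subalg_cst[OF A(1)] subalg_prod[OF A(1)] tA)
    then show ?thesis by (rule_tac C(1)[THEN finite_induct]) (auto intro: m'(2,3))
  qed
  ultimately have "poly (pc q) \<theta> \<in> m" by simp
  from prime_poly_root[OF A(1) P th q0 this] no show False by blast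
qed

end

section \<open>Free modules of functions are Cohen--Macaulay\<close>

lemma power_shift_span:
  "(t + cst c) ^ a \<in> fv.span ((\<lambda>b. t ^ b) ` {..a})"
proof -
  have "(t + cst c) ^ a = (\<Sum>b\<le>a. cst (of_nat (a choose b) * c ^ (a - b)) * t ^ b)"
    unfolding binomial_ring by (intro sum.cong refl) (simp add: cst_mult cst_power of_nat_fun cst_def[of "of_nat _"] mult_ac)
  also have "\<dots> \<in> fv.span ((\<lambda>b. t ^ b) ` {..a})" by (intro sum_in_span fv.span_base imageI)
  finally show ?thesis .
qed

context rs
begin

context
  fixes th :: "nat \<Rightarrow> pt \<Rightarrow> complex" and g :: "(nat \<Rightarrow> nat) \<Rightarrow> pt \<Rightarrow> complex" and A
  assumes A: "A = fv.span (tg th g ` (Ix \<times> KK))" "subalg A" "A \<subseteq> S" and ind: "indep (Ix \<times> KK) (tg th g)"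
    and th: "\<And>i. i < n \<Longrightarrow> th i \<in> A" and g: "\<And>k. k \<in> KK \<Longrightarrow> g k \<in> A"
begin

section \<open>Translated parameters form a regular sequence\<close>

definition tt :: "(nat \<Rightarrow> complex) \<Rightarrow> nat \<Rightarrow> pt \<Rightarrow> complex" where "tt c i = th i - cst (c i)"

lemma tt_A: "i < n \<Longrightarrow> tt c i \<in> A"
  unfolding tt_def by (intro subalg_diff[OF A(2)] th subalg_cst[OF A(2)])

text \<open>Binomial expansion never raises exponents. Translation thus respects the finite boxes
  \<open>BT T\<close>, where independence can be transferred by counting.\<close>

lemma thp_span_tt: "thp th \<kappa> \<in> fv.span (thp (tt c) ` {\<mu>. \<forall>i. \<mu> i \<le> \<kappa> i})"
proof -
  have "(\<Prod>i<j. th i ^ \<kappa> i) \<in> fv.span ((\<lambda>\<mu>. \<Prod>i<j. tt c i ^ \<mu> i) ` {\<mu>. \<forall>i. \<mu> i \<le> \<kappa> i})" for j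
  proof (induction j)
    case 0
    have "(1 :: pt \<Rightarrow> complex) \<in> (\<lambda>\<mu>. \<Prod>i<0. tt c i ^ \<mu> i) ` {\<mu>. \<forall>i. \<mu> i \<le> \<kappa> i}"
      by (rule image_eqI[of _ _ "\<lambda>_. 0"]) auto
    then show ?case by (simp only: lessThan_0 prod.empty) (rule fv.span_base)
  next
    case (Suc j)
    have "th j ^ \<kappa> j \<in> fv.span ((\<lambda>b. tt c j ^ b) ` {..\<kappa> j})"
      using power_shift_span[of "tt c j" "c j" "\<kappa> j"] by (simp add: tt_def)
    then show ?case unfolding prod.lessThan_Suc
    proof (intro span_mult_in[OF fv.subspace_span _ Suc.IH])
      fix x y assume "x \<in> (\<lambda>\<mu>. \<Prod>i<j. tt c i ^ \<mu> i) ` {\<mu>. \<forall>i. \<mu> i \<le> \<kappa> i}" "y \<in> (\<lambda>b. tt c j ^ b) ` {..\<kappa> j}"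
      then obtain \<mu> b where x: "x = (\<Prod>i<j. tt c i ^ \<mu> i)" "\<forall>i. \<mu> i \<le> \<kappa> i" "y = tt c j ^ b" "b \<le> \<kappa> j" by auto
      have "x = (\<Prod>i<j. tt c i ^ (\<mu>(j := b)) i)" unfolding x(1) by (intro prod.cong) auto
      then have "x * y = (\<Prod>i<j. tt c i ^ (\<mu>(j := b)) i) * tt c j ^ (\<mu>(j := b)) j" by (simp add: x(3))
      then show "x * y \<in> fv.span ((\<lambda>\<mu>. (\<Prod>i<j. tt c i ^ \<mu> i) * tt c j ^ \<mu> j) ` {\<mu>. \<forall>i. \<mu> i \<le> \<kappa> i})"
        by (intro fv.span_base image_eqI[of _ _ "\<mu>(j := b)"]) (use x in auto)
    qed
  qed
  from this[of n] show ?thesis unfolding thp_def .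
qed

abbreviation BT :: "nat \<Rightarrow> (nat \<Rightarrow> nat) set" where "BT T \<equiv> {\<kappa>\<in>Ix. \<forall>i. \<kappa> i \<le> T}"

lemma finite_BT: "finite (BT T)"
proof (rule finite_subset)
  show "finite {m. \<forall>i. (i \<in> {..<n} \<longrightarrow> m i \<in> {..T}) \<and> (i \<notin> {..<n} \<longrightarrow> m i = 0)}"
    by (rule finite_set_of_finite_funs) auto
  show "BT T \<subseteq> {m. \<forall>i. (i \<in> {..<n} \<longrightarrow> m i \<in> {..T}) \<and> (i \<notin> {..<n} \<longrightarrow> m i = 0)}"
    by (auto simp: Ix_def)
qed

lemma tg_span_tt:
  assumes p: "p \<in> BT T \<times> KK" shows "tg th g p \<in> fv.span (tg (tt c) g ` (BT T \<times> KK))"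
proof -
  obtain \<kappa> k where p': "p = (\<kappa>, k)" "\<kappa> \<in> Ix" "\<And>i. \<kappa> i \<le> T" "k \<in> KK" using p by auto
  have "fv.span (thp (tt c) ` {\<mu>. \<forall>i. \<mu> i \<le> \<kappa> i}) \<subseteq> {f. f * g k \<in> fv.span (tg (tt c) g ` (BT T \<times> KK))}"
  proof (intro fv.span_minimal subspace_mult_preimage fv.subspace_span image_subsetI)
    fix \<mu> assume "\<mu> \<in> {\<mu>. \<forall>i. \<mu> i \<le> \<kappa> i}"
    then have le: "\<mu> i \<le> \<kappa> i" for i by simp
    have "\<mu> i \<le> T" for i using le[of i] p'(3)[of i] by linarith
    moreover have "\<mu> i = 0" if "n \<le> i" for i using le[of i] p'(2) that by (simp add: Ix_def)
    then have "\<mu> \<in> Ix" by (simp add: Ix_def)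
    ultimately have "(\<mu>, k) \<in> BT T \<times> KK" using p'(4) by simp
    then have "tg (tt c) g (\<mu>, k) \<in> fv.span (tg (tt c) g ` (BT T \<times> KK))" by (intro fv.span_base imageI)
    then show "thp (tt c) \<mu> \<in> {f. f * g k \<in> fv.span (tg (tt c) g ` (BT T \<times> KK))}" by simp
  qed
  from subsetD[OF this thp_span_tt] show ?thesis by (simp add: p'(1))
qed

lemma BT_exhaust:
  assumes "finite J" "J \<subseteq> Ix \<times> KK" obtains T where "J \<subseteq> BT T \<times> KK"
proof (rule that[of "\<Sum>p\<in>J. \<Sum>i<n. fst p i"], rule subsetI)
  fix p assume p: "p \<in> J"
  then have q: "fst p \<in> Ix" "snd p \<in> KK" using assms(2) by auto
  have "fst p i \<le> (\<Sum>p\<in>J. \<Sum>i<n. fst p i)" for i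
  proof (cases "i < n")
    case True
    then have "fst p i \<le> (\<Sum>i<n. fst p i)" by (intro member_le_sum) auto
    also have "\<dots> \<le> (\<Sum>p\<in>J. \<Sum>i<n. fst p i)" using p assms(1) by (intro member_le_sum) auto
    finally show ?thesis .
  qed (use q in \<open>simp add: Ix_def\<close>)
  then show "p \<in> BT (\<Sum>p\<in>J. \<Sum>i<n. fst p i) \<times> KK" using q by (simp add: mem_Times_iff)
qed

lemma indep_tt: "indep (Ix \<times> KK) (tg (tt c) g)"
proof (rule indepI)
  fix J b j assume J: "finite J" "J \<subseteq> Ix \<times> KK" "(\<Sum>j\<in>J. cst (b j) * tg (tt c) g j) = 0" "j \<in> J"
  obtain T where T: "J \<subseteq> BT T \<times> KK" by (rule BT_exhaust[OF J(1,2)])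
  have "indep (BT T \<times> KK) (tg (tt c) g)"
  proof (rule indep_exchange[OF _ indep_subset[OF ind] tg_span_tt])
    show "finite (BT T \<times> KK)" using finite_BT finite_KK by (rule finite_cartesian_product)
    show "BT T \<times> KK \<subseteq> Ix \<times> KK" by auto
  qed
  then show "b j = 0" by (rule indepD[OF _ J(1) T J(3,4)])
qed

lemma span_tt: "A = fv.span (tg (tt c) g ` (Ix \<times> KK))"
proof
  show "A \<subseteq> fv.span (tg (tt c) g ` (Ix \<times> KK))"
    unfolding A(1)
  proof (intro fv.span_minimal fv.subspace_span image_subsetI)
    fix p assume "p \<in> Ix \<times> KK"
    then obtain T where "{p} \<subseteq> BT T \<times> KK" using BT_exhaust[of "{p}"] by blast
    then have "tg th g p \<in> fv.span (tg (tt c) g ` (BT T \<times> KK))" by (intro tg_span_tt) auto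
    moreover have "fv.span (tg (tt c) g ` (BT T \<times> KK)) \<subseteq> fv.span (tg (tt c) g ` (Ix \<times> KK))" by (intro fv.span_mono image_mono) auto
    ultimately show "tg th g p \<in> fv.span (tg (tt c) g ` (Ix \<times> KK))" by blast
  qed
  show "fv.span (tg (tt c) g ` (Ix \<times> KK)) \<subseteq> A"
  proof (rule fv.span_minimal[OF _ subalg_subspace[OF A(2)]], rule image_subsetI)
    fix p assume "p \<in> Ix \<times> KK"
    then show "tg (tt c) g p \<in> A"
      unfolding thp_def split_def
      by (intro subalg_mult[OF A(2)] subalg_prod[OF A(2)] subalg_power[OF A(2)] tt_A g) auto
  qed
qed

definition sh :: "nat \<Rightarrow> (nat \<Rightarrow> nat) \<times> (nat \<Rightarrow> nat) \<Rightarrow> (nat \<Rightarrow> nat) \<times> (nat \<Rightarrow> nat)" where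
  "sh i p = ((fst p)(i := Suc (fst p i)), snd p)"

lemma tg_sh:
  assumes i: "i < n" shows "tg t g' (sh i p) = t i * tg t g' p"
proof -
  obtain \<kappa> k where p: "p = (\<kappa>, k)" by (cases p)
  have "thp t (\<kappa>(i := Suc (\<kappa> i))) = t i ^ Suc (\<kappa> i) * (\<Prod>j\<in>{..<n} - {i}. t j ^ (\<kappa>(i := Suc (\<kappa> i))) j)"
    unfolding thp_def using i by (subst prod.remove[of _ i]) auto
  also have "(\<Prod>j\<in>{..<n} - {i}. t j ^ (\<kappa>(i := Suc (\<kappa> i))) j) = (\<Prod>j\<in>{..<n} - {i}. t j ^ \<kappa> j)" by (intro prod.cong) auto
  also have "t i ^ Suc (\<kappa> i) * (\<Prod>j\<in>{..<n} - {i}. t j ^ \<kappa> j) = t i * (t i ^ \<kappa> i * (\<Prod>j\<in>{..<n} - {i}. t j ^ \<kappa> j))"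
    by (simp add: mult.assoc)
  also have "t i ^ \<kappa> i * (\<Prod>j\<in>{..<n} - {i}. t j ^ \<kappa> j) = thp t \<kappa>"
    unfolding thp_def using i by (intro prod.remove[symmetric]) auto
  finally show ?thesis by (simp only: p sh_def fst_conv snd_conv prod.case mult.assoc)
qed

lemma sh_Ix: "i < n \<Longrightarrow> p \<in> Ix \<times> KK \<Longrightarrow> sh i p \<in> Ix \<times> KK"
  by (auto simp: sh_def Ix_def)

text \<open>Multiplication by a translated parameter permutes basis elements into basis elements, so
  the ideal behaves like a monomial ideal.\<close>

lemma ideal_tt:
  assumes j: "j \<le> n"
  shows "gen_by A (tt c ` {..<j}) = fv.span (tg (tt c) g ` {p\<in>Ix \<times> KK. \<exists>i<j. 0 < fst p i})" (is "_ = ?V")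
proof
  note B = subrng_subalg[OF A(2)]
  show "gen_by A (tt c ` {..<j}) \<subseteq> ?V"
  proof
    fix f assume "f \<in> gen_by A (tt c ` {..<j})"
    then obtain h where h: "f = (\<Sum>q\<in>tt c ` {..<j}. h q * q)" "\<And>q. q \<in> tt c ` {..<j} \<Longrightarrow> h q \<in> A"
      unfolding gen_by_def by blast
    have "h q * q \<in> ?V" if q: "q \<in> tt c ` {..<j}" for q
    proof -
      obtain i where i: "i < j" "q = tt c i" using q by blast
      have "fv.span (tg (tt c) g ` (Ix \<times> KK)) \<subseteq> {f. f * tt c i \<in> ?V}"
      proof (intro fv.span_minimal subspace_mult_preimage fv.subspace_span image_subsetI)
        fix p assume p: "p \<in> Ix \<times> KK"
        have "tg (tt c) g (sh i p) \<in> ?V"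
        proof (intro fv.span_base imageI CollectI conjI exI[of _ i])
          show "sh i p \<in> Ix \<times> KK" using sh_Ix p i(1) j by simp
        qed (use i in \<open>auto simp: sh_def\<close>)
        moreover have "tg (tt c) g (sh i p) = tg (tt c) g p * tt c i"
          by (subst tg_sh[OF less_le_trans[OF i(1) j]], rule mult.commute)
        ultimately show "tg (tt c) g p \<in> {f. f * tt c i \<in> ?V}" by (simp only: mem_Collect_eq)
      qed
      moreover have "h q \<in> fv.span (tg (tt c) g ` (Ix \<times> KK))" by (rule subsetD[OF equalityD1[OF span_tt] h(2)[OF q]])
      ultimately have "h q \<in> {f. f * tt c i \<in> ?V}" by (rule subsetD)
      then show ?thesis unfolding i(2)[symmetric] by (rule CollectD)
    qed
    then show "f \<in> ?V" unfolding h(1) by (rule fv.span_sum)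
  qed
  show "?V \<subseteq> gen_by A (tt c ` {..<j})"
  proof (rule fv.span_minimal)
    show "fv.subspace (gen_by A (tt c ` {..<j}))"
      unfolding fv.subspace_def using gen_by_0[OF B] gen_by_add[OF B] gen_by_mult[OF B] subalg_cst[OF A(2)] by blast
    show "tg (tt c) g ` {p\<in>Ix \<times> KK. \<exists>i<j. 0 < fst p i} \<subseteq> gen_by A (tt c ` {..<j})"
    proof (rule image_subsetI)
      fix p assume "p \<in> {p\<in>Ix \<times> KK. \<exists>i<j. 0 < fst p i}"
      then obtain i where p: "p \<in> Ix \<times> KK" "i < j" "0 < fst p i" by blast
      define p' where "p' = ((fst p)(i := fst p i - 1), snd p)"
      have psh: "p = sh i p'" using p(3) by (simp add: sh_def p'_def prod_eq_iff fun_eq_iff)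
      have eq: "tg (tt c) g p = tg (tt c) g p' * tt c i"
        unfolding psh tg_sh[OF less_le_trans[OF p(2) j]] by (rule mult.commute)
      have "p' \<in> Ix \<times> KK" using p(1) by (auto simp: p'_def Ix_def)
      then have "tg (tt c) g p' \<in> fv.span (tg (tt c) g ` (Ix \<times> KK))" by (intro fv.span_base imageI)
      then have pA: "tg (tt c) g p' \<in> A" by (rule subsetD[OF equalityD2[OF span_tt]])
      show "tg (tt c) g p \<in> gen_by A (tt c ` {..<j})"
        unfolding eq by (rule gen_by_mult[OF B pA gen_by_base[OF B]]) (use p(2) in auto)
    qed
  qed
qed

text \<open>A linear map \<open>\<phi>\<close> that divides basis elements by \<open>tt c k\<close>
  and kills those divisible by an earlier parameter vanishes on the ideal, yet returns from
  \<open>tt c k * b\<close> the part of \<open>b\<close> outside the ideal; so that part is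
  0.\<close>

lemma tt_regular:
  assumes k: "k < n" and b: "b \<in> A" and m: "tt c k * b \<in> gen_by A (tt c ` {..<k})"
  shows "b \<in> gen_by A (tt c ` {..<k})"
proof -
  let ?I = "Ix \<times> KK" and ?w = "tg (tt c) g"
  define bad where "bad p \<longleftrightarrow> (\<exists>i<k. 0 < fst p i)" for p :: "(nat \<Rightarrow> nat) \<times> (nat \<Rightarrow> nat)"
  define h where "h p = (if bad p \<or> fst p k = 0 then 0 else ?w ((fst p)(k := fst p k - 1), snd p))" for p
  obtain \<phi> :: "(pt \<Rightarrow> complex) \<Rightarrow> pt \<Rightarrow> complex" where \<phi>: "\<And>f g. \<phi> (f + g) = \<phi> f + \<phi> g" "\<And>c f. \<phi> (cst c * f) = cst c * \<phi> f"
    "\<And>p. p \<in> ?I \<Longrightarrow> \<phi> (?w p) = h p"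
    using linear_extension[OF indep_tt[of c], of h] by blast
  have "b \<in> fv.span (?w ` ?I)" by (rule subsetD[OF equalityD1[OF span_tt] b])
  then obtain J a where J: "finite J" "J \<subseteq> ?I" "b = (\<Sum>p\<in>J. cst (a p) * ?w p)" by (rule span_family_explicit)
  have badsh: "bad (sh k p) \<longleftrightarrow> bad p" for p by (auto simp: bad_def sh_def)
  have "tt c k * b = (\<Sum>p\<in>J. cst (a p) * ?w (sh k p))"
    unfolding J(3) sum_distrib_left tg_sh[OF k] by (intro sum.cong refl) (simp only: mult_ac)
  then have "\<phi> (tt c k * b) = (\<Sum>p\<in>J. cst (a p) * \<phi> (?w (sh k p)))"
    by (simp only: linear_map_sum[of \<phi>, OF \<phi>(1,2)])
  also have "\<dots> = (\<Sum>p\<in>J. cst (a p) * (if bad p then 0 else ?w p))"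
  proof (rule sum.cong[OF refl])
    fix p assume "p \<in> J"
    then have "sh k p \<in> ?I" using J(2) sh_Ix[OF k] by blast
    from \<phi>(3)[OF this] have "\<phi> (?w (sh k p)) = h (sh k p)" .
    also have "\<dots> = (if bad p then 0 else ?w p)" unfolding h_def badsh by (simp add: sh_def)
    finally show "cst (a p) * \<phi> (?w (sh k p)) = cst (a p) * (if bad p then 0 else ?w p)" by (simp only:)
  qed
  finally have 1: "\<phi> (tt c k * b) = (\<Sum>p\<in>J. cst (a p) * (if bad p then 0 else ?w p))" .
  let ?K = "{p\<in>?I. bad p}"
  have K: "gen_by A (tt c ` {..<k}) = fv.span (?w ` ?K)" unfolding bad_def using k by (intro ideal_tt) simp
  have "tt c k * b \<in> fv.span (?w ` ?K)" by (rule subsetD[OF equalityD1[OF K] m])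
  then obtain J' a' where J': "finite J'" "J' \<subseteq> ?K" "tt c k * b = (\<Sum>p\<in>J'. cst (a' p) * ?w p)" by (rule span_family_explicit)
  have "\<phi> (tt c k * b) = (\<Sum>p\<in>J'. cst (a' p) * \<phi> (?w p))"
    unfolding J'(3) by (rule linear_map_sum[of \<phi>, OF \<phi>(1,2)])
  also have "\<dots> = 0"
  proof (rule sum.neutral, rule ballI)
    fix p assume "p \<in> J'"
    then have "p \<in> ?I" "bad p" using J'(2) by auto
    then show "cst (a' p) * \<phi> (?w p) = 0" using \<phi>(3)[of p] by (simp add: h_def)
  qed
  finally have 0: "(\<Sum>p\<in>J. cst (a p) * (if bad p then 0 else ?w p)) = 0" using 1 by simp
  have "b = (\<Sum>p\<in>J. cst (a p) * (if bad p then ?w p else 0)) + (\<Sum>p\<in>J. cst (a p) * (if bad p then 0 else ?w p))"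
    unfolding J(3) sum.distrib[symmetric] by (intro sum.cong) auto
  then have "b = (\<Sum>p\<in>J. cst (a p) * (if bad p then ?w p else 0))" by (simp only: 0 add_0_right)
  also have "\<dots> \<in> fv.span (?w ` ?K)"
  proof (rule sum_in_span)
    fix p assume "p \<in> J"
    then show "(if bad p then ?w p else 0) \<in> fv.span (?w ` ?K)"
      using J(2) fv.span_zero[of "?w ` ?K"] by (cases "bad p") (auto intro!: fv.span_base imageI)
  qed
  finally show ?thesis unfolding K .
qed

lemma cohen_macaulay_of_free: "cohen_macaulay (fring A)"
  unfolding cohen_macaulay_def
proof (intro conjI allI impI)
  show cr: "cring (fring A)" by (rule cring_fring[OF A(2)])
  have "A = alg (th ` {..<n} \<union> g ` KK)"
  proof
    let ?B = "alg (th ` {..<n} \<union> g ` KK)"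
    show "?B \<subseteq> A" using th g by (intro alg_least[OF A(2)]) auto
    show "A \<subseteq> ?B" unfolding A(1)
    proof (rule fv.span_minimal[OF _ subalg_subspace[OF subalg_alg]], rule image_subsetI)
      fix p assume "p \<in> Ix \<times> KK"
      then show "tg th g p \<in> ?B"
        unfolding thp_def split_def
        by (intro subalg_mult[OF subalg_alg] subalg_prod[OF subalg_alg] subalg_power[OF subalg_alg] alg_base) auto
    qed
  qed
  then have "noeth A" using noeth_alg[of "th ` {..<n} \<union> g ` KK"] finite_KK by simp
  then show "noetherian_ring (fring A)" by (rule noetherian_fring[OF A(2)])
  fix m assume m: "maximalideal m (fring A)"
  have P: "primeideal m (fring A)" by (rule cring.maximalideal_prime[OF cr m])
  then have Pm: "prime_in A m" using prime_in_fring[OF A(2)] by simp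
  \<comment> \<open>Each parameter takes a complex value at the maximal ideal, and these values
    determine the translation that moves all parameters into it.\<close>
  have "\<forall>i. \<exists>c. i < n \<longrightarrow> th i - cst c \<in> m" using maximal_value[OF A(2,3) m th] by blast
  from choice[OF this] obtain c where c: "\<forall>i. i < n \<longrightarrow> th i - cst (c i) \<in> m" by (elim exE)
  define xs where "xs = map (tt c) [0..<n]"
  have len: "length xs = n" by (simp add: xs_def)
  have tk: "set (take k xs) = tt c ` {..<k}" if "k \<le> n" for k
    using that by (auto simp: xs_def take_map atLeast0LessThan)
  have gen: "genideal (fring A) (set (take k xs)) = gen_by A (tt c ` {..<k})" if "k \<le> n" for k
    unfolding tk[OF that] using tt_A that by (intro genideal_fring[OF A(2)]) auto
  have xm: "set xs \<subseteq> m" using c by (auto simp: xs_def tt_def)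
  have mA: "m \<subseteq> A" using Pm by (auto simp: prime_in_def idl_in_def)
  have "regular_seq (fring A) xs" unfolding regular_seq_def
  proof (intro conjI allI impI ballI)
    show "set xs \<subseteq> carrier (fring A)" using xm mA by auto
    have "genideal (fring A) (set xs) \<subseteq> m"
      using xm P by (intro ring.genideal_minimal[OF cring.axioms(1)[OF cr]]) (auto simp: primeideal_def)
    moreover have "1 \<notin> m" using Pm by (simp add: prime_in_def)
    ultimately show "genideal (fring A) (set xs) \<noteq> carrier (fring A)" using subalg_1[OF A(2)] by auto
  next
    fix k b assume k: "k < length xs" and b: "b \<in> carrier (fring A)"
      and mem: "xs ! k \<otimes>\<^bsub>fring A\<^esub> b \<in> genideal (fring A) (set (take k xs))"
    have kn: "k < n" "k \<le> n" using k len by auto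
    have "xs ! k = tt c k" using kn by (simp add: xs_def)
    then have "tt c k * b \<in> gen_by A (tt c ` {..<k})" using mem gen[OF kn(2)] by simp
    then show "b \<in> genideal (fring A) (set (take k xs))"
      unfolding gen[OF kn(2)] using b by (simp add: tt_regular[OF kn(1)])
  qed
  then have "enat n \<le> grade (fring A) m"
    unfolding grade_def using xm by (intro Sup_upper CollectI exI[of _ xs]) (simp add: len)
  moreover have "grade (fring A) m \<le> height (fring A) m" by (rule grade_le_height[OF A(2) P])
  moreover have "height (fring A) m \<le> enat n" by (rule height_le[OF A(2,3)])
  ultimately show "grade (fring A) m = height (fring A) m" by simp
qed

end

lemma cohen_macaulay_cofinite: "\<forall>\<^sub>F a in cofinite. cohen_macaulay (Lambda_ring r s a)"
  using Lam_free_cofinite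
proof (rule eventually_mono, elim exE conjE)
  fix a th g
  assume *: "\<forall>i<n. th i \<in> Lam r s a" "\<forall>k\<in>KK. g k \<in> Lam r s a"
    "Lam r s a = fv.span (tg th g ` (Ix \<times> KK))" "indep (Ix \<times> KK) (tg th g)"
  show "cohen_macaulay (Lambda_ring r s a)"
    unfolding Lambda_ring_fring using * by (intro cohen_macaulay_of_free[OF *(3) subalg_Lam Lam_S *(4)]) auto
qed

end

theorem theorem4p3:
  fixes r s :: nat
  assumes "r > 0" and "s > 0"
  shows "finite {a :: complex. \<not> cohen_macaulay (Lambda_ring r s a)}"
proof -
  interpret rs r s using assms by unfold_locales
  show ?thesis using cohen_macaulay_cofinite unfolding eventually_cofinite .
qed

end
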